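(* Let $(A,\ast,\circ,\vartheta,\theta)$ be a (finite-dimensional) pre-Poisson bialgebra, $(B=\oplus_{i\in\mathbb Z}B_i,\diamond,\omega)$ a quadratic $\mathbb Z$-graded perm algebra, and $(A\otimes B,\cdot,[-,-],\Delta,\delta)$ the induced completed Poisson bialgebra, where $$(a_1\otimes b_1)(a_2\otimes b_2)=(a_1\ast a_2)\otimes(b_1\diamond b_2)+(a_2\ast a_1)\otimes(b_2\diamond b_1),$$ $$[a_1\otimes b_1,a_2\otimes b_2]=(a_1\circ a_2)\otimes(b_1\diamond b_2)-(a_2\circ a_1)\otimes(b_2\diamond b_1),$$ $$\Delta(a\otimes b)=(\mathrm{id}+\hat\tau)(\vartheta(a)\bullet\nu_\omega(b)),\qquad \delta(a\otimes b)=(\mathrm{id}-\hat\tau)(\theta(a)\bullet\nu_\omega(b)).$$ If $(A,\ast,\circ,\vartheta,\theta)$ is a triangular pre-Poisson bialgebra, then $(A\otimes B,\cdot,[-,-],\Delta,\delta)$ is a triangular completed Poisson bialgebra.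
   Context: All vector spaces are over a field $\mathbf k$ of characteristic zero. $\tau(x\otimes y)=y\otimes x$. **Pre-Poisson algebras and coalgebras.** A Zinbiel algebra $(A,\ast)$: $a_1\ast(a_2\ast a_3)=(a_1\ast a_2)\ast a_3+(a_2\ast a_1)\ast a_3$. A pre-Lie algebra $(A,\circ)$: $(a_1\circ a_2)\circ a_3-a_1\circ(a_2\circ a_3)=(a_2\circ a_1)\circ a_3-a_2\circ(a_1\circ a_3)$. A pre-Poisson algebra $(A,\ast,\circ)$: $(A,\ast)$ Zinbiel, $(A,\circ)$ pre-Lie, and $(a_1\circ a_2-a_2\circ a_1)\ast a_3=a_1\circ(a_2\ast a_3)-a_2\ast(a_1\circ a_3)$, $(a_1\ast a_2+a_2\ast a_1)\circ a_3=a_1\ast(a_2\circ a_3)+a_2\ast(a_1\circ a_3)$. A pre-Poisson coalgebra is $(A,\vartheta,\theta)$, $\vartheta,\theta:A\to A\otimes A$, with $(\vartheta\otimes\mathrm{id})\vartheta+(\tau\otimes\mathrm{id})(\vartheta\otimes\mathrm{id})\vartheta=(\mathrm{id}\otimes\vartheta)\vartheta$, $(\mathrm{id}\otimes\theta)\theta-(\tau\otimes\mathrm{id})(\mathrm{id}\otimes\theta)\theta=(\theta\otimes\mathrm{id})\theta-(\tau\otimes\mathrm{id})(\theta\otimes\mathrm{id})\theta$, $((\theta-\tau\theta)\otimes\mathrm{id})\vartheta=(\mathrm{id}\otimes\vartheta)\theta-(\tau\otimes\mathrm{id})(\mathrm{id}\otimes\theta)\vartheta$, $((\vartheta+\tau\vartheta)\otimes\mathrm{id})\theta=(\mathrm{id}\otimes\theta)\vartheta+(\tau\otimes\mathrm{id})(\mathrm{id}\otimes\theta)\vartheta$.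 **Pre-Poisson bialgebra** $(A,\ast,\circ,\vartheta,\theta)$: a pre-Poisson algebra and pre-Poisson coalgebra such that, with $L(a)x=a\ast x$, $R(a)x=x\ast a$, $\hat L(a)x=a\circ x$, $\hat R(a)x=x\circ a$, for all $a_1,a_2$: $(\vartheta+\tau\vartheta)(a_1\ast a_2)=(\mathrm{id}\otimes R(a_2))\vartheta(a_1)+(L(a_1)\otimes\mathrm{id})\vartheta(a_2)+\tau((\mathrm{id}\otimes L(a_1))\vartheta(a_2))$, $\vartheta(a_1\ast a_2+a_2\ast a_1)=(L(a_1)\otimes\mathrm{id})\vartheta(a_2)+(\mathrm{id}\otimes(L+R)(a_2))\vartheta(a_1)$, $(\theta-\tau\theta)(a_1\circ a_2)=(\hat L(a_1)\otimes\mathrm{id}+\mathrm{id}\otimes\hat L(a_1))((\theta-\tau\theta)(a_2))+(\mathrm{id}\otimes\hat R(a_2))\theta(a_1)-(\hat R(a_2)\otimes\mathrm{id})\tau\theta(a_1)$, $\theta(a_1\circ a_2-a_2\circ a_1)=(\mathrm{id}\otimes(\hat R-\hat L)(a_2))\theta(a_1)+(\mathrm{id}\otimes(\hat L-\hat R)(a_1))\theta(a_2)+(\hat L(a_1)\otimes\mathrm{id})\theta(a_2)-(\hat L(a_2)\otimes\mathrm{id})\theta(a_1)$, $\theta(a_1\ast a_2+a_2\ast a_1)=(\mathrm{id}\otimes(L+R)(a_2))\theta(a_1)+(\mathrm{id}\otimes(L+R)(a_1))\theta(a_2)-(\hat L(a_1)\otimes\mathrm{id})\vartheta(a_2)-(\hat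 L(a_2)\otimes\mathrm{id})\vartheta(a_1)$, $\vartheta(a_1\circ a_2-a_2\circ a_1)=(L(a_2)\otimes\mathrm{id}-\mathrm{id}\otimes(L+R)(a_2))\theta(a_1)+(\hat L(a_1)\otimes\mathrm{id}+\mathrm{id}\otimes(\hat L-\hat R)(a_1))\vartheta(a_2)$, $(\vartheta+\tau\vartheta)(a_1\circ a_2)=-(\mathrm{id}\otimes R(a_2))\theta(a_1)-(R(a_2)\otimes\mathrm{id})\tau\theta(a_1)+(\hat L(a_1)\otimes\mathrm{id}+\mathrm{id}\otimes\hat L(a_1))((\vartheta+\tau\vartheta)(a_2))$, $(\theta-\tau\theta)(a_1\ast a_2)=(\mathrm{id}\otimes R(a_2))\theta(a_1)+(\mathrm{id}\otimes L(a_1))((\theta-\tau\theta)(a_2))+(\hat R(a_2)\otimes\mathrm{id})\tau\vartheta(a_1)-(\hat L(a_1)\otimes\mathrm{id})((\vartheta+\tau\vartheta)(a_2))$. It is **triangular** if there is a symmetric solution $r\in A\otimes A$ ($\tau(r)=r$) of the pre-Poisson Yang-Baxter equation with $\vartheta=\vartheta_r$ and $\theta=\theta_r$, where $\vartheta_r(a)=(\mathrm{id}\otimes(L+R)(a)-L(a)\otimes\mathrm{id})(r)$, $\theta_r(a)=(\hat L(a)\otimes\mathrm{id}+\mathrm{id}\otimes(\hat L-\hat R)(a))(r)$. For $r=\sum x_i\otimes y_i$ symmetric, the pre-Poisson Yang-Baxter equation is equivalent to the pair $r_{13}\ast r_{23}+r_{23}\ast r_{13}-r_{12}\ast r_{13}-r_{12}\ast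 r_{23}=0$, $r_{12}\circ r_{13}-r_{12}\circ r_{23}-r_{13}\circ r_{23}+r_{23}\circ r_{13}=0$, where for $\star\in\{\ast,\circ\}$ (sums over $i,j$) $r_{12}\star r_{13}=(x_i\star x_j)\otimes y_i\otimes y_j$, $r_{12}\star r_{23}=x_i\otimes(y_i\star x_j)\otimes y_j$, $r_{13}\star r_{23}=x_i\otimes x_j\otimes(y_i\star y_j)$, $r_{23}\star r_{13}=x_j\otimes x_i\otimes(y_i\star y_j)$. **Quadratic $\mathbb Z$-graded perm algebra** $(B,\diamond,\omega)$: $b_1\diamond(b_2\diamond b_3)=(b_1\diamond b_2)\diamond b_3=(b_2\diamond b_1)\diamond b_3$; $B=\oplus_{i\in\mathbb Z}B_i$, each $B_i$ finite-dimensional, $B_i\diamond B_j\subseteq B_{i+j}$; $\omega$ antisymmetric nondegenerate bilinear, $\omega(b_1\diamond b_2,b_3)=\omega(b_1,b_2\diamond b_3-b_3\diamond b_2)$, and for some $m$, $\omega(B_i,B_j)=0$ unless $i+j+m=0$. **Completions.** $U\hat\otimes V=\prod_{i,j\in\mathbb Z}U_i\otimes V_j$ (similarly for more factors), linear maps act termwise ($f\hat\otimes g$), $\hat\tau$ is the completed flip; $A\otimes B$ is graded by $A\otimes B_i$. $\hat\omega(\sum x\otimes x',y\otimes y')=\sum\omega(x,y)\omega(x',y')$; $\nu_\omega:B\to B\hat\otimes B$ is the unique linear map with $\hat\omega(\nu_\omega(b_1),b_2\otimes b_3)=-\omega(b_1,b_2\diamond b_3)$. $(\sum a'\otimes a'')\bullet(\sum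 b'\otimes b'')=\sum(a'\otimes b')\otimes(a''\otimes b'')$. **Completed Poisson bialgebra** $(P,\cdot,[-,-],\Delta,\delta)$: $P=\oplus P_i$ is a $\mathbb Z$-graded Poisson algebra (finite-dimensional components); $\Delta,\delta:P\to P\hat\otimes P$ satisfy $\hat\tau\Delta=\Delta$, $(\Delta\hat\otimes\mathrm{id})\Delta=(\mathrm{id}\hat\otimes\Delta)\Delta$, $\hat\tau\delta=-\delta$, $(\mathrm{id}\hat\otimes\delta)\delta-(\hat\tau\hat\otimes\mathrm{id})(\mathrm{id}\hat\otimes\delta)\delta=(\delta\hat\otimes\mathrm{id})\delta$, $(\mathrm{id}\hat\otimes\Delta)\delta=(\delta\hat\otimes\mathrm{id})\Delta+(\hat\tau\hat\otimes\mathrm{id})(\mathrm{id}\hat\otimes\delta)\Delta$; and with $u(p)q=pq$, $\mathrm{ad}(p)q=[p,q]$: $\Delta(p_1p_2)=(u(p_2)\hat\otimes\mathrm{id})\Delta(p_1)+(\mathrm{id}\hat\otimes u(p_1))\Delta(p_2)$, $\delta([p_1,p_2])=(\mathrm{ad}(p_1)\hat\otimes\mathrm{id}+\mathrm{id}\hat\otimes\mathrm{ad}(p_1))\delta(p_2)-(\mathrm{ad}(p_2)\hat\otimes\mathrm{id}+\mathrm{id}\hat\otimes\mathrm{ad}(p_2))\delta(p_1)$, $\Delta([p_1,p_2])=(\mathrm{ad}(p_1)\hat\otimes\mathrm{id}+\mathrm{id}\hat\otimes\mathrm{ad}(p_1))\Delta(p_2)+(u(p_2)\hat\otimes\mathrm{id}-\mathrm{id}\hat\otimes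 u(p_2))\delta(p_1)$, $\delta(p_1p_2)=(u(p_1)\hat\otimes\mathrm{id})\delta(p_2)+(u(p_2)\hat\otimes\mathrm{id})\delta(p_1)+(\mathrm{id}\hat\otimes\mathrm{ad}(p_1))\Delta(p_2)+(\mathrm{id}\hat\otimes\mathrm{ad}(p_2))\Delta(p_1)$. It is **triangular** if there is a skew-symmetric ($\hat\tau(r)=-r$) element $r=\sum_\alpha x_\alpha\otimes y_\alpha\in P\hat\otimes P$ that is a completed solution of the Poisson Yang-Baxter equation, i.e. (sums over $\alpha,\beta$, in $P\hat\otimes P\hat\otimes P$) $x_\alpha x_\beta\otimes y_\alpha\otimes y_\beta+x_\alpha\otimes x_\beta\otimes y_\alpha y_\beta-x_\beta\otimes x_\alpha y_\beta\otimes y_\alpha=0$, $[x_\alpha,x_\beta]\otimes y_\alpha\otimes y_\beta+x_\alpha\otimes x_\beta\otimes[y_\alpha,y_\beta]+x_\alpha\otimes[y_\alpha,x_\beta]\otimes y_\beta=0$, such that $\Delta(p)=(\mathrm{id}\hat\otimes u(p)-u(p)\hat\otimes\mathrm{id})(r)$ and $\delta(p)=(\mathrm{id}\hat\otimes\mathrm{ad}(p)+\mathrm{ad}(p)\hat\otimes\mathrm{id})(r)$ for all $p\in P$. *)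

theory Defs
  imports Complex_Main "HOL-Library.Function_Algebras" "HOL-Library.Groups_Big_Fun"
begin

section \<open>Vector spaces with a carrier\<close>

text \<open>
  A vector space is a subspace \<open>car V\<close> of an ambient vector space whose scalar multiplication is
  \<open>scl V\<close>.  Maps between vector spaces are only relevant on the carriers.
\<close>

record ('k, 'v) vspace =
  scl :: "'k \<Rightarrow> 'v \<Rightarrow> 'v"
  car :: "'v set"

definition is_vspace :: "('k::field, 'v::ab_group_add) vspace \<Rightarrow> bool" where
  "is_vspace V \<longleftrightarrow> vector_space (scl V) \<and> module.subspace (scl V) (car V)"

definition finite_dim :: "('k::field, 'v::ab_group_add) vspace \<Rightarrow> 'v set \<Rightarrow> bool" where
  "finite_dim V U \<longleftrightarrow> (\<exists>S. finite S \<and> U = module.span (scl V) S)"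

definition scalars :: "('k::field, 'k) vspace" where
  "scalars = \<lparr>scl = (*), car = UNIV\<rparr>"

definition linear_on ::
  "('k::field, 'u::ab_group_add) vspace \<Rightarrow> ('k, 'v::ab_group_add) vspace \<Rightarrow> ('u \<Rightarrow> 'v) \<Rightarrow> bool" where
  "linear_on U V f \<longleftrightarrow>
     (\<forall>x\<in>car U. f x \<in> car V) \<and>
     (\<forall>x\<in>car U. \<forall>y\<in>car U. f (x + y) = f x + f y) \<and>
     (\<forall>c. \<forall>x\<in>car U. f (scl U c x) = scl V c (f x))"

definition bilinear_on ::
  "('k::field, 'u::ab_group_add) vspace \<Rightarrow> ('k, 'v::ab_group_add) vspace \<Rightarrow>
   ('k, 'w::ab_group_add) vspace \<Rightarrow> ('u \<Rightarrow> 'v \<Rightarrow> 'w) \<Rightarrow> bool" where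
  "bilinear_on U V W f \<longleftrightarrow>
     (\<forall>x\<in>car U. linear_on V W (f x)) \<and> (\<forall>y\<in>car V. linear_on U W (\<lambda>x. f x y))"

definition trilinear_form_on ::
  "('k::field, 'v::ab_group_add) vspace \<Rightarrow> ('v \<Rightarrow> 'v \<Rightarrow> 'v \<Rightarrow> 'k) \<Rightarrow> bool" where
  "trilinear_form_on V f \<longleftrightarrow>
     (\<forall>x\<in>car V. bilinear_on V V scalars (f x)) \<and>
     (\<forall>y\<in>car V. \<forall>z\<in>car V. linear_on V scalars (\<lambda>x. f x y z))"


section \<open>Tensor products\<close>

text \<open>
  \<open>U \<otimes> V\<close> is realised inside the algebraic dual of the space of bilinear forms on \<open>U \<times> V\<close>: the
  pure tensor \<open>u \<otimes> v\<close> is evaluation of bilinear forms at \<open>(u, v)\<close> (extended by \<open>0\<close> to functions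
  that are not bilinear forms, so that equality of tensors is equality of functions), and
  \<open>U \<otimes> V\<close> is the span of the pure tensors.  Threefold tensors are treated in the same way by
  means of trilinear forms.
\<close>

type_synonym ('k, 'u, 'v) tens2 = "('u \<Rightarrow> 'v \<Rightarrow> 'k) \<Rightarrow> 'k"
type_synonym ('k, 'v) tens3 = "('v \<Rightarrow> 'v \<Rightarrow> 'v \<Rightarrow> 'k) \<Rightarrow> 'k"

definition pure2 ::
  "('k::field, 'u::ab_group_add) vspace \<Rightarrow> ('k, 'v::ab_group_add) vspace \<Rightarrow>
   'u \<Rightarrow> 'v \<Rightarrow> ('k, 'u, 'v) tens2" where
  "pure2 U V u v = (\<lambda>\<beta>. if bilinear_on U V scalars \<beta> then \<beta> u v else 0)"

definition pure3 ::
  "('k::field, 'v::ab_group_add) vspace \<Rightarrow> 'v \<Rightarrow> 'v \<Rightarrow> 'v \<Rightarrow> ('k, 'v) tens3" where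
  "pure3 V u v w = (\<lambda>\<beta>. if trilinear_form_on V \<beta> then \<beta> u v w else 0)"

definition fun_scl :: "'k::field \<Rightarrow> ('x \<Rightarrow> 'k) \<Rightarrow> ('x \<Rightarrow> 'k)" where
  "fun_scl c f = (\<lambda>x. c * f x)"

text \<open>For subspaces \<open>X \<subseteq> U\<close> and \<open>Y \<subseteq> V\<close>, the image of \<open>X \<otimes> Y\<close> in \<open>U \<otimes> V\<close>.\<close>

definition subtensor ::
  "('k::field, 'u::ab_group_add) vspace \<Rightarrow> ('k, 'v::ab_group_add) vspace \<Rightarrow>
   'u set \<Rightarrow> 'v set \<Rightarrow> ('k, 'u, 'v) tens2 set" where
  "subtensor U V X Y = module.span fun_scl {pure2 U V u v |u v. u \<in> X \<and> v \<in> Y}"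

definition tensor ::
  "('k::field, 'u::ab_group_add) vspace \<Rightarrow> ('k, 'v::ab_group_add) vspace \<Rightarrow>
   ('k, ('k, 'u, 'v) tens2) vspace" where
  "tensor U V = \<lparr>scl = fun_scl, car = subtensor U V (car U) (car V)\<rparr>"

text \<open>
  The linear map out of a tensor product induced by a bilinear map \<open>\<phi>\<close> into a space of \<open>'k\<close>-valued
  functions (for instance again a space of tensors): if \<open>t = \<Sum>\<^sub>i u\<^sub>i \<otimes> v\<^sub>i\<close>, then
  \<open>lift2 \<phi> t = \<Sum>\<^sub>i \<phi> u\<^sub>i v\<^sub>i\<close>.  Likewise \<open>lift3\<close> for trilinear maps.
\<close>

definition lift2 :: "('u \<Rightarrow> 'v \<Rightarrow> ('x \<Rightarrow> 'k)) \<Rightarrow> ('k, 'u, 'v) tens2 \<Rightarrow> ('x \<Rightarrow> 'k)" where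
  "lift2 \<phi> t = (\<lambda>\<beta>. t (\<lambda>u v. \<phi> u v \<beta>))"

definition lift3 :: "('v \<Rightarrow> 'v \<Rightarrow> 'v \<Rightarrow> ('x \<Rightarrow> 'k)) \<Rightarrow> ('k, 'v) tens3 \<Rightarrow> ('x \<Rightarrow> 'k)" where
  "lift3 \<phi> t = (\<lambda>\<beta>. t (\<lambda>u v w. \<phi> u v w \<beta>))"

lemma bilinear_on_pure2:
  fixes U :: "('k::field, 'u::ab_group_add) vspace" and V :: "('k, 'v::ab_group_add) vspace"
  shows "bilinear_on U V (tensor U V) (pure2 U V)"
proof -
  have m: "module (fun_scl :: 'k \<Rightarrow> (_ \<Rightarrow> 'k) \<Rightarrow> _)"
    by unfold_locales (simp_all add: fun_scl_def fun_eq_iff algebra_simps)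
  have "pure2 U V u v \<in> car (tensor U V)" if "u \<in> car U" "v \<in> car V" for u v
    unfolding tensor_def subtensor_def using that by (auto intro!: module.span_base [OF m])
  then show ?thesis
    by (auto simp: bilinear_on_def linear_on_def pure2_def tensor_def scalars_def fun_scl_def
        fun_eq_iff)
qed

lemma lift2_pure2:
  assumes "\<And>\<beta>. bilinear_on U V scalars (\<lambda>u v. \<phi> u v \<beta>)"
  shows "lift2 \<phi> (pure2 U V u v) = \<phi> u v"
  using assms by (simp add: lift2_def pure2_def)

lemma lift2_add: "lift2 \<phi> (s + t) = lift2 \<phi> s + lift2 \<phi> t"
  by (simp add: lift2_def plus_fun_def)

lemma lift2_scl: "lift2 \<phi> (fun_scl c t) = fun_scl c (lift2 \<phi> t)"
  by (simp add: lift2_def fun_scl_def)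

text \<open>\<open>f \<otimes> g\<close>, \<open>\<tau>\<close>, \<open>\<tau> \<otimes> id\<close>, \<open>\<Delta> \<otimes> id\<close> and \<open>id \<otimes> \<Delta>\<close>.\<close>

definition tmap ::
  "('k::field, 'v::ab_group_add) vspace \<Rightarrow> ('v \<Rightarrow> 'v) \<Rightarrow> ('v \<Rightarrow> 'v) \<Rightarrow>
   ('k, 'v, 'v) tens2 \<Rightarrow> ('k, 'v, 'v) tens2" where
  "tmap V f g = lift2 (\<lambda>u v. pure2 V V (f u) (g v))"

definition flip ::
  "('k::field, 'v::ab_group_add) vspace \<Rightarrow> ('k, 'v, 'v) tens2 \<Rightarrow> ('k, 'v, 'v) tens2" where
  "flip V = lift2 (\<lambda>u v. pure2 V V v u)"

definition flip12 ::
  "('k::field, 'v::ab_group_add) vspace \<Rightarrow> ('k, 'v) tens3 \<Rightarrow> ('k, 'v) tens3" where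
  "flip12 V = lift3 (\<lambda>u v w. pure3 V v u w)"

definition comul_left ::
  "('k::field, 'v::ab_group_add) vspace \<Rightarrow> ('v \<Rightarrow> ('k, 'v, 'v) tens2) \<Rightarrow>
   ('k, 'v, 'v) tens2 \<Rightarrow> ('k, 'v) tens3" where
  "comul_left V \<Delta> = lift2 (\<lambda>u w. lift2 (\<lambda>x y. pure3 V x y w) (\<Delta> u))"

definition comul_right ::
  "('k::field, 'v::ab_group_add) vspace \<Rightarrow> ('v \<Rightarrow> ('k, 'v, 'v) tens2) \<Rightarrow>
   ('k, 'v, 'v) tens2 \<Rightarrow> ('k, 'v) tens3" where
  "comul_right V \<Delta> = lift2 (\<lambda>u w. lift2 (\<lambda>x y. pure3 V u x y) (\<Delta> w))"


section \<open>Pre-Poisson bialgebras\<close>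

locale pre_Poisson_algebra =
  fixes A :: "('k::field, 'a::ab_group_add) vspace"
    and ast :: "'a \<Rightarrow> 'a \<Rightarrow> 'a" (infixl "\<^bold>*" 70)
    and circ :: "'a \<Rightarrow> 'a \<Rightarrow> 'a" (infixl "\<^bold>\<circ>" 70)
  assumes vspace: "is_vspace A"
    and ast_bilinear: "bilinear_on A A A (\<^bold>*)"
    and circ_bilinear: "bilinear_on A A A (\<^bold>\<circ>)"
    and zinbiel: "\<lbrakk>a1 \<in> car A; a2 \<in> car A; a3 \<in> car A\<rbrakk> \<Longrightarrow>
      a1 \<^bold>* (a2 \<^bold>* a3) = (a1 \<^bold>* a2) \<^bold>* a3 + (a2 \<^bold>* a1) \<^bold>* a3"
    and pre_Lie: "\<lbrakk>a1 \<in> car A; a2 \<in> car A; a3 \<in> car A\<rbrakk> \<Longrightarrow>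
      (a1 \<^bold>\<circ> a2) \<^bold>\<circ> a3 - a1 \<^bold>\<circ> (a2 \<^bold>\<circ> a3) = (a2 \<^bold>\<circ> a1) \<^bold>\<circ> a3 - a2 \<^bold>\<circ> (a1 \<^bold>\<circ> a3)"
    and compat1: "\<lbrakk>a1 \<in> car A; a2 \<in> car A; a3 \<in> car A\<rbrakk> \<Longrightarrow>
      (a1 \<^bold>\<circ> a2 - a2 \<^bold>\<circ> a1) \<^bold>* a3 = a1 \<^bold>\<circ> (a2 \<^bold>* a3) - a2 \<^bold>* (a1 \<^bold>\<circ> a3)"
    and compat2: "\<lbrakk>a1 \<in> car A; a2 \<in> car A; a3 \<in> car A\<rbrakk> \<Longrightarrow>
      (a1 \<^bold>* a2 + a2 \<^bold>* a1) \<^bold>\<circ> a3 = a1 \<^bold>* (a2 \<^bold>\<circ> a3) + a2 \<^bold>* (a1 \<^bold>\<circ> a3)"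

locale pre_Poisson_coalgebra =
  fixes A :: "('k::field, 'a::ab_group_add) vspace"
    and vth :: "'a \<Rightarrow> ('k, 'a, 'a) tens2" ("\<vartheta>")
    and th :: "'a \<Rightarrow> ('k, 'a, 'a) tens2" ("\<theta>")
  assumes vspace: "is_vspace A"
    and vth_linear: "linear_on A (tensor A A) \<vartheta>"
    and th_linear: "linear_on A (tensor A A) \<theta>"
    and co_zinbiel: "a \<in> car A \<Longrightarrow>
      comul_left A \<vartheta> (\<vartheta> a) + flip12 A (comul_left A \<vartheta> (\<vartheta> a)) = comul_right A \<vartheta> (\<vartheta> a)"
    and co_pre_Lie: "a \<in> car A \<Longrightarrow>
      comul_right A \<theta> (\<theta> a) - flip12 A (comul_right A \<theta> (\<theta> a))
      = comul_left A \<theta> (\<theta> a) - flip12 A (comul_left A \<theta> (\<theta> a))"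
    and co_compat1: "a \<in> car A \<Longrightarrow>
      comul_left A (\<lambda>x. \<theta> x - flip A (\<theta> x)) (\<vartheta> a)
      = comul_right A \<vartheta> (\<theta> a) - flip12 A (comul_right A \<theta> (\<vartheta> a))"
    and co_compat2: "a \<in> car A \<Longrightarrow>
      comul_left A (\<lambda>x. \<vartheta> x + flip A (\<vartheta> x)) (\<theta> a)
      = comul_right A \<theta> (\<vartheta> a) + flip12 A (comul_right A \<theta> (\<vartheta> a))"

locale pre_Poisson_bialgebra =
  pre_Poisson_algebra A ast circ + pre_Poisson_coalgebra A vth th
  for A :: "('k::field, 'a::ab_group_add) vspace"
    and ast :: "'a \<Rightarrow> 'a \<Rightarrow> 'a" (infixl "\<^bold>*" 70)
    and circ :: "'a \<Rightarrow> 'a \<Rightarrow> 'a" (infixl "\<^bold>\<circ>" 70)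
    and vth :: "'a \<Rightarrow> ('k, 'a, 'a) tens2" ("\<vartheta>")
    and th :: "'a \<Rightarrow> ('k, 'a, 'a) tens2" ("\<theta>") +
  assumes bialg1: "\<lbrakk>a1 \<in> car A; a2 \<in> car A\<rbrakk> \<Longrightarrow>
      \<vartheta> (a1 \<^bold>* a2) + flip A (\<vartheta> (a1 \<^bold>* a2))
      = tmap A id (\<lambda>x. x \<^bold>* a2) (\<vartheta> a1)
        + tmap A (\<lambda>x. a1 \<^bold>* x) id (\<vartheta> a2)
        + flip A (tmap A id (\<lambda>x. a1 \<^bold>* x) (\<vartheta> a2))"
    and bialg2: "\<lbrakk>a1 \<in> car A; a2 \<in> car A\<rbrakk> \<Longrightarrow>
      \<vartheta> (a1 \<^bold>* a2 + a2 \<^bold>* a1)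
      = tmap A (\<lambda>x. a1 \<^bold>* x) id (\<vartheta> a2)
        + tmap A id (\<lambda>x. a2 \<^bold>* x + x \<^bold>* a2) (\<vartheta> a1)"
    and bialg3: "\<lbrakk>a1 \<in> car A; a2 \<in> car A\<rbrakk> \<Longrightarrow>
      \<theta> (a1 \<^bold>\<circ> a2) - flip A (\<theta> (a1 \<^bold>\<circ> a2))
      = tmap A (\<lambda>x. a1 \<^bold>\<circ> x) id (\<theta> a2 - flip A (\<theta> a2))
        + tmap A id (\<lambda>x. a1 \<^bold>\<circ> x) (\<theta> a2 - flip A (\<theta> a2))
        + tmap A id (\<lambda>x. x \<^bold>\<circ> a2) (\<theta> a1)
        - tmap A (\<lambda>x. x \<^bold>\<circ> a2) id (flip A (\<theta> a1))"
    and bialg4: "\<lbrakk>a1 \<in> car A; a2 \<in> car A\<rbrakk> \<Longrightarrow>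
      \<theta> (a1 \<^bold>\<circ> a2 - a2 \<^bold>\<circ> a1)
      = tmap A id (\<lambda>x. x \<^bold>\<circ> a2 - a2 \<^bold>\<circ> x) (\<theta> a1)
        + tmap A id (\<lambda>x. a1 \<^bold>\<circ> x - x \<^bold>\<circ> a1) (\<theta> a2)
        + tmap A (\<lambda>x. a1 \<^bold>\<circ> x) id (\<theta> a2)
        - tmap A (\<lambda>x. a2 \<^bold>\<circ> x) id (\<theta> a1)"
    and bialg5: "\<lbrakk>a1 \<in> car A; a2 \<in> car A\<rbrakk> \<Longrightarrow>
      \<theta> (a1 \<^bold>* a2 + a2 \<^bold>* a1)
      = tmap A id (\<lambda>x. a2 \<^bold>* x + x \<^bold>* a2) (\<theta> a1)
        + tmap A id (\<lambda>x. a1 \<^bold>* x + x \<^bold>* a1) (\<theta> a2)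
        - tmap A (\<lambda>x. a1 \<^bold>\<circ> x) id (\<vartheta> a2)
        - tmap A (\<lambda>x. a2 \<^bold>\<circ> x) id (\<vartheta> a1)"
    and bialg6: "\<lbrakk>a1 \<in> car A; a2 \<in> car A\<rbrakk> \<Longrightarrow>
      \<vartheta> (a1 \<^bold>\<circ> a2 - a2 \<^bold>\<circ> a1)
      = tmap A (\<lambda>x. a2 \<^bold>* x) id (\<theta> a1)
        - tmap A id (\<lambda>x. a2 \<^bold>* x + x \<^bold>* a2) (\<theta> a1)
        + tmap A (\<lambda>x. a1 \<^bold>\<circ> x) id (\<vartheta> a2)
        + tmap A id (\<lambda>x. a1 \<^bold>\<circ> x - x \<^bold>\<circ> a1) (\<vartheta> a2)"
    and bialg7: "\<lbrakk>a1 \<in> car A; a2 \<in> car A\<rbrakk> \<Longrightarrow>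
      \<vartheta> (a1 \<^bold>\<circ> a2) + flip A (\<vartheta> (a1 \<^bold>\<circ> a2))
      = - tmap A id (\<lambda>x. x \<^bold>* a2) (\<theta> a1)
        - tmap A (\<lambda>x. x \<^bold>* a2) id (flip A (\<theta> a1))
        + tmap A (\<lambda>x. a1 \<^bold>\<circ> x) id (\<vartheta> a2 + flip A (\<vartheta> a2))
        + tmap A id (\<lambda>x. a1 \<^bold>\<circ> x) (\<vartheta> a2 + flip A (\<vartheta> a2))"
    and bialg8: "\<lbrakk>a1 \<in> car A; a2 \<in> car A\<rbrakk> \<Longrightarrow>
      \<theta> (a1 \<^bold>* a2) - flip A (\<theta> (a1 \<^bold>* a2))
      = tmap A id (\<lambda>x. x \<^bold>* a2) (\<theta> a1)
        + tmap A id (\<lambda>x. a1 \<^bold>* x) (\<theta> a2 - flip A (\<theta> a2))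
        + tmap A (\<lambda>x. x \<^bold>\<circ> a2) id (flip A (\<vartheta> a1))
        - tmap A (\<lambda>x. a1 \<^bold>\<circ> x) id (\<vartheta> a2 + flip A (\<vartheta> a2))"

definition r12_r13 ::
  "('k::field, 'a::ab_group_add) vspace \<Rightarrow> ('a \<Rightarrow> 'a \<Rightarrow> 'a) \<Rightarrow>
   ('k, 'a, 'a) tens2 \<Rightarrow> ('k, 'a) tens3" where
  "r12_r13 A m r = lift2 (\<lambda>xi yi. lift2 (\<lambda>xj yj. pure3 A (m xi xj) yi yj) r) r"

definition r12_r23 ::
  "('k::field, 'a::ab_group_add) vspace \<Rightarrow> ('a \<Rightarrow> 'a \<Rightarrow> 'a) \<Rightarrow>
   ('k, 'a, 'a) tens2 \<Rightarrow> ('k, 'a) tens3" where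
  "r12_r23 A m r = lift2 (\<lambda>xi yi. lift2 (\<lambda>xj yj. pure3 A xi (m yi xj) yj) r) r"

definition r13_r23 ::
  "('k::field, 'a::ab_group_add) vspace \<Rightarrow> ('a \<Rightarrow> 'a \<Rightarrow> 'a) \<Rightarrow>
   ('k, 'a, 'a) tens2 \<Rightarrow> ('k, 'a) tens3" where
  "r13_r23 A m r = lift2 (\<lambda>xi yi. lift2 (\<lambda>xj yj. pure3 A xi xj (m yi yj)) r) r"

definition r23_r13 ::
  "('k::field, 'a::ab_group_add) vspace \<Rightarrow> ('a \<Rightarrow> 'a \<Rightarrow> 'a) \<Rightarrow>
   ('k, 'a, 'a) tens2 \<Rightarrow> ('k, 'a) tens3" where
  "r23_r13 A m r = lift2 (\<lambda>xi yi. lift2 (\<lambda>xj yj. pure3 A xj xi (m yi yj)) r) r"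

text \<open>Symmetric solutions of the pre-Poisson Yang-Baxter equation.\<close>

definition symmetric_pPYBE_solution ::
  "('k::field, 'a::ab_group_add) vspace \<Rightarrow> ('a \<Rightarrow> 'a \<Rightarrow> 'a) \<Rightarrow> ('a \<Rightarrow> 'a \<Rightarrow> 'a) \<Rightarrow>
   ('k, 'a, 'a) tens2 \<Rightarrow> bool" where
  "symmetric_pPYBE_solution A ast circ r \<longleftrightarrow>
     r \<in> car (tensor A A) \<and> flip A r = r \<and>
     r13_r23 A ast r + r23_r13 A ast r - r12_r13 A ast r - r12_r23 A ast r = 0 \<and>
     r12_r13 A circ r - r12_r23 A circ r - r13_r23 A circ r + r23_r13 A circ r = 0"

definition vth_of ::
  "('k::field, 'a::ab_group_add) vspace \<Rightarrow> ('a \<Rightarrow> 'a \<Rightarrow> 'a) \<Rightarrow>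
   ('k, 'a, 'a) tens2 \<Rightarrow> 'a \<Rightarrow> ('k, 'a, 'a) tens2" where
  "vth_of A ast r a = tmap A id (\<lambda>x. ast a x + ast x a) r - tmap A (\<lambda>x. ast a x) id r"

definition th_of ::
  "('k::field, 'a::ab_group_add) vspace \<Rightarrow> ('a \<Rightarrow> 'a \<Rightarrow> 'a) \<Rightarrow>
   ('k, 'a, 'a) tens2 \<Rightarrow> 'a \<Rightarrow> ('k, 'a, 'a) tens2" where
  "th_of A circ r a = tmap A (\<lambda>x. circ a x) id r + tmap A id (\<lambda>x. circ a x - circ x a) r"

definition triangular_pre_Poisson_bialgebra ::
  "('k::field, 'a::ab_group_add) vspace \<Rightarrow> ('a \<Rightarrow> 'a \<Rightarrow> 'a) \<Rightarrow> ('a \<Rightarrow> 'a \<Rightarrow> 'a) \<Rightarrow>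
   ('a \<Rightarrow> ('k, 'a, 'a) tens2) \<Rightarrow> ('a \<Rightarrow> ('k, 'a, 'a) tens2) \<Rightarrow> bool" where
  "triangular_pre_Poisson_bialgebra A ast circ vth th \<longleftrightarrow>
     pre_Poisson_bialgebra A ast circ vth th \<and>
     (\<exists>r. symmetric_pPYBE_solution A ast circ r \<and>
          (\<forall>a\<in>car A. vth a = vth_of A ast r a \<and> th a = th_of A circ r a))"


section \<open>Graded spaces and completed tensor products\<close>

definition decomposition :: "(int \<Rightarrow> 'v::ab_group_add set) \<Rightarrow> 'v \<Rightarrow> (int \<Rightarrow> 'v) \<Rightarrow> bool" where
  "decomposition G v f \<longleftrightarrow> (\<forall>i. f i \<in> G i) \<and> finite {i. f i \<noteq> 0} \<and> v = Sum_any f"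

text \<open>\<open>V = \<Oplus>\<^sub>i G i\<close> with finite-dimensional components.\<close>

definition graded_vspace ::
  "('k::field, 'v::ab_group_add) vspace \<Rightarrow> (int \<Rightarrow> 'v set) \<Rightarrow> bool" where
  "graded_vspace V G \<longleftrightarrow>
     is_vspace V \<and>
     (\<forall>i. module.subspace (scl V) (G i) \<and> G i \<subseteq> car V \<and> finite_dim V (G i)) \<and>
     (\<forall>v\<in>car V. \<exists>!f. decomposition G v f)"

definition component :: "(int \<Rightarrow> 'v::ab_group_add set) \<Rightarrow> int \<Rightarrow> 'v \<Rightarrow> 'v" where
  "component G i v = (THE f. decomposition G v f) i"

text \<open>
  Elements of \<open>V \<hat>\<otimes> V = \<Prod>\<^sub>i\<^sub>j V\<^sub>i \<otimes> V\<^sub>j\<close> and of the threefold completed tensor product are families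
  of tensors, indexed by pairs and triples of degrees.
\<close>

type_synonym ('k, 'v) ctens2 = "int \<times> int \<Rightarrow> ('k, 'v, 'v) tens2"
type_synonym ('k, 'v) ctens3 = "int \<times> int \<times> int \<Rightarrow> ('k, 'v) tens3"

definition ctensor ::
  "('k::field, 'v::ab_group_add) vspace \<Rightarrow> (int \<Rightarrow> 'v set) \<Rightarrow> ('k, ('k, 'v) ctens2) vspace" where
  "ctensor V G = \<lparr>scl = (\<lambda>c t n. fun_scl c (t n)),
                  car = {t. \<forall>i j. t (i, j) \<in> subtensor V V (G i) (G j)}\<rparr>"

text \<open>Images of the pure tensors of homogeneous or inhomogeneous elements in the completions.\<close>

definition cpure2 ::
  "('k::field, 'v::ab_group_add) vspace \<Rightarrow> (int \<Rightarrow> 'v set) \<Rightarrow> 'v \<Rightarrow> 'v \<Rightarrow> ('k, 'v) ctens2" where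
  "cpure2 V G u v = (\<lambda>(i, j). pure2 V V (component G i u) (component G j v))"

definition cpure3 ::
  "('k::field, 'v::ab_group_add) vspace \<Rightarrow> (int \<Rightarrow> 'v set) \<Rightarrow>
   'v \<Rightarrow> 'v \<Rightarrow> 'v \<Rightarrow> ('k, 'v) ctens3" where
  "cpure3 V G u v w =
     (\<lambda>(i, j, k). pure3 V (component G i u) (component G j v) (component G k w))"

text \<open>
  Termwise application of a bilinear map \<open>\<phi>\<close>, with values in a completed tensor product, to
  \<open>t = \<Sum>\<^sub>\<alpha> u\<^sub>\<alpha> \<otimes> v\<^sub>\<alpha> \<in> V \<hat>\<otimes> V\<close>, i.e. \<open>\<Sum>\<^sub>\<alpha> \<phi> u\<^sub>\<alpha> v\<^sub>\<alpha>\<close>.  This possibly infinite sum makes sense if every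
  homogeneous component receives contributions from finitely many blocks of \<open>t\<close> only
  (\<open>csummable\<close>); \<open>Sum_any\<close> is a sum over all indices with non-zero summand.  The versions with
  primes form \<open>\<Sum>\<^sub>\<alpha>\<^sub>\<beta> \<phi> u\<^sub>\<alpha> v\<^sub>\<alpha> u\<^sub>\<beta> v\<^sub>\<beta>\<close>.
\<close>

definition cterm ::
  "('v \<Rightarrow> 'v \<Rightarrow> 'n \<Rightarrow> ('x \<Rightarrow> 'k)) \<Rightarrow> ('k, 'v) ctens2 \<Rightarrow> 'n \<Rightarrow> int \<times> int \<Rightarrow> ('x \<Rightarrow> 'k)" where
  "cterm \<phi> t n p = lift2 (\<lambda>u v. \<phi> u v n) (t p)"

definition csummable ::
  "('v \<Rightarrow> 'v \<Rightarrow> 'n \<Rightarrow> ('x \<Rightarrow> 'k::field)) \<Rightarrow> ('k, 'v) ctens2 \<Rightarrow> bool" where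
  "csummable \<phi> t \<longleftrightarrow> (\<forall>n. finite {p. cterm \<phi> t n p \<noteq> 0})"

definition clift ::
  "('v \<Rightarrow> 'v \<Rightarrow> 'n \<Rightarrow> ('x \<Rightarrow> 'k::field)) \<Rightarrow> ('k, 'v) ctens2 \<Rightarrow> 'n \<Rightarrow> ('x \<Rightarrow> 'k)" where
  "clift \<phi> t = (\<lambda>n. Sum_any (cterm \<phi> t n))"

definition cterm' ::
  "('v \<Rightarrow> 'v \<Rightarrow> 'v \<Rightarrow> 'v \<Rightarrow> 'n \<Rightarrow> ('x \<Rightarrow> 'k)) \<Rightarrow> ('k, 'v) ctens2 \<Rightarrow> 'n \<Rightarrow>
   (int \<times> int) \<times> (int \<times> int) \<Rightarrow> ('x \<Rightarrow> 'k)" where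
  "cterm' \<phi> t n = (\<lambda>(p, q). lift2 (\<lambda>u v. lift2 (\<lambda>u' v'. \<phi> u v u' v' n) (t q)) (t p))"

definition csummable' ::
  "('v \<Rightarrow> 'v \<Rightarrow> 'v \<Rightarrow> 'v \<Rightarrow> 'n \<Rightarrow> ('x \<Rightarrow> 'k::field)) \<Rightarrow> ('k, 'v) ctens2 \<Rightarrow> bool" where
  "csummable' \<phi> t \<longleftrightarrow> (\<forall>n. finite {pq. cterm' \<phi> t n pq \<noteq> 0})"

definition clift' ::
  "('v \<Rightarrow> 'v \<Rightarrow> 'v \<Rightarrow> 'v \<Rightarrow> 'n \<Rightarrow> ('x \<Rightarrow> 'k::field)) \<Rightarrow> ('k, 'v) ctens2 \<Rightarrow> 'n \<Rightarrow> ('x \<Rightarrow> 'k)" where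
  "clift' \<phi> t = (\<lambda>n. Sum_any (cterm' \<phi> t n))"

text \<open>
  Completed versions of \<open>f \<otimes> g\<close>, \<open>\<tau>\<close>, \<open>\<tau> \<otimes> id\<close>, \<open>\<Delta> \<otimes> id\<close> and \<open>id \<otimes> \<Delta>\<close>.  Summability is automatic
  for \<open>f \<otimes> id\<close> and \<open>id \<otimes> f\<close> when \<open>f\<close> is a multiplication operator of a graded algebra; for
  \<open>\<Delta> \<otimes> id\<close> and \<open>id \<otimes> \<Delta>\<close> it has to be required.
\<close>

definition ctmap ::
  "('k::field, 'v::ab_group_add) vspace \<Rightarrow> (int \<Rightarrow> 'v set) \<Rightarrow> ('v \<Rightarrow> 'v) \<Rightarrow> ('v \<Rightarrow> 'v) \<Rightarrow>
   ('k, 'v) ctens2 \<Rightarrow> ('k, 'v) ctens2" where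
  "ctmap V G f g = clift (\<lambda>u v. cpure2 V G (f u) (g v))"

definition cflip ::
  "('k::field, 'v::ab_group_add) vspace \<Rightarrow> ('k, 'v) ctens2 \<Rightarrow> ('k, 'v) ctens2" where
  "cflip V t = (\<lambda>(i, j). flip V (t (j, i)))"

definition cflip12 ::
  "('k::field, 'v::ab_group_add) vspace \<Rightarrow> ('k, 'v) ctens3 \<Rightarrow> ('k, 'v) ctens3" where
  "cflip12 V t = (\<lambda>(i, j, k). flip12 V (t (j, i, k)))"

definition ctens_left ::
  "('k::field, 'v::ab_group_add) vspace \<Rightarrow> (int \<Rightarrow> 'v set) \<Rightarrow>
   ('k, 'v) ctens2 \<Rightarrow> 'v \<Rightarrow> ('k, 'v) ctens3" where
  "ctens_left V G t w = (\<lambda>(i, j, k). lift2 (\<lambda>x y. pure3 V x y (component G k w)) (t (i, j)))"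

definition ctens_right ::
  "('k::field, 'v::ab_group_add) vspace \<Rightarrow> (int \<Rightarrow> 'v set) \<Rightarrow>
   'v \<Rightarrow> ('k, 'v) ctens2 \<Rightarrow> ('k, 'v) ctens3" where
  "ctens_right V G u t = (\<lambda>(i, j, k). lift2 (\<lambda>x y. pure3 V (component G i u) x y) (t (j, k)))"

definition ccomul_left ::
  "('k::field, 'v::ab_group_add) vspace \<Rightarrow> (int \<Rightarrow> 'v set) \<Rightarrow> ('v \<Rightarrow> ('k, 'v) ctens2) \<Rightarrow>
   ('k, 'v) ctens2 \<Rightarrow> ('k, 'v) ctens3" where
  "ccomul_left V G \<Delta> = clift (\<lambda>u w. ctens_left V G (\<Delta> u) w)"

definition ccomul_right ::
  "('k::field, 'v::ab_group_add) vspace \<Rightarrow> (int \<Rightarrow> 'v set) \<Rightarrow> ('v \<Rightarrow> ('k, 'v) ctens2) \<Rightarrow>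
   ('k, 'v) ctens2 \<Rightarrow> ('k, 'v) ctens3" where
  "ccomul_right V G \<Delta> = clift (\<lambda>u w. ctens_right V G u (\<Delta> w))"

definition comul_summable ::
  "('k::field, 'v::ab_group_add) vspace \<Rightarrow> (int \<Rightarrow> 'v set) \<Rightarrow> ('v \<Rightarrow> ('k, 'v) ctens2) \<Rightarrow>
   ('k, 'v) ctens2 \<Rightarrow> bool" where
  "comul_summable V G \<Delta> t \<longleftrightarrow>
     csummable (\<lambda>u w. ctens_left V G (\<Delta> u) w) t \<and> csummable (\<lambda>u w. ctens_right V G u (\<Delta> w)) t"


section \<open>Completed Poisson bialgebras\<close>

locale graded_Poisson_algebra =
  fixes P :: "('k::field, 'p::ab_group_add) vspace"
    and G :: "int \<Rightarrow> 'p set"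
    and mul :: "'p \<Rightarrow> 'p \<Rightarrow> 'p" (infixl "\<^bold>\<cdot>" 70)
    and brk :: "'p \<Rightarrow> 'p \<Rightarrow> 'p" ("\<^bold>[_, _\<^bold>]")
  assumes graded: "graded_vspace P G"
    and mul_bilinear: "bilinear_on P P P (\<^bold>\<cdot>)"
    and brk_bilinear: "bilinear_on P P P brk"
    and mul_commute: "\<lbrakk>p \<in> car P; q \<in> car P\<rbrakk> \<Longrightarrow> p \<^bold>\<cdot> q = q \<^bold>\<cdot> p"
    and mul_assoc: "\<lbrakk>p \<in> car P; q \<in> car P; s \<in> car P\<rbrakk> \<Longrightarrow> (p \<^bold>\<cdot> q) \<^bold>\<cdot> s = p \<^bold>\<cdot> (q \<^bold>\<cdot> s)"
    and brk_self: "p \<in> car P \<Longrightarrow> \<^bold>[p, p\<^bold>] = 0"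
    and Jacobi: "\<lbrakk>p \<in> car P; q \<in> car P; s \<in> car P\<rbrakk> \<Longrightarrow>
      \<^bold>[p, \<^bold>[q, s\<^bold>]\<^bold>] + \<^bold>[q, \<^bold>[s, p\<^bold>]\<^bold>] + \<^bold>[s, \<^bold>[p, q\<^bold>]\<^bold>] = 0"
    and Leibniz: "\<lbrakk>p \<in> car P; q \<in> car P; s \<in> car P\<rbrakk> \<Longrightarrow>
      \<^bold>[p, q \<^bold>\<cdot> s\<^bold>] = \<^bold>[p, q\<^bold>] \<^bold>\<cdot> s + q \<^bold>\<cdot> \<^bold>[p, s\<^bold>]"
    and mul_degree: "\<lbrakk>p \<in> G i; q \<in> G j\<rbrakk> \<Longrightarrow> p \<^bold>\<cdot> q \<in> G (i + j)"
    and brk_degree: "\<lbrakk>p \<in> G i; q \<in> G j\<rbrakk> \<Longrightarrow> \<^bold>[p, q\<^bold>] \<in> G (i + j)"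

text \<open>\<open>summable\<close> expresses that all the composites in the subsequent axioms are well-defined.\<close>

locale completed_Poisson_bialgebra = graded_Poisson_algebra P G mul brk
  for P :: "('k::field, 'p::ab_group_add) vspace"
    and G :: "int \<Rightarrow> 'p set"
    and mul :: "'p \<Rightarrow> 'p \<Rightarrow> 'p" (infixl "\<^bold>\<cdot>" 70)
    and brk :: "'p \<Rightarrow> 'p \<Rightarrow> 'p" ("\<^bold>[_, _\<^bold>]") +
  fixes Delta :: "'p \<Rightarrow> ('k, 'p) ctens2" ("\<Delta>")
    and delta :: "'p \<Rightarrow> ('k, 'p) ctens2" ("\<delta>")
  assumes Delta_linear: "linear_on P (ctensor P G) \<Delta>"
    and delta_linear: "linear_on P (ctensor P G) \<delta>"
    and summable: "p \<in> car P \<Longrightarrow>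
      comul_summable P G \<Delta> (\<Delta> p) \<and> comul_summable P G \<Delta> (\<delta> p) \<and>
      comul_summable P G \<delta> (\<Delta> p) \<and> comul_summable P G \<delta> (\<delta> p)"
    and cocommutative: "p \<in> car P \<Longrightarrow> cflip P (\<Delta> p) = \<Delta> p"
    and coassociative: "p \<in> car P \<Longrightarrow>
      ccomul_left P G \<Delta> (\<Delta> p) = ccomul_right P G \<Delta> (\<Delta> p)"
    and co_skew: "p \<in> car P \<Longrightarrow> cflip P (\<delta> p) = - \<delta> p"
    and co_Jacobi: "p \<in> car P \<Longrightarrow>
      ccomul_right P G \<delta> (\<delta> p) - cflip12 P (ccomul_right P G \<delta> (\<delta> p)) = ccomul_left P G \<delta> (\<delta> p)"
    and co_Leibniz: "p \<in> car P \<Longrightarrow>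
      ccomul_right P G \<Delta> (\<delta> p)
      = ccomul_left P G \<delta> (\<Delta> p) + cflip12 P (ccomul_right P G \<delta> (\<Delta> p))"
    and Delta_mul: "\<lbrakk>p1 \<in> car P; p2 \<in> car P\<rbrakk> \<Longrightarrow>
      \<Delta> (p1 \<^bold>\<cdot> p2)
      = ctmap P G (\<lambda>q. p2 \<^bold>\<cdot> q) id (\<Delta> p1) + ctmap P G id (\<lambda>q. p1 \<^bold>\<cdot> q) (\<Delta> p2)"
    and delta_brk: "\<lbrakk>p1 \<in> car P; p2 \<in> car P\<rbrakk> \<Longrightarrow>
      \<delta> \<^bold>[p1, p2\<^bold>]
      = (ctmap P G (\<lambda>q. \<^bold>[p1, q\<^bold>]) id (\<delta> p2) + ctmap P G id (\<lambda>q. \<^bold>[p1, q\<^bold>]) (\<delta> p2))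
        - (ctmap P G (\<lambda>q. \<^bold>[p2, q\<^bold>]) id (\<delta> p1) + ctmap P G id (\<lambda>q. \<^bold>[p2, q\<^bold>]) (\<delta> p1))"
    and Delta_brk: "\<lbrakk>p1 \<in> car P; p2 \<in> car P\<rbrakk> \<Longrightarrow>
      \<Delta> \<^bold>[p1, p2\<^bold>]
      = (ctmap P G (\<lambda>q. \<^bold>[p1, q\<^bold>]) id (\<Delta> p2) + ctmap P G id (\<lambda>q. \<^bold>[p1, q\<^bold>]) (\<Delta> p2))
        + (ctmap P G (\<lambda>q. p2 \<^bold>\<cdot> q) id (\<delta> p1) - ctmap P G id (\<lambda>q. p2 \<^bold>\<cdot> q) (\<delta> p1))"
    and delta_mul: "\<lbrakk>p1 \<in> car P; p2 \<in> car P\<rbrakk> \<Longrightarrow>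
      \<delta> (p1 \<^bold>\<cdot> p2)
      = ctmap P G (\<lambda>q. p1 \<^bold>\<cdot> q) id (\<delta> p2) + ctmap P G (\<lambda>q. p2 \<^bold>\<cdot> q) id (\<delta> p1)
        + ctmap P G id (\<lambda>q. \<^bold>[p1, q\<^bold>]) (\<Delta> p2) + ctmap P G id (\<lambda>q. \<^bold>[p2, q\<^bold>]) (\<Delta> p1)"

definition completed_PYBE_solution ::
  "('k::field, 'p::ab_group_add) vspace \<Rightarrow> (int \<Rightarrow> 'p set) \<Rightarrow>
   ('p \<Rightarrow> 'p \<Rightarrow> 'p) \<Rightarrow> ('p \<Rightarrow> 'p \<Rightarrow> 'p) \<Rightarrow> ('k, 'p) ctens2 \<Rightarrow> bool" where
  "completed_PYBE_solution P G mul brk r \<longleftrightarrow>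
     r \<in> car (ctensor P G) \<and>
     (\<forall>m\<in>{mul, brk}.
        csummable' (\<lambda>xa ya xb yb. cpure3 P G (m xa xb) ya yb) r \<and>
        csummable' (\<lambda>xa ya xb yb. cpure3 P G xa xb (m ya yb)) r) \<and>
     csummable' (\<lambda>xa ya xb yb. cpure3 P G xb (mul xa yb) ya) r \<and>
     csummable' (\<lambda>xa ya xb yb. cpure3 P G xa (brk ya xb) yb) r \<and>
     clift' (\<lambda>xa ya xb yb. cpure3 P G (mul xa xb) ya yb) r
       + clift' (\<lambda>xa ya xb yb. cpure3 P G xa xb (mul ya yb)) r
       - clift' (\<lambda>xa ya xb yb. cpure3 P G xb (mul xa yb) ya) r = 0 \<and>
     clift' (\<lambda>xa ya xb yb. cpure3 P G (brk xa xb) ya yb) r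
       + clift' (\<lambda>xa ya xb yb. cpure3 P G xa xb (brk ya yb)) r
       + clift' (\<lambda>xa ya xb yb. cpure3 P G xa (brk ya xb) yb) r = 0"

definition triangular_completed_Poisson_bialgebra ::
  "('k::field, 'p::ab_group_add) vspace \<Rightarrow> (int \<Rightarrow> 'p set) \<Rightarrow>
   ('p \<Rightarrow> 'p \<Rightarrow> 'p) \<Rightarrow> ('p \<Rightarrow> 'p \<Rightarrow> 'p) \<Rightarrow>
   ('p \<Rightarrow> ('k, 'p) ctens2) \<Rightarrow> ('p \<Rightarrow> ('k, 'p) ctens2) \<Rightarrow> bool" where
  "triangular_completed_Poisson_bialgebra P G mul brk Delta delta \<longleftrightarrow>
     completed_Poisson_bialgebra P G mul brk Delta delta \<and>
     (\<exists>r. completed_PYBE_solution P G mul brk r \<and> cflip P r = - r \<and>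
          (\<forall>p\<in>car P.
             Delta p = ctmap P G id (\<lambda>q. mul p q) r - ctmap P G (\<lambda>q. mul p q) id r \<and>
             delta p = ctmap P G id (\<lambda>q. brk p q) r + ctmap P G (\<lambda>q. brk p q) id r))"


section \<open>Quadratic graded perm algebras and the induced structure\<close>

locale quadratic_graded_perm_algebra =
  fixes B :: "('k::field, 'b::ab_group_add) vspace"
    and H :: "int \<Rightarrow> 'b set"
    and dia :: "'b \<Rightarrow> 'b \<Rightarrow> 'b" (infixl "\<diamondop>" 70)
    and om :: "'b \<Rightarrow> 'b \<Rightarrow> 'k" ("\<omega>")
  assumes graded: "graded_vspace B H"
    and dia_bilinear: "bilinear_on B B B (\<diamondop>)"
    and perm_assoc: "\<lbrakk>b1 \<in> car B; b2 \<in> car B; b3 \<in> car B\<rbrakk> \<Longrightarrow>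
      b1 \<diamondop> (b2 \<diamondop> b3) = (b1 \<diamondop> b2) \<diamondop> b3"
    and perm_commute: "\<lbrakk>b1 \<in> car B; b2 \<in> car B; b3 \<in> car B\<rbrakk> \<Longrightarrow>
      (b1 \<diamondop> b2) \<diamondop> b3 = (b2 \<diamondop> b1) \<diamondop> b3"
    and dia_degree: "\<lbrakk>b \<in> H i; c \<in> H j\<rbrakk> \<Longrightarrow> b \<diamondop> c \<in> H (i + j)"
    and om_bilinear: "bilinear_on B B scalars \<omega>"
    and om_antisym: "\<lbrakk>b \<in> car B; c \<in> car B\<rbrakk> \<Longrightarrow> \<omega> b c = - \<omega> c b"
    and om_nondegenerate: "\<lbrakk>b \<in> car B; \<And>c. c \<in> car B \<Longrightarrow> \<omega> b c = 0\<rbrakk> \<Longrightarrow> b = 0"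
    and om_invariant: "\<lbrakk>b1 \<in> car B; b2 \<in> car B; b3 \<in> car B\<rbrakk> \<Longrightarrow>
      \<omega> (b1 \<diamondop> b2) b3 = \<omega> b1 (b2 \<diamondop> b3 - b3 \<diamondop> b2)"
    and om_degree: "\<exists>m. \<forall>i j. i + j + m \<noteq> 0 \<longrightarrow> (\<forall>b\<in>H i. \<forall>c\<in>H j. \<omega> b c = 0)"

text \<open>
  \<open>om_hat \<omega> t y y'\<close> is the pairing of \<open>t \<in> B \<hat>\<otimes> B\<close> with \<open>y \<otimes> y'\<close>; a tensor in \<open>B\<^sub>i \<otimes> B\<^sub>j\<close> is paired by
  evaluating it at the bilinear form \<open>(x, x') \<mapsto> \<omega>(x, y) \<omega>(x', y')\<close>.
\<close>

definition om_hat ::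
  "('b \<Rightarrow> 'b \<Rightarrow> 'k::field) \<Rightarrow> ('k, 'b) ctens2 \<Rightarrow> 'b \<Rightarrow> 'b \<Rightarrow> 'k" where
  "om_hat om t y y' = Sum_any (\<lambda>p. t p (\<lambda>x x'. om x y * om x' y'))"

definition nu ::
  "('k::field, 'b::ab_group_add) vspace \<Rightarrow> (int \<Rightarrow> 'b set) \<Rightarrow> ('b \<Rightarrow> 'b \<Rightarrow> 'b) \<Rightarrow>
   ('b \<Rightarrow> 'b \<Rightarrow> 'k) \<Rightarrow> 'b \<Rightarrow> ('k, 'b) ctens2" where
  "nu B H dia om b1 =
     (THE t. t \<in> car (ctensor B H) \<and>
             (\<forall>b2\<in>car B. \<forall>b3\<in>car B. om_hat om t b2 b3 = - om b1 (dia b2 b3)))"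

definition ind_grading ::
  "('k::field, 'a::ab_group_add) vspace \<Rightarrow> ('k, 'b::ab_group_add) vspace \<Rightarrow>
   (int \<Rightarrow> 'b set) \<Rightarrow> int \<Rightarrow> ('k, 'a, 'b) tens2 set" where
  "ind_grading A B H i = subtensor A B (car A) (H i)"

definition ind_mul ::
  "('k::field, 'a::ab_group_add) vspace \<Rightarrow> ('k, 'b::ab_group_add) vspace \<Rightarrow>
   ('a \<Rightarrow> 'a \<Rightarrow> 'a) \<Rightarrow> ('b \<Rightarrow> 'b \<Rightarrow> 'b) \<Rightarrow>
   ('k, 'a, 'b) tens2 \<Rightarrow> ('k, 'a, 'b) tens2 \<Rightarrow> ('k, 'a, 'b) tens2" where
  "ind_mul A B ast dia p q =
     lift2 (\<lambda>a1 b1. lift2 (\<lambda>a2 b2.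
       pure2 A B (ast a1 a2) (dia b1 b2) + pure2 A B (ast a2 a1) (dia b2 b1)) q) p"

definition ind_brk ::
  "('k::field, 'a::ab_group_add) vspace \<Rightarrow> ('k, 'b::ab_group_add) vspace \<Rightarrow>
   ('a \<Rightarrow> 'a \<Rightarrow> 'a) \<Rightarrow> ('b \<Rightarrow> 'b \<Rightarrow> 'b) \<Rightarrow>
   ('k, 'a, 'b) tens2 \<Rightarrow> ('k, 'a, 'b) tens2 \<Rightarrow> ('k, 'a, 'b) tens2" where
  "ind_brk A B circ dia p q =
     lift2 (\<lambda>a1 b1. lift2 (\<lambda>a2 b2.
       pure2 A B (circ a1 a2) (dia b1 b2) - pure2 A B (circ a2 a1) (dia b2 b1)) q) p"

definition bullet ::
  "('k::field, 'a::ab_group_add) vspace \<Rightarrow> ('k, 'b::ab_group_add) vspace \<Rightarrow>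
   ('k, 'a, 'a) tens2 \<Rightarrow> ('k, 'b) ctens2 \<Rightarrow> ('k, ('k, 'a, 'b) tens2) ctens2" where
  "bullet A B s t = (\<lambda>ij. lift2 (\<lambda>a' a''. lift2 (\<lambda>b' b''.
     pure2 (tensor A B) (tensor A B) (pure2 A B a' b') (pure2 A B a'' b'')) (t ij)) s)"

definition ind_Delta ::
  "('k::field, 'a::ab_group_add) vspace \<Rightarrow> ('k, 'b::ab_group_add) vspace \<Rightarrow>
   ('a \<Rightarrow> ('k, 'a, 'a) tens2) \<Rightarrow> ('b \<Rightarrow> ('k, 'b) ctens2) \<Rightarrow>
   ('k, 'a, 'b) tens2 \<Rightarrow> ('k, ('k, 'a, 'b) tens2) ctens2" where
  "ind_Delta A B vth \<nu> p = (\<lambda>ij. lift2 (\<lambda>a b.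
     (bullet A B (vth a) (\<nu> b) + cflip (tensor A B) (bullet A B (vth a) (\<nu> b))) ij) p)"

definition ind_delta ::
  "('k::field, 'a::ab_group_add) vspace \<Rightarrow> ('k, 'b::ab_group_add) vspace \<Rightarrow>
   ('a \<Rightarrow> ('k, 'a, 'a) tens2) \<Rightarrow> ('b \<Rightarrow> ('k, 'b) ctens2) \<Rightarrow>
   ('k, 'a, 'b) tens2 \<Rightarrow> ('k, ('k, 'a, 'b) tens2) ctens2" where
  "ind_delta A B th \<nu> p = (\<lambda>ij. lift2 (\<lambda>a b.
     (bullet A B (th a) (\<nu> b) - cflip (tensor A B) (bullet A B (th a) (\<nu> b))) ij) p)"

end

theory Submission
  imports Defs
begin

text \<open>
  Contracting every factor \<open>B\<close> with \<open>\<omega>\<close> turns an element of a completed tensor power of \<open>A \<otimes> B\<close> into a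
  family of elements of the corresponding tensor power of \<open>A\<close>, indexed by homogeneous elements
  \<open>c\<^sub>1, c\<^sub>2, \<dots>\<close> of \<open>B\<close>, and nondegeneracy makes this pairing faithful.  Under it the structure maps of
  \<open>A \<otimes> B\<close> become those of \<open>A\<close> with coefficients such as \<open>\<omega>(b, c\<^sub>1 \<diamondop> c\<^sub>2)\<close>; the perm identities and the
  invariance of \<open>\<omega>\<close> leave few independent coefficients, and comparing them turns every bialgebra
  axiom into axioms of \<open>A\<close>.  For triangularity take \<open>r \<bullet> \<kappa>\<close>, where \<open>\<kappa> \<in> B \<hat>\<otimes> B\<close> is the inverse of
  \<open>\<omega>\<close>: by symmetry of \<open>r\<close>, each term of the Poisson Yang-Baxter equation becomes a combination of
  values of \<open>r\<^sub>1\<^sub>2 \<star> r\<^sub>1\<^sub>3\<close> at permuted arguments, and the coefficients of the two independent words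
  \<open>\<omega>(c\<^sub>2 \<diamondop> c\<^sub>1, c\<^sub>3)\<close> and \<open>\<omega>(c\<^sub>3 \<diamondop> c\<^sub>1, c\<^sub>2)\<close> both vanish by the equation for \<open>r\<close>.
\<close>

section \<open>Linear and bilinear forms\<close>

text \<open>Two obstacles shape the development. Moreover, sums in the completions are infinite;
  these are controlled by degrees. As \<omega> pairs \<open>H i\<close> with
  \<open>H (- m - i)\<close> only and these pieces are finite-dimensional, there are finite dual
  bases \<open>Eb i\<close> and \<open>fb i\<close>. The coproducts shift the total degree by
  \<open>- m\<close>, so one component of a composite receives a contribution from one block only.
  The words in \<open>B\<close> become few because left multiplications are self-adjoint for
  \<omega>, the adjoint of \<open>y \<mapsto> y \<diamondop> b\<close> is
  \<open>c \<mapsto> b \<diamondop> c - c \<diamondop> b\<close>, and in a product of several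
  letters all letters but the last may be permuted. Each bialgebra axiom then involves three words.
  A sign \<epsilon> treats product and bracket, and likewise \<Delta> and \<delta>, by one
  computation.\<close>

lemma linear_formI:
  assumes "\<And>x y. x \<in> car U \<Longrightarrow> y \<in> car U \<Longrightarrow> f (x + y) = f x + f y"
    and "\<And>c x. x \<in> car U \<Longrightarrow> f (scl U c x) = c * f x"
  shows "linear_on U scalars f"
  using assms by (simp add: linear_on_def scalars_def)

lemma linear_form_add: "linear_on U scalars f \<Longrightarrow> x \<in> car U \<Longrightarrow> y \<in> car U \<Longrightarrow> f (x + y) = f x + f y"
  and linear_form_scl: "linear_on U scalars f \<Longrightarrow> x \<in> car U \<Longrightarrow> f (scl U c x) = c * f x"
  by (simp_all add: linear_on_def scalars_def)

lemma linear_on_mem: "linear_on U V f \<Longrightarrow> x \<in> car U \<Longrightarrow> f x \<in> car V"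
  by (simp add: linear_on_def)

lemma linear_on_add: "linear_on U V f \<Longrightarrow> x \<in> car U \<Longrightarrow> y \<in> car U \<Longrightarrow> f (x + y) = f x + f y"
  by (simp add: linear_on_def)

lemma linear_on_scl: "linear_on U V f \<Longrightarrow> x \<in> car U \<Longrightarrow> f (scl U c x) = scl V c (f x)"
  by (simp add: linear_on_def)

lemma linear_on_comp: "linear_on V W f \<Longrightarrow> linear_on U V g \<Longrightarrow> linear_on U W (\<lambda>x. f (g x))"
  by (simp add: linear_on_def)

named_theorems lin

lemma lin_intros [lin]:
  "linear_on U scalars (\<lambda>_. 0)"
  "linear_on U scalars f \<Longrightarrow> linear_on U scalars g \<Longrightarrow> linear_on U scalars (\<lambda>x. f x + g x)"
  "linear_on U scalars f \<Longrightarrow> linear_on U scalars g \<Longrightarrow> linear_on U scalars (\<lambda>x. f x - g x)"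
  "linear_on U scalars f \<Longrightarrow> linear_on U scalars (\<lambda>x. - f x)"
  "linear_on U scalars f \<Longrightarrow> linear_on U scalars (\<lambda>x. c * f x)"
  "linear_on U scalars f \<Longrightarrow> linear_on U scalars (\<lambda>x. f x * c)"
  by (simp_all add: linear_on_def scalars_def algebra_simps)

lemma lin_sum [lin]:
  "(\<And>i. i \<in> I \<Longrightarrow> linear_on U scalars (f i)) \<Longrightarrow> linear_on U scalars (\<lambda>x. \<Sum>i\<in>I. f i x)"
  by (induction I rule: infinite_finite_induct) (auto intro: lin)

lemma bilinear_formI:
  assumes "\<And>x. x \<in> car U \<Longrightarrow> linear_on V scalars (\<beta> x)"
    and "\<And>y. y \<in> car V \<Longrightarrow> linear_on U scalars (\<lambda>x. \<beta> x y)"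
  shows "bilinear_on U V scalars \<beta>"
  using assms by (simp add: bilinear_on_def)

lemma bilinear_onD1: "bilinear_on U V W \<beta> \<Longrightarrow> x \<in> car U \<Longrightarrow> linear_on V W (\<beta> x)"
  and bilinear_onD2: "bilinear_on U V W \<beta> \<Longrightarrow> y \<in> car V \<Longrightarrow> linear_on U W (\<lambda>x. \<beta> x y)"
  by (simp_all add: bilinear_on_def)

lemma bilin_intros [lin]:
  "bilinear_on U V scalars (\<lambda>_ _. 0)"
  "bilinear_on U V scalars f \<Longrightarrow> bilinear_on U V scalars g \<Longrightarrow> bilinear_on U V scalars (\<lambda>x y. f x y + g x y)"
  "bilinear_on U V scalars f \<Longrightarrow> bilinear_on U V scalars g \<Longrightarrow> bilinear_on U V scalars (\<lambda>x y. f x y - g x y)"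
  "bilinear_on U V scalars f \<Longrightarrow> bilinear_on U V scalars (\<lambda>x y. - f x y)"
  "bilinear_on U V scalars f \<Longrightarrow> bilinear_on U V scalars (\<lambda>x y. c * f x y)"
  "bilinear_on U V scalars f \<Longrightarrow> bilinear_on U V scalars (\<lambda>x y. f x y * c)"
  by (auto simp: bilinear_on_def intro: lin)

lemma bilin_sum [lin]:
  "(\<And>i. i \<in> I \<Longrightarrow> bilinear_on U V scalars (f i)) \<Longrightarrow> bilinear_on U V scalars (\<lambda>x y. \<Sum>i\<in>I. f i x y)"
  by (auto simp: bilinear_on_def intro: lin)

lemma bilin_mult [lin]:
  "linear_on U scalars f \<Longrightarrow> linear_on V scalars g \<Longrightarrow> bilinear_on U V scalars (\<lambda>x y. f x * g y)"
  by (auto simp: bilinear_on_def intro: lin)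

lemma bilin_swap: "bilinear_on U V W \<beta> \<Longrightarrow> bilinear_on V U W (\<lambda>y x. \<beta> x y)"
  by (auto simp: bilinear_on_def)

lemma bilin_comp:
  "bilinear_on U V W \<beta> \<Longrightarrow> linear_on U' U f \<Longrightarrow> linear_on V' V g \<Longrightarrow>
   bilinear_on U' V' W (\<lambda>x y. \<beta> (f x) (g y))"
  by (auto simp: bilinear_on_def linear_on_def)

lemma linear_on_ident: "linear_on U U (\<lambda>x. x)"
  by (simp add: linear_on_def)

lemma trilinear_formI:
  assumes "\<And>y z. y \<in> car V \<Longrightarrow> z \<in> car V \<Longrightarrow> linear_on V scalars (\<lambda>x. f x y z)"
    and "\<And>x z. x \<in> car V \<Longrightarrow> z \<in> car V \<Longrightarrow> linear_on V scalars (\<lambda>y. f x y z)"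
    and "\<And>x y. x \<in> car V \<Longrightarrow> y \<in> car V \<Longrightarrow> linear_on V scalars (\<lambda>z. f x y z)"
  shows "trilinear_form_on V f"
  using assms by (auto simp: trilinear_form_on_def bilinear_on_def)

lemma trilinear_formD:
  assumes "trilinear_form_on V f" "x \<in> car V" "y \<in> car V"
  shows "linear_on V scalars (\<lambda>z. f z x y)" "linear_on V scalars (\<lambda>z. f x z y)"
    "linear_on V scalars (\<lambda>z. f x y z)"
  using assms by (auto simp: trilinear_form_on_def bilinear_on_def)

lemma trilinear_permute:
  assumes "trilinear_form_on V f"
  shows "trilinear_form_on V (\<lambda>x y z. f x z y)" "trilinear_form_on V (\<lambda>x y z. f y x z)"
    "trilinear_form_on V (\<lambda>x y z. f y z x)" "trilinear_form_on V (\<lambda>x y z. f z x y)"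
    "trilinear_form_on V (\<lambda>x y z. f z y x)"
  using assms by (auto simp: trilinear_form_on_def bilinear_on_def)

lemma trilinear_bilinear:
  assumes "trilinear_form_on V f" "w \<in> car V"
  shows "bilinear_on V V scalars (\<lambda>x y. f x y w)" "bilinear_on V V scalars (\<lambda>x y. f x w y)"
    "bilinear_on V V scalars (\<lambda>x y. f w x y)" "bilinear_on V V scalars (\<lambda>x y. f y x w)"
    "bilinear_on V V scalars (\<lambda>x y. f y w x)" "bilinear_on V V scalars (\<lambda>x y. f w y x)"
  using assms by (auto simp: trilinear_form_on_def bilinear_on_def)

lemma linear_on_0:
  assumes "linear_on U V f" "is_vspace U"
  shows "f 0 = 0"
proof -
  interpret vector_space "scl U" using assms(2) by (simp add: is_vspace_def)
  have "0 \<in> car U" using assms(2) by (simp add: is_vspace_def subspace_def)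
  then have "f (0 + 0) = f 0 + f 0" using assms(1) unfolding linear_on_def by blast
  then show ?thesis by simp
qed

lemma is_vspaceD:
  assumes "is_vspace V"
  shows "0 \<in> car V" "x \<in> car V \<Longrightarrow> y \<in> car V \<Longrightarrow> x + y \<in> car V" "x \<in> car V \<Longrightarrow> scl V c x \<in> car V"
    "x \<in> car V \<Longrightarrow> y \<in> car V \<Longrightarrow> x - y \<in> car V" "x \<in> car V \<Longrightarrow> - x \<in> car V"
    "scl V 1 x = x" "scl V (- 1) x = - x" "scl V 0 x = 0"
    "(\<And>i. i \<in> I \<Longrightarrow> g i \<in> car V) \<Longrightarrow> sum g I \<in> car V"
proof -
  interpret vector_space "scl V" using assms by (simp add: is_vspace_def)
  have s: "subspace (car V)" using assms by (simp add: is_vspace_def)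
  show "0 \<in> car V" "x \<in> car V \<Longrightarrow> y \<in> car V \<Longrightarrow> x + y \<in> car V" "x \<in> car V \<Longrightarrow> scl V c x \<in> car V"
    "x \<in> car V \<Longrightarrow> y \<in> car V \<Longrightarrow> x - y \<in> car V" "x \<in> car V \<Longrightarrow> - x \<in> car V"
    "(\<And>i. i \<in> I \<Longrightarrow> g i \<in> car V) \<Longrightarrow> sum g I \<in> car V"
    using s by (auto intro: subspace_0 subspace_add subspace_scale subspace_diff subspace_neg subspace_sum)
  show "scl V 1 x = x" "scl V (- 1) x = - x" "scl V 0 x = 0" by simp_all
qed

lemma linear_on_diff:
  assumes "linear_on U V f" "is_vspace U" "x \<in> car U" "y \<in> car U"
  shows "f (x - y) = f x - f y"
proof -
  have "f (x - y) + f y = f (x - y + y)"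
    using assms by (intro linear_on_add[symmetric]) (auto intro: is_vspaceD)
  then show ?thesis by (simp add: algebra_simps)
qed

lemma linear_on_sum:
  assumes "linear_on U V f" "is_vspace U" "\<And>i. i \<in> I \<Longrightarrow> g i \<in> car U"
  shows "f (\<Sum>i\<in>I. g i) = (\<Sum>i\<in>I. f (g i))"
  using assms(3)
  by (induction I rule: infinite_finite_induct)
    (auto simp: linear_on_0[OF assms(1,2)] linear_on_add[OF assms(1)] is_vspaceD[OF assms(2)])

lemma fun_sum_apply: "(\<Sum>i\<in>I. f i) x = (\<Sum>i\<in>I. f i x)"
  by (induction I rule: infinite_finite_induct) auto

section \<open>Tensors as functionals\<close>

lemma vector_space_fun_scl: "vector_space (fun_scl :: 'k::field \<Rightarrow> ('x \<Rightarrow> 'k) \<Rightarrow> _)"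
  by unfold_locales (simp_all add: fun_scl_def fun_eq_iff algebra_simps)

interpretation fsc: vector_space "fun_scl :: 'k::field \<Rightarrow> ('x \<Rightarrow> 'k) \<Rightarrow> _"
  by (rule vector_space_fun_scl)

lemma fun_scl_apply: "fun_scl c f x = c * f x"
  by (simp add: fun_scl_def)

lemma scl_tensor [simp]: "scl (tensor U V) = fun_scl"
  and car_tensor: "car (tensor U V) = subtensor U V (car U) (car V)"
  by (simp_all add: tensor_def)

lemma is_vspace_tensor: "is_vspace (tensor U V)"
  unfolding is_vspace_def scl_tensor car_tensor subtensor_def
  by (intro conjI fsc.subspace_span vector_space_fun_scl)

lemma subspace_subtensor: "module.subspace fun_scl (subtensor U V X Y)"
  unfolding subtensor_def by (rule fsc.subspace_span)

lemma subtensor_mono: "X \<subseteq> X' \<Longrightarrow> Y \<subseteq> Y' \<Longrightarrow> subtensor U V X Y \<subseteq> subtensor U V X' Y'"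
  unfolding subtensor_def by (rule fsc.span_mono) blast

lemma subtensor_car: "X \<subseteq> car U \<Longrightarrow> Y \<subseteq> car V \<Longrightarrow> t \<in> subtensor U V X Y \<Longrightarrow> t \<in> car (tensor U V)"
  using subtensor_mono[of X "car U" Y "car V" U V] by (auto simp: car_tensor)

lemma pure2_mem: "u \<in> X \<Longrightarrow> v \<in> Y \<Longrightarrow> pure2 U V u v \<in> subtensor U V X Y"
  unfolding subtensor_def by (rule fsc.span_base) blast

lemma pure2_car: "u \<in> car U \<Longrightarrow> v \<in> car V \<Longrightarrow> pure2 U V u v \<in> car (tensor U V)"
  unfolding car_tensor by (rule pure2_mem)

lemma subtensor_closed:
  "0 \<in> subtensor U V X Y"
  "s \<in> subtensor U V X Y \<Longrightarrow> t \<in> subtensor U V X Y \<Longrightarrow> s + t \<in> subtensor U V X Y"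
  "s \<in> subtensor U V X Y \<Longrightarrow> t \<in> subtensor U V X Y \<Longrightarrow> s - t \<in> subtensor U V X Y"
  "s \<in> subtensor U V X Y \<Longrightarrow> - s \<in> subtensor U V X Y"
  "s \<in> subtensor U V X Y \<Longrightarrow> fun_scl c s \<in> subtensor U V X Y"
  "(\<And>i. i \<in> I \<Longrightarrow> g i \<in> subtensor U V X Y) \<Longrightarrow> sum g I \<in> subtensor U V X Y"
  unfolding subtensor_def
  by (rule fsc.span_zero fsc.span_add fsc.span_diff fsc.span_neg fsc.span_scale fsc.span_sum; assumption)+

lemma pure2_apply: "bilinear_on U V scalars \<beta> \<Longrightarrow> pure2 U V u v \<beta> = \<beta> u v"
  by (simp add: pure2_def)

lemma pure2_linear1: "v \<in> car V \<Longrightarrow> linear_on U (tensor U V) (\<lambda>u. pure2 U V u v)"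
  and pure2_linear2: "u \<in> car U \<Longrightarrow> linear_on V (tensor U V) (pure2 U V u)"
  using bilinear_on_pure2[of U V] by (auto simp: bilinear_on_def)

lemma pure2_scl: "u \<in> car U \<Longrightarrow> v \<in> car V \<Longrightarrow> fun_scl c (pure2 U V u v) = pure2 U V (scl U c u) v"
  using linear_on_scl[OF pure2_linear1, of v V u U c] by simp

text \<open>In a pure tensor a scalar can be absorbed by the first factor, so a span of pure tensors
  consists of plain sums of them. This removes the scalar from the induction step, at the price of
  \<open>X\<close> being closed under scaling.\<close>

lemma subtensor_induct [consumes 3, case_names scl zero add]:
  assumes t: "t \<in> subtensor U V X Y"
    and sub: "X \<subseteq> car U" "Y \<subseteq> car V" and cl: "\<And>c u. u \<in> X \<Longrightarrow> scl U c u \<in> X"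
    and z: "Q 0"
    and a: "\<And>s u v. s \<in> subtensor U V X Y \<Longrightarrow> Q s \<Longrightarrow> u \<in> X \<Longrightarrow> v \<in> Y \<Longrightarrow> Q (s + pure2 U V u v)"
  shows "Q t"
proof -
  have "t \<in> subtensor U V X Y \<and> Q t"
    using t unfolding subtensor_def
  proof (induction rule: fsc.span_induct_alt)
    case base
    show ?case using z fsc.span_zero by blast
  next
    case (step c x y)
    then obtain u v where uv: "x = pure2 U V u v" "u \<in> X" "v \<in> Y" by blast
    have e: "fun_scl c x + y = y + pure2 U V (scl U c u) v"
      using pure2_scl[of u U v V c] uv sub by (metis add.commute subsetD)
    have y: "y \<in> subtensor U V X Y" "Q y" using step.IH unfolding subtensor_def by blast+
    have "y + pure2 U V (scl U c u) v \<in> subtensor U V X Y"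
      using y uv cl by (intro subtensor_closed pure2_mem)
    then show ?case using y uv cl a[of y "scl U c u" v] unfolding e subtensor_def by blast
  qed
  then show ?thesis ..
qed

lemma tensor_induct [consumes 2, case_names zero add]:
  assumes "t \<in> car (tensor U V)" "is_vspace U" "Q 0"
    "\<And>s u v. s \<in> car (tensor U V) \<Longrightarrow> Q s \<Longrightarrow> u \<in> car U \<Longrightarrow> v \<in> car V \<Longrightarrow> Q (s + pure2 U V u v)"
  shows "Q t"
proof -
  have "t \<in> subtensor U V (car U) (car V)" using assms(1) by (simp add: car_tensor)
  then show ?thesis
    by (rule subtensor_induct) (use assms(3) in \<open>auto intro: is_vspaceD[OF assms(2)] intro!: assms(4) simp: car_tensor simp del: plus_fun_apply zero_fun_apply\<close>)
qed

text \<open>Pure tensors evaluate bilinear forms at a point, which is additive in the form, and sums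
  inherit this. Bilinearity of both summands matters: \<open>pure2\<close> is cut off to 0
  elsewhere, and a sum of two functions that are not bilinear may well be bilinear.\<close>

lemma tens_add:
  assumes "t \<in> car (tensor U V)" "is_vspace U" "bilinear_on U V scalars \<beta>" "bilinear_on U V scalars \<beta>'"
  shows "t (\<lambda>u v. \<beta> u v + \<beta>' u v) = t \<beta> + t \<beta>'"
  using assms(1,2)
  by (induction rule: tensor_induct) (use assms in \<open>auto simp: pure2_apply lin\<close>)

lemma tens_cmult:
  assumes "t \<in> car (tensor U V)" "is_vspace U" "bilinear_on U V scalars \<beta>"
  shows "t (\<lambda>u v. c * \<beta> u v) = c * t \<beta>"
  using assms(1,2)
  by (induction rule: tensor_induct) (use assms in \<open>auto simp: pure2_apply lin algebra_simps\<close>)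

lemma tens_multc:
  assumes "t \<in> car (tensor U V)" "is_vspace U" "bilinear_on U V scalars \<beta>"
  shows "t (\<lambda>u v. \<beta> u v * c) = t \<beta> * c"
  using tens_cmult[OF assms, of c] by (simp add: mult.commute)

lemma tens_zero:
  assumes "t \<in> car (tensor U V)" "is_vspace U"
  shows "t (\<lambda>u v. 0) = 0"
  using tens_cmult[OF assms bilin_intros(1), of 0] by simp

lemma tens_minus:
  assumes "t \<in> car (tensor U V)" "is_vspace U" "bilinear_on U V scalars \<beta>"
  shows "t (\<lambda>u v. - \<beta> u v) = - t \<beta>"
  using tens_cmult[OF assms, of "-1"] by simp

lemma tens_diff:
  assumes "t \<in> car (tensor U V)" "is_vspace U" "bilinear_on U V scalars \<beta>" "bilinear_on U V scalars \<beta>'"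
  shows "t (\<lambda>u v. \<beta> u v - \<beta>' u v) = t \<beta> - t \<beta>'"
  using tens_add[OF assms(1-3), of "\<lambda>u v. - \<beta>' u v"] tens_minus[OF assms(1,2,4)] assms(4)
  by (simp add: lin)

lemma tens_sum:
  assumes "t \<in> car (tensor U V)" "is_vspace U" "\<And>i. i \<in> I \<Longrightarrow> bilinear_on U V scalars (f i)"
  shows "t (\<lambda>u v. \<Sum>i\<in>I. f i u v) = (\<Sum>i\<in>I. t (f i))"
  using assms(3)
proof (induction I rule: infinite_finite_induct)
  case (insert x F)
  then show ?case
    using tens_add[OF assms(1,2), of "f x" "\<lambda>u v. \<Sum>i\<in>F. f i u v"] bilin_sum[of F U V f] by simp
qed (simp_all add: tens_zero[OF assms(1,2)])

text \<open>The cut-off in \<open>pure2\<close> survives sums; this is what allows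
  \<open>tensor_eqI\<close> to compare tensors, which are total functions, at bilinear forms
  only.\<close>

lemma tens_nonbilinear:
  assumes "t \<in> car (tensor U V)" "is_vspace U" "\<not> bilinear_on U V scalars \<beta>"
  shows "t \<beta> = 0"
  using assms(1,2)
  by (induction rule: tensor_induct) (use assms in \<open>auto simp: pure2_def\<close>)

text \<open>Substitute for rewriting below a tensor: forms that agree on \<open>X\<close> and
  \<open>Y\<close> may differ elsewhere as functions. Induction reduces the claim to pure tensors,
  where only the values on \<open>X\<close> and \<open>Y\<close> are seen.\<close>

lemma subtensor_cong:
  assumes t: "t \<in> subtensor U V X Y" and sub: "X \<subseteq> car U" "Y \<subseteq> car V" and cl: "\<And>c u. u \<in> X \<Longrightarrow> scl U c u \<in> X"
    and "bilinear_on U V scalars \<beta>" "bilinear_on U V scalars \<beta>'"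
    and "\<And>u v. u \<in> X \<Longrightarrow> v \<in> Y \<Longrightarrow> \<beta> u v = \<beta>' u v"
  shows "t \<beta> = t \<beta>'"
  using t sub
  by (induction rule: subtensor_induct) (use assms in \<open>auto simp: pure2_apply\<close>)

lemma tens_cong:
  assumes "t \<in> car (tensor U V)" "is_vspace U"
    and "bilinear_on U V scalars \<beta>" "bilinear_on U V scalars \<beta>'"
    and "\<And>u v. u \<in> car U \<Longrightarrow> v \<in> car V \<Longrightarrow> \<beta> u v = \<beta>' u v"
  shows "t \<beta> = t \<beta>'"
  using assms unfolding car_tensor by (intro subtensor_cong[of t U V]) (auto intro: is_vspaceD)

lemma tensor_eqI:
  assumes "s \<in> car (tensor U V)" "t \<in> car (tensor U V)" "is_vspace U"
    and "\<And>\<beta>. bilinear_on U V scalars \<beta> \<Longrightarrow> s \<beta> = t \<beta>"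
  shows "s = t"
proof
  fix \<beta>
  show "s \<beta> = t \<beta>"
    using assms(4) tens_nonbilinear[OF assms(1,3)] tens_nonbilinear[OF assms(2,3)]
    by (cases "bilinear_on U V scalars \<beta>") simp_all
qed

text \<open>Contracting two arguments of a trilinear expression with a fixed tensor keeps the linear
  dependence on the third. Forms built by partial contraction, such as \<open>tst\<close> and the
  composites of coproducts, get their linearity from here.\<close>

lemma tens_param:
  assumes "t \<in> car (tensor U V)" "is_vspace U" "is_vspace W"
    and "\<And>w. w \<in> car W \<Longrightarrow> bilinear_on U V scalars (\<lambda>u v. F u v w)"
    and "\<And>u v. u \<in> car U \<Longrightarrow> v \<in> car V \<Longrightarrow> linear_on W scalars (F u v)"
  shows "linear_on W scalars (\<lambda>w. t (\<lambda>u v. F u v w))"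
proof (rule linear_formI)
  fix x y assume xy: "x \<in> car W" "y \<in> car W"
  have "t (\<lambda>u v. F u v (x + y)) = t (\<lambda>u v. F u v x + F u v y)"
    by (intro tens_cong[OF assms(1,2)] assms(4) bilin_intros(2) is_vspaceD(2)[OF assms(3)] xy
        linear_form_add[OF assms(5)])
  then show "t (\<lambda>u v. F u v (x + y)) = t (\<lambda>u v. F u v x) + t (\<lambda>u v. F u v y)"
    using tens_add[OF assms(1,2) assms(4,4)] xy by simp
next
  fix c x assume x: "x \<in> car W"
  have "t (\<lambda>u v. F u v (scl W c x)) = t (\<lambda>u v. c * F u v x)"
    by (intro tens_cong[OF assms(1,2)] assms(4) bilin_intros(5) is_vspaceD(3)[OF assms(3)] x
        linear_form_scl[OF assms(5)])
  then show "t (\<lambda>u v. F u v (scl W c x)) = c * t (\<lambda>u v. F u v x)"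
    using tens_cmult[OF assms(1,2) assms(4)] x by simp
qed

lemma lin_eval: "linear_on U (tensor V W) D \<Longrightarrow> linear_on U scalars (\<lambda>x. D x \<beta>)"
  by (simp add: linear_on_def scalars_def fun_scl_apply)

lemma lin_eval_tensor: "linear_on (tensor V W) scalars (\<lambda>p. p \<beta>)"
  by (simp add: linear_on_def scalars_def fun_scl_apply)

lemma tens_bilin:
  assumes "t \<in> car (tensor U' V')" "is_vspace U" "is_vspace V" "is_vspace U'"
    and "\<And>u v. u \<in> car U \<Longrightarrow> v \<in> car V \<Longrightarrow> bilinear_on U' V' scalars (F u v)"
    and "\<And>u' v'. u' \<in> car U' \<Longrightarrow> v' \<in> car V' \<Longrightarrow> bilinear_on U V scalars (\<lambda>u v. F u v u' v')"
  shows "bilinear_on U V scalars (\<lambda>u v. t (F u v))"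
proof (rule bilinear_formI)
  fix x assume x: "x \<in> car U"
  show "linear_on V scalars (\<lambda>v. t (F x v))"
    using tens_param[of t U' V' V "\<lambda>u v w. F x w u v"] assms x by (simp add: bilinear_on_def)
next
  fix y assume y: "y \<in> car V"
  show "linear_on U scalars (\<lambda>u. t (F u y))"
    using tens_param[of t U' V' U "\<lambda>u v w. F w y u v"] assms y by (simp add: bilinear_on_def)
qed

text \<open>A Fubini rule for two contractions: induction on \<open>t\<close> reduces it to a pure
  tensor, where both sides are the contraction with \<open>s\<close> at one point.\<close>

lemma tens_swap:
  assumes s: "s \<in> car (tensor U V)" and t: "t \<in> car (tensor U' V')"
    and vs: "is_vspace U" "is_vspace V" "is_vspace U'" "is_vspace V'"
    and uv: "\<And>u v. u \<in> car U \<Longrightarrow> v \<in> car V \<Longrightarrow> bilinear_on U' V' scalars (F u v)"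
    and bi: "\<And>u' v'. u' \<in> car U' \<Longrightarrow> v' \<in> car V' \<Longrightarrow> bilinear_on U V scalars (\<lambda>u v. F u v u' v')"
  shows "s (\<lambda>u v. t (F u v)) = t (\<lambda>u' v'. s (\<lambda>u v. F u v u' v'))"
  using t vs(3)
proof (induction rule: tensor_induct)
  case zero
  show ?case using tens_zero[OF s vs(1)] by simp
next
  case (add q x y)
  have b: "bilinear_on U V scalars (\<lambda>u v. q (F u v))" if "q \<in> car (tensor U' V')" for q
    by (rule tens_bilin[OF that vs(1,2,3) uv bi])
  have b2: "bilinear_on U' V' scalars (\<lambda>u' v'. s (\<lambda>u v. F u v u' v'))"
    by (rule tens_bilin[OF s vs(3,4,1) bi uv])
  have "s (\<lambda>u v. (q + pure2 U' V' x y) (F u v)) = s (\<lambda>u v. q (F u v) + F u v x y)"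
  proof (rule tens_cong[OF s vs(1)])
    show "bilinear_on U V scalars (\<lambda>u v. (q + pure2 U' V' x y) (F u v))"
      using b[OF is_vspaceD(2)[OF is_vspace_tensor add.hyps(1) pure2_car[OF add.hyps(2,3)]]] .
    show "bilinear_on U V scalars (\<lambda>u v. q (F u v) + F u v x y)"
      by (rule bilin_intros(2)[OF b[OF add.hyps(1)] bi[OF add.hyps(2,3)]])
  next
    fix u v assume "u \<in> car U" "v \<in> car V"
    then show "(q + pure2 U' V' x y) (F u v) = q (F u v) + F u v x y"
      using pure2_apply[OF uv, of u v] by simp
  qed
  also have "\<dots> = s (\<lambda>u v. q (F u v)) + s (\<lambda>u v. F u v x y)"
    by (rule tens_add[OF s vs(1) b[OF add.hyps(1)] bi[OF add.hyps(2,3)]])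
  also have "\<dots> = (q + pure2 U' V' x y) (\<lambda>u' v'. s (\<lambda>u v. F u v u' v'))"
    using add.IH by (simp add: pure2_apply[OF b2])
  finally show ?case .
qed

section \<open>Threefold tensors\<close>

text \<open>With homogeneous subspaces as arguments this is one block of a threefold completed
  tensor.\<close>

definition subtensor3 :: "('k::field, 'v::ab_group_add) vspace \<Rightarrow> 'v set \<Rightarrow> 'v set \<Rightarrow> 'v set \<Rightarrow> ('k, 'v) tens3 set" where
  "subtensor3 V X Y Z = module.span fun_scl {pure3 V u v w |u v w. u \<in> X \<and> v \<in> Y \<and> w \<in> Z}"

lemma pure3_apply: "trilinear_form_on V \<tau> \<Longrightarrow> pure3 V x y z \<tau> = \<tau> x y z"
  by (simp add: pure3_def)

lemma pure3_mem: "u \<in> X \<Longrightarrow> v \<in> Y \<Longrightarrow> w \<in> Z \<Longrightarrow> pure3 V u v w \<in> subtensor3 V X Y Z"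
  unfolding subtensor3_def by (rule fsc.span_base) blast

lemma subtensor3_closed:
  "0 \<in> subtensor3 V X Y Z"
  "s \<in> subtensor3 V X Y Z \<Longrightarrow> t \<in> subtensor3 V X Y Z \<Longrightarrow> s + t \<in> subtensor3 V X Y Z"
  "s \<in> subtensor3 V X Y Z \<Longrightarrow> t \<in> subtensor3 V X Y Z \<Longrightarrow> s - t \<in> subtensor3 V X Y Z"
  "s \<in> subtensor3 V X Y Z \<Longrightarrow> fun_scl c s \<in> subtensor3 V X Y Z"
  unfolding subtensor3_def
  by (rule fsc.span_zero fsc.span_add fsc.span_diff fsc.span_scale; assumption)+

lemma subtensor3_induct [consumes 4, case_names scl zero add]:
  assumes t: "t \<in> subtensor3 V X Y Z"
    and sub: "X \<subseteq> car V" "Y \<subseteq> car V" "Z \<subseteq> car V" and cl: "\<And>c u. u \<in> X \<Longrightarrow> scl V c u \<in> X"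
    and z: "Q 0"
    and a: "\<And>s u v w. s \<in> subtensor3 V X Y Z \<Longrightarrow> Q s \<Longrightarrow> u \<in> X \<Longrightarrow> v \<in> Y \<Longrightarrow> w \<in> Z \<Longrightarrow> Q (s + pure3 V u v w)"
  shows "Q t"
proof -
  have "t \<in> subtensor3 V X Y Z \<and> Q t"
    using t unfolding subtensor3_def
  proof (induction rule: fsc.span_induct_alt)
    case base
    show ?case using z fsc.span_zero by blast
  next
    case (step c x y)
    then obtain u v w where uv: "x = pure3 V u v w" "u \<in> X" "v \<in> Y" "w \<in> Z" by blast
    then have m: "u \<in> car V" "v \<in> car V" "w \<in> car V" using sub by auto
    have e: "fun_scl c x = pure3 V (scl V c u) v w"
    proof (rule ext)
      fix \<tau>
      show "fun_scl c x \<tau> = pure3 V (scl V c u) v w \<tau>"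
        unfolding uv(1) using m linear_form_scl[OF trilinear_formD(1), of V \<tau> v w u c]
        by (simp add: pure3_def fun_scl_apply)
    qed
    have e: "fun_scl c x + y = y + pure3 V (scl V c u) v w" unfolding e by (rule add.commute)
    have y: "y \<in> subtensor3 V X Y Z" "Q y" using step.IH unfolding subtensor3_def by blast+
    have "y + pure3 V (scl V c u) v w \<in> subtensor3 V X Y Z"
      using y uv cl by (intro subtensor3_closed pure3_mem)
    then show ?case using y uv cl a[of y "scl V c u" v w] unfolding e subtensor3_def by blast
  qed
  then show ?thesis ..
qed

section \<open>Graded spaces\<close>

lemma graded_vspaceD:
  assumes "graded_vspace V G"
  shows "is_vspace V" "module.subspace (scl V) (G i)" "G i \<subseteq> car V" "finite_dim V (G i)"
    "v \<in> car V \<Longrightarrow> \<exists>!f. decomposition G v f"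
  using assms by (auto simp: graded_vspace_def)

lemma graded_closed:
  assumes "graded_vspace V G"
  shows "0 \<in> G i" "x \<in> G i \<Longrightarrow> y \<in> G i \<Longrightarrow> x + y \<in> G i" "x \<in> G i \<Longrightarrow> y \<in> G i \<Longrightarrow> x - y \<in> G i"
    "x \<in> G i \<Longrightarrow> scl V c x \<in> G i" "x \<in> G i \<Longrightarrow> x \<in> car V"
proof -
  interpret vector_space "scl V"
    using graded_vspaceD(1)[OF assms] by (simp add: is_vspace_def)
  note s = graded_vspaceD(2)[OF assms]
  show "0 \<in> G i" "x \<in> G i \<Longrightarrow> y \<in> G i \<Longrightarrow> x + y \<in> G i" "x \<in> G i \<Longrightarrow> y \<in> G i \<Longrightarrow> x - y \<in> G i"
    "x \<in> G i \<Longrightarrow> scl V c x \<in> G i"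
    by (rule subspace_0 subspace_add subspace_diff subspace_scale, rule s, assumption?, assumption?)+
  show "x \<in> G i \<Longrightarrow> x \<in> car V" using graded_vspaceD(3)[OF assms] by auto
qed

lemma decomposition_add:
  assumes "\<And>i x y. x \<in> G i \<Longrightarrow> y \<in> G i \<Longrightarrow> x + y \<in> G i"
    and "decomposition G v f" "decomposition G w g"
  shows "decomposition G (v + w) (\<lambda>i. f i + g i)"
proof -
  have "finite {i. f i + g i \<noteq> 0}"
    by (rule finite_subset[of _ "{i. f i \<noteq> 0} \<union> {i. g i \<noteq> 0}"])
      (use assms in \<open>auto simp: decomposition_def\<close>)
  then show ?thesis
    using assms by (auto simp: decomposition_def Sum_any.distrib)
qed

lemma decomposition_single:
  assumes "\<And>j. 0 \<in> G j" "v \<in> G i"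
  shows "decomposition G v (\<lambda>j. if j = i then v else 0)"
proof -
  have "Sum_any (\<lambda>j. if j = i then v else 0) = (\<Sum>j\<in>{i}. if j = i then v else 0)"
    by (rule Sum_any.expand_superset) auto
  moreover have "finite {j. (if j = i then v else 0) \<noteq> 0}"
    by (rule finite_subset[of _ "{i}"]) auto
  ultimately show ?thesis using assms by (auto simp: decomposition_def)
qed

lemma decomposition_image:
  assumes "linear_on V W h" "is_vspace V" "\<And>i x. x \<in> G i \<Longrightarrow> x \<in> car V \<and> h x \<in> G' i"
    and "decomposition G v f"
  shows "decomposition G' (h v) (\<lambda>i. h (f i))"
proof -
  have fin: "finite {i. f i \<noteq> 0}" and v: "v = Sum_any f" and m: "f i \<in> G i" for i
    using assms(4) by (auto simp: decomposition_def)
  have h0: "h 0 = 0" by (rule linear_on_0[OF assms(1,2)])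
  have sub: "{i. h (f i) \<noteq> 0} \<subseteq> {i. f i \<noteq> 0}" using h0 by auto
  have "h v = (\<Sum>i | f i \<noteq> 0. h (f i))"
    unfolding v Sum_any.expand_set by (rule linear_on_sum[OF assms(1,2)]) (use m assms(3) in blast)
  also have "\<dots> = Sum_any (\<lambda>i. h (f i))"
    by (rule Sum_any.expand_superset[symmetric]) (use fin sub in auto)
  finally show ?thesis
    using finite_subset[OF sub fin] m assms(3) by (auto simp: decomposition_def)
qed

context
  fixes V :: "('k::field, 'v::ab_group_add) vspace" and G
  assumes gr: "graded_vspace V G"
begin

lemma component_decomposition: "v \<in> car V \<Longrightarrow> decomposition G v (\<lambda>i. component G i v)"
  using theI'[OF graded_vspaceD(5)[OF gr]] by (simp add: component_def)

lemma component_mem: "v \<in> car V \<Longrightarrow> component G i v \<in> G i"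
  using component_decomposition by (auto simp: decomposition_def)

lemma component_car: "v \<in> car V \<Longrightarrow> component G i v \<in> car V"
  using component_mem graded_closed(5)[OF gr] by blast

lemma component_unique: "v \<in> car V \<Longrightarrow> decomposition G v f \<Longrightarrow> component G i v = f i"
  using graded_vspaceD(5)[OF gr, of v] component_decomposition by metis

lemma component_hom:
  assumes "v \<in> G j"
  shows "component G i v = (if i = j then v else 0)"
  using component_unique[OF _ decomposition_single, of v j i] graded_closed[OF gr] assms by simp

lemma component_finite: "v \<in> car V \<Longrightarrow> finite {i. component G i v \<noteq> 0}"
  using component_decomposition by (auto simp: decomposition_def)

lemma component_sum:
  assumes "v \<in> car V" "finite I" "{i. component G i v \<noteq> 0} \<subseteq> I"
  shows "v = (\<Sum>i\<in>I. component G i v)"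
proof -
  have "v = Sum_any (\<lambda>i. component G i v)"
    using component_decomposition[OF assms(1)] by (simp add: decomposition_def)
  then show ?thesis using assms by (simp add: Sum_any.expand_superset)
qed

text \<open>Componentwise sums and multiples of decompositions are decompositions again, and
  uniqueness identifies them with the components of the sum and of the multiple.\<close>

lemma component_linear: "linear_on V V (component G i)"
proof -
  note vs = graded_vspaceD(1)[OF gr]
  have "component G i (x + y) = component G i x + component G i y" if "x \<in> car V" "y \<in> car V" for x y
    using component_unique[OF is_vspaceD(2)[OF vs that]
        decomposition_add[OF graded_closed(2)[OF gr] component_decomposition component_decomposition]] that
    by simp
  moreover have "component G i (scl V c x) = scl V c (component G i x)" if x: "x \<in> car V" for c x
  proof -
    have lin: "linear_on V V (scl V c)"
    proof -
      interpret vector_space "scl V" using vs by (simp add: is_vspace_def)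
      show ?thesis using vs by (simp add: linear_on_def is_vspaceD scale_right_distrib scale_scale mult.commute)
    qed
    show ?thesis
      using component_unique[OF is_vspaceD(3)[OF vs x]
          decomposition_image[OF lin vs _ component_decomposition[OF x]]] graded_closed[OF gr]
      by simp
  qed
  ultimately show ?thesis using component_car by (simp add: linear_on_def)
qed

end

text \<open>Turns formally infinite sums over blocks into one term; the hypothesis will be supplied
  by degree arguments.\<close>

lemma Sum_any_single:
  assumes "\<And>q. q \<noteq> p \<Longrightarrow> g q = 0"
  shows "Sum_any g = g p"
proof -
  have "{q. g q \<noteq> 0} \<subseteq> {p}" using assms by auto
  then show ?thesis using Sum_any.expand_superset[of "{p}" g] by simp
qed

section \<open>Dual bases in quadratic perm algebras\<close>

text \<open>Induction on the independent set \<open>E\<close> in the manner of Gram-Schmidt: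
  nondegeneracy on \<open>U\<close> supplies a vector of \<open>C\<close> that detects the new
  element modulo the old ones, and the old dual vectors are then corrected to vanish on the new
  element. No comparison of the dimensions of \<open>U\<close> and \<open>C\<close> is
  involved.\<close>

lemma dual_family:
  fixes s :: "'k::field \<Rightarrow> 'v::ab_group_add \<Rightarrow> 'v" and \<omega> :: "'v \<Rightarrow> 'v \<Rightarrow> 'k"
  assumes vs: "vector_space s" and U: "module.subspace s U" and C: "module.subspace s C"
    and bil: "\<And>x y z. \<lbrakk>x \<in> U; y \<in> U; z \<in> C\<rbrakk> \<Longrightarrow> \<omega> (x + y) z = \<omega> x z + \<omega> y z"
      "\<And>x y z. \<lbrakk>x \<in> U; y \<in> C; z \<in> C\<rbrakk> \<Longrightarrow> \<omega> x (y + z) = \<omega> x y + \<omega> x z"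
      "\<And>x y c. \<lbrakk>x \<in> U; y \<in> C\<rbrakk> \<Longrightarrow> \<omega> (s c x) y = c * \<omega> x y"
      "\<And>x y c. \<lbrakk>x \<in> U; y \<in> C\<rbrakk> \<Longrightarrow> \<omega> x (s c y) = c * \<omega> x y"
    and nd: "\<And>x. x \<in> U \<Longrightarrow> (\<And>y. y \<in> C \<Longrightarrow> \<omega> x y = 0) \<Longrightarrow> x = 0"
    and "finite E" "E \<subseteq> U" "\<not> module.dependent s E"
  shows "\<exists>f. (\<forall>e\<in>E. f e \<in> C) \<and> (\<forall>e\<in>E. \<forall>e'\<in>E. \<omega> e (f e') = (if e = e' then 1 else 0))"
proof -
  interpret vector_space s by (rule vs)
  have sum1: "\<omega> (sum g I) z = (\<Sum>i\<in>I. \<omega> (g i) z)" if "\<And>i. i \<in> I \<Longrightarrow> g i \<in> U" "z \<in> C" for g I z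
    using that bil(3)[of 0 z 0] U
    by (induction I rule: infinite_finite_induct)
      (auto simp: bil(1) subspace_sum[OF U] subspace_0)
  have sum2: "\<omega> z (sum g I) = (\<Sum>i\<in>I. \<omega> z (g i))" if "\<And>i. i \<in> I \<Longrightarrow> g i \<in> C" "z \<in> U" for g I z
    using that bil(4)[of z 0 0] C
    by (induction I rule: infinite_finite_induct)
      (auto simp: bil(2) subspace_sum[OF C] subspace_0)
  have neg1: "\<omega> (x - y) z = \<omega> x z - \<omega> y z" if "x \<in> U" "y \<in> U" "z \<in> C" for x y z
    using bil(1)[of "x - y" y z] that U by (simp add: subspace_diff algebra_simps)
  have neg2: "\<omega> x (y - z) = \<omega> x y - \<omega> x z" if "x \<in> U" "y \<in> C" "z \<in> C" for x y z
    using bil(2)[of x "y - z" z] that C by (simp add: subspace_diff algebra_simps)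
  show ?thesis
    using assms(9-11)
  proof (induction E rule: finite_induct)
    case empty
    then show ?case by simp
  next
    case (insert e E)
    then have ind: "\<not> dependent E" and ne: "e \<notin> span E" and EU: "E \<subseteq> U" "e \<in> U"
      by (auto simp: dependent_insertD independent_insert)
    with insert obtain f where f: "\<And>x. x \<in> E \<Longrightarrow> f x \<in> C"
      and df: "\<And>x y. x \<in> E \<Longrightarrow> y \<in> E \<Longrightarrow> \<omega> x (f y) = (if x = y then 1 else 0)"
      by (metis insert_subset)
    \<comment> \<open>Removing this combination of \<open>E\<close> leaves a vector that pairs to 0
      with every old \<open>f x\<close>; it is nonzero because \<open>e\<close> is independent of
      \<open>E\<close>.\<close>
    define e0 where "e0 = e - (\<Sum>x\<in>E. s (\<omega> e (f x)) x)"
    have "(\<Sum>x\<in>E. s (\<omega> e (f x)) x) \<in> span E" by (intro span_sum span_scale span_base)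
    with ne have "e0 \<noteq> 0" by (auto simp: e0_def)
    moreover have sU: "(\<Sum>x\<in>E. s (\<omega> e (f x)) x) \<in> U"
      using EU by (intro subspace_sum[OF U] subspace_scale[OF U]) auto
    then have "e0 \<in> U" using EU U unfolding e0_def by (intro subspace_diff)
    ultimately obtain c where c: "c \<in> C" "\<omega> e0 c \<noteq> 0" using nd by blast
    \<comment> \<open>The corresponding correction on the other side: \<open>c1\<close> pairs to 0
      with all of \<open>E\<close>, and its pairing with \<open>e\<close> turns out to be
      \<open>\<omega> e0 c\<close>, hence nonzero.\<close>
    define c1 where "c1 = c - (\<Sum>x\<in>E. s (\<omega> x c) (f x))"
    have sC: "(\<Sum>x\<in>E. s (\<omega> x c) (f x)) \<in> C"
      using f by (intro subspace_sum[OF C] subspace_scale[OF C]) auto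
    then have c1C: "c1 \<in> C" unfolding c1_def using c C by (intro subspace_diff)
    have sf: "s k (f x) \<in> C" if "x \<in> E" for x k using f that subspace_scale[OF C] by blast
    have sx: "s k x \<in> U" if "x \<in> E" for x k using EU that subspace_scale[OF U] by blast
    have c1x: "\<omega> x c1 = 0" if "x \<in> E" for x
    proof -
      have xU: "x \<in> U" using EU that by auto
      have "\<omega> x c1 = \<omega> x c - (\<Sum>y\<in>E. \<omega> y c * \<omega> x (f y))"
        using c f xU by (simp add: c1_def neg2[OF xU c(1) sC] sum2 sf bil(4))
      also have "(\<Sum>y\<in>E. \<omega> y c * \<omega> x (f y)) = (\<Sum>y\<in>E. if x = y then \<omega> y c else 0)"
        by (rule sum.cong) (auto simp: df that)
      finally show ?thesis using insert that by simp
    qed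
    have "\<omega> e c1 = \<omega> e c - (\<Sum>y\<in>E. \<omega> y c * \<omega> e (f y))"
      using c f EU by (simp add: c1_def neg2[OF EU(2) c(1) sC] sum2 sf bil(4))
    also have "\<dots> = \<omega> e0 c"
      using c f EU by (simp add: e0_def neg1[OF EU(2) sU c(1)] sum1 sx bil(3) subset_iff mult.commute)
    finally have e1: "\<omega> e c1 \<noteq> 0" using c by simp
    define c2 where "c2 = s (inverse (\<omega> e c1)) c1"
    have c2C: "c2 \<in> C" unfolding c2_def using c1C by (rule subspace_scale[OF C])
    have c2: "\<omega> e c2 = 1" "\<And>x. x \<in> E \<Longrightarrow> \<omega> x c2 = 0"
      using e1 EU c1C c1x by (auto simp: c2_def bil(4) subset_iff)
    \<comment> \<open>Each old dual vector loses its pairing with \<open>e\<close>; its pairings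
      with \<open>E\<close> do not change, since \<open>c2\<close> pairs to 0 with
      \<open>E\<close>.\<close>
    define g where "g x = (if x = e then c2 else f x - s (\<omega> e (f x)) c2)" for x
    have sc: "s k c2 \<in> C" for k using c2C subspace_scale[OF C] by blast
    have "g x \<in> C" if "x \<in> insert e E" for x
      using that f c2C sc by (auto simp: g_def intro!: subspace_diff[OF C])
    moreover have "\<omega> x (g y) = (if x = y then 1 else 0)" if "x \<in> insert e E" "y \<in> insert e E" for x y
    proof -
      have xU: "x \<in> U" using that EU by auto
      have gy: "\<omega> x (f y - s k c2) = \<omega> x (f y) - k * \<omega> x c2" if "y \<in> E" for y k
        using neg2[OF xU f[OF that] sc] bil(4)[OF xU c2C] by simp
      show ?thesis
      proof (cases "y = e")
        case True
        then show ?thesis using that c2 by (auto simp: g_def)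
      next
        case False
        then have "\<omega> x (g y) = \<omega> x (f y) - \<omega> e (f y) * \<omega> x c2" using that by (simp add: g_def gy)
        then show ?thesis using that c2 df insert(2) False by auto
      qed
    qed
    ultimately show ?case by blast
  qed
qed

text \<open>Names the degree \<open>m\<close>, whose existence alone is asserted by the axioms of a
  quadratic graded perm algebra, so that later definitions may depend on it.\<close>

locale quadratic_perm = quadratic_graded_perm_algebra B H dia om
  for B :: "('k::field, 'b::ab_group_add) vspace"
    and H :: "int \<Rightarrow> 'b set"
    and dia :: "'b \<Rightarrow> 'b \<Rightarrow> 'b" (infixl "\<diamondop>" 70)
    and om :: "'b \<Rightarrow> 'b \<Rightarrow> 'k" ("\<omega>") +
  fixes m :: int
  assumes om_deg: "\<lbrakk>i + j + m \<noteq> 0; b \<in> H i; c \<in> H j\<rbrakk> \<Longrightarrow> \<omega> b c = 0"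
begin

lemmas vsB = graded_vspaceD(1)[OF graded]
lemmas H_closed = graded_closed[OF graded]

lemma H_car: "b \<in> H i \<Longrightarrow> b \<in> car B"
  by (rule H_closed(5))

lemma dia_car: "x \<in> car B \<Longrightarrow> y \<in> car B \<Longrightarrow> x \<diamondop> y \<in> car B"
  using dia_bilinear by (simp add: bilinear_on_def linear_on_def)

lemma om_lin1: "c \<in> car B \<Longrightarrow> linear_on B scalars (\<lambda>b. \<omega> b c)"
  and om_lin2: "b \<in> car B \<Longrightarrow> linear_on B scalars (\<omega> b)"
  using om_bilinear by (simp_all add: bilinear_on_def)

lemma dia_lin1: "c \<in> car B \<Longrightarrow> linear_on B B (\<lambda>b. b \<diamondop> c)"
  and dia_lin2: "b \<in> car B \<Longrightarrow> linear_on B B ((\<diamondop>) b)"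
  using dia_bilinear by (simp_all add: bilinear_on_def)

lemma om_diff1: "x \<in> car B \<Longrightarrow> y \<in> car B \<Longrightarrow> c \<in> car B \<Longrightarrow> \<omega> (x - y) c = \<omega> x c - \<omega> y c"
  and om_diff2: "x \<in> car B \<Longrightarrow> y \<in> car B \<Longrightarrow> c \<in> car B \<Longrightarrow> \<omega> c (x - y) = \<omega> c x - \<omega> c y"
  using linear_on_diff[OF om_lin1 vsB] linear_on_diff[OF om_lin2 vsB] by blast+

lemma om_right:
  "x \<in> car B \<Longrightarrow> y \<in> car B \<Longrightarrow> z \<in> car B \<Longrightarrow> \<omega> (x \<diamondop> y) z = \<omega> x (y \<diamondop> z) - \<omega> x (z \<diamondop> y)"
  by (simp add: om_invariant om_diff2 dia_car)

text \<open>Left multiplications are self-adjoint: apply antisymmetry to the invariance condition twice.\<close>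

lemma om_left:
  assumes x: "x \<in> car B" "y \<in> car B" "z \<in> car B"
  shows "\<omega> (x \<diamondop> y) z = \<omega> y (x \<diamondop> z)"
proof -
  have "\<omega> z (x \<diamondop> y) = \<omega> (z \<diamondop> x) y + \<omega> z (y \<diamondop> x)" using om_right[of z x y] x by simp
  moreover have "\<omega> (z \<diamondop> y) x = \<omega> z (y \<diamondop> x) - \<omega> z (x \<diamondop> y)" using om_right[of z y x] x by simp
  moreover have "\<omega> (z \<diamondop> y) x = - \<omega> x (z \<diamondop> y)" "\<omega> (z \<diamondop> x) y = - \<omega> y (z \<diamondop> x)"
    "\<omega> (x \<diamondop> y) z = - \<omega> z (x \<diamondop> y)"
    using x by (simp_all add: om_antisym[of _ x] om_antisym[of _ y] om_antisym[of _ z] dia_car)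
  moreover have "\<omega> (x \<diamondop> z) y = \<omega> x (z \<diamondop> y) - \<omega> x (y \<diamondop> z)" using om_right[of x z y] x by simp
  moreover have "\<omega> (x \<diamondop> y) z = \<omega> x (y \<diamondop> z) - \<omega> x (z \<diamondop> y)" using om_right[of x y z] x by simp
  moreover have "\<omega> (x \<diamondop> z) y = - \<omega> y (x \<diamondop> z)"
    using x by (simp add: om_antisym[of _ y] dia_car)
  ultimately show ?thesis by (simp add: algebra_simps)
qed

text \<open>A basis \<open>E\<close> of the finite-dimensional \<open>H i\<close> has a dual family
  in \<open>H (- m - i)\<close> by \<open>dual_family\<close>. Coordinates of elements of
  \<open>H i\<close> are read off by pairing with it; the expansion in \<open>H (- m - i)\<close>
  holds because the difference of the two sides is orthogonal to \<open>H i\<close>.\<close>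

lemma dual_basis_ex:
  "\<exists>E f. finite E \<and> E \<subseteq> H i \<and> f ` E \<subseteq> H (- m - i) \<and>
     (\<forall>b\<in>H i. b = (\<Sum>e\<in>E. scl B (\<omega> b (f e)) e)) \<and>
     (\<forall>c\<in>H (- m - i). c = (\<Sum>e\<in>E. scl B (\<omega> e c) (f e)))"
proof -
  interpret V: vector_space "scl B" using vsB by (simp add: is_vspace_def)
  obtain S where S: "finite S" "H i = V.span S"
    using graded_vspaceD(4)[OF graded] by (auto simp: finite_dim_def)
  obtain E where E: "E \<subseteq> S" "V.independent E" "S \<subseteq> V.span E"
    using V.maximal_independent_subset by metis
  have HE: "H i = V.span E" using E S V.span_mono V.span_minimal V.subspace_span by blast
  have fE: "finite E" using E S finite_subset by blast
  have EH: "E \<subseteq> H i" using HE V.span_superset by auto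
  \<comment> \<open>Nondegeneracy on all of \<open>B\<close> restricts to one pair of degrees: among
    the components of \<open>c\<close> only the one of degree \<open>- m - j\<close> can pair
    nontrivially with \<open>b\<close>.\<close>
  have nd: "b = 0" if b: "b \<in> H j" and z: "\<And>c. c \<in> H (- m - j) \<Longrightarrow> \<omega> b c = 0" for b j
  proof (rule om_nondegenerate)
    fix c assume c: "c \<in> car B"
    define I where "I = {k. component H k c \<noteq> 0}"
    have "\<omega> b (component H k c) = 0" for k
    proof (cases "k = - m - j")
      case True
      then show ?thesis using z component_mem[OF graded c] by simp
    next
      case False
      then show ?thesis using om_deg[of j k] b component_mem[OF graded c] by simp
    qed
    moreover have "c = (\<Sum>k\<in>I. component H k c)"
      using component_sum[OF graded c component_finite[OF graded c]] by (simp add: I_def)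
    then have "\<omega> b c = (\<Sum>k\<in>I. \<omega> b (component H k c))"
      using linear_on_sum[OF om_lin2[OF H_car[OF b]] vsB, of I "\<lambda>k. component H k c"]
        component_car[OF graded c] by simp
    ultimately show "\<omega> b c = 0" by simp
  qed (use b H_car in auto)
  have "\<exists>f. (\<forall>e\<in>E. f e \<in> H (- m - i)) \<and> (\<forall>e\<in>E. \<forall>e'\<in>E. \<omega> e (f e') = (if e = e' then 1 else 0))"
  proof (rule dual_family[OF V.vector_space_axioms graded_vspaceD(2)[OF graded] graded_vspaceD(2)[OF graded] _ _ _ _ _ fE EH])
    show "\<not> module.dependent (scl B) E" by (rule E(2))
  qed (blast intro: nd H_car linear_form_add[OF om_lin1] linear_form_add[OF om_lin2]
          linear_form_scl[OF om_lin1] linear_form_scl[OF om_lin2])+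
  then obtain f where f: "\<And>e. e \<in> E \<Longrightarrow> f e \<in> H (- m - i)"
    and d: "\<And>e e'. e \<in> E \<Longrightarrow> e' \<in> E \<Longrightarrow> \<omega> e (f e') = (if e = e' then 1 else 0)" by blast
  have Ec: "e \<in> car B" and fc: "f e \<in> car B" if "e \<in> E" for e
    using that EH f H_car by blast+
  have b: "b = (\<Sum>e\<in>E. scl B (\<omega> b (f e)) e)" if "b \<in> H i" for b
  proof -
    from that HE obtain u where u: "b = (\<Sum>e\<in>E. scl B (u e) e)"
      using V.span_finite[OF fE] by auto
    have "\<omega> b (f e) = u e" if e: "e \<in> E" for e
    proof -
      have "\<omega> b (f e) = (\<Sum>x\<in>E. \<omega> (scl B (u x) x) (f e))"
        unfolding u by (rule linear_on_sum[OF om_lin1[OF fc[OF e]] vsB]) (intro is_vspaceD(3)[OF vsB] Ec)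
      also have "\<dots> = (\<Sum>x\<in>E. if x = e then u x else 0)"
        by (rule sum.cong) (simp_all add: linear_form_scl[OF om_lin1[OF fc[OF e]] Ec] d e)
      finally show ?thesis using e fE by simp
    qed
    then show ?thesis using u by simp
  qed
  have c: "c = (\<Sum>e\<in>E. scl B (\<omega> e c) (f e))" if c: "c \<in> H (- m - i)" for c
  proof -
    let ?d = "\<Sum>e\<in>E. scl B (\<omega> e c) (f e)"
    have dH: "?d \<in> H (- m - i)"
      using f by (intro V.subspace_sum[OF graded_vspaceD(2)[OF graded]] H_closed(4)) auto
    have "c - ?d = 0"
    \<comment> \<open>The partner of degree \<open>- m - i\<close> is \<open>i\<close> again.
      Antisymmetry moves the difference into the second argument, where the expansion of
      \<open>b\<close> applies.\<close>
    proof (rule nd[of _ "- m - i"])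
      show "c - ?d \<in> H (- m - i)" using c dH by (rule H_closed(3))
      fix b assume "b \<in> H (- m - (- m - i))"
      then have bi: "b \<in> H i" by simp
      have "\<omega> b c = (\<Sum>e\<in>E. \<omega> (scl B (\<omega> b (f e)) e) c)"
        by (subst b[OF bi], rule linear_on_sum[OF om_lin1[OF H_car[OF c]] vsB]) (intro is_vspaceD(3)[OF vsB] Ec)
      also have "\<dots> = (\<Sum>e\<in>E. \<omega> b (scl B (\<omega> e c) (f e)))"
        by (rule sum.cong) (simp_all add: linear_form_scl[OF om_lin1[OF H_car[OF c]] Ec]
            linear_form_scl[OF om_lin2[OF H_car[OF bi]] fc])
      also have "\<dots> = \<omega> b ?d"
        by (rule linear_on_sum[OF om_lin2[OF H_car[OF bi]] vsB, symmetric]) (intro is_vspaceD(3)[OF vsB] fc)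
      finally have "\<omega> b (c - ?d) = 0" using bi c dH H_car by (simp add: om_diff2)
      then show "\<omega> (c - ?d) b = 0"
        using om_antisym[of "c - ?d" b] bi c dH H_car is_vspaceD(4)[OF vsB] by simp
    qed
    then show ?thesis by simp
  qed
  show ?thesis by (intro exI[of _ E] exI[of _ f] conjI ballI image_subsetI fE EH f b c)
qed

definition dual_basis :: "int \<Rightarrow> 'b set \<Rightarrow> ('b \<Rightarrow> 'b) \<Rightarrow> bool" where
  "dual_basis i E f \<longleftrightarrow> finite E \<and> E \<subseteq> H i \<and> f ` E \<subseteq> H (- m - i) \<and>
     (\<forall>b\<in>H i. b = (\<Sum>e\<in>E. scl B (\<omega> b (f e)) e)) \<and>
     (\<forall>c\<in>H (- m - i). c = (\<Sum>e\<in>E. scl B (\<omega> e c) (f e)))"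

text \<open>A basis and its dual family are chosen as a pair, so that \<open>Eb\<close> and
  \<open>fb\<close> fit together in each degree.\<close>

definition "dual_pair i = (SOME (E, f). dual_basis i E f)"

definition "Eb i = fst (dual_pair i)"

definition "fb i = snd (dual_pair i)"

lemma dual_basis_Eb: "dual_basis i (Eb i) (fb i)"
proof -
  obtain E f where "dual_basis i E f"
    using dual_basis_ex[of i] unfolding dual_basis_def by (elim exE)
  then have "case (E, f) of (E, f) \<Rightarrow> dual_basis i E f" by simp
  then have "case dual_pair i of (E, f) \<Rightarrow> dual_basis i E f"
    unfolding dual_pair_def by (rule someI)
  then show ?thesis by (simp add: Eb_def fb_def case_prod_unfold)
qed

lemma finite_Eb: "finite (Eb i)"
  and Eb_H: "e \<in> Eb i \<Longrightarrow> e \<in> H i"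
  and fb_H: "e \<in> Eb i \<Longrightarrow> fb i e \<in> H (- m - i)"
  using dual_basis_Eb[of i] by (auto simp: dual_basis_def)

lemma Eb_car: "e \<in> Eb i \<Longrightarrow> e \<in> car B" and fb_car: "e \<in> Eb i \<Longrightarrow> fb i e \<in> car B"
  using Eb_H fb_H H_car by blast+

lemma Eb_expand: "b \<in> H i \<Longrightarrow> (\<Sum>e\<in>Eb i. scl B (\<omega> b (fb i e)) e) = b"
  using dual_basis_Eb[of i] unfolding dual_basis_def by metis

lemma fb_expand: "c \<in> H (- m - i) \<Longrightarrow> (\<Sum>e\<in>Eb i. scl B (\<omega> e c) (fb i e)) = c"
  using dual_basis_Eb[of i] unfolding dual_basis_def by metis

end

text \<open>Only 0 and closure under addition are demanded of \<open>S\<close>; hence one rule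
  yields membership in carriers, in homogeneous blocks and in blocks of threefold tensors.\<close>

lemma lift2_mem:
  assumes t: "t \<in> subtensor U V X Y" and sub: "X \<subseteq> car U" "Y \<subseteq> car V" "\<And>c u. u \<in> X \<Longrightarrow> scl U c u \<in> X"
    and bil: "\<And>\<beta>. bilinear_on U V scalars (\<lambda>u v. \<phi> u v \<beta>)"
    and S: "0 \<in> S" "\<And>x y. x \<in> S \<Longrightarrow> y \<in> S \<Longrightarrow> x + y \<in> S"
    and mem: "\<And>u v. u \<in> X \<Longrightarrow> v \<in> Y \<Longrightarrow> \<phi> u v \<in> S"
  shows "lift2 \<phi> t \<in> S"
  using t sub(1,2)
proof (induction rule: subtensor_induct)
  case (scl c u)
  then show ?case by (rule sub(3))
next
  case zero
  have "lift2 \<phi> 0 = 0" by (simp add: lift2_def fun_eq_iff)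
  then show ?case using S(1) by metis
next
  case (add s u v)
  then show ?case unfolding lift2_add lift2_pure2[of U V \<phi>, OF bil] by (intro S(2) mem)
qed

lemma linear_form_eq_on:
  assumes t: "t \<in> subtensor U V X Y" and sub: "X \<subseteq> car U" "Y \<subseteq> car V" "\<And>c u. u \<in> X \<Longrightarrow> scl U c u \<in> X"
    and f: "linear_on (tensor U V) W f" and g: "linear_on (tensor U V) W g"
    and eq: "\<And>u v. u \<in> X \<Longrightarrow> v \<in> Y \<Longrightarrow> f (pure2 U V u v) = g (pure2 U V u v)"
  shows "f t = g t"
  using t sub(1,2)
proof (induction rule: subtensor_induct)
  case (scl c u)
  then show ?case by (rule sub(3))
next
  case zero
  show ?case using linear_on_0[OF f is_vspace_tensor] linear_on_0[OF g is_vspace_tensor] by metis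
next
  case (add s u v)
  have "s \<in> car (tensor U V)" "pure2 U V u v \<in> car (tensor U V)"
    using add sub subtensor_car[of X U Y V s] pure2_car[of u U v V] by auto
  then show ?case using add linear_on_add[OF f] linear_on_add[OF g] eq by metis
qed

section \<open>The graded space A \<otimes> B\<close>

locale induced_setting = quadratic_perm B H dia om m
  for B :: "('k::field, 'b::ab_group_add) vspace"
    and H :: "int \<Rightarrow> 'b set"
    and dia :: "'b \<Rightarrow> 'b \<Rightarrow> 'b" (infixl "\<diamondop>" 70)
    and om :: "'b \<Rightarrow> 'b \<Rightarrow> 'k" ("\<omega>")
    and m :: int +
  fixes A :: "('k, 'a::ab_group_add) vspace"
  assumes vsA: "is_vspace A" and finA: "finite_dim A (car A)"
begin

abbreviation P :: "('k, ('k, 'a, 'b) tens2) vspace" where "P \<equiv> tensor A B"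
abbreviation G :: "int \<Rightarrow> ('k, 'a, 'b) tens2 set" where "G \<equiv> ind_grading A B H"
abbreviation pt :: "'a \<Rightarrow> 'b \<Rightarrow> ('k, 'a, 'b) tens2" (infix "\<otimes>" 68) where "a \<otimes> b \<equiv> pure2 A B a b"

lemma vsP: "is_vspace P" by (rule is_vspace_tensor)

lemma pt_lin1: "b \<in> car B \<Longrightarrow> linear_on A P (\<lambda>a. a \<otimes> b)" by (rule pure2_linear1)

lemma pt_lin2: "a \<in> car A \<Longrightarrow> linear_on B P (\<lambda>b. a \<otimes> b)" by (rule pure2_linear2)

lemma pt_eval: "bilinear_on A B scalars (\<lambda>a b. (a \<otimes> b) \<beta>)"
  by (rule bilinear_formI[OF lin_eval[OF pt_lin2] lin_eval[OF pt_lin1]])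

lemma G_eq: "G i = subtensor A B (car A) (H i)" by (simp add: ind_grading_def)

lemma H_sub: "H i \<subseteq> car B" using H_car by blast

lemma pt_G: "a \<in> car A \<Longrightarrow> b \<in> H i \<Longrightarrow> a \<otimes> b \<in> G i"
  unfolding G_eq by (rule pure2_mem)

lemma pt_car: "a \<in> car A \<Longrightarrow> b \<in> car B \<Longrightarrow> a \<otimes> b \<in> car P"
  by (rule pure2_car)

lemma ptH_car: "a \<in> car A \<Longrightarrow> b \<in> H i \<Longrightarrow> a \<otimes> b \<in> car P"
  by (intro pt_car H_car)

lemma G_car: "p \<in> G i \<Longrightarrow> p \<in> car P"
  unfolding G_eq by (rule subtensor_car[OF order_refl H_sub])

lemma G_sub: "G i \<subseteq> car P" using G_car by blast

lemma G_scl: "u \<in> G i \<Longrightarrow> scl P c u \<in> G i"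
  unfolding G_eq scl_tensor by (rule subtensor_closed)

lemma G_scl': "u \<in> G i \<Longrightarrow> fun_scl c u \<in> G i"
  unfolding G_eq by (rule subtensor_closed)

text \<open>Refines \<open>tensor_induct\<close> to pure tensors with homogeneous second factor, by
  splitting \<open>b\<close> into its finitely many components.\<close>

lemma P_induct [consumes 1, case_names zero add]:
  assumes p: "p \<in> car P" and z: "Q 0"
    and a: "\<And>s a b i. s \<in> car P \<Longrightarrow> Q s \<Longrightarrow> a \<in> car A \<Longrightarrow> b \<in> H i \<Longrightarrow> Q (s + a \<otimes> b)"
  shows "Q p"
  using p vsA z
proof (rule tensor_induct)
  fix s x b assume s: "s \<in> car P" "Q s" and x: "x \<in> car A" and b: "b \<in> car B"
  let ?c = "\<lambda>i. component H i b"
  have c: "?c i \<in> car B" for i by (rule component_car[OF graded b])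
  \<comment> \<open>The components of \<open>b\<close> are added one at a time; membership in
    \<open>car P\<close> is carried along because the induction hypothesis on \<open>Q\<close> asks
    for it.\<close>
  have "Q (s + (\<Sum>i\<in>I. x \<otimes> ?c i)) \<and> s + (\<Sum>i\<in>I. x \<otimes> ?c i) \<in> car P" if "finite I" for I
    using that
  proof (induction I)
    case empty
    show ?case unfolding sum.empty add_0_right using s by blast
  next
    case (insert i I)
    have e: "s + (\<Sum>i\<in>insert i I. x \<otimes> ?c i) = (s + (\<Sum>i\<in>I. x \<otimes> ?c i)) + x \<otimes> ?c i"
      unfolding sum.insert[OF insert.hyps] by (simp only: ac_simps)
    show ?case
      unfolding e using insert.IH a x component_mem[OF graded b] is_vspaceD(2)[OF vsP] pt_car[OF x c] by blast
  qed
  moreover have "(\<Sum>i | ?c i \<noteq> 0. x \<otimes> ?c i) = x \<otimes> b"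
    using linear_on_sum[OF pt_lin2[OF x] vsB, of "{i. ?c i \<noteq> 0}" ?c] c
      component_sum[OF graded b component_finite[OF graded b] order_refl] by simp
  ultimately show "Q (s + x \<otimes> b)" using component_finite[OF graded b] by metis
qed

text \<open>Spanned by the \<open>a \<otimes> e\<close> with \<open>a\<close> in a finite spanning
  set of \<open>A\<close> and \<open>e\<close> in \<open>Eb i\<close>; finite dimension of
  \<open>A\<close> enters here.\<close>

lemma finite_dim_G: "finite_dim P (G i)"
proof -
  obtain S where S: "finite S" "car A = module.span (scl A) S"
    using finA by (auto simp: finite_dim_def)
  interpret VA: vector_space "scl A" using vsA by (simp add: is_vspace_def)
  have SA: "S \<subseteq> car A" using S VA.span_superset by auto
  let ?T = "(\<lambda>(a, e). a \<otimes> e) ` (S \<times> Eb i)"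
  have 1: "a \<otimes> e \<in> fsc.span ?T" if "a \<in> car A" and e: "e \<in> Eb i" for a e
  proof -
    have "a \<in> VA.span S" using that S by simp
    then have "a \<in> car A \<and> a \<otimes> e \<in> fsc.span ?T"
    proof (induction rule: VA.span_induct_alt)
      case base
      show ?case using linear_on_0[OF pt_lin1[OF Eb_car[OF e]] vsA] is_vspaceD(1)[OF vsA] fsc.span_zero by metis
    next
      case (step c x y)
      have xA: "x \<in> car A" using step SA by blast
      have e1: "(scl A c x + y) \<otimes> e = fun_scl c (x \<otimes> e) + y \<otimes> e"
        using linear_on_add[OF pt_lin1[OF Eb_car[OF e]] is_vspaceD(3)[OF vsA xA], of y c]
          linear_on_scl[OF pt_lin1[OF Eb_car[OF e]] xA, of c] step unfolding scl_tensor by metis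
      have "x \<otimes> e \<in> fsc.span ?T" using step e by (intro fsc.span_base) auto
      then show ?case unfolding e1 using step xA is_vspaceD(2,3)[OF vsA] fsc.span_add fsc.span_scale by blast
    qed
    then show ?thesis ..
  qed
  have "fsc.span ?T = G i"
  proof
    have "?T \<subseteq> G i" using SA Eb_H pt_G by auto
    then show "fsc.span ?T \<subseteq> G i" unfolding G_eq by (rule fsc.span_minimal[OF _ subspace_subtensor])
  next
    have "a \<otimes> b \<in> fsc.span ?T" if a: "a \<in> car A" and b: "b \<in> H i" for a b
    proof -
      have "a \<otimes> b = (\<Sum>e\<in>Eb i. a \<otimes> scl B (\<omega> b (fb i e)) e)"
        using linear_on_sum[OF pt_lin2[OF a] vsB, of "Eb i" "\<lambda>e. scl B (\<omega> b (fb i e)) e"]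
          Eb_car is_vspaceD(3)[OF vsB] Eb_expand[OF b] by simp
      also have "\<dots> = (\<Sum>e\<in>Eb i. fun_scl (\<omega> b (fb i e)) (a \<otimes> e))"
        using linear_on_scl[OF pt_lin2[OF a] Eb_car] by (intro sum.cong) simp_all
      finally show ?thesis using 1[OF a] by (simp only: fsc.span_sum fsc.span_scale)
    qed
    then show "G i \<subseteq> fsc.span ?T"
      unfolding G_eq subtensor_def by (intro fsc.span_minimal fsc.subspace_span) blast
  qed
  moreover have "finite ?T" using S finite_Eb by auto
  ultimately show ?thesis unfolding finite_dim_def scl_tensor by metis
qed

text \<open>The projection to degree \<open>i\<close>, written down through the grading of
  \<open>B\<close> because \<open>component G\<close> makes sense only after
  \<open>A \<otimes> B\<close> is known to be graded.\<close>

definition "proj i = lift2 (\<lambda>a b. a \<otimes> component H i b)"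

lemma proj_pt: "proj i (a \<otimes> b) = a \<otimes> component H i b"
  unfolding proj_def
  by (rule lift2_pure2[OF bilin_comp[OF pt_eval linear_on_ident component_linear[OF graded]]])

lemma proj_lin: "linear_on P P (proj i)"
proof -
  have "proj i p \<in> car P" if "p \<in> car P" for p
    using that
  proof (induction rule: P_induct)
    case zero
    have "proj i 0 = 0" by (simp add: proj_def lift2_def fun_eq_iff)
    then show ?case using is_vspaceD(1)[OF vsP] by metis
  next
    case (add s a b j)
    have "component H i b \<in> car B" using component_car[OF graded H_car[OF add(3)]] .
    then have "proj i (a \<otimes> b) \<in> car P" unfolding proj_pt using add pt_car by blast
    moreover have "proj i (s + a \<otimes> b) = proj i s + proj i (a \<otimes> b)" unfolding proj_def by (rule lift2_add)
    ultimately show ?case using add is_vspaceD(2)[OF vsP] by metis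
  qed
  then show ?thesis by (simp add: linear_on_def proj_def lift2_add lift2_scl)
qed

lemma proj_G: "p \<in> G j \<Longrightarrow> proj i p = (if i = j then p else 0)"
proof -
  assume p: "p \<in> G j"
  have l: "linear_on P P (\<lambda>p. if i = j then p else 0)"
    using is_vspaceD(1)[OF vsP] by (simp add: linear_on_def fun_scl_def fun_eq_iff)
  show "proj i p = (if i = j then p else 0)"
  proof (rule linear_form_eq_on[OF p[unfolded G_eq] order_refl H_sub is_vspaceD(3)[OF vsA] proj_lin l])
    fix a b assume "a \<in> car A" "b \<in> H j"
    then show "proj i (a \<otimes> b) = (if i = j then a \<otimes> b else 0)"
      unfolding proj_pt component_hom[OF graded \<open>b \<in> H j\<close>]
      using linear_on_0[OF pt_lin2 vsB] by simp
  qed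
qed

text \<open>Existence of decompositions is additive and clear for homogeneous pure tensors;
  uniqueness holds since \<open>proj i\<close> recovers the term of degree \<open>i\<close> from any
  decomposition.\<close>

lemma gradedP: "graded_vspace P G"
proof -
  have ex: "\<exists>f. decomposition G p f" if "p \<in> car P" for p
    using that
  proof (induction rule: P_induct)
    case zero
    show ?case using decomposition_single[of G 0 0] subtensor_closed(1) unfolding G_eq by metis
  next
    case (add s a b i)
    then obtain f where "decomposition G s f" by blast
    moreover have "decomposition G (a \<otimes> b) (\<lambda>j. if j = i then a \<otimes> b else 0)"
      by (rule decomposition_single) (use add pt_G in \<open>auto simp: G_eq subtensor_closed(1)\<close>)
    ultimately have "decomposition G (s + a \<otimes> b) (\<lambda>j. f j + (if j = i then a \<otimes> b else 0))"
      by (intro decomposition_add) (auto simp only: G_eq subtensor_closed(2))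
    then show ?case by blast
  qed
  have un: "f i = proj i p" if d: "decomposition G p f" for p f i
  proof -
    have fin: "finite {j. f j \<noteq> 0}" and p: "p = Sum_any f" and m: "\<And>j. f j \<in> G j"
      using d by (auto simp: decomposition_def)
    have "proj i p = (\<Sum>j | f j \<noteq> 0. proj i (f j))"
      unfolding p Sum_any.expand_set by (rule linear_on_sum[OF proj_lin vsP]) (use m G_car in blast)
    also have "\<dots> = (\<Sum>j | f j \<noteq> 0. if j = i then f i else 0)"
      using proj_G[OF m] by (intro sum.cong) auto
    also have "\<dots> = f i" using fin by (simp add: sum.delta)
    finally show ?thesis by simp
  qed
  have "\<exists>!f. decomposition G p f" if "p \<in> car P" for p
    using ex[OF that] un by (metis ext)
  moreover have "module.subspace (scl P) (G i)" for i
    unfolding G_eq scl_tensor by (rule subspace_subtensor)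
  ultimately show ?thesis
    unfolding graded_vspace_def using vsP finite_dim_G G_sub by blast
qed

lemmas componentP_hom = component_hom[OF gradedP]
lemmas componentP_lin = component_linear[OF gradedP]
lemmas G_closed = graded_closed[OF gradedP]

lemma G_form_eq:
  assumes "p \<in> G i" "linear_on P W f" "linear_on P W g"
    "\<And>a b. a \<in> car A \<Longrightarrow> b \<in> H i \<Longrightarrow> f (a \<otimes> b) = g (a \<otimes> b)"
  shows "f p = g p"
  by (rule linear_form_eq_on[OF assms(1)[unfolded G_eq] order_refl H_sub is_vspaceD(3)[OF vsA] assms(2,3,4)])

abbreviation blk :: "int \<Rightarrow> int \<Rightarrow> ('k, ('k, 'a, 'b) tens2, ('k, 'a, 'b) tens2) tens2 set" where
  "blk i j \<equiv> subtensor P P (G i) (G j)"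

lemma blk_car: "t \<in> blk i j \<Longrightarrow> t \<in> car (tensor P P)"
  by (rule subtensor_car[OF G_sub G_sub])

lemma blk_cong:
  assumes t: "t \<in> blk i j" and "bilinear_on P P scalars \<beta>" "bilinear_on P P scalars \<beta>'"
    and eq: "\<And>a b a' b'. \<lbrakk>a \<in> car A; b \<in> H i; a' \<in> car A; b' \<in> H j\<rbrakk> \<Longrightarrow>
      \<beta> (a \<otimes> b) (a' \<otimes> b') = \<beta>' (a \<otimes> b) (a' \<otimes> b')"
  shows "t \<beta> = t \<beta>'"
proof (rule subtensor_cong[OF t G_sub G_sub G_scl assms(2,3)])
  fix u v assume u: "u \<in> G i" and v: "v \<in> G j"
  show "\<beta> u v = \<beta>' u v"
  proof (rule G_form_eq[OF v bilinear_onD1[OF assms(2) G_car[OF u]] bilinear_onD1[OF assms(3) G_car[OF u]]])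
    fix a b assume ab: "a \<in> car A" "b \<in> H j"
    show "\<beta> u (a \<otimes> b) = \<beta>' u (a \<otimes> b)"
      by (rule G_form_eq[OF u bilinear_onD2[OF assms(2) ptH_car[OF ab]] bilinear_onD2[OF assms(3) ptH_car[OF ab]]])
        (rule eq[OF _ _ ab])
  qed
qed

abbreviation blk3 :: "int \<Rightarrow> int \<Rightarrow> int \<Rightarrow> ('k, ('k, 'a, 'b) tens2) tens3 set" where
  "blk3 i j k \<equiv> subtensor3 P (G i) (G j) (G k)"

text \<open>An identity of trilinear forms that is valid on homogeneous pure tensors is valid on the
  whole block. An empty index set gives vanishing, a singleton gives congruence, and a product of
  dual bases gives the expansion into test forms.\<close>

lemma blk3_lin:
  assumes "T \<in> blk3 i j k" "finite I" "\<And>x. x \<in> I \<Longrightarrow> trilinear_form_on P (F x)"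
    "trilinear_form_on P \<tau>"
    and eq: "\<And>a b a' b' a'' b''. \<lbrakk>a \<in> car A; b \<in> H i; a' \<in> car A; b' \<in> H j; a'' \<in> car A; b'' \<in> H k\<rbrakk> \<Longrightarrow>
      \<tau> (a \<otimes> b) (a' \<otimes> b') (a'' \<otimes> b'') = (\<Sum>x\<in>I. F x (a \<otimes> b) (a' \<otimes> b') (a'' \<otimes> b''))"
  shows "T \<tau> = (\<Sum>x\<in>I. T (F x))"
proof -
  have e: "\<tau> u v w = (\<Sum>x\<in>I. F x u v w)" if u: "u \<in> G i" and v: "v \<in> G j" and w: "w \<in> G k" for u v w
  proof (rule G_form_eq[OF u trilinear_formD(1)[OF assms(4) G_car[OF v] G_car[OF w]]
        lin_sum[OF trilinear_formD(1)[OF assms(3) G_car[OF v] G_car[OF w]]]])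
    fix a b assume ab: "a \<in> car A" "b \<in> H i"
    note abc = ptH_car[OF ab]
    show "\<tau> (a \<otimes> b) v w = (\<Sum>x\<in>I. F x (a \<otimes> b) v w)"
    proof (rule G_form_eq[OF v trilinear_formD(2)[OF assms(4) abc G_car[OF w]]
          lin_sum[OF trilinear_formD(2)[OF assms(3) abc G_car[OF w]]]])
      fix a' b' assume ab': "a' \<in> car A" "b' \<in> H j"
      note abc' = ptH_car[OF ab']
      show "\<tau> (a \<otimes> b) (a' \<otimes> b') w = (\<Sum>x\<in>I. F x (a \<otimes> b) (a' \<otimes> b') w)"
        by (rule G_form_eq[OF w trilinear_formD(3)[OF assms(4) abc abc']
          lin_sum[OF trilinear_formD(3)[OF assms(3) abc abc']]])
          (assumption | rule eq[OF ab ab'])+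
    qed
  qed
  show ?thesis
    using assms(1)
  proof (rule subtensor3_induct[OF _ G_sub G_sub G_sub G_scl])
    show "(0::('k, ('k, 'a, 'b) tens2) tens3) \<tau> = (\<Sum>x\<in>I. 0 (F x))" by simp
  next
    fix s :: "('k, ('k, 'a, 'b) tens2) tens3" and u v w
    assume s: "s \<tau> = (\<Sum>x\<in>I. s (F x))" and uvw: "u \<in> G i" "v \<in> G j" "w \<in> G k"
    show "(s + pure3 P u v w) \<tau> = (\<Sum>x\<in>I. (s + pure3 P u v w) (F x))"
      using s e[OF uvw] assms(3,4) by (simp add: sum.distrib pure3_apply)
  qed
qed

end

section \<open>The coproduct of B dual to its product\<close>

context quadratic_perm
begin

lemma fb_expand_form:
  assumes "linear_on B scalars g" "c \<in> H (- m - i)"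
  shows "g c = (\<Sum>e\<in>Eb i. \<omega> e c * g (fb i e))"
proof -
  have "g c = (\<Sum>e\<in>Eb i. g (scl B (\<omega> e c) (fb i e)))"
    by (subst fb_expand[OF assms(2), symmetric], rule linear_on_sum[OF assms(1) vsB])
      (intro is_vspaceD(3)[OF vsB] fb_car)
  then show ?thesis using linear_form_scl[OF assms(1) fb_car] by simp
qed

lemma Eb_expand_form:
  assumes "linear_on B scalars g" "b \<in> H i"
  shows "g b = (\<Sum>e\<in>Eb i. \<omega> b (fb i e) * g e)"
proof -
  have "g b = (\<Sum>e\<in>Eb i. g (scl B (\<omega> b (fb i e)) e))"
    by (subst Eb_expand[OF assms(2), symmetric], rule linear_on_sum[OF assms(1) vsB])
      (intro is_vspaceD(3)[OF vsB] Eb_car)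
  then show ?thesis using linear_form_scl[OF assms(1) Eb_car] by simp
qed

lemma omega2_bil: "c \<in> car B \<Longrightarrow> c' \<in> car B \<Longrightarrow> bilinear_on B B scalars (\<lambda>x x'. \<omega> x c * \<omega> x' c')"
  by (rule bilin_mult[OF om_lin1 om_lin1])

lemma H_sub: "H i \<subseteq> car B" using H_car by blast

lemma om_dia_lin1: "b \<in> car B \<Longrightarrow> y \<in> car B \<Longrightarrow> linear_on B scalars (\<lambda>x. \<omega> b (x \<diamondop> y))"
  by (rule linear_on_comp[OF om_lin2 dia_lin1])

lemma om_dia_lin2: "b \<in> car B \<Longrightarrow> x \<in> car B \<Longrightarrow> linear_on B scalars (\<lambda>y. \<omega> b (x \<diamondop> y))"
  by (rule linear_on_comp[OF om_lin2 dia_lin2])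

text \<open>The explicit value of \<open>nu\<close>: its defining equation, tested at the dual
  vectors \<open>fb i e\<close> and \<open>fb j e'\<close>, forces these coefficients of
  \<open>e \<otimes> e'\<close>.\<close>

definition nuE :: "'b \<Rightarrow> ('k, 'b) ctens2" where
  "nuE b = (\<lambda>(i, j). \<Sum>e\<in>Eb i. \<Sum>e'\<in>Eb j. fun_scl (- \<omega> b (fb i e \<diamondop> fb j e')) (pure2 B B e e'))"

lemma nuE_mem: "nuE b (i, j) \<in> subtensor B B (H i) (H j)"
  unfolding nuE_def prod.case by (intro subtensor_closed(5,6) pure2_mem Eb_H)

lemma nuE_apply:
  assumes "bilinear_on B B scalars \<beta>"
  shows "nuE b (i, j) \<beta> = (\<Sum>e\<in>Eb i. \<Sum>e'\<in>Eb j. - \<omega> b (fb i e \<diamondop> fb j e') * \<beta> e e')"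
  using assms by (simp add: nuE_def fun_sum_apply fun_scl_apply pure2_apply)

lemma nuE_eval:
  assumes "b \<in> car B" "c \<in> H (- m - i)" "c' \<in> H (- m - j)"
  shows "nuE b (i, j) (\<lambda>x x'. \<omega> x c * \<omega> x' c') = - \<omega> b (c \<diamondop> c')"
proof -
  have "\<omega> b (c \<diamondop> c') = (\<Sum>e\<in>Eb i. \<omega> e c * \<omega> b (fb i e \<diamondop> c'))"
    by (rule fb_expand_form[OF om_dia_lin1]) (use assms H_car in auto)
  also have "\<dots> = (\<Sum>e\<in>Eb i. \<omega> e c * (\<Sum>e'\<in>Eb j. \<omega> e' c' * \<omega> b (fb i e \<diamondop> fb j e')))"
    by (intro sum.cong refl arg_cong2[of _ _ _ _ "(*)"] fb_expand_form[OF om_dia_lin2] assms fb_car)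
  finally show ?thesis
    using omega2_bil[OF assms(2,3)[THEN H_car]]
    by (simp add: nuE_apply sum_distrib_left sum_negf mult_ac)
qed

lemma om_component:
  assumes "e \<in> H i" "c \<in> car B"
  shows "\<omega> e c = \<omega> e (component H (- m - i) c)"
proof -
  let ?I = "insert (- m - i) {k. component H k c \<noteq> 0}"
  have f: "finite ?I" using component_finite[OF graded assms(2)] by simp
  have "\<omega> e c = (\<Sum>k\<in>?I. \<omega> e (component H k c))"
    by (subst component_sum[OF graded assms(2) f], blast,
        rule linear_on_sum[OF om_lin2[OF H_car[OF assms(1)]] vsB])
      (rule component_car[OF graded assms(2)])
  also have "\<dots> = (\<Sum>k\<in>?I. if k = - m - i then \<omega> e (component H k c) else 0)"
    by (rule sum.cong) (use om_deg[OF _ assms(1) component_mem[OF graded assms(2)]] in auto)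
  also have "\<dots> = \<omega> e (component H (- m - i) c)"
    using f by (simp add: sum.delta)
  finally show ?thesis .
qed

text \<open>Block \<open>(i, j)\<close> sees of \<open>x\<close> and \<open>y\<close> only the
  components of the partner degrees, by \<open>om_component\<close>. The sum over all blocks is
  therefore a finite sum over the degrees that occur in \<open>x\<close> and \<open>y\<close>, and
  bilinearity adds it up to the value at \<open>x \<diamondop> y\<close>.\<close>

lemma om_hat_nuE:
  assumes b: "b \<in> car B" and x: "x \<in> car B" and y: "y \<in> car B"
  shows "om_hat \<omega> (nuE b) x y = - \<omega> b (x \<diamondop> y)"
proof -
  let ?x = "\<lambda>i. component H i x" and ?y = "\<lambda>i. component H i y"
  let ?I = "{i. ?x i \<noteq> 0}" and ?J = "{i. ?y i \<noteq> 0}"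
  note xc = component_car[OF graded x] and yc = component_car[OF graded y]
  have fI: "finite ?I" "finite ?J" using component_finite[OF graded] x y by auto
  have ev: "nuE b (i, j) (\<lambda>u u'. \<omega> u x * \<omega> u' y) = - \<omega> b (?x (- m - i) \<diamondop> ?y (- m - j))" for i j
  proof -
    have "nuE b (i, j) (\<lambda>u u'. \<omega> u x * \<omega> u' y) =
        nuE b (i, j) (\<lambda>u u'. \<omega> u (?x (- m - i)) * \<omega> u' (?y (- m - j)))"
    proof (rule subtensor_cong[OF nuE_mem H_sub H_sub H_closed(4) omega2_bil[OF x y] omega2_bil[OF xc yc]])
      fix u v assume "u \<in> H i" "v \<in> H j"
      then show "\<omega> u x * \<omega> v y = \<omega> u (?x (- m - i)) * \<omega> v (?y (- m - j))"
        using om_component[OF _ x] om_component[OF _ y] by metis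
    qed
    then show ?thesis
      using nuE_eval[OF b component_mem[OF graded x] component_mem[OF graded y]] by simp
  qed
  \<comment> \<open>Pairs of degrees of components correspond to blocks through the involution
    \<open>k \<mapsto> - m - k\<close>.\<close>
  let ?h = "\<lambda>(k, l). (- m - k, - m - l)"
  have z: "\<omega> b (?x k \<diamondop> ?y l) = 0" if "?x k = 0 \<or> ?y l = 0" for k l
    using that linear_on_0[OF om_dia_lin1[OF b yc[of l]] vsB] linear_on_0[OF om_dia_lin2[OF b xc[of k]] vsB]
    by (elim disjE) simp_all
  have "om_hat \<omega> (nuE b) x y = (\<Sum>p\<in>?h ` (?I \<times> ?J). nuE b p (\<lambda>u u'. \<omega> u x * \<omega> u' y))"
    unfolding om_hat_def
  proof (rule Sum_any.expand_superset)
    show "{a. nuE b a (\<lambda>x' x''. \<omega> x' x * \<omega> x'' y) \<noteq> 0} \<subseteq> ?h ` (?I \<times> ?J)"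
    proof clarify
      fix i j assume "nuE b (i, j) (\<lambda>x' x''. \<omega> x' x * \<omega> x'' y) \<noteq> 0"
      then have "(- m - i, - m - j) \<in> ?I \<times> ?J" using z unfolding ev by auto
      then show "(i, j) \<in> ?h ` (?I \<times> ?J)" by (rule rev_image_eqI) simp
    qed
  qed (use fI in auto)
  also have "\<dots> = (\<Sum>(k, l)\<in>?I \<times> ?J. - \<omega> b (?x k \<diamondop> ?y l))"
    by (subst sum.reindex) (auto simp: inj_on_def ev case_prod_unfold)
  also have "\<dots> = - (\<Sum>k\<in>?I. \<Sum>l\<in>?J. \<omega> b (?x k \<diamondop> ?y l))"
    by (simp add: sum.cartesian_product sum_negf case_prod_unfold)
  also have "(\<Sum>k\<in>?I. \<Sum>l\<in>?J. \<omega> b (?x k \<diamondop> ?y l)) = (\<Sum>k\<in>?I. \<omega> b (?x k \<diamondop> y))"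
  proof (rule sum.cong[OF refl])
    fix k
    show "(\<Sum>l\<in>?J. \<omega> b (?x k \<diamondop> ?y l)) = \<omega> b (?x k \<diamondop> y)"
      using arg_cong[OF component_sum[OF graded y fI(2) order_refl], of "\<lambda>y. \<omega> b (?x k \<diamondop> y)"]
        linear_on_sum[OF om_dia_lin2[OF b xc[of k]] vsB, of ?J ?y] yc by simp
  qed
  also have "\<dots> = \<omega> b (x \<diamondop> y)"
    using arg_cong[OF component_sum[OF graded x fI(1) order_refl], of "\<lambda>x. \<omega> b (x \<diamondop> y)"]
      linear_on_sum[OF om_dia_lin1[OF b y] vsB, of ?I ?x] xc by simp
  finally show ?thesis .
qed

text \<open>Both arguments of \<beta> are expanded in dual bases. In particular an element of a
  block is determined by its pairings with dual vectors.\<close>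

lemma subtensor_dual_expand:
  assumes t: "t \<in> subtensor B B (H i) (H j)" and \<beta>: "bilinear_on B B scalars \<beta>"
  shows "t \<beta> = (\<Sum>e\<in>Eb i. \<Sum>e'\<in>Eb j. t (\<lambda>x x'. \<omega> x (fb i e) * \<omega> x' (fb j e')) * \<beta> e e')"
proof -
  have tc: "t \<in> car (tensor B B)" using subtensor_car[OF H_sub H_sub t] .
  have b: "bilinear_on B B scalars (\<lambda>x x'. (\<omega> x (fb i e) * \<omega> x' (fb j e')) * \<beta> e e')"
    if "e \<in> Eb i" "e' \<in> Eb j" for e e'
    by (intro bilin_intros(6) omega2_bil fb_car that)
  have "t \<beta> = t (\<lambda>x x'. \<Sum>e\<in>Eb i. \<Sum>e'\<in>Eb j. (\<omega> x (fb i e) * \<omega> x' (fb j e')) * \<beta> e e')"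
  proof (rule subtensor_cong[OF t H_sub H_sub H_closed(4) \<beta> bilin_sum[OF bilin_sum[OF b]]])
    fix x x' assume x: "x \<in> H i" "x' \<in> H j"
    have "\<beta> x x' = (\<Sum>e\<in>Eb i. \<omega> x (fb i e) * \<beta> e x')"
      by (rule Eb_expand_form[OF bilinear_onD2[OF \<beta> H_car[OF x(2)]] x(1)])
    also have "\<dots> = (\<Sum>e\<in>Eb i. \<omega> x (fb i e) * (\<Sum>e'\<in>Eb j. \<omega> x' (fb j e') * \<beta> e e'))"
      by (intro sum.cong refl arg_cong2[of _ _ _ _ "(*)"] Eb_expand_form[OF bilinear_onD1[OF \<beta> Eb_car] x(2)])
    finally show "\<beta> x x' = (\<Sum>e\<in>Eb i. \<Sum>e'\<in>Eb j. (\<omega> x (fb i e) * \<omega> x' (fb j e')) * \<beta> e e')"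
      by (simp add: sum_distrib_left mult_ac)
  qed
  also have "\<dots> = (\<Sum>e\<in>Eb i. t (\<lambda>x x'. \<Sum>e'\<in>Eb j. (\<omega> x (fb i e) * \<omega> x' (fb j e')) * \<beta> e e'))"
    by (rule tens_sum[OF tc vsB bilin_sum[OF b]])
  also have "\<dots> = (\<Sum>e\<in>Eb i. \<Sum>e'\<in>Eb j. t (\<lambda>x x'. (\<omega> x (fb i e) * \<omega> x' (fb j e')) * \<beta> e e'))"
    by (rule sum.cong[OF refl], rule tens_sum[OF tc vsB b])
  finally show ?thesis using tens_multc[OF tc vsB omega2_bil[OF fb_car fb_car]] by simp
qed

lemma om_hat_hom:
  assumes t: "t \<in> car (ctensor B H)" and c: "c \<in> H (- m - i)" "c' \<in> H (- m - j)"
  shows "om_hat \<omega> t c c' = t (i, j) (\<lambda>x x'. \<omega> x c * \<omega> x' c')"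
  unfolding om_hat_def
proof (rule Sum_any_single)
  fix q assume "q \<noteq> (i, j)"
  then obtain k l where q: "q = (k, l)" "k \<noteq> i \<or> l \<noteq> j" by (cases q) auto
  have tm: "t (k, l) \<in> subtensor B B (H k) (H l)" using t by (simp add: ctensor_def)
  have "t (k, l) (\<lambda>x x'. \<omega> x c * \<omega> x' c') = t (k, l) (\<lambda>x x'. 0)"
  proof (rule subtensor_cong[OF tm H_sub H_sub H_closed(4) omega2_bil[OF c[THEN H_car]] bilin_intros(1)])
    fix x x' assume "x \<in> H k" "x' \<in> H l"
    then have "\<omega> x c = 0 \<or> \<omega> x' c' = 0"
      using q om_deg[OF _ _ c(1), of k x] om_deg[OF _ _ c(2), of l x'] by auto
    then show "\<omega> x c * \<omega> x' c' = 0" by simp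
  qed
  then show "t q (\<lambda>x x'. \<omega> x c * \<omega> x' c') = 0"
    using tens_zero[OF subtensor_car[OF H_sub H_sub tm] vsB] q by simp
qed

text \<open>\<open>nuE\<close> satisfies the defining equation, and any other solution has the same
  pairings with the dual vectors, hence the same blocks. So the definite description is meaningful
  and can be replaced by the explicit formula.\<close>

lemma nu_eq:
  assumes b: "b \<in> car B"
  shows "nu B H (\<diamondop>) \<omega> b = nuE b"
  unfolding nu_def
proof (rule the_equality)
  show "nuE b \<in> car (ctensor B H) \<and> (\<forall>x\<in>car B. \<forall>y\<in>car B. om_hat \<omega> (nuE b) x y = - \<omega> b (x \<diamondop> y))"
    using nuE_mem om_hat_nuE[OF b] by (simp add: ctensor_def)
next
  fix t assume t: "t \<in> car (ctensor B H) \<and> (\<forall>x\<in>car B. \<forall>y\<in>car B. om_hat \<omega> t x y = - \<omega> b (x \<diamondop> y))"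
  show "t = nuE b"
  proof (rule ext)
    fix q :: "int \<times> int"
    obtain i j where q: "q = (i, j)" by (cases q)
    have tm: "t (i, j) \<in> subtensor B B (H i) (H j)" using t by (simp add: ctensor_def)
    have "t (i, j) (\<lambda>x x'. \<omega> x (fb i e) * \<omega> x' (fb j e')) = - \<omega> b (fb i e \<diamondop> fb j e')"
      if "e \<in> Eb i" "e' \<in> Eb j" for e e'
      using t om_hat_hom[OF _ fb_H[OF that(1)] fb_H[OF that(2)], of t] fb_car that by metis
    then have "t (i, j) \<beta> = nuE b (i, j) \<beta>" if "bilinear_on B B scalars \<beta>" for \<beta>
      using subtensor_dual_expand[OF tm that] nuE_apply[OF that] by simp
    then have "t (i, j) = nuE b (i, j)"
      by (rule tensor_eqI[OF subtensor_car[OF H_sub H_sub tm] subtensor_car[OF H_sub H_sub nuE_mem] vsB])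
    then show "t q = nuE b q" by (simp add: q)
  qed
qed

lemma nuE_linear: "linear_on B (tensor B B) (\<lambda>b. nuE b (i, j))"
proof -
  have l: "linear_on B scalars (\<lambda>b. nuE b (i, j) \<beta>)" for \<beta>
  proof (cases "bilinear_on B B scalars \<beta>")
    case True
    show ?thesis unfolding nuE_apply[OF True]
      by (intro lin_sum lin_intros(4) lin_intros(6) om_lin1 dia_car fb_car)
  next
    case False
    then have "nuE b (i, j) \<beta> = 0" for b
      using tens_nonbilinear[OF subtensor_car[OF H_sub H_sub nuE_mem] vsB] by blast
    then show ?thesis by (simp add: lin_intros(1))
  qed
  show ?thesis
    unfolding linear_on_def scl_tensor
    using subtensor_car[OF H_sub H_sub nuE_mem] linear_form_add[OF l] linear_form_scl[OF l]
    by (intro conjI ballI allI ext) (auto simp: fun_scl_apply)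
qed

text \<open>The product of \<open>fb i e\<close> and \<open>fb j e'\<close> has degree
  \<open>- 2 * m - i - j\<close>, and it pairs with degree \<open>d\<close> only if
  \<open>i + j = d - m\<close>.\<close>

lemma nuE_degree:
  assumes "b \<in> H d" "i + j \<noteq> d - m"
  shows "nuE b (i, j) = 0"
proof -
  have "\<omega> b (fb i e \<diamondop> fb j e') = 0" if "e \<in> Eb i" "e' \<in> Eb j" for e e'
    using om_deg[OF _ assms(1) dia_degree[OF fb_H[OF that(1)] fb_H[OF that(2)]]] assms(2) by auto
  then show ?thesis by (simp add: nuE_def fun_scl_def fun_eq_iff fun_sum_apply)
qed

end

section \<open>Test forms on the tensor powers of A \<otimes> B\<close>

context induced_setting
begin

text \<open>The forms \<open>\<gamma> \<otimes> \<omega>(-, c) \<otimes> \<omega>(-, c')\<close> separate the points of the completed tensor square, see \<open>sep2\<close>.\<close>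

definition tst :: "('a \<Rightarrow> 'a \<Rightarrow> 'k) \<Rightarrow> 'b \<Rightarrow> 'b \<Rightarrow> ('k, 'a, 'b) tens2 \<Rightarrow> ('k, 'a, 'b) tens2 \<Rightarrow> 'k" where
  "tst \<gamma> c c' p q = p (\<lambda>a b. q (\<lambda>a' b'. \<gamma> a a' * (\<omega> b c * \<omega> b' c')))"

lemma tst_inner:
  assumes "bilinear_on A A scalars \<gamma>" "c \<in> car B" "c' \<in> car B"
  shows "a \<in> car A \<Longrightarrow> b \<in> car B \<Longrightarrow> bilinear_on A B scalars (\<lambda>a' b'. \<gamma> a a' * (\<omega> b c * \<omega> b' c'))"
    and "a' \<in> car A \<Longrightarrow> b' \<in> car B \<Longrightarrow> bilinear_on A B scalars (\<lambda>a b. \<gamma> a a' * (\<omega> b c * \<omega> b' c'))"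
  by (rule bilin_mult[OF bilinear_onD1[OF assms(1)] lin_intros(5)[OF om_lin1[OF assms(3)]]], assumption)
    (rule bilin_mult[OF bilinear_onD2[OF assms(1)] lin_intros(6)[OF om_lin1[OF assms(2)]]], assumption)

lemma tst_outer:
  assumes "bilinear_on A A scalars \<gamma>" "c \<in> car B" "c' \<in> car B" "q \<in> car P"
  shows "bilinear_on A B scalars (\<lambda>a b. q (\<lambda>a' b'. \<gamma> a a' * (\<omega> b c * \<omega> b' c')))"
  by (rule tens_bilin[OF assms(4) vsA vsB vsA tst_inner[OF assms(1-3)]])

lemma tst_pt:
  assumes g: "bilinear_on A A scalars \<gamma>" "c \<in> car B" "c' \<in> car B"
    and "a \<in> car A" "b \<in> car B" "a' \<in> car A" "b' \<in> car B"
  shows "tst \<gamma> c c' (a \<otimes> b) (a' \<otimes> b') = \<gamma> a a' * (\<omega> b c * \<omega> b' c')"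
  unfolding tst_def pure2_apply[OF tst_outer[OF g pt_car[OF assms(6,7)]]]
  by (rule pure2_apply[OF tst_inner(1)[OF g assms(4,5)]])

lemma tst_bil:
  assumes g: "bilinear_on A A scalars \<gamma>" "c \<in> car B" "c' \<in> car B"
  shows "bilinear_on P P scalars (tst \<gamma> c c')"
proof (rule bilinear_formI)
  fix q assume q: "q \<in> car P"
  show "linear_on P scalars (\<lambda>p. tst \<gamma> c c' p q)"
    unfolding tst_def by (rule lin_eval_tensor)
  show "linear_on P scalars (tst \<gamma> c c' q)"
    unfolding tst_def
    by (rule tens_param[OF q vsA vsP tst_outer[OF g] lin_eval_tensor])
qed

lemma tst_param:
  assumes W: "is_vspace W" and F: "\<And>w. w \<in> car W \<Longrightarrow> bilinear_on A A scalars (F w)"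
    and L: "\<And>a a'. a \<in> car A \<Longrightarrow> a' \<in> car A \<Longrightarrow> linear_on W scalars (\<lambda>w. F w a a')"
    and c: "c \<in> car B" "c' \<in> car B" and p: "p \<in> car P" and q: "q \<in> car P"
  shows "linear_on W scalars (\<lambda>w. tst (F w) c c' p q)"
  unfolding tst_def
  by (rule tens_param[OF p vsA W tst_outer[OF F c q] tens_param[OF q vsA W tst_inner(1)[OF F c] lin_intros(6)[OF L]]])

text \<open>Splitting off the first factor and using \<open>tst\<close> for the other two makes
  multilinearity a consequence of that of \<open>tst\<close>. In the value on pure tensors,
  \<open>tst3_pt\<close>, the three factors play equal roles.\<close>

definition tst3 :: "('a \<Rightarrow> 'a \<Rightarrow> 'a \<Rightarrow> 'k) \<Rightarrow> 'b \<Rightarrow> 'b \<Rightarrow> 'b \<Rightarrow>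
    ('k, 'a, 'b) tens2 \<Rightarrow> ('k, 'a, 'b) tens2 \<Rightarrow> ('k, 'a, 'b) tens2 \<Rightarrow> 'k" where
  "tst3 \<gamma> c1 c2 c3 p q s = p (\<lambda>a b. tst (\<gamma> a) c2 c3 q s * \<omega> b c1)"

context
  fixes \<gamma> :: "'a \<Rightarrow> 'a \<Rightarrow> 'a \<Rightarrow> 'k" and c1 c2 c3 :: 'b
  assumes \<gamma>: "trilinear_form_on A \<gamma>" and c: "c1 \<in> car B" "c2 \<in> car B" "c3 \<in> car B"
begin

lemma tst3_inner:
  assumes "q \<in> car P" "s \<in> car P"
  shows "bilinear_on A B scalars (\<lambda>a b. tst (\<gamma> a) c2 c3 q s * \<omega> b c1)"
  by (rule bilin_mult[OF tst_param[OF vsA trilinear_bilinear(3)[OF \<gamma>] trilinear_formD(1)[OF \<gamma>] c(2,3) assms]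
        om_lin1[OF c(1)]])

lemma tst3_tri: "trilinear_form_on P (tst3 \<gamma> c1 c2 c3)"
proof (rule trilinear_formI)
  fix q s assume q: "q \<in> car P" and s: "s \<in> car P"
  note bg = tst_bil[OF trilinear_bilinear(3)[OF \<gamma>] c(2,3)]
  show "linear_on P scalars (\<lambda>p. tst3 \<gamma> c1 c2 c3 p q s)"
    unfolding tst3_def by (rule lin_eval_tensor)
  show "linear_on P scalars (\<lambda>p. tst3 \<gamma> c1 c2 c3 q p s)"
    unfolding tst3_def
    by (rule tens_param[OF q vsA vsP tst3_inner[OF _ s] lin_intros(6)[OF bilinear_onD2[OF bg s]]])
  show "linear_on P scalars (tst3 \<gamma> c1 c2 c3 q s)"
    unfolding tst3_def
    by (rule tens_param[OF q vsA vsP tst3_inner[OF s] lin_intros(6)[OF bilinear_onD1[OF bg s]]])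
qed

lemma tst3_pt:
  assumes "a \<in> car A" "b \<in> car B" "a' \<in> car A" "b' \<in> car B" "a'' \<in> car A" "b'' \<in> car B"
  shows "tst3 \<gamma> c1 c2 c3 (a \<otimes> b) (a' \<otimes> b') (a'' \<otimes> b'')
    = \<gamma> a a' a'' * (\<omega> b c1 * (\<omega> b' c2 * \<omega> b'' c3))"
  unfolding tst3_def pure2_apply[OF tst3_inner[OF pt_car[OF assms(3,4)] pt_car[OF assms(5,6)]]]
    tst_pt[OF trilinear_bilinear(3)[OF \<gamma> assms(1)] c(2,3) assms(3-6)]
  by (simp add: mult_ac)

end

section \<open>Pairings with the completed tensor powers\<close>

lemma car2_iff: "t \<in> car (ctensor P G) \<longleftrightarrow> (\<forall>i j. t (i, j) \<in> blk i j)"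
  by (simp add: ctensor_def)

lemma car2D: "t \<in> car (ctensor P G) \<Longrightarrow> t (i, j) \<in> blk i j"
  by (simp add: car2_iff)

text \<open>Summation over all blocks avoids naming the degrees of \<open>c\<close> and
  \<open>c'\<close>; for homogeneous \<open>c\<close> and \<open>c'\<close> a single block is
  involved, see \<open>pr2_hom\<close>.\<close>

definition pr2 :: "('k, ('k, 'a, 'b) tens2) ctens2 \<Rightarrow> ('a \<Rightarrow> 'a \<Rightarrow> 'k) \<Rightarrow> 'b \<Rightarrow> 'b \<Rightarrow> 'k" where
  "pr2 t \<gamma> c c' = Sum_any (\<lambda>p. t p (tst \<gamma> c c'))"

lemma pr2_hom:
  assumes t: "t \<in> car (ctensor P G)" and g: "bilinear_on A A scalars \<gamma>"
    and c: "c \<in> H k" "k = - m - i" "c' \<in> H l" "l = - m - j"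
  shows "pr2 t \<gamma> c c' = t (i, j) (tst \<gamma> c c')"
  unfolding pr2_def
proof (rule Sum_any_single)
  note cc = H_car[OF c(1)] H_car[OF c(3)]
  fix q assume q: "q \<noteq> (i, j)"
  obtain i' j' where q': "q = (i', j')" by (cases q)
  have "t (i', j') (tst \<gamma> c c') = t (i', j') (\<lambda>_ _. 0)"
  proof (rule blk_cong[OF car2D[OF t] tst_bil[OF g cc] bilin_intros(1)])
    fix a b a' b' assume ab: "a \<in> car A" "b \<in> H i'" "a' \<in> car A" "b' \<in> H j'"
    have "\<omega> b c = 0 \<or> \<omega> b' c' = 0"
      using q q' c om_deg[OF _ ab(2) c(1)] om_deg[OF _ ab(4) c(3)] by auto
    then show "tst \<gamma> c c' (a \<otimes> b) (a' \<otimes> b') = 0"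
      using tst_pt[OF g cc ab(1) H_car[OF ab(2)] ab(3) H_car[OF ab(4)]] by auto
  qed
  then show "t q (tst \<gamma> c c') = 0"
    using tens_zero[OF blk_car[OF car2D[OF t]] vsP] q' by simp
qed

text \<open>Two test forms suffice, because the induced products and coproducts consist of two
  terms, one for each order of the arguments.\<close>

lemma pr2_eval:
  assumes t: "t \<in> car (ctensor P G)" and F: "bilinear_on P P scalars F"
    and g: "bilinear_on A A scalars \<gamma>\<^sub>1" "bilinear_on A A scalars \<gamma>\<^sub>2"
    and c: "c\<^sub>1 \<in> H (- m - i)" "c\<^sub>1' \<in> H (- m - j)" "c\<^sub>2 \<in> H (- m - i)" "c\<^sub>2' \<in> H (- m - j)"
    and eq: "\<And>a b a' b'. \<lbrakk>a \<in> car A; b \<in> H i; a' \<in> car A; b' \<in> H j\<rbrakk> \<Longrightarrow> F (a \<otimes> b) (a' \<otimes> b') =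
      k\<^sub>1 * (\<gamma>\<^sub>1 a a' * (\<omega> b c\<^sub>1 * \<omega> b' c\<^sub>1')) + k\<^sub>2 * (\<gamma>\<^sub>2 a a' * (\<omega> b c\<^sub>2 * \<omega> b' c\<^sub>2'))"
  shows "t (i, j) F = k\<^sub>1 * pr2 t \<gamma>\<^sub>1 c\<^sub>1 c\<^sub>1' + k\<^sub>2 * pr2 t \<gamma>\<^sub>2 c\<^sub>2 c\<^sub>2'"
proof -
  note b1 = tst_bil[OF g(1) H_car[OF c(1)] H_car[OF c(2)]]
  note b2 = tst_bil[OF g(2) H_car[OF c(3)] H_car[OF c(4)]]
  note tc = blk_car[OF car2D[OF t]]
  have "t (i, j) F = t (i, j) (\<lambda>p q. k\<^sub>1 * tst \<gamma>\<^sub>1 c\<^sub>1 c\<^sub>1' p q + k\<^sub>2 * tst \<gamma>\<^sub>2 c\<^sub>2 c\<^sub>2' p q)"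
  proof (rule blk_cong[OF car2D[OF t] F bilin_intros(2)[OF bilin_intros(5)[OF b1] bilin_intros(5)[OF b2]]])
    fix a b a' b' assume ab: "a \<in> car A" "b \<in> H i" "a' \<in> car A" "b' \<in> H j"
    note ab' = ab(1) H_car[OF ab(2)] ab(3) H_car[OF ab(4)]
    show "F (a \<otimes> b) (a' \<otimes> b') = k\<^sub>1 * tst \<gamma>\<^sub>1 c\<^sub>1 c\<^sub>1' (a \<otimes> b) (a' \<otimes> b') + k\<^sub>2 * tst \<gamma>\<^sub>2 c\<^sub>2 c\<^sub>2' (a \<otimes> b) (a' \<otimes> b')"
      unfolding tst_pt[OF g(1) H_car[OF c(1)] H_car[OF c(2)] ab'] tst_pt[OF g(2) H_car[OF c(3)] H_car[OF c(4)] ab']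
      by (rule eq[OF ab])
  qed
  also have "\<dots> = k\<^sub>1 * t (i, j) (tst \<gamma>\<^sub>1 c\<^sub>1 c\<^sub>1') + k\<^sub>2 * t (i, j) (tst \<gamma>\<^sub>2 c\<^sub>2 c\<^sub>2')"
    unfolding tens_add[OF tc vsP bilin_intros(5)[OF b1] bilin_intros(5)[OF b2]]
      tens_cmult[OF tc vsP b1] tens_cmult[OF tc vsP b2] ..
  finally show ?thesis
    unfolding pr2_hom[OF t g(1) c(1) refl c(2) refl] pr2_hom[OF t g(2) c(3) refl c(4) refl] .
qed

text \<open>Expanding both factors from \<open>B\<close> in dual bases writes \<beta> on a block as
  a finite sum of test forms; its values at basis vectors are the bilinear forms on \<open>A\<close>
  that occur there.\<close>

lemma blk_dual_expand:
  assumes t: "t \<in> blk i j" and \<beta>: "bilinear_on P P scalars \<beta>"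
  shows "t \<beta> = (\<Sum>e\<in>Eb i. \<Sum>e'\<in>Eb j. t (tst (\<lambda>a a'. \<beta> (a \<otimes> e) (a' \<otimes> e')) (fb i e) (fb j e')))"
proof -
  note tc = blk_car[OF t]
  have bb: "bilinear_on A A scalars (\<lambda>a a'. \<beta> (a \<otimes> e) (a' \<otimes> e'))" if "e \<in> Eb i" "e' \<in> Eb j" for e e'
    by (rule bilin_comp[OF \<beta> pt_lin1[OF Eb_car[OF that(1)]] pt_lin1[OF Eb_car[OF that(2)]]])
  note tb = tst_bil[OF bb fb_car fb_car]
  have "t \<beta> = t (\<lambda>p q. \<Sum>e\<in>Eb i. \<Sum>e'\<in>Eb j. tst (\<lambda>a a'. \<beta> (a \<otimes> e) (a' \<otimes> e')) (fb i e) (fb j e') p q)"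
  proof (rule blk_cong[OF t \<beta> bilin_sum[OF bilin_sum[OF tb]]])
    fix a b a' b' assume ab: "a \<in> car A" "b \<in> H i" "a' \<in> car A" "b' \<in> H j"
    note ab' = ab(1) H_car[OF ab(2)] ab(3) H_car[OF ab(4)]
    have "\<beta> (a \<otimes> b) (a' \<otimes> b') = (\<Sum>e\<in>Eb i. \<omega> b (fb i e) * \<beta> (a \<otimes> e) (a' \<otimes> b'))"
      by (rule Eb_expand_form[OF linear_on_comp[OF bilinear_onD2[OF \<beta> pt_car[OF ab'(3,4)]] pt_lin2[OF ab(1)]] ab(2)])
    also have "\<dots> = (\<Sum>e\<in>Eb i. \<omega> b (fb i e) * (\<Sum>e'\<in>Eb j. \<omega> b' (fb j e') * \<beta> (a \<otimes> e) (a' \<otimes> e')))"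
      by (intro sum.cong refl arg_cong2[of _ _ _ _ "(*)"]
          Eb_expand_form[OF linear_on_comp[OF bilinear_onD1[OF \<beta> pt_car[OF ab(1) Eb_car]] pt_lin2[OF ab(3)]] ab(4)])
    also have "\<dots> = (\<Sum>e\<in>Eb i. \<Sum>e'\<in>Eb j. tst (\<lambda>a a'. \<beta> (a \<otimes> e) (a' \<otimes> e')) (fb i e) (fb j e') (a \<otimes> b) (a' \<otimes> b'))"
      by (simp add: tst_pt[OF bb fb_car fb_car ab'] sum_distrib_left mult_ac)
    finally show "\<beta> (a \<otimes> b) (a' \<otimes> b') = (\<Sum>e\<in>Eb i. \<Sum>e'\<in>Eb j. tst (\<lambda>a a'. \<beta> (a \<otimes> e) (a' \<otimes> e')) (fb i e) (fb j e') (a \<otimes> b) (a' \<otimes> b'))" .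
  qed
  also have "\<dots> = (\<Sum>e\<in>Eb i. t (\<lambda>p q. \<Sum>e'\<in>Eb j. tst (\<lambda>a a'. \<beta> (a \<otimes> e) (a' \<otimes> e')) (fb i e) (fb j e') p q))"
    by (rule tens_sum[OF tc vsP bilin_sum[OF tb]])
  also have "\<dots> = (\<Sum>e\<in>Eb i. \<Sum>e'\<in>Eb j. t (tst (\<lambda>a a'. \<beta> (a \<otimes> e) (a' \<otimes> e')) (fb i e) (fb j e')))"
    by (rule sum.cong[OF refl], rule tens_sum[OF tc vsP tb])
  finally show ?thesis .
qed

text \<open>A block is determined by its values at test forms, by \<open>blk_dual_expand\<close>;
  nondegeneracy of \<omega> is hidden in the dual bases.\<close>

lemma sep2:
  assumes s: "s \<in> car (ctensor P G)" and t: "t \<in> car (ctensor P G)"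
    and eq: "\<And>\<gamma> k l c c'. bilinear_on A A scalars \<gamma> \<Longrightarrow> c \<in> H k \<Longrightarrow> c' \<in> H l \<Longrightarrow> pr2 s \<gamma> c c' = pr2 t \<gamma> c c'"
  shows "s = t"
proof (rule ext)
  fix q :: "int \<times> int"
  obtain i j where q: "q = (i, j)" by (cases q)
  note sb = car2D[OF s, of i j] and tb = car2D[OF t, of i j]
  have "s (i, j) = t (i, j)"
  proof (rule tensor_eqI[OF blk_car[OF sb] blk_car[OF tb] vsP])
    fix \<beta> assume \<beta>: "bilinear_on P P scalars \<beta>"
    show "s (i, j) \<beta> = t (i, j) \<beta>"
      unfolding blk_dual_expand[OF sb \<beta>] blk_dual_expand[OF tb \<beta>]
    proof (intro sum.cong refl)
      fix e e' assume e: "e \<in> Eb i" "e' \<in> Eb j"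
      have bb: "bilinear_on A A scalars (\<lambda>a a'. \<beta> (a \<otimes> e) (a' \<otimes> e'))"
        by (rule bilin_comp[OF \<beta> pt_lin1[OF Eb_car[OF e(1)]] pt_lin1[OF Eb_car[OF e(2)]]])
      show "s (i, j) (tst (\<lambda>a a'. \<beta> (a \<otimes> e) (a' \<otimes> e')) (fb i e) (fb j e')) =
          t (i, j) (tst (\<lambda>a a'. \<beta> (a \<otimes> e) (a' \<otimes> e')) (fb i e) (fb j e'))"
        using eq[OF bb fb_H[OF e(1)] fb_H[OF e(2)]]
        unfolding pr2_hom[OF s bb fb_H[OF e(1)] refl fb_H[OF e(2)] refl]
          pr2_hom[OF t bb fb_H[OF e(1)] refl fb_H[OF e(2)] refl] .
    qed
  qed
  then show "s q = t q" by (simp add: q)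
qed

lemma pr2_add:
  assumes "s \<in> car (ctensor P G)" "t \<in> car (ctensor P G)" "bilinear_on A A scalars \<gamma>" "c \<in> H k" "c' \<in> H l"
  shows "pr2 (s + t) \<gamma> c c' = pr2 s \<gamma> c c' + pr2 t \<gamma> c c'"
    and "pr2 (s - t) \<gamma> c c' = pr2 s \<gamma> c c' - pr2 t \<gamma> c c'"
    and "pr2 (- t) \<gamma> c c' = - pr2 t \<gamma> c c'"
proof -
  have kl: "k = - m - (- m - k)" "l = - m - (- m - l)" by simp_all
  note h = pr2_hom[OF _ assms(3,4) kl(1) assms(5) kl(2)]
  have "s + t \<in> car (ctensor P G)" "s - t \<in> car (ctensor P G)" "- t \<in> car (ctensor P G)"
    using assms(1,2) unfolding car2_iff by (simp_all add: subtensor_closed)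
  note h' = this[THEN h] assms(1,2)[THEN h]
  show "pr2 (s + t) \<gamma> c c' = pr2 s \<gamma> c c' + pr2 t \<gamma> c c'"
    "pr2 (s - t) \<gamma> c c' = pr2 s \<gamma> c c' - pr2 t \<gamma> c c'" "pr2 (- t) \<gamma> c c' = - pr2 t \<gamma> c c'"
    unfolding h' by simp_all
qed

text \<open>The threefold completion proper: the type \<open>ctens3\<close> alone does not force the
  entries of a family into the homogeneous blocks, which \<open>sep3\<close> requires.\<close>

definition car3 :: "('k, ('k, 'a, 'b) tens2) ctens3 set" where
  "car3 = {T. \<forall>i j k. T (i, j, k) \<in> blk3 i j k}"

lemma car3_closed: "S \<in> car3 \<Longrightarrow> T \<in> car3 \<Longrightarrow> S + T \<in> car3" "S \<in> car3 \<Longrightarrow> T \<in> car3 \<Longrightarrow> S - T \<in> car3" "0 \<in> car3"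
  by (simp_all add: car3_def subtensor3_closed)

lemma car3D: "T \<in> car3 \<Longrightarrow> T (i, j, k) \<in> blk3 i j k"
  by (simp add: car3_def)

definition pr3 :: "('k, ('k, 'a, 'b) tens2) ctens3 \<Rightarrow> ('a \<Rightarrow> 'a \<Rightarrow> 'a \<Rightarrow> 'k) \<Rightarrow> 'b \<Rightarrow> 'b \<Rightarrow> 'b \<Rightarrow> 'k" where
  "pr3 T \<gamma> c1 c2 c3 = Sum_any (\<lambda>n. T n (tst3 \<gamma> c1 c2 c3))"

lemma pr3_hom:
  assumes T: "T \<in> car3" and g: "trilinear_form_on A \<gamma>"
    and c: "c1 \<in> H x" "x = - m - i" "c2 \<in> H y" "y = - m - j" "c3 \<in> H z" "z = - m - k"
  shows "pr3 T \<gamma> c1 c2 c3 = T (i, j, k) (tst3 \<gamma> c1 c2 c3)"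
  unfolding pr3_def
proof (rule Sum_any_single)
  note cc = H_car[OF c(1)] H_car[OF c(3)] H_car[OF c(5)]
  fix q assume q: "q \<noteq> (i, j, k)"
  obtain i' j' k' where q': "q = (i', j', k')" by (cases q)
  have "T (i', j', k') (tst3 \<gamma> c1 c2 c3) = (\<Sum>x\<in>({} :: unit set). T (i', j', k') (\<lambda>_ _ _. 0))"
  proof (rule blk3_lin[OF car3D[OF T] _ _ tst3_tri[OF g cc]])
    fix a b a' b' a'' b''
    assume ab: "a \<in> car A" "b \<in> H i'" "a' \<in> car A" "b' \<in> H j'" "a'' \<in> car A" "b'' \<in> H k'"
    have "\<omega> b c1 = 0 \<or> \<omega> b' c2 = 0 \<or> \<omega> b'' c3 = 0"
      using q q' c om_deg[OF _ ab(2) c(1)] om_deg[OF _ ab(4) c(3)] om_deg[OF _ ab(6) c(5)] by auto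
    then show "tst3 \<gamma> c1 c2 c3 (a \<otimes> b) (a' \<otimes> b') (a'' \<otimes> b'') = (\<Sum>x\<in>({} :: unit set). 0)"
      using tst3_pt[OF g cc ab(1) H_car[OF ab(2)] ab(3) H_car[OF ab(4)] ab(5) H_car[OF ab(6)]] by auto
  qed simp_all
  then show "T q (tst3 \<gamma> c1 c2 c3) = 0" using q' by simp
qed

text \<open>Same principle as \<open>sep2\<close>, with a sum over triples of dual vectors.
  Functions that are not trilinear are treated apart: there both families vanish by the cut-off in
  \<open>pure3\<close>.\<close>

lemma sep3:
  assumes S: "S \<in> car3" and T: "T \<in> car3"
    and eq: "\<And>\<gamma> x y z c1 c2 c3. trilinear_form_on A \<gamma> \<Longrightarrow> c1 \<in> H x \<Longrightarrow> c2 \<in> H y \<Longrightarrow> c3 \<in> H z \<Longrightarrow>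
      pr3 S \<gamma> c1 c2 c3 = pr3 T \<gamma> c1 c2 c3"
  shows "S = T"
proof (rule ext)
  fix q :: "int \<times> int \<times> int"
  obtain i j k where q: "q = (i, j, k)" by (cases q)
  have "S (i, j, k) \<tau> = T (i, j, k) \<tau>" for \<tau>
  proof (cases "trilinear_form_on P \<tau>")
    case False
    have "U \<tau> = 0" if "U \<in> blk3 i j k" for U
      using that G_sub G_sub G_sub
      by (induction rule: subtensor3_induct) (use False in \<open>auto simp: pure3_def G_scl'\<close>)
    from this[OF car3D[OF S]] this[OF car3D[OF T]] show ?thesis by simp
  next
    case True
    let ?I = "Eb i \<times> Eb j \<times> Eb k"
    let ?g = "\<lambda>(e, e', e''). \<lambda>a a' a''. \<tau> (a \<otimes> e) (a' \<otimes> e') (a'' \<otimes> e'')"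
    let ?F = "\<lambda>x. case x of (e, e', e'') \<Rightarrow> tst3 (?g x) (fb i e) (fb j e') (fb k e'')"
    have g: "trilinear_form_on A (?g (e, e', e''))" if "e \<in> Eb i" "e' \<in> Eb j" "e'' \<in> Eb k" for e e' e''
    proof -
      note ec = Eb_car[OF that(1)] Eb_car[OF that(2)] Eb_car[OF that(3)]
      note pc = pt_car[OF _ ec(1)] pt_car[OF _ ec(2)] pt_car[OF _ ec(3)]
      show ?thesis
        unfolding prod.case
        by (rule trilinear_formI[OF linear_on_comp[OF trilinear_formD(1)[OF True pc(2,3)] pt_lin1[OF ec(1)]]
          linear_on_comp[OF trilinear_formD(2)[OF True pc(1,3)] pt_lin1[OF ec(2)]]
          linear_on_comp[OF trilinear_formD(3)[OF True pc(1,2)] pt_lin1[OF ec(3)]]])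
    qed
    have fin: "finite ?I" by (simp add: finite_Eb)
    have tri: "trilinear_form_on P (?F x)" if "x \<in> ?I" for x
      using that tst3_tri[OF g fb_car fb_car fb_car] by auto
    have ex: "\<tau> (a \<otimes> b) (a' \<otimes> b') (a'' \<otimes> b'') = (\<Sum>x\<in>?I. ?F x (a \<otimes> b) (a' \<otimes> b') (a'' \<otimes> b''))"
      if ab: "a \<in> car A" "b \<in> H i" "a' \<in> car A" "b' \<in> H j" "a'' \<in> car A" "b'' \<in> H k" for a b a' b' a'' b''
    proof -
      note bc = H_car[OF ab(2)] H_car[OF ab(4)] H_car[OF ab(6)]
      have "\<tau> (a \<otimes> b) (a' \<otimes> b') (a'' \<otimes> b'') = (\<Sum>e\<in>Eb i. \<omega> b (fb i e) * \<tau> (a \<otimes> e) (a' \<otimes> b') (a'' \<otimes> b''))"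
        by (rule Eb_expand_form[OF linear_on_comp[OF trilinear_formD(1)[OF True pt_car[OF ab(3) bc(2)] pt_car[OF ab(5) bc(3)]] pt_lin2[OF ab(1)]] ab(2)])
      also have "\<dots> = (\<Sum>e\<in>Eb i. \<omega> b (fb i e) * (\<Sum>e'\<in>Eb j. \<omega> b' (fb j e') * \<tau> (a \<otimes> e) (a' \<otimes> e') (a'' \<otimes> b'')))"
        by (intro sum.cong refl arg_cong2[of _ _ _ _ "(*)"]
          Eb_expand_form[OF linear_on_comp[OF trilinear_formD(2)[OF True pt_car[OF ab(1) Eb_car] pt_car[OF ab(5) bc(3)]] pt_lin2[OF ab(3)]] ab(4)])
      also have "\<dots> = (\<Sum>e\<in>Eb i. \<omega> b (fb i e) * (\<Sum>e'\<in>Eb j. \<omega> b' (fb j e') *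
          (\<Sum>e''\<in>Eb k. \<omega> b'' (fb k e'') * \<tau> (a \<otimes> e) (a' \<otimes> e') (a'' \<otimes> e''))))"
        by (intro sum.cong refl arg_cong2[of _ _ _ _ "(*)"]
          Eb_expand_form[OF linear_on_comp[OF trilinear_formD(3)[OF True pt_car[OF ab(1) Eb_car] pt_car[OF ab(3) Eb_car]] pt_lin2[OF ab(5)]] ab(6)])
      also have "\<dots> = (\<Sum>e\<in>Eb i. \<Sum>e'\<in>Eb j. \<Sum>e''\<in>Eb k. ?F (e, e', e'') (a \<otimes> b) (a' \<otimes> b') (a'' \<otimes> b''))"
        unfolding prod.case
        by (simp add: tst3_pt[OF g[unfolded prod.case] fb_car fb_car fb_car ab(1) bc(1) ab(3) bc(2) ab(5) bc(3)]
            sum_distrib_left mult_ac)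
      finally show ?thesis
        by (simp add: sum.cartesian_product case_prod_unfold)
    qed
    have LS: "S (i, j, k) \<tau> = (\<Sum>x\<in>?I. S (i, j, k) (?F x))"
      by (rule blk3_lin[OF car3D[OF S] fin tri True ex])
    have LT: "T (i, j, k) \<tau> = (\<Sum>x\<in>?I. T (i, j, k) (?F x))"
      by (rule blk3_lin[OF car3D[OF T] fin tri True ex])
    have "S (i, j, k) (?F x) = T (i, j, k) (?F x)" if x: "x \<in> ?I" for x
    proof -
      obtain e e' e'' where x': "x = (e, e', e'')" by (cases x)
      with x have e: "e \<in> Eb i" "e' \<in> Eb j" "e'' \<in> Eb k" by auto
      note h = pr3_hom[OF _ g[OF e] fb_H[OF e(1)] refl fb_H[OF e(2)] refl fb_H[OF e(3)] refl]
      show ?thesis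
        using eq[OF g[OF e] fb_H[OF e(1)] fb_H[OF e(2)] fb_H[OF e(3)]]
        unfolding h[OF S] h[OF T] x' by simp
    qed
    then show ?thesis
      unfolding LS LT by (intro sum.cong refl)
  qed
  then show "S q = T q" unfolding q by (rule ext)
qed

lemma pr3_add:
  assumes "S \<in> car3" "T \<in> car3" "trilinear_form_on A \<gamma>" "c1 \<in> H x" "c2 \<in> H y" "c3 \<in> H z"
  shows "pr3 (S + T) \<gamma> c1 c2 c3 = pr3 S \<gamma> c1 c2 c3 + pr3 T \<gamma> c1 c2 c3"
    and "pr3 (S - T) \<gamma> c1 c2 c3 = pr3 S \<gamma> c1 c2 c3 - pr3 T \<gamma> c1 c2 c3"
proof -
  have kl: "x = - m - (- m - x)" "y = - m - (- m - y)" "z = - m - (- m - z)" by simp_all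
  note h = pr3_hom[OF _ assms(3,4) kl(1) assms(5) kl(2) assms(6) kl(3)]
  note h' = car3_closed(1,2)[OF assms(1,2), THEN h] assms(1,2)[THEN h]
  show "pr3 (S + T) \<gamma> c1 c2 c3 = pr3 S \<gamma> c1 c2 c3 + pr3 T \<gamma> c1 c2 c3"
    "pr3 (S - T) \<gamma> c1 c2 c3 = pr3 S \<gamma> c1 c2 c3 - pr3 T \<gamma> c1 c2 c3"
    unfolding h' by simp_all
qed

end

lemma linear_on_tensorI:
  assumes "\<And>x. x \<in> car W \<Longrightarrow> D x \<in> car (tensor U V)" "\<And>\<beta>. linear_on W scalars (\<lambda>x. D x \<beta>)"
  shows "linear_on W (tensor U V) D"
  unfolding linear_on_def scl_tensor
  using assms(1) linear_form_add[OF assms(2)] linear_form_scl[OF assms(2)]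
  by (intro conjI ballI allI ext) (auto simp: fun_scl_apply)

lemma linear_on_plus:
  assumes "is_vspace V" "linear_on U V f" "linear_on U V g"
  shows "linear_on U V (\<lambda>x. f x + g x)"
proof -
  interpret vector_space "scl V" using assms(1) by (simp add: is_vspace_def)
  show ?thesis
    using assms(2,3) is_vspaceD(2)[OF assms(1)] by (simp add: linear_on_def scale_right_distrib algebra_simps)
qed

lemma linear_on_zero: "is_vspace V \<Longrightarrow> linear_on U V (\<lambda>_. 0)"
proof -
  assume V: "is_vspace V"
  interpret vector_space "scl V" using V by (simp add: is_vspace_def)
  show ?thesis using is_vspaceD(1)[OF V] by (simp add: linear_on_def)
qed

lemma linear_on_uminus:
  assumes "is_vspace V" "linear_on U V f"
  shows "linear_on U V (\<lambda>x. - f x)"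
proof -
  interpret vector_space "scl V" using assms(1) by (simp add: is_vspace_def)
  show ?thesis
    using assms(2) is_vspaceD(5)[OF assms(1)] by (simp add: linear_on_def)
qed

context induced_setting
begin

section \<open>The induced products\<close>

lemma P_form_eq:
  assumes "p \<in> car P" "linear_on P W f" "linear_on P W g"
    "\<And>a b. a \<in> car A \<Longrightarrow> b \<in> car B \<Longrightarrow> f (a \<otimes> b) = g (a \<otimes> b)"
  shows "f p = g p"
  by (rule linear_form_eq_on[OF assms(1)[unfolded car_tensor] order_refl order_refl is_vspaceD(3)[OF vsA] assms(2,3,4)])

definition psi :: "('a \<Rightarrow> 'a \<Rightarrow> 'a) \<Rightarrow> 'k \<Rightarrow> 'a \<Rightarrow> 'b \<Rightarrow> 'a \<Rightarrow> 'b \<Rightarrow> ('k, 'a, 'b) tens2" where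
  "psi \<mu> \<epsilon> a b a' b' = \<mu> a a' \<otimes> (b \<diamondop> b') + fun_scl \<epsilon> (\<mu> a' a \<otimes> (b' \<diamondop> b))"

text \<open>\<open>iop \<mu> \<epsilon>\<close> is the product of \<open>A \<otimes> B\<close> induced by \<open>\<mu>\<close>: the commutative product for \<open>\<epsilon> = 1\<close> and
  the bracket for \<open>\<epsilon> = -1\<close>.\<close>

definition iop :: "('a \<Rightarrow> 'a \<Rightarrow> 'a) \<Rightarrow> 'k \<Rightarrow> ('k, 'a, 'b) tens2 \<Rightarrow> ('k, 'a, 'b) tens2 \<Rightarrow> ('k, 'a, 'b) tens2" where
  "iop \<mu> \<epsilon> p q = lift2 (\<lambda>a b. lift2 (psi \<mu> \<epsilon> a b) q) p"

lemma ind_mul_iop: "ind_mul A B \<mu> (\<diamondop>) = iop \<mu> 1"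
  by (intro ext) (simp add: ind_mul_def iop_def psi_def[abs_def] lift2_def fun_scl_apply)

lemma ind_brk_iop: "ind_brk A B \<mu> (\<diamondop>) = iop \<mu> (- 1)"
  by (intro ext) (simp add: ind_brk_def iop_def psi_def[abs_def] lift2_def fun_scl_apply)

lemma psi_apply: "psi \<mu> \<epsilon> a b a' b' \<beta> = (\<mu> a a' \<otimes> (b \<diamondop> b')) \<beta> + \<epsilon> * (\<mu> a' a \<otimes> (b' \<diamondop> b)) \<beta>"
  by (simp add: psi_def fun_scl_apply)

lemma iop_apply: "iop \<mu> \<epsilon> p q \<beta> = p (\<lambda>a b. q (\<lambda>a' b'. psi \<mu> \<epsilon> a b a' b' \<beta>))"
  by (simp add: iop_def lift2_def)

context
  fixes \<mu> :: "'a \<Rightarrow> 'a \<Rightarrow> 'a" and \<epsilon> :: 'k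
  assumes mu: "bilinear_on A A A \<mu>"
begin

lemma mu_car: "a \<in> car A \<Longrightarrow> a' \<in> car A \<Longrightarrow> \<mu> a a' \<in> car A"
  using bilinear_onD1[OF mu] linear_on_mem by metis

lemma psi_bil1:
  assumes "a' \<in> car A" "b' \<in> car B"
  shows "bilinear_on A B scalars (\<lambda>a b. psi \<mu> \<epsilon> a b a' b' \<beta>)"
  unfolding psi_apply
  by (rule bilin_intros(2)[OF bilin_comp[OF pt_eval bilinear_onD2[OF mu assms(1)] dia_lin1[OF assms(2)]]
    bilin_intros(5)[OF bilin_comp[OF pt_eval bilinear_onD1[OF mu assms(1)] dia_lin2[OF assms(2)]]]])

lemma psi_bil2:
  assumes "a \<in> car A" "b \<in> car B"
  shows "bilinear_on A B scalars (\<lambda>a' b'. psi \<mu> \<epsilon> a b a' b' \<beta>)"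
  unfolding psi_apply
  by (rule bilin_intros(2)[OF bilin_comp[OF pt_eval bilinear_onD1[OF mu assms(1)] dia_lin2[OF assms(2)]]
    bilin_intros(5)[OF bilin_comp[OF pt_eval bilinear_onD2[OF mu assms(1)] dia_lin1[OF assms(2)]]]])

lemma psi_G: "a \<in> car A \<Longrightarrow> b \<in> H i \<Longrightarrow> a' \<in> car A \<Longrightarrow> b' \<in> H j \<Longrightarrow> psi \<mu> \<epsilon> a b a' b' \<in> G (i + j)"
  unfolding psi_def
  using pt_G[OF mu_car dia_degree, of a a' b i b' j]
    G_scl'[OF pt_G[OF mu_car dia_degree], of a' a b' j b i \<epsilon>]
  by (intro G_closed(2)) (simp_all add: add.commute)

lemma psi_car: "a \<in> car A \<Longrightarrow> b \<in> car B \<Longrightarrow> a' \<in> car A \<Longrightarrow> b' \<in> car B \<Longrightarrow> psi \<mu> \<epsilon> a b a' b' \<in> car P"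
  unfolding psi_def
  by (intro is_vspaceD(2)[OF vsP] is_vspaceD(3)[OF vsP, unfolded scl_tensor] pt_car mu_car dia_car)

lemma psi_outer:
  assumes "q \<in> car P"
  shows "bilinear_on A B scalars (\<lambda>a b. q (\<lambda>a' b'. psi \<mu> \<epsilon> a b a' b' \<beta>))"
  by (rule tens_bilin[OF assms vsA vsB vsA psi_bil2 psi_bil1])

lemma iop_pt: 
  assumes "a \<in> car A" "b \<in> car B" "a' \<in> car A" "b' \<in> car B"
  shows "iop \<mu> \<epsilon> (a \<otimes> b) (a' \<otimes> b') = psi \<mu> \<epsilon> a b a' b'"
proof (rule ext)
  fix \<beta>
  show "iop \<mu> \<epsilon> (a \<otimes> b) (a' \<otimes> b') \<beta> = psi \<mu> \<epsilon> a b a' b' \<beta>"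
    unfolding iop_apply pure2_apply[OF psi_outer[OF pt_car[OF assms(3,4)]]]
    by (rule pure2_apply[OF psi_bil2[OF assms(1,2)]])
qed

lemma lift2_psi_mem:
  assumes "X \<subseteq> car B" "Y \<subseteq> car B" "p \<in> subtensor A B (car A) X" "q \<in> subtensor A B (car A) Y"
    and "0 \<in> S" "\<And>x y. x \<in> S \<Longrightarrow> y \<in> S \<Longrightarrow> x + y \<in> S"
    and "\<And>a b a' b'. a \<in> car A \<Longrightarrow> b \<in> X \<Longrightarrow> a' \<in> car A \<Longrightarrow> b' \<in> Y \<Longrightarrow> psi \<mu> \<epsilon> a b a' b' \<in> S"
  shows "iop \<mu> \<epsilon> p q \<in> S"
  unfolding iop_def
proof (rule lift2_mem[OF assms(3) order_refl assms(1) is_vspaceD(3)[OF vsA] _ assms(5,6)])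
  show "bilinear_on A B scalars (\<lambda>u v. lift2 (psi \<mu> \<epsilon> u v) q \<beta>)" for \<beta>
    unfolding lift2_def by (rule psi_outer[OF subtensor_car[OF order_refl assms(2,4)]])
  fix a b assume ab: "a \<in> car A" "b \<in> X"
  then have b: "b \<in> car B" using assms(1) by blast
  show "lift2 (psi \<mu> \<epsilon> a b) q \<in> S"
    by (rule lift2_mem[OF assms(4) order_refl assms(2) is_vspaceD(3)[OF vsA] psi_bil2[OF ab(1) b] assms(5,6)])
      (use assms(7) ab in blast)+
qed

lemma iop_G: "p \<in> G i \<Longrightarrow> q \<in> G j \<Longrightarrow> iop \<mu> \<epsilon> p q \<in> G (i + j)"
  by (rule lift2_psi_mem[OF H_sub H_sub _ _ G_closed(1,2) psi_G]) (simp_all add: G_eq)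

lemma iop_car: "p \<in> car P \<Longrightarrow> q \<in> car P \<Longrightarrow> iop \<mu> \<epsilon> p q \<in> car P"
  by (rule lift2_psi_mem[OF order_refl order_refl _ _ is_vspaceD(1,2)[OF vsP] psi_car]) (simp_all add: car_tensor)

lemma iop_bil: "bilinear_on P P P (iop \<mu> \<epsilon>)"
  unfolding bilinear_on_def
proof (intro conjI ballI)
  fix q assume q: "q \<in> car P"
  show "linear_on P P (\<lambda>p. iop \<mu> \<epsilon> p q)"
    by (rule linear_on_tensorI[OF iop_car[OF _ q]], assumption)
      (unfold iop_apply, rule lin_eval_tensor)
  show "linear_on P P (iop \<mu> \<epsilon> q)"
    by (rule linear_on_tensorI[OF iop_car[OF q]], assumption)
      (unfold iop_apply, rule tens_param[OF q vsA vsP psi_outer lin_eval_tensor])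
qed

end

lemma pt_eval_add: "x \<in> car A \<Longrightarrow> y \<in> car A \<Longrightarrow> b \<in> car B \<Longrightarrow> ((x + y) \<otimes> b) \<beta> = (x \<otimes> b) \<beta> + (y \<otimes> b) \<beta>"
  by (simp add: linear_on_add[OF pt_lin1])

lemma pt_eval_diff: "x \<in> car A \<Longrightarrow> y \<in> car A \<Longrightarrow> b \<in> car B \<Longrightarrow> ((x - y) \<otimes> b) \<beta> = (x \<otimes> b) \<beta> - (y \<otimes> b) \<beta>"
  by (simp add: linear_on_diff[OF pt_lin1 vsA])

text \<open>\<open>x \<diamondop> y\<close> and \<open>y \<diamondop> x\<close> have the same left
  action by the perm identity, so left multiplications commute.\<close>

lemma perm_left_commute:
  assumes "x \<in> car B" "y \<in> car B" "z \<in> car B"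
  shows "x \<diamondop> (y \<diamondop> z) = y \<diamondop> (x \<diamondop> z)"
  using perm_assoc[OF assms] perm_assoc[OF assms(2,1,3)] perm_commute[OF assms] by simp

end

section \<open>The Poisson algebra axioms\<close>

locale induced_algebra = induced_setting B H dia om m A + pre_Poisson_algebra A ast circ
  for B :: "('k::field, 'b::ab_group_add) vspace"
    and H :: "int \<Rightarrow> 'b set"
    and dia :: "'b \<Rightarrow> 'b \<Rightarrow> 'b" (infixl "\<diamondop>" 70)
    and om :: "'b \<Rightarrow> 'b \<Rightarrow> 'k" ("\<omega>")
    and m :: int
    and A :: "('k, 'a::ab_group_add) vspace"
    and ast :: "'a \<Rightarrow> 'a \<Rightarrow> 'a" (infixl "\<^bold>*" 70)
    and circ :: "'a \<Rightarrow> 'a \<Rightarrow> 'a" (infixl "\<^bold>\<circ>" 70)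
begin

abbreviation mul where "mul \<equiv> iop (\<^bold>*) 1"
abbreviation brk where "brk \<equiv> iop (\<^bold>\<circ>) (- 1)"

lemmas ast_car = mu_car[OF ast_bilinear]
lemmas circ_car = mu_car[OF circ_bilinear]
lemmas mul_lin1 = bilinear_onD2[OF iop_bil[OF ast_bilinear]]
lemmas mul_lin2 = bilinear_onD1[OF iop_bil[OF ast_bilinear]]
lemmas brk_lin1 = bilinear_onD2[OF iop_bil[OF circ_bilinear]]
lemmas brk_lin2 = bilinear_onD1[OF iop_bil[OF circ_bilinear]]
lemmas mul_car = iop_car[OF ast_bilinear]
lemmas brk_car = iop_car[OF circ_bilinear]

text \<open>Nested products of pure tensors become sums of \<open>psi\<close> terms; after
  \<open>psi_apply\<close> every Poisson identity is a relation among evaluations of pure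
  tensors.\<close>

lemma iop_iop:
  assumes mu: "bilinear_on A A A \<mu>" and nu: "bilinear_on A A A \<nu>"
    and ab: "a \<in> car A" "b \<in> car B" "a' \<in> car A" "b' \<in> car B" "a'' \<in> car A" "b'' \<in> car B"
  shows "iop \<mu> \<epsilon> (a \<otimes> b) (iop \<nu> \<eta> (a' \<otimes> b') (a'' \<otimes> b'')) \<beta> =
      psi \<mu> \<epsilon> a b (\<nu> a' a'') (b' \<diamondop> b'') \<beta> + \<eta> * psi \<mu> \<epsilon> a b (\<nu> a'' a') (b'' \<diamondop> b') \<beta>"
    "iop \<mu> \<epsilon> (iop \<nu> \<eta> (a' \<otimes> b') (a'' \<otimes> b'')) (a \<otimes> b) \<beta> =
      psi \<mu> \<epsilon> (\<nu> a' a'') (b' \<diamondop> b'') a b \<beta> + \<eta> * psi \<mu> \<epsilon> (\<nu> a'' a') (b'' \<diamondop> b') a b \<beta>"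
proof -
  note c = mu_car[OF nu ab(3,5)] mu_car[OF nu ab(5,3)] dia_car[OF ab(4,6)] dia_car[OF ab(6,4)]
  note cp = pt_car[OF c(1,3)] pt_car[OF c(2,4)]
  note cs = is_vspaceD(3)[OF vsP cp(2), of \<eta>, unfolded scl_tensor]
  show "iop \<mu> \<epsilon> (a \<otimes> b) (iop \<nu> \<eta> (a' \<otimes> b') (a'' \<otimes> b'')) \<beta> =
      psi \<mu> \<epsilon> a b (\<nu> a' a'') (b' \<diamondop> b'') \<beta> + \<eta> * psi \<mu> \<epsilon> a b (\<nu> a'' a') (b'' \<diamondop> b') \<beta>"
    unfolding iop_pt[OF nu ab(3-6)] unfolding psi_def[of \<nu>]
      linear_on_add[OF bilinear_onD1[OF iop_bil[OF mu] pt_car[OF ab(1,2)]] cp(1) cs]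
      linear_on_scl[OF bilinear_onD1[OF iop_bil[OF mu] pt_car[OF ab(1,2)]] cp(2), unfolded scl_tensor]
      iop_pt[OF mu ab(1,2) c(1,3)] iop_pt[OF mu ab(1,2) c(2,4)]
    by (simp add: fun_scl_apply)
  show "iop \<mu> \<epsilon> (iop \<nu> \<eta> (a' \<otimes> b') (a'' \<otimes> b'')) (a \<otimes> b) \<beta> =
      psi \<mu> \<epsilon> (\<nu> a' a'') (b' \<diamondop> b'') a b \<beta> + \<eta> * psi \<mu> \<epsilon> (\<nu> a'' a') (b'' \<diamondop> b') a b \<beta>"
    unfolding iop_pt[OF nu ab(3-6)] unfolding psi_def[of \<nu>]
      linear_on_add[OF bilinear_onD2[OF iop_bil[OF mu] pt_car[OF ab(1,2)]] cp(1) cs]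
      linear_on_scl[OF bilinear_onD2[OF iop_bil[OF mu] pt_car[OF ab(1,2)]] cp(2), unfolded scl_tensor]
      iop_pt[OF mu c(1,3) ab(1,2)] iop_pt[OF mu c(2,4) ab(1,2)]
    by (simp add: fun_scl_apply)
qed

lemmas iop_iop_ac = iop_iop[OF ast_bilinear ast_bilinear] iop_iop[OF ast_bilinear circ_bilinear]
  iop_iop[OF circ_bilinear ast_bilinear] iop_iop[OF circ_bilinear circ_bilinear]

text \<open>Here and in the next three lemmas an axiom of \<open>A\<close> is tensored with a fixed
  element of \<open>B\<close> and evaluated, because it is met in this form once the products on
  \<open>A \<otimes> B\<close> are expanded.\<close>

lemma zinbiel_eval:
  assumes "a1 \<in> car A" "a2 \<in> car A" "a3 \<in> car A" "b \<in> car B"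
  shows "(a1 \<^bold>* (a2 \<^bold>* a3) \<otimes> b) \<beta> = (a1 \<^bold>* a2 \<^bold>* a3 \<otimes> b) \<beta> + (a2 \<^bold>* a1 \<^bold>* a3 \<otimes> b) \<beta>"
  unfolding zinbiel[OF assms(1-3)] by (rule pt_eval_add) (simp_all add: ast_car assms)

lemma pre_Lie_eval:
  assumes "a1 \<in> car A" "a2 \<in> car A" "a3 \<in> car A" "b \<in> car B"
  shows "(a1 \<^bold>\<circ> a2 \<^bold>\<circ> a3 \<otimes> b) \<beta> = (a1 \<^bold>\<circ> (a2 \<^bold>\<circ> a3) \<otimes> b) \<beta> + (a2 \<^bold>\<circ> a1 \<^bold>\<circ> a3 \<otimes> b) \<beta> - (a2 \<^bold>\<circ> (a1 \<^bold>\<circ> a3) \<otimes> b) \<beta>"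
proof -
  note c = circ_car assms
  have "((a1 \<^bold>\<circ> a2 \<^bold>\<circ> a3 - a1 \<^bold>\<circ> (a2 \<^bold>\<circ> a3)) \<otimes> b) \<beta> = ((a2 \<^bold>\<circ> a1 \<^bold>\<circ> a3 - a2 \<^bold>\<circ> (a1 \<^bold>\<circ> a3)) \<otimes> b) \<beta>"
    unfolding pre_Lie[OF assms(1-3)] ..
  then show ?thesis by (simp add: pt_eval_diff c algebra_simps)
qed

lemma compat1_eval:
  assumes "a1 \<in> car A" "a2 \<in> car A" "a3 \<in> car A" "b \<in> car B"
  shows "(a1 \<^bold>\<circ> (a2 \<^bold>* a3) \<otimes> b) \<beta> = (a1 \<^bold>\<circ> a2 \<^bold>* a3 \<otimes> b) \<beta> - (a2 \<^bold>\<circ> a1 \<^bold>* a3 \<otimes> b) \<beta> + (a2 \<^bold>* (a1 \<^bold>\<circ> a3) \<otimes> b) \<beta>"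
proof -
  note c = circ_car ast_car assms
  have "(a1 \<^bold>\<circ> a2 - a2 \<^bold>\<circ> a1) \<^bold>* a3 = a1 \<^bold>\<circ> a2 \<^bold>* a3 - a2 \<^bold>\<circ> a1 \<^bold>* a3"
    by (rule linear_on_diff[OF bilinear_onD2[OF ast_bilinear] vsA]) (simp_all add: c)
  then have "((a1 \<^bold>\<circ> a2 \<^bold>* a3 - a2 \<^bold>\<circ> a1 \<^bold>* a3) \<otimes> b) \<beta> = ((a1 \<^bold>\<circ> (a2 \<^bold>* a3) - a2 \<^bold>* (a1 \<^bold>\<circ> a3)) \<otimes> b) \<beta>"
    using compat1[OF assms(1-3)] by simp
  then show ?thesis by (simp add: pt_eval_diff c algebra_simps)
qed

lemma compat2_eval:
  assumes "a1 \<in> car A" "a2 \<in> car A" "a3 \<in> car A" "b \<in> car B"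
  shows "(a1 \<^bold>* a2 \<^bold>\<circ> a3 \<otimes> b) \<beta> = (a1 \<^bold>* (a2 \<^bold>\<circ> a3) \<otimes> b) \<beta> + (a2 \<^bold>* (a1 \<^bold>\<circ> a3) \<otimes> b) \<beta> - (a2 \<^bold>* a1 \<^bold>\<circ> a3 \<otimes> b) \<beta>"
proof -
  note c = circ_car ast_car assms
  have "(a1 \<^bold>* a2 + a2 \<^bold>* a1) \<^bold>\<circ> a3 = a1 \<^bold>* a2 \<^bold>\<circ> a3 + a2 \<^bold>* a1 \<^bold>\<circ> a3"
    by (rule linear_on_add[OF bilinear_onD2[OF circ_bilinear]]) (simp_all add: c)
  then have "((a1 \<^bold>* a2 \<^bold>\<circ> a3 + a2 \<^bold>* a1 \<^bold>\<circ> a3) \<otimes> b) \<beta> = ((a1 \<^bold>* (a2 \<^bold>\<circ> a3) + a2 \<^bold>* (a1 \<^bold>\<circ> a3)) \<otimes> b) \<beta>"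
    using compat2[OF assms(1-3)] by simp
  then show ?thesis by (simp add: pt_eval_add c algebra_simps)
qed

text \<open>Normal form of words in \<open>B\<close>: bracketed to the right, with the letters
  before the last one sorted. Words in three given letters thus differ only in their last
  letter.\<close>

lemmas b_simps = perm_assoc[symmetric] perm_left_commute dia_car

lemma mul_comm: "p \<in> car P \<Longrightarrow> q \<in> car P \<Longrightarrow> mul p q = mul q p"
proof -
  assume p: "p \<in> car P" and q: "q \<in> car P"
  show ?thesis
  proof (rule P_form_eq[OF p mul_lin1[OF q] mul_lin2[OF q]])
    fix a b assume ab: "a \<in> car A" "b \<in> car B"
    show "mul (a \<otimes> b) q = mul q (a \<otimes> b)"
      by (rule P_form_eq[OF q mul_lin2[OF pt_car[OF ab]] mul_lin1[OF pt_car[OF ab]]])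
        (simp add: iop_pt[OF ast_bilinear] ab psi_def fun_scl_def add.commute)
  qed
qed

lemma brk_antisym: "p \<in> car P \<Longrightarrow> q \<in> car P \<Longrightarrow> brk p q = - brk q p"
proof -
  assume p: "p \<in> car P" and q: "q \<in> car P"
  show ?thesis
  proof (rule P_form_eq[OF p brk_lin1[OF q] linear_on_uminus[OF vsP brk_lin2[OF q]]])
    fix a b assume ab: "a \<in> car A" "b \<in> car B"
    show "brk (a \<otimes> b) q = - brk q (a \<otimes> b)"
      by (rule P_form_eq[OF q brk_lin2[OF pt_car[OF ab]] linear_on_uminus[OF vsP brk_lin1[OF pt_car[OF ab]]]])
        (simp add: iop_pt[OF circ_bilinear] ab psi_def fun_scl_def fun_eq_iff)
  qed
qed

text \<open>Induction over sums: the bracket of a pure tensor with itself vanishes by the shape of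
  \<open>psi\<close>, and the two mixed brackets cancel by antisymmetry.\<close>

lemma brk_zero: "p \<in> car P \<Longrightarrow> brk p p = 0"
proof (induction rule: P_induct)
  case zero
  show ?case by (rule linear_on_0[OF brk_lin1[OF is_vspaceD(1)[OF vsP]] vsP])
next
  case (add s a b i)
  let ?x = "a \<otimes> b"
  have x: "?x \<in> car P" by (rule ptH_car[OF add.hyps(2,3)])
  have "brk ?x ?x = 0"
    unfolding iop_pt[OF circ_bilinear add.hyps(2) H_car[OF add.hyps(3)] add.hyps(2) H_car[OF add.hyps(3)]]
    by (simp add: psi_def fun_scl_def fun_eq_iff)
  then show ?case
    unfolding linear_on_add[OF brk_lin1[OF is_vspaceD(2)[OF vsP add.hyps(1) x]] add.hyps(1) x]
      linear_on_add[OF brk_lin2[OF add.hyps(1)] add.hyps(1) x] linear_on_add[OF brk_lin2[OF x] add.hyps(1) x]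
    using brk_antisym[OF add.hyps(1) x] add.IH by simp
qed

lemma trilinear_eqI:
  assumes "p \<in> car P" "q \<in> car P" "s \<in> car P"
    and "\<And>q s. q \<in> car P \<Longrightarrow> s \<in> car P \<Longrightarrow> linear_on P P (\<lambda>p. F p q s)"
      "\<And>q s. q \<in> car P \<Longrightarrow> s \<in> car P \<Longrightarrow> linear_on P P (\<lambda>p. F q p s)"
      "\<And>q s. q \<in> car P \<Longrightarrow> s \<in> car P \<Longrightarrow> linear_on P P (\<lambda>p. F q s p)"
    and "\<And>q s. q \<in> car P \<Longrightarrow> s \<in> car P \<Longrightarrow> linear_on P P (\<lambda>p. F' p q s)"
      "\<And>q s. q \<in> car P \<Longrightarrow> s \<in> car P \<Longrightarrow> linear_on P P (\<lambda>p. F' q p s)"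
      "\<And>q s. q \<in> car P \<Longrightarrow> s \<in> car P \<Longrightarrow> linear_on P P (\<lambda>p. F' q s p)"
    and "\<And>a b a' b' a'' b'' \<beta>. \<lbrakk>a \<in> car A; b \<in> car B; a' \<in> car A; b' \<in> car B; a'' \<in> car A; b'' \<in> car B\<rbrakk> \<Longrightarrow>
      F (a \<otimes> b) (a' \<otimes> b') (a'' \<otimes> b'') \<beta> = F' (a \<otimes> b) (a' \<otimes> b') (a'' \<otimes> b'') \<beta>"
  shows "F p q s = F' p q s"
proof (rule P_form_eq[OF assms(1) assms(4)[OF assms(2,3)] assms(7)[OF assms(2,3)]])
  fix a b assume ab: "a \<in> car A" "b \<in> car B"
  note x = pt_car[OF ab]
  show "F (a \<otimes> b) q s = F' (a \<otimes> b) q s"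
  proof (rule P_form_eq[OF assms(2) assms(5)[OF x assms(3)] assms(8)[OF x assms(3)]])
    fix a' b' assume ab': "a' \<in> car A" "b' \<in> car B"
    note y = pt_car[OF ab']
    show "F (a \<otimes> b) (a' \<otimes> b') s = F' (a \<otimes> b) (a' \<otimes> b') s"
      by (rule P_form_eq[OF assms(3) assms(6)[OF x y] assms(9)[OF x y]]) (rule ext, rule assms(10)[OF ab ab'])
  qed
qed

lemma mul_assoc: "p \<in> car P \<Longrightarrow> q \<in> car P \<Longrightarrow> s \<in> car P \<Longrightarrow> mul (mul p q) s = mul p (mul q s)"
proof (rule trilinear_eqI[of p q s "\<lambda>p q s. mul (mul p q) s" "\<lambda>p q s. mul p (mul q s)"])
  fix a b a' b' a'' b'' \<beta>
  assume ab: "a \<in> car A" "b \<in> car B" "a' \<in> car A" "b' \<in> car B" "a'' \<in> car A" "b'' \<in> car B"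
  show "mul (mul (a \<otimes> b) (a' \<otimes> b')) (a'' \<otimes> b'') \<beta> = mul (a \<otimes> b) (mul (a' \<otimes> b') (a'' \<otimes> b'')) \<beta>"
    \<comment> \<open>The Zinbiel identity, applied from left to right, brings the coefficients of
      all three words to the same form.\<close>
    by (simp add: iop_iop_ac ab psi_apply b_simps zinbiel_eval)
qed (blast intro: mul_lin1 mul_lin2 mul_car linear_on_comp[OF mul_lin1 mul_lin1] linear_on_comp[OF mul_lin1 mul_lin2]
   linear_on_comp[OF mul_lin2 mul_lin1] linear_on_comp[OF mul_lin2 mul_lin2])+

lemma brk_Jacobi:
  "p \<in> car P \<Longrightarrow> q \<in> car P \<Longrightarrow> s \<in> car P \<Longrightarrow> brk p (brk q s) + brk q (brk s p) + brk s (brk p q) = 0"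
proof (rule trilinear_eqI[of p q s "\<lambda>p q s. brk p (brk q s) + brk q (brk s p) + brk s (brk p q)" "\<lambda>_ _ _. 0"])
  fix a b a' b' a'' b'' \<beta>
  assume ab: "a \<in> car A" "b \<in> car B" "a' \<in> car A" "b' \<in> car B" "a'' \<in> car A" "b'' \<in> car B"
  show "(brk (a \<otimes> b) (brk (a' \<otimes> b') (a'' \<otimes> b'')) + brk (a' \<otimes> b') (brk (a'' \<otimes> b'') (a \<otimes> b))
    + brk (a'' \<otimes> b'') (brk (a \<otimes> b) (a' \<otimes> b'))) \<beta> = 0 \<beta>"
    \<comment> \<open>One pre-Lie identity for each of the three words, which end in
      \<open>b''\<close>, \<open>b'\<close> and \<open>b\<close>.\<close>
    using pre_Lie_eval[of a a' a'' "b \<diamondop> (b' \<diamondop> b'')" \<beta>] pre_Lie_eval[of a a'' a' "b \<diamondop> (b'' \<diamondop> b')" \<beta>]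
      pre_Lie_eval[of a' a'' a "b' \<diamondop> (b'' \<diamondop> b)" \<beta>]
    by (simp add: iop_iop_ac ab psi_apply b_simps)
qed ((intro linear_on_plus[OF vsP] linear_on_zero[OF vsP])?;
  blast intro: brk_lin1 brk_lin2 brk_car linear_on_comp[OF brk_lin1 brk_lin1] linear_on_comp[OF brk_lin1 brk_lin2]
   linear_on_comp[OF brk_lin2 brk_lin1] linear_on_comp[OF brk_lin2 brk_lin2])+

lemma brk_Leibniz:
  "p \<in> car P \<Longrightarrow> q \<in> car P \<Longrightarrow> s \<in> car P \<Longrightarrow> brk p (mul q s) = mul (brk p q) s + mul q (brk p s)"
proof (rule trilinear_eqI[of p q s "\<lambda>p q s. brk p (mul q s)" "\<lambda>p q s. mul (brk p q) s + mul q (brk p s)"])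
  fix a b a' b' a'' b'' \<beta>
  assume ab: "a \<in> car A" "b \<in> car B" "a' \<in> car A" "b' \<in> car B" "a'' \<in> car A" "b'' \<in> car B"
  show "brk (a \<otimes> b) (mul (a' \<otimes> b') (a'' \<otimes> b'')) \<beta>
    = (mul (brk (a \<otimes> b) (a' \<otimes> b')) (a'' \<otimes> b'') + mul (a' \<otimes> b') (brk (a \<otimes> b) (a'' \<otimes> b''))) \<beta>"
    \<comment> \<open>The words ending in \<open>b''\<close> and \<open>b'\<close> need the first
      compatibility condition, the word ending in \<open>b\<close> the second.\<close>
    using compat1_eval[of a a' a'' "b \<diamondop> (b' \<diamondop> b'')" \<beta>] compat1_eval[of a a'' a' "b \<diamondop> (b'' \<diamondop> b')" \<beta>]
      compat2_eval[of a' a'' a "b' \<diamondop> (b'' \<diamondop> b)" \<beta>]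
    by (simp add: iop_iop_ac ab psi_apply b_simps)
qed ((intro linear_on_plus[OF vsP])?;
  blast intro: brk_lin1 brk_lin2 brk_car mul_lin1 mul_lin2 mul_car linear_on_comp[OF brk_lin1 mul_lin1] linear_on_comp[OF brk_lin1 mul_lin2]
   linear_on_comp[OF brk_lin2 mul_lin1] linear_on_comp[OF brk_lin2 mul_lin2] linear_on_comp[OF mul_lin1 brk_lin1] linear_on_comp[OF mul_lin1 brk_lin2]
   linear_on_comp[OF mul_lin2 brk_lin1] linear_on_comp[OF mul_lin2 brk_lin2])+

lemma graded_Poisson: "graded_Poisson_algebra P G mul brk"
  by unfold_locales
    (rule gradedP iop_bil[OF ast_bilinear] iop_bil[OF circ_bilinear] mul_comm mul_assoc brk_zero brk_Jacobi
      brk_Leibniz iop_G[OF ast_bilinear] iop_G[OF circ_bilinear]; assumption)+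

end

lemma bilin_cong:
  assumes "bilinear_on U V scalars f" "is_vspace U" "is_vspace V"
    and "\<And>u v. u \<in> car U \<Longrightarrow> v \<in> car V \<Longrightarrow> g u v = f u v"
  shows "bilinear_on U V scalars g"
  using assms(1) unfolding bilinear_on_def linear_on_def
  by (simp add: assms(4) is_vspaceD(2,3)[OF assms(2)] is_vspaceD(2,3)[OF assms(3)])

lemma pure2_eval: "bilinear_on U V scalars (\<lambda>u v. pure2 U V u v \<beta>)"
  by (rule bilinear_formI[OF lin_eval[OF pure2_linear2] lin_eval[OF pure2_linear1]])

context induced_setting
begin

section \<open>The induced coproducts\<close>

lemma flip_apply: "bilinear_on P P scalars \<beta> \<Longrightarrow> flip P t \<beta> = t (\<lambda>u v. \<beta> v u)"
  by (simp add: flip_def lift2_def pure2_apply)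

lemma cflip_mem:
  assumes t: "t \<in> car (ctensor P G)"
  shows "cflip P t \<in> car (ctensor P G)"
  unfolding car2_iff
proof (intro allI)
  fix i j
  show "cflip P t (i, j) \<in> blk i j"
    unfolding cflip_def prod.case flip_def
    by (rule lift2_mem[OF car2D[OF t] G_sub G_sub G_scl bilin_swap[OF pure2_eval] subtensor_closed(1,2)])
      (assumption | rule pure2_mem)+
qed

lemma pr2_cflip:
  assumes t: "t \<in> car (ctensor P G)" and g: "bilinear_on A A scalars \<gamma>" and c: "c \<in> H k" "c' \<in> H l"
  shows "pr2 (cflip P t) \<gamma> c c' = pr2 t (\<lambda>x y. \<gamma> y x) c' c"
proof -
  have kl: "k = - m - (- m - k)" "l = - m - (- m - l)" by simp_all
  note gs = bilin_swap[OF g] and cc = H_car[OF c(1)] H_car[OF c(2)]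
  note tb = tst_bil[OF g cc]
  have "pr2 (cflip P t) \<gamma> c c' = cflip P t (- m - k, - m - l) (tst \<gamma> c c')"
    by (rule pr2_hom[OF cflip_mem[OF t] g c(1) kl(1) c(2) kl(2)])
  also have "\<dots> = t (- m - l, - m - k) (\<lambda>u v. tst \<gamma> c c' v u)"
    unfolding cflip_def prod.case by (rule flip_apply[OF tb])
  also have "\<dots> = 1 * pr2 t (\<lambda>x y. \<gamma> y x) c' c + 0 * pr2 t (\<lambda>x y. \<gamma> y x) c' c"
  proof (rule pr2_eval[OF t bilin_swap[OF tb] gs gs])
    fix a b a' b' assume ab: "a \<in> car A" "b \<in> H (- m - l)" "a' \<in> car A" "b' \<in> H (- m - k)"
    show "tst \<gamma> c c' (a' \<otimes> b') (a \<otimes> b) = 1 * (\<gamma> a' a * (\<omega> b c' * \<omega> b' c)) + 0 * (\<gamma> a' a * (\<omega> b c' * \<omega> b' c))"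
      unfolding tst_pt[OF g cc ab(3) H_car[OF ab(4)] ab(1) H_car[OF ab(2)]] by simp
  qed (use c kl in auto)
  finally show ?thesis by simp
qed

lemma bullet_apply:
  "bullet A B s T ij \<beta> = s (\<lambda>a' a''. T ij (\<lambda>b' b''. pure2 P P (a' \<otimes> b') (a'' \<otimes> b'') \<beta>))"
  by (simp add: bullet_def lift2_def)

lemma bullet_inner:
  assumes "T \<in> car (tensor B B)"
  shows "bilinear_on A A scalars (\<lambda>a' a''. T (\<lambda>b' b''. pure2 P P (a' \<otimes> b') (a'' \<otimes> b'') \<beta>))"
  by (rule tens_bilin[OF assms vsA vsA vsB bilin_comp[OF pure2_eval pt_lin2 pt_lin2]
     bilin_comp[OF pure2_eval pt_lin1 pt_lin1]])

lemma bullet_mem: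
  assumes s: "s \<in> car (tensor A A)" and T: "T (i, j) \<in> subtensor B B (H i) (H j)"
  shows "bullet A B s T (i, j) \<in> blk i j"
  unfolding bullet_def
proof (rule lift2_mem[OF s[unfolded car_tensor] order_refl order_refl is_vspaceD(3)[OF vsA] _ subtensor_closed(1,2)])
  show "bilinear_on A A scalars
     (\<lambda>u v. lift2 (\<lambda>b' b''. pure2 P P (u \<otimes> b') (v \<otimes> b'')) (T (i, j)) \<beta>)" for \<beta>
    unfolding lift2_def by (rule bullet_inner[OF subtensor_car[OF H_sub H_sub T]])
  fix a a' assume a: "a \<in> car A" "a' \<in> car A"
  show "lift2 (\<lambda>b' b''. pure2 P P (a \<otimes> b') (a' \<otimes> b'')) (T (i, j)) \<in> blk i j"
    by (rule lift2_mem[OF T H_sub H_sub H_closed(4) bilin_comp[OF pure2_eval pt_lin2[OF a(1)] pt_lin2[OF a(2)]]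
      subtensor_closed(1,2)]) (assumption | rule pure2_mem pt_G a)+
qed

text \<open>A test form factors into \<gamma> on the side of \<open>A\<close> and the two pairings
  on the side of \<open>B\<close>, and so does its value on a \<open>bullet\<close> product.\<close>

lemma pr2_bullet:
  assumes s: "s \<in> car (tensor A A)" and T: "\<And>i j. T (i, j) \<in> subtensor B B (H i) (H j)"
    and g: "bilinear_on A A scalars \<gamma>" and c: "c \<in> H k" "k = - m - i" "c' \<in> H l" "l = - m - j"
  shows "pr2 (bullet A B s T) \<gamma> c c' = s \<gamma> * T (i, j) (\<lambda>x x'. \<omega> x c * \<omega> x' c')"
proof -
  have bc: "bullet A B s T \<in> car (ctensor P G)"
    unfolding car2_iff using bullet_mem[where T = T, OF s T] by blast
  note cc = H_car[OF c(1)] H_car[OF c(3)]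
  note Tc = subtensor_car[OF H_sub H_sub T]
  let ?k = "T (i, j) (\<lambda>x x'. \<omega> x c * \<omega> x' c')"
  have "pr2 (bullet A B s T) \<gamma> c c' =
      s (\<lambda>a' a''. T (i, j) (\<lambda>b' b''. pure2 P P (a' \<otimes> b') (a'' \<otimes> b'') (tst \<gamma> c c')))"
    unfolding pr2_hom[OF bc g c] bullet_apply ..
  also have "\<dots> = s (\<lambda>a' a''. \<gamma> a' a'' * ?k)"
  proof (rule tens_cong[OF s vsA bullet_inner[OF Tc] bilin_intros(6)[OF g]])
    fix a a' assume a: "a \<in> car A" "a' \<in> car A"
    have "T (i, j) (\<lambda>b' b''. pure2 P P (a \<otimes> b') (a' \<otimes> b'') (tst \<gamma> c c'))
        = T (i, j) (\<lambda>x x'. \<gamma> a a' * (\<omega> x c * \<omega> x' c'))"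
      by (rule tens_cong[OF Tc vsB bilin_comp[OF pure2_eval pt_lin2[OF a(1)] pt_lin2[OF a(2)]]
          bilin_intros(5)[OF omega2_bil[OF cc]]])
        (simp add: pure2_apply[OF tst_bil[OF g cc]] tst_pt[OF g cc] a)
    then show "T (i, j) (\<lambda>b' b''. pure2 P P (a \<otimes> b') (a' \<otimes> b'') (tst \<gamma> c c')) = \<gamma> a a' * ?k"
      unfolding tens_cmult[OF Tc vsB omega2_bil[OF cc]] .
  qed
  finally show ?thesis unfolding tens_multc[OF s vsA g] .
qed

abbreviation nuB :: "'b \<Rightarrow> ('k, 'b) ctens2" where "nuB \<equiv> nu B H (\<diamondop>) \<omega>"

text \<open>With \<epsilon> = 1 this is the induced \<Delta> and with \<epsilon> = -1 the induced
  \<delta>, so facts common to both are proved once.\<close>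

definition iD :: "('a \<Rightarrow> ('k, 'a, 'a) tens2) \<Rightarrow> 'k \<Rightarrow> ('k, 'a, 'b) tens2 \<Rightarrow> ('k, ('k, 'a, 'b) tens2) ctens2" where
  "iD d \<epsilon> p = (\<lambda>ij. lift2 (\<lambda>a b. bullet A B (d a) (nuB b) ij +
     fun_scl \<epsilon> (cflip P (bullet A B (d a) (nuB b)) ij)) p)"

lemma ind_Delta_iD: "ind_Delta A B d nuB = iD d 1"
  by (intro ext) (simp add: ind_Delta_def iD_def lift2_def fun_scl_apply)

lemma ind_delta_iD: "ind_delta A B d nuB = iD d (- 1)"
  by (intro ext) (simp add: ind_delta_def iD_def lift2_def fun_scl_apply)

context
  fixes d :: "'a \<Rightarrow> ('k, 'a, 'a) tens2" and \<epsilon> :: 'k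
  assumes d: "linear_on A (tensor A A) d"
begin

lemma bullet_nu_mem: "a \<in> car A \<Longrightarrow> b \<in> car B \<Longrightarrow> bullet A B (d a) (nuB b) \<in> car (ctensor P G)"
  unfolding car2_iff by (simp add: nu_eq bullet_mem[where T = "nuE b", OF linear_on_mem[OF d] nuE_mem])

lemma bullet_nu_bil: "bilinear_on A B scalars (\<lambda>a b. bullet A B (d a) (nuB b) ij \<beta>)"
proof (rule bilin_cong[OF _ vsA vsB])
  obtain i j where ij: "ij = (i, j)" by (cases ij)
  show "bilinear_on A B scalars (\<lambda>a b. bullet A B (d a) (nuE b) ij \<beta>)"
  proof (rule bilinear_formI)
    fix b
    show "linear_on A scalars (\<lambda>a. bullet A B (d a) (nuE b) ij \<beta>)"
      unfolding bullet_apply by (rule lin_eval[OF d])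
  next
    fix a assume a: "a \<in> car A"
    note nc = subtensor_car[OF H_sub H_sub nuE_mem]
    show "linear_on B scalars (\<lambda>b. bullet A B (d a) (nuE b) ij \<beta>)"
      unfolding bullet_apply ij
      by (rule tens_param[OF linear_on_mem[OF d a] vsA vsB bullet_inner[OF nc] lin_eval[OF nuE_linear]])
  qed
qed (simp add: nu_eq)

lemma iD_form_bil:
  "bilinear_on A B scalars (\<lambda>a b. (bullet A B (d a) (nuB b) ij + fun_scl \<epsilon> (cflip P (bullet A B (d a) (nuB b)) ij)) \<beta>)"
proof -
  obtain i j where ij: "ij = (i, j)" by (cases ij)
  show ?thesis
    unfolding ij cflip_def prod.case flip_def lift2_def plus_fun_apply fun_scl_apply
    by (rule bilin_intros(2)[OF bullet_nu_bil bilin_intros(5)[OF bullet_nu_bil]])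
qed

lemma iD_pt':
  "iD d \<epsilon> (a \<otimes> b) ij = bullet A B (d a) (nuB b) ij + fun_scl \<epsilon> (cflip P (bullet A B (d a) (nuB b)) ij)"
  unfolding iD_def by (rule lift2_pure2[OF iD_form_bil])

lemma iD_pt:
  assumes "a \<in> car A" "b \<in> car B"
  shows "iD d \<epsilon> (a \<otimes> b) ij = bullet A B (d a) (nuE b) ij + fun_scl \<epsilon> (cflip P (bullet A B (d a) (nuE b)) ij)"
  unfolding iD_pt' nu_eq[OF assms(2)] ..

lemma iD_mem: "p \<in> car P \<Longrightarrow> iD d \<epsilon> p \<in> car (ctensor P G)"
  unfolding car2_iff
proof (intro allI)
  fix i j assume p: "p \<in> car P"
  show "iD d \<epsilon> p (i, j) \<in> blk i j"
    unfolding iD_def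
  proof (rule lift2_mem[OF p[unfolded car_tensor] order_refl order_refl is_vspaceD(3)[OF vsA] iD_form_bil subtensor_closed(1,2)])
    fix a b assume ab: "a \<in> car A" "b \<in> car B"
    note t = bullet_nu_mem[OF ab]
    show "bullet A B (d a) (nuB b) (i, j) + fun_scl \<epsilon> (cflip P (bullet A B (d a) (nuB b)) (i, j)) \<in> blk i j"
      by (intro subtensor_closed(2,5) car2D t cflip_mem)
  qed
qed

lemma iD_linear: "linear_on P (ctensor P G) (iD d \<epsilon>)"
  unfolding linear_on_def
  using iD_mem by (simp add: ctensor_def iD_def lift2_add lift2_scl fun_eq_iff)

lemma iD_blk_linear: "linear_on P (tensor P P) (\<lambda>p. iD d \<epsilon> p (i, j))"
  unfolding linear_on_def
  using blk_car[OF car2D[OF iD_mem]] by (simp add: iD_def lift2_add lift2_scl)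

lemma iD_degree:
  assumes p: "p \<in> G k" and "i + j \<noteq> k - m"
  shows "iD d \<epsilon> p (i, j) = 0"
proof (rule G_form_eq[OF p iD_blk_linear linear_on_zero[OF is_vspace_tensor]])
  fix a b assume a: "a \<in> car A" and b: "b \<in> H k"
  have "bullet A B (d a) (nuE b) (x, y) = 0" if "x + y \<noteq> k - m" for x y
    using tens_zero[OF linear_on_mem[OF d a] vsA]
    by (simp add: fun_eq_iff bullet_apply nuE_degree[OF b that])
  from this[of i j] this[of j i] show "iD d \<epsilon> (a \<otimes> b) (i, j) = 0"
    using assms(2) by (simp add: iD_pt[OF a H_car[OF b]] cflip_def flip_def lift2_def fun_scl_def add.commute fun_eq_iff)
qed

text \<open>The sign comes from the defining equation of \<open>nu\<close>. The flipped summand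
  exchanges the arguments of \<gamma> together with \<open>c\<close> and \<open>c'\<close>. Every
  later comparison of coefficients starts from this formula.\<close>

lemma pr2_iD:
  assumes ab: "a \<in> car A" "b \<in> car B" and g: "bilinear_on A A scalars \<gamma>" and c: "c \<in> H k" "c' \<in> H l"
  shows "pr2 (iD d \<epsilon> (a \<otimes> b)) \<gamma> c c' = - (d a \<gamma> * \<omega> b (c \<diamondop> c')) - \<epsilon> * (d a (\<lambda>x y. \<gamma> y x) * \<omega> b (c' \<diamondop> c))"
proof -
  have kl: "k = - m - (- m - k)" "l = - m - (- m - l)" by simp_all
  note t = bullet_nu_mem[OF ab]
  let ?t = "bullet A B (d a) (nuB b)"
  have e: "pr2 ?t \<gamma> c c' = - (d a \<gamma> * \<omega> b (c \<diamondop> c'))"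
    if g: "bilinear_on A A scalars \<gamma>" and c: "c \<in> H k" "c' \<in> H l" for \<gamma> c c' k l
  proof -
    have kl: "k = - m - (- m - k)" "l = - m - (- m - l)" by simp_all
    show ?thesis
      unfolding nu_eq[OF ab(2)] pr2_bullet[OF linear_on_mem[OF d ab(1)] nuE_mem g c(1) kl(1) c(2) kl(2)]
      using nuE_eval[OF ab(2), of c "- m - k" c' "- m - l"] c by simp
  qed
  have "pr2 (iD d \<epsilon> (a \<otimes> b)) \<gamma> c c' = pr2 ?t \<gamma> c c' + \<epsilon> * pr2 (cflip P ?t) \<gamma> c c'"
    unfolding pr2_hom[OF iD_mem[OF pt_car[OF ab]] g c(1) kl(1) c(2) kl(2)]
      pr2_hom[OF t g c(1) kl(1) c(2) kl(2)] pr2_hom[OF cflip_mem[OF t] g c(1) kl(1) c(2) kl(2)]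
      iD_pt' by (simp add: fun_scl_apply)
  then show ?thesis
    unfolding pr2_cflip[OF t g c] e[OF g c] e[OF bilin_swap[OF g] c(2,1)] by simp
qed

end

section \<open>Operators on the completed tensor square\<close>

text \<open>Multiplication by an inhomogeneous element is a finite sum of shifts of degree. This
  notion covers it, is stable under sums, and ensures that termwise application to a completed
  tensor involves only finite sums.\<close>

definition locfin :: "(('k, 'a, 'b) tens2 \<Rightarrow> ('k, 'a, 'b) tens2) \<Rightarrow> bool" where
  "locfin f \<longleftrightarrow> linear_on P P f \<and> (\<forall>i. finite {x. \<exists>u\<in>G x. component G i (f u) \<noteq> 0})"

lemma locfinD: "locfin f \<Longrightarrow> linear_on P P f"
  "locfin f \<Longrightarrow> finite {x. \<exists>u\<in>G x. component G i (f u) \<noteq> 0}"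
  by (auto simp: locfin_def)

lemma locfin_shift:
  assumes "linear_on P P f" "\<And>i u. u \<in> G i \<Longrightarrow> f u \<in> G (i + e)"
  shows "locfin f"
proof -
  have "{x. \<exists>u\<in>G x. component G i (f u) \<noteq> 0} \<subseteq> {i - e}" for i
    using componentP_hom[OF assms(2)] by (auto split: if_splits)
  then show ?thesis using assms(1) finite_subset unfolding locfin_def by blast
qed

lemma locfin_id: "locfin id"
  by (rule locfin_shift[of _ 0]) (simp_all add: linear_on_def)

lemma locfin_add:
  assumes f: "locfin f" and g: "locfin g"
  shows "locfin (\<lambda>u. f u + g u)"
  unfolding locfin_def
proof (intro conjI allI)
  show "linear_on P P (\<lambda>u. f u + g u)" by (rule linear_on_plus[OF vsP locfinD(1)[OF f] locfinD(1)[OF g]])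
  fix i
  have "{x. \<exists>u\<in>G x. component G i (f u + g u) \<noteq> 0} \<subseteq>
      {x. \<exists>u\<in>G x. component G i (f u) \<noteq> 0} \<union> {x. \<exists>u\<in>G x. component G i (g u) \<noteq> 0}"
  proof clarify
    fix x u assume u: "u \<in> G x" "component G i (f u + g u) \<noteq> 0" and "\<not> (\<exists>u\<in>G x. component G i (g u) \<noteq> 0)"
    moreover have "component G i (f u + g u) = component G i (f u) + component G i (g u)"
      by (rule linear_on_add[OF componentP_lin])
        (use linear_on_mem[OF locfinD(1)[OF f]] linear_on_mem[OF locfinD(1)[OF g]] G_car[OF u(1)] in auto)
    ultimately show "\<exists>u\<in>G x. component G i (f u) \<noteq> 0" by (intro bexI[of _ u]) auto
  qed
  then show "finite {x. \<exists>u\<in>G x. component G i (f u + g u) \<noteq> 0}"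
    using locfinD(2)[OF f] locfinD(2)[OF g] finite_subset by blast
qed

definition ctm :: "(('k, 'a, 'b) tens2 \<Rightarrow> ('k, 'a, 'b) tens2) \<Rightarrow> (('k, 'a, 'b) tens2 \<Rightarrow> ('k, 'a, 'b) tens2) \<Rightarrow>
    int \<Rightarrow> int \<Rightarrow> ('k, ('k, 'a, 'b) tens2, ('k, 'a, 'b) tens2) tens2 \<Rightarrow> ('k, ('k, 'a, 'b) tens2, ('k, 'a, 'b) tens2) tens2" where
  "ctm f g i j = lift2 (\<lambda>u v. pure2 P P (component G i (f u)) (component G j (g v)))"

lemma ctm_add: "ctm f g i j (s + t) = ctm f g i j s + ctm f g i j t"
  by (simp add: ctm_def lift2_add)

lemma ctm_bil:
  assumes "linear_on P P f" "linear_on P P g"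
  shows "bilinear_on P P scalars (\<lambda>u v. pure2 P P (component G i (f u)) (component G j (g v)) \<beta>)"
  by (rule bilin_comp[OF pure2_eval linear_on_comp[OF componentP_lin assms(1)] linear_on_comp[OF componentP_lin assms(2)]])

lemma ctm_eq_0:
  assumes t: "t \<in> blk x y" and fg: "linear_on P P f" "linear_on P P g"
    and z: "(\<forall>u\<in>G x. component G i (f u) = 0) \<or> (\<forall>v\<in>G y. component G j (g v) = 0)"
  shows "ctm f g i j t = 0"
proof (rule ext)
  fix \<beta>
  have "t (\<lambda>u v. pure2 P P (component G i (f u)) (component G j (g v)) \<beta>) = t (\<lambda>_ _. 0)"
  proof (rule blk_cong[OF t ctm_bil[OF fg] bilin_intros(1)])
    fix a b a' b' assume ab: "a \<in> car A" "b \<in> H x" "a' \<in> car A" "b' \<in> H y"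
    have "component G i (f (a \<otimes> b)) = 0 \<or> component G j (g (a' \<otimes> b')) = 0"
      using z pt_G ab by blast
    moreover have "component G i (f (a \<otimes> b)) \<in> car P" "component G j (g (a' \<otimes> b')) \<in> car P"
      by (rule linear_on_mem[OF linear_on_comp[OF componentP_lin fg(1)] ptH_car[OF ab(1,2)]],
          rule linear_on_mem[OF linear_on_comp[OF componentP_lin fg(2)] ptH_car[OF ab(3,4)]])
    ultimately show "pure2 P P (component G i (f (a \<otimes> b))) (component G j (g (a' \<otimes> b'))) \<beta> = 0"
      using linear_on_0[OF lin_eval[OF pure2_linear1] vsP] linear_on_0[OF lin_eval[OF pure2_linear2] vsP]
      by metis
  qed
  then show "ctm f g i j t \<beta> = 0 \<beta>"
    using tens_zero[OF blk_car[OF t] vsP] by (simp add: ctm_def lift2_def)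
qed

text \<open>The index sets may be any finite supersets of the contributing degrees; this permits the
  comparison of several operators over one common index set.\<close>

lemma ctmap_rep:
  assumes t: "t \<in> car (ctensor P G)" and f: "linear_on P P f" and g: "linear_on P P g"
    and S: "finite S" "{x. \<exists>u\<in>G x. component G i (f u) \<noteq> 0} \<subseteq> S"
    and S': "finite S'" "{x. \<exists>u\<in>G x. component G j (g u) \<noteq> 0} \<subseteq> S'"
  shows "ctmap P G f g t (i, j) = (\<Sum>(x, y)\<in>S \<times> S'. ctm f g i j (t (x, y)))"
proof -
  have e: "cterm (\<lambda>u v. cpure2 P G (f u) (g v)) t (i, j) = (\<lambda>(x, y). ctm f g i j (t (x, y)))"
    by (intro ext) (simp add: cterm_def cpure2_def ctm_def case_prod_unfold)
  show ?thesis
    unfolding ctmap_def clift_def e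
  proof (rule Sum_any.expand_superset)
    show "{a. (case a of (x, y) \<Rightarrow> ctm f g i j (t (x, y))) \<noteq> 0} \<subseteq> S \<times> S'"
    proof (rule subsetI)
      fix q assume "q \<in> {a. (case a of (x, y) \<Rightarrow> ctm f g i j (t (x, y))) \<noteq> 0}"
      then obtain x y where q: "q = (x, y)" and "ctm f g i j (t (x, y)) \<noteq> 0" by (cases q) auto
      with ctm_eq_0[OF car2D[OF t] f g, of x i y j]
      have "\<not> ((\<forall>u\<in>G x. component G i (f u) = 0) \<or> (\<forall>v\<in>G y. component G j (g v) = 0))" by blast
      then show "q \<in> S \<times> S'" using S S' q by blast
    qed
  qed (use S S' in simp)
qed

lemma ctm_mem:
  assumes t: "t \<in> blk x y" and fg: "linear_on P P f" "linear_on P P g"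
  shows "ctm f g i j t \<in> blk i j"
  unfolding ctm_def
proof (rule lift2_mem[OF t G_sub G_sub G_scl ctm_bil[OF fg] subtensor_closed(1,2)])
  fix u v assume "u \<in> G x" "v \<in> G y"
  then show "pure2 P P (component G i (f u)) (component G j (g v)) \<in> blk i j"
    using linear_on_mem[OF fg(1) G_car] linear_on_mem[OF fg(2) G_car]
    by (intro pure2_mem component_mem[OF gradedP]) auto
qed

lemma ctmap_mem:
  assumes t: "t \<in> car (ctensor P G)" and f: "locfin f" and g: "locfin g"
  shows "ctmap P G f g t \<in> car (ctensor P G)"
  unfolding car2_iff
proof (intro allI)
  fix i j
  show "ctmap P G f g t (i, j) \<in> blk i j"
    unfolding ctmap_rep[OF t locfinD(1)[OF f] locfinD(1)[OF g] locfinD(2)[OF f] order_refl locfinD(2)[OF g] order_refl]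
      case_prod_unfold
    by (intro subtensor_closed(6) ctm_mem[OF car2D[OF t] locfinD(1)[OF f] locfinD(1)[OF g]])
qed

lemma ctmap_add:
  assumes s: "s \<in> car (ctensor P G)" and t: "t \<in> car (ctensor P G)" and f: "locfin f" and g: "locfin g"
  shows "ctmap P G f g (s + t) = ctmap P G f g s + ctmap P G f g t"
proof (rule ext, clarify)
  fix i j
  have st: "s + t \<in> car (ctensor P G)" using s t by (simp add: car2_iff subtensor_closed)
  note rep = ctmap_rep[OF _ locfinD(1)[OF f] locfinD(1)[OF g] locfinD(2)[OF f] order_refl locfinD(2)[OF g] order_refl]
  show "ctmap P G f g (s + t) (i, j) = (ctmap P G f g s + ctmap P G f g t) (i, j)"
    unfolding rep[OF st] plus_fun_apply[of "ctmap P G f g s"] plus_fun_apply[of s] rep[OF s] rep[OF t]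
      ctm_add case_prod_unfold sum.distrib ..
qed

lemma ctmap_add_op:
  assumes t: "t \<in> car (ctensor P G)" and f: "locfin f" "locfin f'" and g: "locfin g"
  shows "ctmap P G (\<lambda>u. f u + f' u) g t = ctmap P G f g t + ctmap P G f' g t"
    and "ctmap P G g (\<lambda>u. f u + f' u) t = ctmap P G g f t + ctmap P G g f' t"
proof -
  let ?supp = "\<lambda>f i. {x. \<exists>u\<in>G x. component G i (f u) \<noteq> 0}"
  let ?h = "\<lambda>u. f u + f' u"
  note h = locfin_add[OF f]
  note fl = locfinD(1)[OF f(1)] locfinD(1)[OF f(2)] and gl = locfinD(1)[OF g] and hl = locfinD(1)[OF h]
  \<comment> \<open>One index set that serves \<open>f\<close>, \<open>f'\<close> and their sum, so
    that the three finite sums can be compared term by term.\<close>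
  let ?S = "\<lambda>i. ?supp f i \<union> ?supp f' i \<union> ?supp ?h i"
  have fin: "finite (?S i)" for i using f h locfinD(2) by auto
  have sub: "?supp f i \<subseteq> ?S i" "?supp f' i \<subseteq> ?S i" "?supp ?h i \<subseteq> ?S i" for i by blast+
  have cadd: "component G i (?h u) = component G i (f u) + component G i (f' u)" if "u \<in> car P" for u i
    by (rule linear_on_add[OF componentP_lin linear_on_mem[OF fl(1) that] linear_on_mem[OF fl(2) that]])
  have cc: "component G i (k u) \<in> car P" if "linear_on P P k" "u \<in> car P" for u i k
    by (rule linear_on_mem[OF linear_on_comp[OF componentP_lin that(1)] that(2)])
  have 1: "ctm ?h g i j (t (x, y)) = ctm f g i j (t (x, y)) + ctm f' g i j (t (x, y))" for x y i j
  proof (rule ext)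
    fix \<beta>
    note tb = blk_car[OF car2D[OF t, of x y]]
    have "t (x, y) (\<lambda>u v. pure2 P P (component G i (?h u)) (component G j (g v)) \<beta>) =
      t (x, y) (\<lambda>u v. pure2 P P (component G i (f u)) (component G j (g v)) \<beta> + pure2 P P (component G i (f' u)) (component G j (g v)) \<beta>)"
      by (rule tens_cong[OF tb vsP ctm_bil[OF hl gl] bilin_intros(2)[OF ctm_bil[OF fl(1) gl] ctm_bil[OF fl(2) gl]]])
        (simp add: cadd linear_form_add[OF lin_eval[OF pure2_linear1[OF cc[OF gl]]] cc[OF fl(1)] cc[OF fl(2)]])
    then show "ctm ?h g i j (t (x, y)) \<beta> = (ctm f g i j (t (x, y)) + ctm f' g i j (t (x, y))) \<beta>"
      unfolding tens_add[OF tb vsP ctm_bil[OF fl(1) gl] ctm_bil[OF fl(2) gl]]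
      by (simp add: ctm_def lift2_def)
  qed
  have 2: "ctm g ?h i j (t (x, y)) = ctm g f i j (t (x, y)) + ctm g f' i j (t (x, y))" for x y i j
  proof (rule ext)
    fix \<beta>
    note tb = blk_car[OF car2D[OF t, of x y]]
    have "t (x, y) (\<lambda>u v. pure2 P P (component G i (g u)) (component G j (?h v)) \<beta>) =
      t (x, y) (\<lambda>u v. pure2 P P (component G i (g u)) (component G j (f v)) \<beta> + pure2 P P (component G i (g u)) (component G j (f' v)) \<beta>)"
      by (rule tens_cong[OF tb vsP ctm_bil[OF gl hl] bilin_intros(2)[OF ctm_bil[OF gl fl(1)] ctm_bil[OF gl fl(2)]]])
        (simp add: cadd linear_form_add[OF lin_eval[OF pure2_linear2[OF cc[OF gl]]] cc[OF fl(1)] cc[OF fl(2)]])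
    then show "ctm g ?h i j (t (x, y)) \<beta> = (ctm g f i j (t (x, y)) + ctm g f' i j (t (x, y))) \<beta>"
      unfolding tens_add[OF tb vsP ctm_bil[OF gl fl(1)] ctm_bil[OF gl fl(2)]]
      by (simp add: ctm_def lift2_def)
  qed
  show "ctmap P G ?h g t = ctmap P G f g t + ctmap P G f' g t"
  proof (rule ext, clarify)
    fix i j
    show "ctmap P G ?h g t (i, j) = (ctmap P G f g t + ctmap P G f' g t) (i, j)"
      unfolding plus_fun_apply[of "ctmap P G f g t"] ctmap_rep[OF t hl gl fin sub(3) locfinD(2)[OF g] order_refl]
        ctmap_rep[OF t fl(1) gl fin sub(1) locfinD(2)[OF g] order_refl]
        ctmap_rep[OF t fl(2) gl fin sub(2) locfinD(2)[OF g] order_refl]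
        case_prod_unfold 1 sum.distrib ..
  qed
  show "ctmap P G g ?h t = ctmap P G g f t + ctmap P G g f' t"
  proof (rule ext, clarify)
    fix i j
    show "ctmap P G g ?h t (i, j) = (ctmap P G g f t + ctmap P G g f' t) (i, j)"
      unfolding plus_fun_apply[of "ctmap P G g f t"] ctmap_rep[OF t gl hl locfinD(2)[OF g] order_refl fin sub(3)]
        ctmap_rep[OF t gl fl(1) locfinD(2)[OF g] order_refl fin sub(1)]
        ctmap_rep[OF t gl fl(2) locfinD(2)[OF g] order_refl fin sub(2)]
        case_prod_unfold 2 sum.distrib ..
  qed
qed

text \<open>Homogeneous operators move blocks rigidly: block \<open>(i, j)\<close> of the image
  comes from block \<open>(i - e, j - e')\<close>, and there the component maps act as the
  identity.\<close>

lemma ctmap_shift: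
  assumes t: "t \<in> car (ctensor P G)" and f: "linear_on P P f" "\<And>i u. u \<in> G i \<Longrightarrow> f u \<in> G (i + e)"
    and g: "linear_on P P g" "\<And>i u. u \<in> G i \<Longrightarrow> g u \<in> G (i + e')"
    and \<beta>: "bilinear_on P P scalars \<beta>"
  shows "ctmap P G f g t (i, j) \<beta> = t (i - e, j - e') (\<lambda>u v. \<beta> (f u) (g v))"
proof -
  have s: "{x. \<exists>u\<in>G x. component G i (f u) \<noteq> 0} \<subseteq> {i - e}" "{x. \<exists>u\<in>G x. component G j (g u) \<noteq> 0} \<subseteq> {j - e'}"
    using componentP_hom[OF f(2)] componentP_hom[OF g(2)] by (auto split: if_splits)
  have "ctmap P G f g t (i, j) = ctm f g i j (t (i - e, j - e'))"
    unfolding ctmap_rep[OF t f(1) g(1) _ s(1) _ s(2), simplified] by simp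
  then have "ctmap P G f g t (i, j) \<beta> =
      t (i - e, j - e') (\<lambda>u v. pure2 P P (component G i (f u)) (component G j (g v)) \<beta>)"
    by (simp add: ctm_def lift2_def)
  also have "\<dots> = t (i - e, j - e') (\<lambda>u v. \<beta> (f u) (g v))"
  proof (rule blk_cong[OF car2D[OF t] ctm_bil[OF f(1) g(1)] bilin_comp[OF \<beta> f(1) g(1)]])
    fix a b a' b' assume ab: "a \<in> car A" "b \<in> H (i - e)" "a' \<in> car A" "b' \<in> H (j - e')"
    show "pure2 P P (component G i (f (a \<otimes> b))) (component G j (g (a' \<otimes> b'))) \<beta> = \<beta> (f (a \<otimes> b)) (g (a' \<otimes> b'))"
      using componentP_hom[OF f(2)[OF pt_G[OF ab(1,2)]], of i] componentP_hom[OF g(2)[OF pt_G[OF ab(3,4)]], of j]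
      by (simp add: pure2_apply[OF \<beta>])
  qed
  finally show ?thesis .
qed

context
  fixes \<mu> :: "'a \<Rightarrow> 'a \<Rightarrow> 'a" and \<epsilon> :: 'k
  assumes mu: "bilinear_on A A A \<mu>"
begin

lemma iop_shift:
  assumes "a \<in> car A" "b \<in> H e" "u \<in> G i"
  shows "iop \<mu> \<epsilon> (a \<otimes> b) u \<in> G (i + e)"
  using iop_G[OF mu pt_G[OF assms(1,2)] assms(3)] by (simp add: add.commute)

lemma iop_lin: "p \<in> car P \<Longrightarrow> linear_on P P (iop \<mu> \<epsilon> p)"
  by (rule bilinear_onD1[OF iop_bil[OF mu]])

lemma iop_add: "iop \<mu> \<epsilon> (p + q) = (\<lambda>s. iop \<mu> \<epsilon> p s + iop \<mu> \<epsilon> q s)"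
  by (simp add: iop_def lift2_add fun_eq_iff)

lemma iop_zero: "iop \<mu> \<epsilon> 0 = (\<lambda>s. 0)"
  by (simp add: iop_def lift2_def fun_eq_iff)

lemma locfin_iop: "p \<in> car P \<Longrightarrow> locfin (iop \<mu> \<epsilon> p)"
proof (induction rule: P_induct)
  case zero
  show ?case
    unfolding iop_zero by (rule locfin_shift[OF linear_on_zero[OF vsP], of 0]) (rule G_closed(1))
next
  case (add s a b i)
  show ?case
    unfolding iop_add
    by (rule locfin_add[OF add.IH locfin_shift[OF iop_lin[OF ptH_car] iop_shift]]) (rule add.hyps)+
qed

text \<open>Passing to adjoints: \<open>y \<mapsto> b \<diamondop> y\<close> is self-adjoint by
  \<open>om_left\<close>, while \<open>y \<mapsto> y \<diamondop> b\<close> has the adjoint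
  \<open>c \<mapsto> b \<diamondop> c - c \<diamondop> b\<close> by invariance. The operator on the
  completed tensor is thereby traded for new arguments of the pairing.\<close>

lemma pr2_ctmap_left:
  assumes t: "t \<in> car (ctensor P G)" and a: "a \<in> car A" and b: "b \<in> H e"
    and g: "bilinear_on A A scalars \<gamma>" and c: "c \<in> H k" "c' \<in> H l"
  shows "pr2 (ctmap P G (iop \<mu> \<epsilon> (a \<otimes> b)) id t) \<gamma> c c' =
    pr2 t (\<lambda>x y. \<gamma> (\<mu> a x) y) (b \<diamondop> c) c' + \<epsilon> * pr2 t (\<lambda>x y. \<gamma> (\<mu> x a) y) (b \<diamondop> c - c \<diamondop> b) c'"
proof -
  have kl: "k = - m - (- m - k)" "l = - m - (- m - l)" by simp_all
  note cc = H_car[OF c(1)] H_car[OF c(2)] and bc = H_car[OF b]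
  note tb = tst_bil[OF g cc]
  note p = ptH_car[OF a b]
  have li: "linear_on P P id" by (simp add: linear_on_def)
  have "pr2 (ctmap P G (iop \<mu> \<epsilon> (a \<otimes> b)) id t) \<gamma> c c' =
      ctmap P G (iop \<mu> \<epsilon> (a \<otimes> b)) id t (- m - k, - m - l) (tst \<gamma> c c')"
    by (rule pr2_hom[OF ctmap_mem[OF t locfin_iop[OF p] locfin_id] g c(1) kl(1) c(2) kl(2)])
  also have "\<dots> = t (- m - k - e, - m - l - 0) (\<lambda>u v. tst \<gamma> c c' (iop \<mu> \<epsilon> (a \<otimes> b) u) (id v))"
    by (rule ctmap_shift[OF t iop_lin[OF p] iop_shift[OF a b] li _ tb]) simp_all
  also have "\<dots> = 1 * pr2 t (\<lambda>x y. \<gamma> (\<mu> a x) y) (b \<diamondop> c) c' + \<epsilon> * pr2 t (\<lambda>x y. \<gamma> (\<mu> x a) y) (b \<diamondop> c - c \<diamondop> b) c'"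
  proof (rule pr2_eval[OF t bilin_comp[OF tb iop_lin[OF p] li] bilin_comp[OF g bilinear_onD1[OF mu a] linear_on_ident]
        bilin_comp[OF g bilinear_onD2[OF mu a] linear_on_ident]])
    fix x y x' y' assume xy: "x \<in> car A" "y \<in> H (- m - k - e)" "x' \<in> car A" "y' \<in> H (- m - l - 0)"
    note xc = xy(1) H_car[OF xy(2)] xy(3) H_car[OF xy(4)]
    note mc = mu_car[OF mu a xc(1)] mu_car[OF mu xc(1) a] dia_car[OF bc xc(2)] dia_car[OF xc(2) bc]
    have "tst \<gamma> c c' (iop \<mu> \<epsilon> (a \<otimes> b) (x \<otimes> y)) (x' \<otimes> y') =
        tst \<gamma> c c' (\<mu> a x \<otimes> (b \<diamondop> y)) (x' \<otimes> y') + \<epsilon> * tst \<gamma> c c' (\<mu> x a \<otimes> (y \<diamondop> b)) (x' \<otimes> y')"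
      unfolding iop_pt[OF mu a bc xc(1,2)] psi_def tst_def by (simp add: fun_scl_apply)
    then show "tst \<gamma> c c' (iop \<mu> \<epsilon> (a \<otimes> b) (x \<otimes> y)) (id (x' \<otimes> y')) =
        1 * (\<gamma> (\<mu> a x) x' * (\<omega> y (b \<diamondop> c) * \<omega> y' c')) + \<epsilon> * (\<gamma> (\<mu> x a) x' * (\<omega> y (b \<diamondop> c - c \<diamondop> b) * \<omega> y' c'))"
      unfolding tst_pt[OF g cc mc(1,3) xc(3,4)] tst_pt[OF g cc mc(2,4) xc(3,4)]
        om_left[OF bc xc(2) cc(1)] om_invariant[OF xc(2) bc cc(1)] by simp
  qed (use dia_degree[OF b c(1)] dia_degree[OF c(1) b] c(2) in \<open>auto intro!: H_closed(3) simp: algebra_simps\<close>)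
  finally show ?thesis by simp
qed

lemma pr2_ctmap_right:
  assumes t: "t \<in> car (ctensor P G)" and a: "a \<in> car A" and b: "b \<in> H e"
    and g: "bilinear_on A A scalars \<gamma>" and c: "c \<in> H k" "c' \<in> H l"
  shows "pr2 (ctmap P G id (iop \<mu> \<epsilon> (a \<otimes> b)) t) \<gamma> c c' =
    pr2 t (\<lambda>x y. \<gamma> x (\<mu> a y)) c (b \<diamondop> c') + \<epsilon> * pr2 t (\<lambda>x y. \<gamma> x (\<mu> y a)) c (b \<diamondop> c' - c' \<diamondop> b)"
proof -
  have kl: "k = - m - (- m - k)" "l = - m - (- m - l)" by simp_all
  note cc = H_car[OF c(1)] H_car[OF c(2)] and bc = H_car[OF b]
  note tb = tst_bil[OF g cc]
  note p = ptH_car[OF a b]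
  have li: "linear_on P P id" by (simp add: linear_on_def)
  have "pr2 (ctmap P G id (iop \<mu> \<epsilon> (a \<otimes> b)) t) \<gamma> c c' =
      ctmap P G id (iop \<mu> \<epsilon> (a \<otimes> b)) t (- m - k, - m - l) (tst \<gamma> c c')"
    by (rule pr2_hom[OF ctmap_mem[OF t locfin_id locfin_iop[OF p]] g c(1) kl(1) c(2) kl(2)])
  also have "\<dots> = t (- m - k - 0, - m - l - e) (\<lambda>u v. tst \<gamma> c c' (id u) (iop \<mu> \<epsilon> (a \<otimes> b) v))"
    by (rule ctmap_shift[OF t li _ iop_lin[OF p] iop_shift[OF a b] tb]) simp_all
  also have "\<dots> = 1 * pr2 t (\<lambda>x y. \<gamma> x (\<mu> a y)) c (b \<diamondop> c') + \<epsilon> * pr2 t (\<lambda>x y. \<gamma> x (\<mu> y a)) c (b \<diamondop> c' - c' \<diamondop> b)"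
  proof (rule pr2_eval[OF t bilin_comp[OF tb li iop_lin[OF p]] bilin_comp[OF g linear_on_ident bilinear_onD1[OF mu a]]
        bilin_comp[OF g linear_on_ident bilinear_onD2[OF mu a]]])
    fix x y x' y' assume xy: "x \<in> car A" "y \<in> H (- m - k - 0)" "x' \<in> car A" "y' \<in> H (- m - l - e)"
    note xc = xy(1) H_car[OF xy(2)] xy(3) H_car[OF xy(4)]
    note mc = mu_car[OF mu a xc(3)] mu_car[OF mu xc(3) a] dia_car[OF bc xc(4)] dia_car[OF xc(4) bc]
    note tp = bilinear_onD1[OF tb pt_car[OF xc(1,2)]]
    have "tst \<gamma> c c' (x \<otimes> y) (iop \<mu> \<epsilon> (a \<otimes> b) (x' \<otimes> y')) =
        tst \<gamma> c c' (x \<otimes> y) (\<mu> a x' \<otimes> (b \<diamondop> y')) + \<epsilon> * tst \<gamma> c c' (x \<otimes> y) (\<mu> x' a \<otimes> (y' \<diamondop> b))"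
      unfolding iop_pt[OF mu a bc xc(3,4)] psi_def
        linear_form_add[OF tp pt_car[OF mc(1,3)] is_vspaceD(3)[OF vsP pt_car[OF mc(2,4)], unfolded scl_tensor]]
        linear_form_scl[OF tp pt_car[OF mc(2,4)], unfolded scl_tensor] ..
    then show "tst \<gamma> c c' (id (x \<otimes> y)) (iop \<mu> \<epsilon> (a \<otimes> b) (x' \<otimes> y')) =
        1 * (\<gamma> x (\<mu> a x') * (\<omega> y c * \<omega> y' (b \<diamondop> c'))) + \<epsilon> * (\<gamma> x (\<mu> x' a) * (\<omega> y c * \<omega> y' (b \<diamondop> c' - c' \<diamondop> b)))"
      unfolding tst_pt[OF g cc xc(1,2) mc(1,3)] tst_pt[OF g cc xc(1,2) mc(2,4)]
        om_left[OF bc xc(4) cc(2)] om_invariant[OF xc(4) bc cc(2)] by simp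
  qed (use dia_degree[OF b c(2)] dia_degree[OF c(2) b] c(1) in \<open>auto intro!: H_closed(3) simp: algebra_simps\<close>)
  finally show ?thesis by simp
qed

end

section \<open>Composites of coproducts\<close>

text \<open>Linearity together with homogeneity of degree \<open>- m\<close>, the property that
  makes composites of coproducts summable.\<close>

definition hcomul :: "(('k, 'a, 'b) tens2 \<Rightarrow> ('k, ('k, 'a, 'b) tens2) ctens2) \<Rightarrow> bool" where
  "hcomul D \<longleftrightarrow> linear_on P (ctensor P G) D \<and> (\<forall>k p i j. p \<in> G k \<longrightarrow> i + j \<noteq> k - m \<longrightarrow> D p (i, j) = 0)"

lemma hcomul_iD: "linear_on A (tensor A A) d \<Longrightarrow> hcomul (iD d \<epsilon>)"
  unfolding hcomul_def using iD_linear iD_degree by blast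

text \<open>No condition on \<tau> appears, as \<open>pure3\<close> is 0 at functions that are not
  trilinear.\<close>

lemma pure3_tri: "trilinear_form_on P (\<lambda>x y z. pure3 P x y z \<tau>)"
proof (cases "trilinear_form_on P \<tau>")
  case True
  then show ?thesis by (simp add: pure3_apply)
next
  case False
  then have "(\<lambda>x y z. pure3 P x y z \<tau>) = (\<lambda>_ _ _. 0)" by (simp add: pure3_def)
  then show ?thesis by (simp add: trilinear_form_on_def bilinear_on_def lin_intros(1))
qed

lemma pure3_0: "u \<in> car P \<Longrightarrow> v \<in> car P \<Longrightarrow> pure3 P u v 0 \<tau> = 0"
  "u \<in> car P \<Longrightarrow> v \<in> car P \<Longrightarrow> pure3 P 0 u v \<tau> = 0"
  using linear_on_0[OF trilinear_formD(3)[OF pure3_tri] vsP] linear_on_0[OF trilinear_formD(1)[OF pure3_tri] vsP]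
  by blast+

context
  fixes D
  assumes D: "hcomul D"
begin

lemma D_lin_ctensor: "linear_on P (ctensor P G) D"
  using D unfolding hcomul_def by blast

lemmas D_mem = linear_on_mem[OF D_lin_ctensor]

lemma D_deg: "p \<in> G k \<Longrightarrow> i + j \<noteq> k - m \<Longrightarrow> D p (i, j) = 0"
  using D unfolding hcomul_def by blast

lemma D_lin: "linear_on P (tensor P P) (\<lambda>p. D p (i, j))"
  using D_lin_ctensor blk_car[OF car2D[OF D_mem]] unfolding linear_on_def by (simp add: ctensor_def)

lemma left_bil:
  "bilinear_on P P scalars (\<lambda>u w. D u (i, j) (\<lambda>x y. pure3 P x y (component G k w) \<tau>))"
proof (rule bilinear_formI)
  fix w
  show "linear_on P scalars (\<lambda>u. D u (i, j) (\<lambda>x y. pure3 P x y (component G k w) \<tau>))"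
    by (rule lin_eval[OF D_lin])
next
  fix u assume u: "u \<in> car P"
  note cc = linear_on_mem[OF componentP_lin]
  show "linear_on P scalars (\<lambda>w. D u (i, j) (\<lambda>x y. pure3 P x y (component G k w) \<tau>))"
    by (rule tens_param[OF blk_car[OF car2D[OF D_mem[OF u]]] vsP vsP trilinear_bilinear(1)[OF pure3_tri cc]
      linear_on_comp[OF trilinear_formD(3)[OF pure3_tri] componentP_lin]])
qed

lemma right_bil:
  "bilinear_on P P scalars (\<lambda>u w. D w (i, j) (\<lambda>x y. pure3 P (component G k u) x y \<tau>))"
proof (rule bilinear_formI)
  fix w
  show "linear_on P scalars (\<lambda>u. D u (i, j) (\<lambda>x y. pure3 P (component G k w) x y \<tau>))"
    by (rule lin_eval[OF D_lin])
next
  fix u assume u: "u \<in> car P"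
  note cc = linear_on_mem[OF componentP_lin]
  show "linear_on P scalars (\<lambda>w. D u (i, j) (\<lambda>x y. pure3 P (component G k w) x y \<tau>))"
    by (rule tens_param[OF blk_car[OF car2D[OF D_mem[OF u]]] vsP vsP trilinear_bilinear(3)[OF pure3_tri cc]
      linear_on_comp[OF trilinear_formD(1)[OF pure3_tri] componentP_lin]])
qed

text \<open>Component \<open>(i, j, k)\<close> forces \<open>w\<close> to have degree
  \<open>k\<close> and, as \<open>D\<close> shifts the total degree by \<open>- m\<close>,
  \<open>u\<close> to have degree \<open>i + j + m\<close>. So one block of \<open>t\<close>
  contributes.\<close>

lemma left_term_0:
  assumes t: "t \<in> blk x y" and ne: "(x, y) \<noteq> (i + j + m, k)"
  shows "lift2 (\<lambda>u w. ctens_left P G (D u) w (i, j, k)) t = 0"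
proof (rule ext)
  fix \<tau>
  have "t (\<lambda>u w. D u (i, j) (\<lambda>x y. pure3 P x y (component G k w) \<tau>)) = t (\<lambda>_ _. 0)"
  proof (rule blk_cong[OF t left_bil bilin_intros(1)])
    fix a b a' b' assume ab: "a \<in> car A" "b \<in> H x" "a' \<in> car A" "b' \<in> H y"
    note p = pt_G[OF ab(1,2)] and q = pt_G[OF ab(3,4)]
    note tc = blk_car[OF car2D[OF D_mem[OF G_car[OF p]]]]
    show "D (a \<otimes> b) (i, j) (\<lambda>x y. pure3 P x y (component G k (a' \<otimes> b')) \<tau>) = 0"
    proof (cases "y = k")
      case True
      then show ?thesis using D_deg[OF p, of i j] ne by simp
    next
      case False
      have "D (a \<otimes> b) (i, j) (\<lambda>x y. pure3 P x y 0 \<tau>) = D (a \<otimes> b) (i, j) (\<lambda>_ _. 0)"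
        by (rule tens_cong[OF tc vsP trilinear_bilinear(1)[OF pure3_tri is_vspaceD(1)[OF vsP]] bilin_intros(1) pure3_0(1)])
      then show ?thesis using False by (simp add: componentP_hom[OF q] tens_zero[OF tc vsP])
    qed
  qed
  then show "lift2 (\<lambda>u w. ctens_left P G (D u) w (i, j, k)) t \<tau> = 0 \<tau>"
    using tens_zero[OF blk_car[OF t] vsP] by (simp add: lift2_def ctens_left_def)
qed

lemma right_term_0:
  assumes t: "t \<in> blk x y" and ne: "(x, y) \<noteq> (i, j + k + m)"
  shows "lift2 (\<lambda>u w. ctens_right P G u (D w) (i, j, k)) t = 0"
proof (rule ext)
  fix \<tau>
  have "t (\<lambda>u w. D w (j, k) (\<lambda>x y. pure3 P (component G i u) x y \<tau>)) = t (\<lambda>_ _. 0)"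
  proof (rule blk_cong[OF t bilin_swap[OF right_bil, THEN bilin_swap] bilin_intros(1)])
    fix a b a' b' assume ab: "a \<in> car A" "b \<in> H x" "a' \<in> car A" "b' \<in> H y"
    note p = pt_G[OF ab(1,2)] and q = pt_G[OF ab(3,4)]
    note tc = blk_car[OF car2D[OF D_mem[OF G_car[OF q]]]]
    show "D (a' \<otimes> b') (j, k) (\<lambda>x y. pure3 P (component G i (a \<otimes> b)) x y \<tau>) = 0"
    proof (cases "x = i")
      case True
      then show ?thesis using D_deg[OF q, of j k] ne by simp
    next
      case False
      have "D (a' \<otimes> b') (j, k) (\<lambda>x y. pure3 P 0 x y \<tau>) = D (a' \<otimes> b') (j, k) (\<lambda>_ _. 0)"
        by (rule tens_cong[OF tc vsP trilinear_bilinear(3)[OF pure3_tri is_vspaceD(1)[OF vsP]] bilin_intros(1) pure3_0(2)])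
      then show ?thesis using False by (simp add: componentP_hom[OF p] tens_zero[OF tc vsP])
    qed
  qed
  then show "lift2 (\<lambda>u w. ctens_right P G u (D w) (i, j, k)) t \<tau> = 0 \<tau>"
    using tens_zero[OF blk_car[OF t] vsP] by (simp add: lift2_def ctens_right_def)
qed

context
  fixes t
  assumes t: "t \<in> car (ctensor P G)"
begin

lemma summable_D: "comul_summable P G D t"
proof -
  have "{p. cterm (\<lambda>u w. ctens_left P G (D u) w) t (i, j, k) p \<noteq> 0} \<subseteq> {(i + j + m, k)}" for i j k
    using left_term_0[OF car2D[OF t]] by (auto simp: cterm_def)
  moreover have "{p. cterm (\<lambda>u w. ctens_right P G u (D w)) t (i, j, k) p \<noteq> 0} \<subseteq> {(i, j + k + m)}" for i j k
    using right_term_0[OF car2D[OF t]] by (auto simp: cterm_def)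
  ultimately show ?thesis
    unfolding comul_summable_def csummable_def split_paired_All
    by (intro conjI allI) (rule finite_subset, assumption, simp)+
qed

lemma ccomul_left_blk: "ccomul_left P G D t (i, j, k) = lift2 (\<lambda>u w. ctens_left P G (D u) w (i, j, k)) (t (i + j + m, k))"
proof -
  have "cterm (\<lambda>u w. ctens_left P G (D u) w) t (i, j, k) q = 0" if "q \<noteq> (i + j + m, k)" for q
    using left_term_0[OF car2D[OF t], of "fst q" "snd q" i j k] that by (simp add: cterm_def)
  then show ?thesis
    unfolding ccomul_left_def clift_def by (subst Sum_any_single) (auto simp: cterm_def)
qed

lemma ccomul_right_blk: "ccomul_right P G D t (i, j, k) = lift2 (\<lambda>u w. ctens_right P G u (D w) (i, j, k)) (t (i, j + k + m))"
proof -
  have "cterm (\<lambda>u w. ctens_right P G u (D w)) t (i, j, k) q = 0" if "q \<noteq> (i, j + k + m)" for q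
    using right_term_0[OF car2D[OF t], of "fst q" "snd q" i j k] that by (simp add: cterm_def)
  then show ?thesis
    unfolding ccomul_right_def clift_def by (subst Sum_any_single) (auto simp: cterm_def)
qed

lemma ccomul_left_mem: "ccomul_left P G D t \<in> car3"
  unfolding car3_def mem_Collect_eq
proof (intro allI)
  fix i j k
  show "ccomul_left P G D t (i, j, k) \<in> blk3 i j k"
    unfolding ccomul_left_blk
  proof (rule lift2_mem[OF car2D[OF t] G_sub G_sub G_scl _ subtensor3_closed(1,2)])
    show "bilinear_on P P scalars (\<lambda>u v. ctens_left P G (D u) v (i, j, k) \<beta>)" for \<beta>
      unfolding ctens_left_def prod.case lift2_def by (rule left_bil)
    fix u w assume u: "u \<in> G (i + j + m)" and w: "w \<in> G k"
    have wk: "component G k w \<in> G k" by (rule component_mem[OF gradedP G_car[OF w]])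
    show "ctens_left P G (D u) w (i, j, k) \<in> blk3 i j k"
      unfolding ctens_left_def prod.case
      by (rule lift2_mem[OF car2D[OF D_mem[OF G_car[OF u]]] G_sub G_sub G_scl
         trilinear_bilinear(1)[OF pure3_tri G_car[OF wk]] subtensor3_closed(1,2)])
       (assumption | rule pure3_mem wk)+
  qed
qed

lemma ccomul_right_mem: "ccomul_right P G D t \<in> car3"
  unfolding car3_def mem_Collect_eq
proof (intro allI)
  fix i j k
  show "ccomul_right P G D t (i, j, k) \<in> blk3 i j k"
    unfolding ccomul_right_blk
  proof (rule lift2_mem[OF car2D[OF t] G_sub G_sub G_scl _ subtensor3_closed(1,2)])
    show "bilinear_on P P scalars (\<lambda>u v. ctens_right P G u (D v) (i, j, k) \<beta>)" for \<beta>
      unfolding ctens_right_def prod.case lift2_def by (rule right_bil)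
    fix u w assume u: "u \<in> G i" and w: "w \<in> G (j + k + m)"
    have wk: "component G i u \<in> G i" by (rule component_mem[OF gradedP G_car[OF u]])
    show "ctens_right P G u (D w) (i, j, k) \<in> blk3 i j k"
      unfolding ctens_right_def prod.case
      by (rule lift2_mem[OF car2D[OF D_mem[OF G_car[OF w]]] G_sub G_sub G_scl
         trilinear_bilinear(3)[OF pure3_tri G_car[OF wk]] subtensor3_closed(1,2)])
       (assumption | rule pure3_mem wk)+
  qed
qed

end

end

lemma tst3_left:
  assumes "trilinear_form_on A \<gamma>" "c1 \<in> car B" "c2 \<in> car B" "c3 \<in> car B"
    and "a \<in> car A" "b \<in> car B" "q \<in> car P" "s \<in> car P"
  shows "tst3 \<gamma> c1 c2 c3 (a \<otimes> b) q s = tst (\<gamma> a) c2 c3 q s * \<omega> b c1"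
  unfolding tst3_def by (rule pure2_apply[OF tst3_inner[OF assms(1-4,7,8)]])

text \<open>The last factor is not the outermost one in \<open>tst3\<close>, so the factorisation is
  checked on pure tensors in the other two arguments.\<close>

lemma tst3_right:
  assumes g: "trilinear_form_on A \<gamma>" and c: "c1 \<in> car B" "c2 \<in> car B" "c3 \<in> car B"
    and ab: "a \<in> car A" "b \<in> car B" and p: "p \<in> car P" and q: "q \<in> car P"
  shows "tst3 \<gamma> c1 c2 c3 p q (a \<otimes> b) = tst (\<lambda>x y. \<gamma> x y a) c1 c2 p q * \<omega> b c3"
proof -
  note x = pt_car[OF ab] and g' = trilinear_bilinear(1)[OF g ab(1)]
  note t3 = tst3_tri[OF g c] and t2 = tst_bil[OF g' c(1,2)]
  show ?thesis
  proof (rule P_form_eq[OF p trilinear_formD(1)[OF t3 q x] lin_intros(6)[OF bilinear_onD2[OF t2 q]]])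
    fix a' b' assume ab': "a' \<in> car A" "b' \<in> car B"
    note y = pt_car[OF ab']
    show "tst3 \<gamma> c1 c2 c3 (a' \<otimes> b') q (a \<otimes> b) = tst (\<lambda>x y. \<gamma> x y a) c1 c2 (a' \<otimes> b') q * \<omega> b c3"
    proof (rule P_form_eq[OF q trilinear_formD(2)[OF t3 y x] lin_intros(6)[OF bilinear_onD1[OF t2 y]]])
      fix a'' b'' assume ab'': "a'' \<in> car A" "b'' \<in> car B"
      show "tst3 \<gamma> c1 c2 c3 (a' \<otimes> b') (a'' \<otimes> b'') (a \<otimes> b) = tst (\<lambda>x y. \<gamma> x y a) c1 c2 (a' \<otimes> b') (a'' \<otimes> b'') * \<omega> b c3"
        unfolding tst3_pt[OF g c ab' ab'' ab] tst_pt[OF g' c(1,2) ab' ab''] by simp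
    qed
  qed
qed

text \<open>The inner coproduct consumes \<open>c1\<close> and \<open>c2\<close> through
  \<open>pr2_iD\<close> and leaves a pairing with \<open>c1 \<diamondop> c2\<close> or
  \<open>c2 \<diamondop> c1\<close>; what remains is a pairing of \<open>t\<close> itself.\<close>

lemma pr3_ccomul_left:
  assumes d: "linear_on A (tensor A A) d" and t: "t \<in> car (ctensor P G)"
    and g: "trilinear_form_on A \<gamma>" and c: "c1 \<in> H k1" "c2 \<in> H k2" "c3 \<in> H k3"
  shows "pr3 (ccomul_left P G (iD d \<epsilon>) t) \<gamma> c1 c2 c3 =
    - pr2 t (\<lambda>u w. d u (\<lambda>x y. \<gamma> x y w)) (c1 \<diamondop> c2) c3
    - \<epsilon> * pr2 t (\<lambda>u w. d u (\<lambda>x y. \<gamma> y x w)) (c2 \<diamondop> c1) c3"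
proof -
  note D = hcomul_iD[OF d]
  note cc = H_car[OF c(1)] H_car[OF c(2)] H_car[OF c(3)]
  have deg: "k1 = - m - (- m - k1)" "k2 = - m - (- m - k2)" "k3 = - m - (- m - k3)" by simp_all
  note t3 = tst3_tri[OF g cc]
  have gb: "bilinear_on A A scalars (\<lambda>u w. d u (\<lambda>x y. \<gamma> x y w))"
    if g: "trilinear_form_on A \<gamma>" for \<gamma>
    by (rule bilinear_formI[OF tens_param[OF linear_on_mem[OF d] vsA vsA trilinear_bilinear(1)[OF g] trilinear_formD(3)[OF g]]
       lin_eval[OF d]])
  let ?L = "ccomul_left P G (iD d \<epsilon>) t"
  let ?F = "\<lambda>u w. iD d \<epsilon> u (- m - k1, - m - k2) (\<lambda>x y. pure3 P x y (component G (- m - k3) w) (tst3 \<gamma> c1 c2 c3))"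
  have "pr3 ?L \<gamma> c1 c2 c3 = ?L (- m - k1, - m - k2, - m - k3) (tst3 \<gamma> c1 c2 c3)"
    by (rule pr3_hom[OF ccomul_left_mem[OF D t] g c(1) deg(1) c(2) deg(2) c(3) deg(3)])
  \<comment> \<open>This degree is the partner of the degree \<open>k1 + k2\<close> of
    \<open>c1 \<diamondop> c2\<close>, as
    \<open>- m - k1 + (- m - k2) + m = - m - (k1 + k2)\<close>.\<close>
  also have "\<dots> = t (- m - k1 + (- m - k2) + m, - m - k3) ?F"
    unfolding ccomul_left_blk[OF D t] by (simp add: lift2_def ctens_left_def)
  also have "\<dots> = - 1 * pr2 t (\<lambda>u w. d u (\<lambda>x y. \<gamma> x y w)) (c1 \<diamondop> c2) c3
      + - \<epsilon> * pr2 t (\<lambda>u w. d u (\<lambda>x y. \<gamma> y x w)) (c2 \<diamondop> c1) c3"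
  proof (rule pr2_eval[OF t left_bil[OF D] gb[OF g] gb[OF trilinear_permute(2)[OF g]]])
    fix a b a' b'
    assume ab: "a \<in> car A" "b \<in> H (- m - k1 + (- m - k2) + m)" "a' \<in> car A" "b' \<in> H (- m - k3)"
    note xc = ab(1) H_car[OF ab(2)] and yc = ab(3) H_car[OF ab(4)]
    note xp = pt_car[OF xc] and yp = pt_car[OF yc]
    note g' = trilinear_bilinear(1)[OF g ab(3)]
    let ?D = "iD d \<epsilon> (a \<otimes> b)"
    note Dm = D_mem[OF D xp]
    note tb = tst_bil[OF g' cc(1,2)]
    have "?F (a \<otimes> b) (a' \<otimes> b') = ?D (- m - k1, - m - k2) (\<lambda>p q. tst3 \<gamma> c1 c2 c3 p q (a' \<otimes> b'))"
      unfolding componentP_hom[OF pt_G[OF ab(3,4)]] by (simp add: pure3_apply[OF t3])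
    also have "\<dots> = ?D (- m - k1, - m - k2) (\<lambda>p q. tst (\<lambda>x y. \<gamma> x y a') c1 c2 p q * \<omega> b' c3)"
      by (rule tens_cong[OF blk_car[OF car2D[OF Dm]] vsP trilinear_bilinear(1)[OF t3 yp]
        bilin_intros(6)[OF tb] tst3_right[OF g cc yc]])
    also have "\<dots> = pr2 ?D (\<lambda>x y. \<gamma> x y a') c1 c2 * \<omega> b' c3"
      unfolding tens_multc[OF blk_car[OF car2D[OF Dm]] vsP tb] pr2_hom[OF Dm g' c(1) deg(1) c(2) deg(2)] ..
    also have "\<dots> = - 1 * (d a (\<lambda>x y. \<gamma> x y a') * (\<omega> b (c1 \<diamondop> c2) * \<omega> b' c3))
        + - \<epsilon> * (d a (\<lambda>x y. \<gamma> y x a') * (\<omega> b (c2 \<diamondop> c1) * \<omega> b' c3))"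
      unfolding pr2_iD[OF d xc g' c(1,2)] by (simp add: algebra_simps)
    finally show "?F (a \<otimes> b) (a' \<otimes> b') = - 1 * (d a (\<lambda>x y. \<gamma> x y a') * (\<omega> b (c1 \<diamondop> c2) * \<omega> b' c3))
        + - \<epsilon> * (d a (\<lambda>x y. \<gamma> y x a') * (\<omega> b (c2 \<diamondop> c1) * \<omega> b' c3))" .
  qed (use dia_degree[OF c(1,2)] dia_degree[OF c(2,1)] c(3) in \<open>simp_all add: algebra_simps\<close>)
  finally show ?thesis by simp
qed

lemma pr3_ccomul_right:
  assumes d: "linear_on A (tensor A A) d" and t: "t \<in> car (ctensor P G)"
    and g: "trilinear_form_on A \<gamma>" and c: "c1 \<in> H k1" "c2 \<in> H k2" "c3 \<in> H k3"
  shows "pr3 (ccomul_right P G (iD d \<epsilon>) t) \<gamma> c1 c2 c3 =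
    - pr2 t (\<lambda>u w. d w (\<lambda>x y. \<gamma> u x y)) c1 (c2 \<diamondop> c3)
    - \<epsilon> * pr2 t (\<lambda>u w. d w (\<lambda>x y. \<gamma> u y x)) c1 (c3 \<diamondop> c2)"
proof -
  note D = hcomul_iD[OF d]
  note cc = H_car[OF c(1)] H_car[OF c(2)] H_car[OF c(3)]
  have deg: "k1 = - m - (- m - k1)" "k2 = - m - (- m - k2)" "k3 = - m - (- m - k3)" by simp_all
  note t3 = tst3_tri[OF g cc]
  have gb: "bilinear_on A A scalars (\<lambda>u w. d w (\<lambda>x y. \<gamma> u x y))"
    if g: "trilinear_form_on A \<gamma>" for \<gamma>
    by (rule bilinear_formI[OF lin_eval[OF d] tens_param[OF linear_on_mem[OF d] vsA vsA trilinear_bilinear(3)[OF g] trilinear_formD(1)[OF g]]])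
  let ?L = "ccomul_right P G (iD d \<epsilon>) t"
  let ?F = "\<lambda>u w. iD d \<epsilon> w (- m - k2, - m - k3) (\<lambda>x y. pure3 P (component G (- m - k1) u) x y (tst3 \<gamma> c1 c2 c3))"
  have "pr3 ?L \<gamma> c1 c2 c3 = ?L (- m - k1, - m - k2, - m - k3) (tst3 \<gamma> c1 c2 c3)"
    by (rule pr3_hom[OF ccomul_right_mem[OF D t] g c(1) deg(1) c(2) deg(2) c(3) deg(3)])
  also have "\<dots> = t (- m - k1, - m - k2 + (- m - k3) + m) ?F"
    unfolding ccomul_right_blk[OF D t] by (simp add: lift2_def ctens_right_def)
  also have "\<dots> = - 1 * pr2 t (\<lambda>u w. d w (\<lambda>x y. \<gamma> u x y)) c1 (c2 \<diamondop> c3)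
      + - \<epsilon> * pr2 t (\<lambda>u w. d w (\<lambda>x y. \<gamma> u y x)) c1 (c3 \<diamondop> c2)"
  proof (rule pr2_eval[OF t right_bil[OF D] gb[OF g] gb[OF trilinear_permute(1)[OF g]]])
    fix a b a' b'
    assume ab: "a \<in> car A" "b \<in> H (- m - k1)" "a' \<in> car A" "b' \<in> H (- m - k2 + (- m - k3) + m)"
    note xc = ab(1) H_car[OF ab(2)] and yc = ab(3) H_car[OF ab(4)]
    note xp = pt_car[OF xc] and yp = pt_car[OF yc]
    note g' = trilinear_bilinear(3)[OF g ab(1)]
    let ?D = "iD d \<epsilon> (a' \<otimes> b')"
    note Dm = D_mem[OF D yp]
    note tb = tst_bil[OF g' cc(2,3)]
    have "?F (a \<otimes> b) (a' \<otimes> b') = ?D (- m - k2, - m - k3) (\<lambda>p q. tst3 \<gamma> c1 c2 c3 (a \<otimes> b) p q)"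
      unfolding componentP_hom[OF pt_G[OF ab(1,2)]] by (simp add: pure3_apply[OF t3])
    also have "\<dots> = ?D (- m - k2, - m - k3) (\<lambda>p q. tst (\<gamma> a) c2 c3 p q * \<omega> b c1)"
      by (rule tens_cong[OF blk_car[OF car2D[OF Dm]] vsP trilinear_bilinear(3)[OF t3 xp]
        bilin_intros(6)[OF tb] tst3_left[OF g cc xc]])
    also have "\<dots> = pr2 ?D (\<gamma> a) c2 c3 * \<omega> b c1"
      unfolding tens_multc[OF blk_car[OF car2D[OF Dm]] vsP tb] pr2_hom[OF Dm g' c(2) deg(2) c(3) deg(3)] ..
    also have "\<dots> = - 1 * (d a' (\<lambda>x y. \<gamma> a x y) * (\<omega> b c1 * \<omega> b' (c2 \<diamondop> c3)))
        + - \<epsilon> * (d a' (\<lambda>x y. \<gamma> a y x) * (\<omega> b c1 * \<omega> b' (c3 \<diamondop> c2)))"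
      unfolding pr2_iD[OF d yc g' c(2,3)] by (simp add: algebra_simps)
    finally show "?F (a \<otimes> b) (a' \<otimes> b') = - 1 * (d a' (\<lambda>x y. \<gamma> a x y) * (\<omega> b c1 * \<omega> b' (c2 \<diamondop> c3)))
        + - \<epsilon> * (d a' (\<lambda>x y. \<gamma> a y x) * (\<omega> b c1 * \<omega> b' (c3 \<diamondop> c2)))" .
  qed (use dia_degree[OF c(2,3)] dia_degree[OF c(3,2)] c(1) in \<open>simp_all add: algebra_simps\<close>)
  finally show ?thesis by simp
qed

lemma cflip12_mem:
  assumes T: "T \<in> car3"
  shows "cflip12 P T \<in> car3"
  unfolding car3_def mem_Collect_eq
proof (intro allI)
  fix i j k
  have "flip12 P U \<in> blk3 i j k" if "U \<in> blk3 j i k" for U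
    using that G_sub G_sub G_sub
  proof (induction rule: subtensor3_induct)
    case (scl c u)
    then show ?case by (rule G_scl)
  next
    case zero
    have "flip12 P 0 = 0" by (simp add: flip12_def lift3_def fun_eq_iff)
    then show ?case using subtensor3_closed(1) by metis
  next
    case (add s u v w)
    have "flip12 P (s + pure3 P u v w) = flip12 P s + pure3 P v u w"
    proof (rule ext)
      fix \<tau>
      show "flip12 P (s + pure3 P u v w) \<tau> = (flip12 P s + pure3 P v u w) \<tau>"
        using pure3_apply[OF trilinear_permute(2)[OF pure3_tri], of u v w \<tau>] by (simp add: flip12_def lift3_def)
    qed
    then show ?case using add by (simp only: subtensor3_closed(2) pure3_mem)
  qed
  then show "cflip12 P T (i, j, k) \<in> blk3 i j k"
    unfolding cflip12_def prod.case using car3D[OF T] by blast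
qed

lemma pr3_cflip12:
  assumes T: "T \<in> car3" and g: "trilinear_form_on A \<gamma>" and c: "c1 \<in> H k1" "c2 \<in> H k2" "c3 \<in> H k3"
  shows "pr3 (cflip12 P T) \<gamma> c1 c2 c3 = pr3 T (\<lambda>x y z. \<gamma> y x z) c2 c1 c3"
proof -
  note cc = H_car[OF c(1)] H_car[OF c(2)] H_car[OF c(3)]
  note g' = trilinear_permute(2)[OF g]
  have deg: "k1 = - m - (- m - k1)" "k2 = - m - (- m - k2)" "k3 = - m - (- m - k3)" by simp_all
  note t3 = tst3_tri[OF g cc] and t3' = tst3_tri[OF g' cc(2,1,3)]
  have "pr3 (cflip12 P T) \<gamma> c1 c2 c3 = cflip12 P T (- m - k1, - m - k2, - m - k3) (tst3 \<gamma> c1 c2 c3)"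
    by (rule pr3_hom[OF cflip12_mem[OF T] g c(1) deg(1) c(2) deg(2) c(3) deg(3)])
  also have "\<dots> = T (- m - k2, - m - k1, - m - k3) (\<lambda>u v w. tst3 \<gamma> c1 c2 c3 v u w)"
    by (simp add: cflip12_def flip12_def lift3_def pure3_apply[OF t3])
  also have "\<dots> = (\<Sum>x\<in>{()}. T (- m - k2, - m - k1, - m - k3) (tst3 (\<lambda>x y z. \<gamma> y x z) c2 c1 c3))"
  proof (rule blk3_lin[OF car3D[OF T] _ t3' trilinear_permute(2)[OF t3]])
    fix a b a' b' a'' b''
    assume ab: "a \<in> car A" "b \<in> H (- m - k2)" "a' \<in> car A" "b' \<in> H (- m - k1)" "a'' \<in> car A" "b'' \<in> H (- m - k3)"
    note xc = ab(1) H_car[OF ab(2)] and yc = ab(3) H_car[OF ab(4)] and zc = ab(5) H_car[OF ab(6)]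
    show "tst3 \<gamma> c1 c2 c3 (a' \<otimes> b') (a \<otimes> b) (a'' \<otimes> b'') =
        (\<Sum>x\<in>{()}. tst3 (\<lambda>x y z. \<gamma> y x z) c2 c1 c3 (a \<otimes> b) (a' \<otimes> b') (a'' \<otimes> b''))"
      unfolding tst3_pt[OF g cc yc xc zc] tst3_pt[OF g' cc(2,1,3) xc yc zc] by simp
  qed simp
  also have "\<dots> = pr3 T (\<lambda>x y z. \<gamma> y x z) c2 c1 c3"
    unfolding pr3_hom[OF T g' c(2) deg(2) c(1) deg(1) c(3) deg(3)] by simp
  finally show ?thesis .
qed

context
  fixes d e :: "'a \<Rightarrow> ('k, 'a, 'a) tens2" and \<epsilon> \<eta> :: 'k
    and a :: 'a and b c1 c2 c3 :: 'b and k1 k2 k3 :: int and \<gamma> :: "'a \<Rightarrow> 'a \<Rightarrow> 'a \<Rightarrow> 'k"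
  assumes d: "linear_on A (tensor A A) d" and e: "linear_on A (tensor A A) e"
    and ab: "a \<in> car A" "b \<in> car B"
    and g: "trilinear_form_on A \<gamma>" and c: "c1 \<in> H k1" "c2 \<in> H k2" "c3 \<in> H k3"
begin

text \<open>Two applications of the coproduct formula give four terms. A word in three letters
  depends only on its last one, so \<open>c1 \<diamondop> c2 \<diamondop> c3\<close> and
  \<open>c2 \<diamondop> c1 \<diamondop> c3\<close> coincide and three words remain.\<close>

lemma pr3_left_iD:
  "pr3 (ccomul_left P G (iD d \<epsilon>) (iD e \<eta> (a \<otimes> b))) \<gamma> c1 c2 c3 =
    \<omega> b (c1 \<diamondop> (c2 \<diamondop> c3)) * (e a (\<lambda>u w. d u (\<lambda>x y. \<gamma> x y w)) + \<epsilon> * e a (\<lambda>u w. d u (\<lambda>x y. \<gamma> y x w)))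
    + \<omega> b (c1 \<diamondop> (c3 \<diamondop> c2)) * (\<eta> * e a (\<lambda>u w. d w (\<lambda>x y. \<gamma> x y u)))
    + \<omega> b (c2 \<diamondop> (c3 \<diamondop> c1)) * (\<epsilon> * \<eta> * e a (\<lambda>u w. d w (\<lambda>x y. \<gamma> y x u)))"
proof -
  note cc = H_car[OF c(1)] H_car[OF c(2)] H_car[OF c(3)]
  have gb: "bilinear_on A A scalars (\<lambda>u w. d u (\<lambda>x y. \<gamma> x y w))"
    if g: "trilinear_form_on A \<gamma>" for \<gamma>
    by (rule bilinear_formI[OF tens_param[OF linear_on_mem[OF d] vsA vsA trilinear_bilinear(1)[OF g] trilinear_formD(3)[OF g]]
       lin_eval[OF d]])
  have w: "c1 \<diamondop> c2 \<diamondop> c3 = c1 \<diamondop> (c2 \<diamondop> c3)" "c2 \<diamondop> c1 \<diamondop> c3 = c1 \<diamondop> (c2 \<diamondop> c3)"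
    "c3 \<diamondop> (c1 \<diamondop> c2) = c1 \<diamondop> (c3 \<diamondop> c2)" "c3 \<diamondop> (c2 \<diamondop> c1) = c2 \<diamondop> (c3 \<diamondop> c1)"
    using cc perm_left_commute by (simp_all add: perm_assoc[symmetric])
  show ?thesis
    unfolding pr3_ccomul_left[OF d iD_mem[OF e pt_car[OF ab]] g c]
      pr2_iD[OF e ab gb[OF g] dia_degree[OF c(1,2)] c(3)]
      pr2_iD[OF e ab gb[OF trilinear_permute(2)[OF g]] dia_degree[OF c(2,1)] c(3)] w
    by (simp add: algebra_simps)
qed

lemma pr3_right_iD:
  "pr3 (ccomul_right P G (iD d \<epsilon>) (iD e \<eta> (a \<otimes> b))) \<gamma> c1 c2 c3 =
    \<omega> b (c1 \<diamondop> (c2 \<diamondop> c3)) * (e a (\<lambda>u w. d w (\<lambda>x y. \<gamma> u x y)))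
    + \<omega> b (c1 \<diamondop> (c3 \<diamondop> c2)) * (\<epsilon> * e a (\<lambda>u w. d w (\<lambda>x y. \<gamma> u y x)))
    + \<omega> b (c2 \<diamondop> (c3 \<diamondop> c1)) * (\<eta> * (e a (\<lambda>u w. d u (\<lambda>x y. \<gamma> w x y)) + \<epsilon> * e a (\<lambda>u w. d u (\<lambda>x y. \<gamma> w y x))))"
proof -
  note cc = H_car[OF c(1)] H_car[OF c(2)] H_car[OF c(3)]
  have gb: "bilinear_on A A scalars (\<lambda>u w. d w (\<lambda>x y. \<gamma> u x y))"
    if g: "trilinear_form_on A \<gamma>" for \<gamma>
    by (rule bilinear_formI[OF lin_eval[OF d] tens_param[OF linear_on_mem[OF d] vsA vsA trilinear_bilinear(3)[OF g] trilinear_formD(1)[OF g]]])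
  have w: "c2 \<diamondop> c3 \<diamondop> c1 = c2 \<diamondop> (c3 \<diamondop> c1)" "c3 \<diamondop> c2 \<diamondop> c1 = c2 \<diamondop> (c3 \<diamondop> c1)"
    using cc perm_left_commute by (simp_all add: perm_assoc[symmetric])
  show ?thesis
    unfolding pr3_ccomul_right[OF d iD_mem[OF e pt_car[OF ab]] g c]
      pr2_iD[OF e ab gb[OF g] c(1) dia_degree[OF c(2,3)]]
      pr2_iD[OF e ab gb[OF trilinear_permute(1)[OF g]] c(1) dia_degree[OF c(3,2)]] w
    by (simp add: algebra_simps)
qed

end

lemma ccomul_add:
  assumes d: "linear_on A (tensor A A) d" and s: "s \<in> car (ctensor P G)" and t: "t \<in> car (ctensor P G)"
  shows "ccomul_left P G (iD d \<epsilon>) (s + t) = ccomul_left P G (iD d \<epsilon>) s + ccomul_left P G (iD d \<epsilon>) t"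
    and "ccomul_right P G (iD d \<epsilon>) (s + t) = ccomul_right P G (iD d \<epsilon>) s + ccomul_right P G (iD d \<epsilon>) t"
proof -
  note D = hcomul_iD[OF d]
  have st: "s + t \<in> car (ctensor P G)" using s t by (simp add: car2_iff subtensor_closed)
  show "ccomul_left P G (iD d \<epsilon>) (s + t) = ccomul_left P G (iD d \<epsilon>) s + ccomul_left P G (iD d \<epsilon>) t"
  proof (rule ext, clarify)
    fix i j k
    show "ccomul_left P G (iD d \<epsilon>) (s + t) (i, j, k) =
        (ccomul_left P G (iD d \<epsilon>) s + ccomul_left P G (iD d \<epsilon>) t) (i, j, k)"
      unfolding plus_fun_apply[of "ccomul_left P G (iD d \<epsilon>) s"] ccomul_left_blk[OF D st]
        ccomul_left_blk[OF D s] ccomul_left_blk[OF D t] plus_fun_apply[of s] lift2_add ..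
  qed
  show "ccomul_right P G (iD d \<epsilon>) (s + t) = ccomul_right P G (iD d \<epsilon>) s + ccomul_right P G (iD d \<epsilon>) t"
  proof (rule ext, clarify)
    fix i j k
    show "ccomul_right P G (iD d \<epsilon>) (s + t) (i, j, k) =
        (ccomul_right P G (iD d \<epsilon>) s + ccomul_right P G (iD d \<epsilon>) t) (i, j, k)"
      unfolding plus_fun_apply[of "ccomul_right P G (iD d \<epsilon>) s"] ccomul_right_blk[OF D st]
        ccomul_right_blk[OF D s] ccomul_right_blk[OF D t] plus_fun_apply[of s] lift2_add ..
  qed
qed

lemma cflip12_add: "cflip12 P (S + T) = cflip12 P S + cflip12 P T"
  by (simp add: cflip12_def flip12_def lift3_def fun_eq_iff)

lemma cflip_add: "cflip P (s + t) = cflip P s + cflip P t"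
  by (simp add: cflip_def flip_def lift2_def fun_eq_iff)

section \<open>Evaluation of operators on \<open>A \<otimes> A\<close>\<close>

lemma flipA_apply: "bilinear_on A A scalars \<gamma> \<Longrightarrow> flip A t \<gamma> = t (\<lambda>u v. \<gamma> v u)"
  by (simp add: flip_def lift2_def pure2_apply)

lemma tmap_apply: "bilinear_on A A scalars \<gamma> \<Longrightarrow> tmap A f g t \<gamma> = t (\<lambda>u v. \<gamma> (f u) (g v))"
  by (simp add: tmap_def lift2_def pure2_apply)

lemma tens_add_right:
  assumes t: "t \<in> car (tensor A A)" and g: "bilinear_on A A scalars \<gamma>" and h: "linear_on A A h" "linear_on A A h'"
  shows "t (\<lambda>u v. \<gamma> u (h v + h' v)) = t (\<lambda>u v. \<gamma> u (h v)) + t (\<lambda>u v. \<gamma> u (h' v))"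
    and "t (\<lambda>u v. \<gamma> (h u + h' u) v) = t (\<lambda>u v. \<gamma> (h u) v) + t (\<lambda>u v. \<gamma> (h' u) v)"
    and "t (\<lambda>u v. \<gamma> u (h v - h' v)) = t (\<lambda>u v. \<gamma> u (h v)) - t (\<lambda>u v. \<gamma> u (h' v))"
    and "t (\<lambda>u v. \<gamma> (h u - h' u) v) = t (\<lambda>u v. \<gamma> (h u) v) - t (\<lambda>u v. \<gamma> (h' u) v)"
proof -
  note r = bilin_comp[OF g linear_on_ident h(1)] bilin_comp[OF g linear_on_ident h(2)]
  note l = bilin_comp[OF g h(1) linear_on_ident] bilin_comp[OF g h(2) linear_on_ident]
  note m = linear_on_mem[OF h(1)] linear_on_mem[OF h(2)]
  have e: "\<gamma> u (h v + h' v) = \<gamma> u (h v) + \<gamma> u (h' v)" "\<gamma> (h v + h' v) u = \<gamma> (h v) u + \<gamma> (h' v) u"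
    "\<gamma> u (h v - h' v) = \<gamma> u (h v) - \<gamma> u (h' v)" "\<gamma> (h v - h' v) u = \<gamma> (h v) u - \<gamma> (h' v) u"
    if "u \<in> car A" "v \<in> car A" for u v
    using linear_form_add[OF bilinear_onD1[OF g that(1)] m[OF that(2)]]
      linear_form_add[OF bilinear_onD2[OF g that(1)] m[OF that(2)]]
      linear_on_diff[OF bilinear_onD1[OF g that(1)] vsA m[OF that(2)]]
      linear_on_diff[OF bilinear_onD2[OF g that(1)] vsA m[OF that(2)]] by simp_all
  have "t (\<lambda>u v. \<gamma> u (h v + h' v)) = t (\<lambda>u v. \<gamma> u (h v) + \<gamma> u (h' v))"
    by (rule tens_cong[OF t vsA bilin_cong[OF bilin_intros(2)[OF r] vsA vsA e(1)] bilin_intros(2)[OF r] e(1)])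
  then show "t (\<lambda>u v. \<gamma> u (h v + h' v)) = t (\<lambda>u v. \<gamma> u (h v)) + t (\<lambda>u v. \<gamma> u (h' v))"
    unfolding tens_add[OF t vsA r] .
  have "t (\<lambda>u v. \<gamma> (h u + h' u) v) = t (\<lambda>u v. \<gamma> (h u) v + \<gamma> (h' u) v)"
    by (rule tens_cong[OF t vsA bilin_cong[OF bilin_intros(2)[OF l] vsA vsA] bilin_intros(2)[OF l]]) (rule e(2); assumption)+
  then show "t (\<lambda>u v. \<gamma> (h u + h' u) v) = t (\<lambda>u v. \<gamma> (h u) v) + t (\<lambda>u v. \<gamma> (h' u) v)"
    unfolding tens_add[OF t vsA l] .
  have "t (\<lambda>u v. \<gamma> u (h v - h' v)) = t (\<lambda>u v. \<gamma> u (h v) - \<gamma> u (h' v))"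
    by (rule tens_cong[OF t vsA bilin_cong[OF bilin_intros(3)[OF r] vsA vsA e(3)] bilin_intros(3)[OF r] e(3)])
  then show "t (\<lambda>u v. \<gamma> u (h v - h' v)) = t (\<lambda>u v. \<gamma> u (h v)) - t (\<lambda>u v. \<gamma> u (h' v))"
    unfolding tens_diff[OF t vsA r] .
  have "t (\<lambda>u v. \<gamma> (h u - h' u) v) = t (\<lambda>u v. \<gamma> (h u) v - \<gamma> (h' u) v)"
    by (rule tens_cong[OF t vsA bilin_cong[OF bilin_intros(3)[OF l] vsA vsA] bilin_intros(3)[OF l]]) (rule e(4); assumption)+
  then show "t (\<lambda>u v. \<gamma> (h u - h' u) v) = t (\<lambda>u v. \<gamma> (h u) v) - t (\<lambda>u v. \<gamma> (h' u) v)"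
    unfolding tens_diff[OF t vsA l] .
qed

text \<open>Additivity can replace linearity because scalars are absorbed by pure tensors; the
  completed operators then only have to be shown additive.\<close>

lemma P_additive_eqI:
  fixes F F' :: "('k, 'a, 'b) tens2 \<Rightarrow> 'x::ab_group_add"
  assumes "p \<in> car P"
    and "\<And>s x. s \<in> car P \<Longrightarrow> x \<in> car P \<Longrightarrow> F (s + x) = F s + F x"
    and "\<And>s x. s \<in> car P \<Longrightarrow> x \<in> car P \<Longrightarrow> F' (s + x) = F' s + F' x"
    and "\<And>a b i. a \<in> car A \<Longrightarrow> b \<in> H i \<Longrightarrow> F (a \<otimes> b) = F' (a \<otimes> b)"
  shows "F p = F' p"
  using assms(1)
proof (induction rule: P_induct)
  case zero
  have "(0::('k, 'a, 'b) tens2) \<in> car P" by (rule is_vspaceD(1)[OF vsP])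
  from assms(2)[OF this this] assms(3)[OF this this] have "F 0 = 0" "F' 0 = 0" by simp_all
  then show ?case by metis
next
  case (add s a b i)
  then show ?case
    using assms(2)[OF add.hyps(1) ptH_car[OF add.hyps(2,3)]] assms(3)[OF add.hyps(1) ptH_car[OF add.hyps(2,3)]]
      assms(4)[OF add.hyps(2,3)] by metis
qed

lemma iD_add: "iD d \<epsilon> (p + q) = iD d \<epsilon> p + iD d \<epsilon> q"
  by (simp add: iD_def lift2_add fun_eq_iff)

section \<open>Coefficients in the compatibility axioms\<close>

context
  fixes b1 b2 c c' :: 'b and e1 e2 k l :: int
  assumes b: "b1 \<in> H e1" "b2 \<in> H e2" and c: "c \<in> H k" "c' \<in> H l"
begin

text \<open>Words paired with \<open>b2\<close> are rewritten as words paired with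
  \<open>b1\<close>. In the first two, self-adjointness moves \<open>b1\<close> across and
  invariance splits the product \<open>b1 \<diamondop> b2\<close>; in the third, both
  \<open>c\<close> and \<open>c'\<close> are moved across.\<close>

lemma words:
  "\<omega> b2 (b1 \<diamondop> (c \<diamondop> c')) = \<omega> b1 (b2 \<diamondop> (c \<diamondop> c')) - \<omega> b1 (c \<diamondop> (c' \<diamondop> b2))"
  "\<omega> b2 (b1 \<diamondop> (c' \<diamondop> c)) = \<omega> b1 (b2 \<diamondop> (c' \<diamondop> c)) - \<omega> b1 (c \<diamondop> (c' \<diamondop> b2))"
  "\<omega> b2 (c \<diamondop> (c' \<diamondop> b1)) = - \<omega> b1 (c \<diamondop> (c' \<diamondop> b2))"
proof -
  note cc = H_car[OF b(1)] H_car[OF b(2)] H_car[OF c(1)] H_car[OF c(2)]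
  note cd = dia_car
  have w: "c \<diamondop> c' \<diamondop> b2 = c \<diamondop> (c' \<diamondop> b2)" "c' \<diamondop> c \<diamondop> b2 = c \<diamondop> (c' \<diamondop> b2)"
    using cc perm_left_commute by (simp_all add: perm_assoc[symmetric])
  show "\<omega> b2 (b1 \<diamondop> (c \<diamondop> c')) = \<omega> b1 (b2 \<diamondop> (c \<diamondop> c')) - \<omega> b1 (c \<diamondop> (c' \<diamondop> b2))"
    using om_left[of b1 b2 "c \<diamondop> c'"] om_right[of b1 b2 "c \<diamondop> c'"] cc by (simp add: cd w)
  show "\<omega> b2 (b1 \<diamondop> (c' \<diamondop> c)) = \<omega> b1 (b2 \<diamondop> (c' \<diamondop> c)) - \<omega> b1 (c \<diamondop> (c' \<diamondop> b2))"
    using om_left[of b1 b2 "c' \<diamondop> c"] om_right[of b1 b2 "c' \<diamondop> c"] cc by (simp add: cd w)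
  have "\<omega> b2 (c \<diamondop> (c' \<diamondop> b1)) = \<omega> (c \<diamondop> b2) (c' \<diamondop> b1)" using om_left[of c b2 "c' \<diamondop> b1"] cc by (simp add: cd)
  also have "\<dots> = \<omega> (c' \<diamondop> (c \<diamondop> b2)) b1" using om_left[of c' "c \<diamondop> b2" b1] cc by (simp add: cd)
  also have "\<dots> = - \<omega> b1 (c' \<diamondop> (c \<diamondop> b2))" by (rule om_antisym) (simp_all add: cd cc)
  finally show "\<omega> b2 (c \<diamondop> (c' \<diamondop> b1)) = - \<omega> b1 (c \<diamondop> (c' \<diamondop> b2))"
    using perm_left_commute[of c c' b2] cc by simp
qed

lemma dia_diff_H: "b2 \<diamondop> c - c \<diamondop> b2 \<in> H (e2 + k)" "b2 \<diamondop> c' - c' \<diamondop> b2 \<in> H (e2 + l)"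
  using H_closed(3)[OF dia_degree[OF b(2) c(1)], of "c \<diamondop> b2"] dia_degree[OF c(1) b(2)]
    H_closed(3)[OF dia_degree[OF b(2) c(2)], of "c' \<diamondop> b2"] dia_degree[OF c(2) b(2)]
  by (simp_all add: add.commute)

end

context
  fixes \<mu> :: "'a \<Rightarrow> 'a \<Rightarrow> 'a" and d :: "'a \<Rightarrow> ('k, 'a, 'a) tens2" and \<epsilon> \<eta> :: 'k
    and a1 a2 :: 'a and b1 b2 c c' :: 'b and e1 e2 k l :: int and \<gamma> :: "'a \<Rightarrow> 'a \<Rightarrow> 'k"
  assumes mu: "bilinear_on A A A \<mu>" and d: "linear_on A (tensor A A) d"
    and a: "a1 \<in> car A" "a2 \<in> car A" and b: "b1 \<in> H e1" "b2 \<in> H e2"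
    and g: "bilinear_on A A scalars \<gamma>" and c: "c \<in> H k" "c' \<in> H l"
begin

lemma pr2_left_iD:
  "pr2 (ctmap P G (iop \<mu> \<epsilon> (a2 \<otimes> b2)) id (iD d \<eta> (a1 \<otimes> b1))) \<gamma> c c' =
    - (d a1 (\<lambda>x y. \<gamma> (\<mu> a2 x) y) * \<omega> b1 (b2 \<diamondop> (c \<diamondop> c')))
    - \<eta> * (d a1 (\<lambda>x y. \<gamma> (\<mu> a2 y) x) * \<omega> b1 (b2 \<diamondop> (c' \<diamondop> c)))
    - \<epsilon> * (\<eta> * (d a1 (\<lambda>x y. \<gamma> (\<mu> y a2) x) * (\<omega> b1 (b2 \<diamondop> (c' \<diamondop> c)) - \<omega> b1 (c \<diamondop> (c' \<diamondop> b2)))))"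
proof -
  note cc = H_car[OF b(1)] H_car[OF b(2)] H_car[OF c(1)] H_car[OF c(2)]
  note t = iD_mem[OF d ptH_car[OF a(1) b(1)]]
  note g1 = bilin_comp[OF g bilinear_onD1[OF mu a(2)] linear_on_ident]
  note g2 = bilin_comp[OF g bilinear_onD2[OF mu a(2)] linear_on_ident]
  \<comment> \<open>The commutator of \<open>b2\<close> and \<open>c\<close> acts as zero from the
    left by the perm identity, which removes one of the four terms.\<close>
  have w: "b2 \<diamondop> c \<diamondop> c' = b2 \<diamondop> (c \<diamondop> c')" "c' \<diamondop> (b2 \<diamondop> c) = b2 \<diamondop> (c' \<diamondop> c)"
    "(b2 \<diamondop> c - c \<diamondop> b2) \<diamondop> c' = 0"
    "\<omega> b1 (c' \<diamondop> (b2 \<diamondop> c - c \<diamondop> b2)) = \<omega> b1 (b2 \<diamondop> (c' \<diamondop> c)) - \<omega> b1 (c \<diamondop> (c' \<diamondop> b2))"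
    using cc perm_left_commute[of c' c b2] perm_left_commute[of c' b2 c] perm_commute[of b2 c c']
      linear_on_diff[OF dia_lin1[of c'] vsB, of "b2 \<diamondop> c" "c \<diamondop> b2"]
      linear_on_diff[OF dia_lin2[of c'] vsB, of "b2 \<diamondop> c" "c \<diamondop> b2"]
    by (simp_all add: perm_assoc[symmetric] dia_car om_diff2)
  show ?thesis
    unfolding pr2_ctmap_left[OF mu t a(2) b(2) g c]
      pr2_iD[OF d a(1) cc(1) g1 dia_degree[OF b(2) c(1)] c(2)] pr2_iD[OF d a(1) cc(1) g2 dia_diff_H(1)[OF b c] c(2)] w
      linear_on_0[OF om_lin2[OF cc(1)] vsB]
    by (simp add: algebra_simps)
qed

lemma pr2_right_iD:
  "pr2 (ctmap P G id (iop \<mu> \<epsilon> (a2 \<otimes> b2)) (iD d \<eta> (a1 \<otimes> b1))) \<gamma> c c' =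
    - (d a1 (\<lambda>x y. \<gamma> x (\<mu> a2 y)) * \<omega> b1 (b2 \<diamondop> (c \<diamondop> c')))
    - \<eta> * (d a1 (\<lambda>x y. \<gamma> y (\<mu> a2 x)) * \<omega> b1 (b2 \<diamondop> (c' \<diamondop> c)))
    - \<epsilon> * (d a1 (\<lambda>x y. \<gamma> x (\<mu> y a2)) * (\<omega> b1 (b2 \<diamondop> (c \<diamondop> c')) - \<omega> b1 (c \<diamondop> (c' \<diamondop> b2))))"
proof -
  note cc = H_car[OF b(1)] H_car[OF b(2)] H_car[OF c(1)] H_car[OF c(2)]
  note t = iD_mem[OF d ptH_car[OF a(1) b(1)]]
  note g1 = bilin_comp[OF g linear_on_ident bilinear_onD1[OF mu a(2)]]
  note g2 = bilin_comp[OF g linear_on_ident bilinear_onD2[OF mu a(2)]]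
  have w: "b2 \<diamondop> c' \<diamondop> c = b2 \<diamondop> (c' \<diamondop> c)" "c \<diamondop> (b2 \<diamondop> c') = b2 \<diamondop> (c \<diamondop> c')"
    "(b2 \<diamondop> c' - c' \<diamondop> b2) \<diamondop> c = 0"
    "\<omega> b1 (c \<diamondop> (b2 \<diamondop> c' - c' \<diamondop> b2)) = \<omega> b1 (b2 \<diamondop> (c \<diamondop> c')) - \<omega> b1 (c \<diamondop> (c' \<diamondop> b2))"
    using cc perm_left_commute[of c b2 c'] perm_commute[of b2 c' c]
      linear_on_diff[OF dia_lin1[of c] vsB, of "b2 \<diamondop> c'" "c' \<diamondop> b2"]
      linear_on_diff[OF dia_lin2[of c] vsB, of "b2 \<diamondop> c'" "c' \<diamondop> b2"]
    by (simp_all add: perm_assoc[symmetric] dia_car om_diff2)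
  show ?thesis
    unfolding pr2_ctmap_right[OF mu t a(2) b(2) g c]
      pr2_iD[OF d a(1) cc(1) g1 c(1) dia_degree[OF b(2) c(2)]] pr2_iD[OF d a(1) cc(1) g2 c(1) dia_diff_H(2)[OF b c]] w
      linear_on_0[OF om_lin2[OF cc(1)] vsB]
    by (simp add: algebra_simps)
qed

lemma pr2_iD_iop:
  "pr2 (iD d \<eta> (iop \<mu> \<epsilon> (a1 \<otimes> b1) (a2 \<otimes> b2))) \<gamma> c c' =
    - (d (\<mu> a1 a2) \<gamma> * (\<omega> b1 (b2 \<diamondop> (c \<diamondop> c')) - \<omega> b1 (c \<diamondop> (c' \<diamondop> b2))))
    - \<eta> * (d (\<mu> a1 a2) (\<lambda>x y. \<gamma> y x) * (\<omega> b1 (b2 \<diamondop> (c' \<diamondop> c)) - \<omega> b1 (c \<diamondop> (c' \<diamondop> b2))))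
    - \<epsilon> * (d (\<mu> a2 a1) \<gamma> * \<omega> b1 (b2 \<diamondop> (c \<diamondop> c')) + \<eta> * (d (\<mu> a2 a1) (\<lambda>x y. \<gamma> y x) * \<omega> b1 (b2 \<diamondop> (c' \<diamondop> c))))"
proof -
  note cc = H_car[OF b(1)] H_car[OF b(2)] H_car[OF c(1)] H_car[OF c(2)]
  have kl: "k = - m - (- m - k)" "l = - m - (- m - l)" by simp_all
  note mc = mu_car[OF mu a] mu_car[OF mu a(2,1)] dia_car[OF cc(1,2)] dia_car[OF cc(2,1)]
  note p1 = pt_car[OF mc(1,3)] and p2 = pt_car[OF mc(2,4)]
  have w: "c \<diamondop> c' \<diamondop> b2 = c \<diamondop> (c' \<diamondop> b2)" "c' \<diamondop> c \<diamondop> b2 = c \<diamondop> (c' \<diamondop> b2)"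
    using cc perm_left_commute by (simp_all add: perm_assoc[symmetric])
  have ww: "\<omega> (b1 \<diamondop> b2) (c \<diamondop> c') = \<omega> b1 (b2 \<diamondop> (c \<diamondop> c')) - \<omega> b1 (c \<diamondop> (c' \<diamondop> b2))"
    "\<omega> (b1 \<diamondop> b2) (c' \<diamondop> c) = \<omega> b1 (b2 \<diamondop> (c' \<diamondop> c)) - \<omega> b1 (c \<diamondop> (c' \<diamondop> b2))"
    "\<omega> (b2 \<diamondop> b1) (c \<diamondop> c') = \<omega> b1 (b2 \<diamondop> (c \<diamondop> c'))"
    "\<omega> (b2 \<diamondop> b1) (c' \<diamondop> c) = \<omega> b1 (b2 \<diamondop> (c' \<diamondop> c))"
    using om_right[of b1 b2 "c \<diamondop> c'"] om_right[of b1 b2 "c' \<diamondop> c"] om_left[of b2 b1 "c \<diamondop> c'"] om_left[of b2 b1 "c' \<diamondop> c"]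
    by (simp_all add: cc dia_car w)
  have m: "iop \<mu> \<epsilon> (a1 \<otimes> b1) (a2 \<otimes> b2) \<in> car P"
    by (rule iop_car[OF mu pt_car[OF a(1) cc(1)] pt_car[OF a(2) cc(2)]])
  have "iD d \<eta> (iop \<mu> \<epsilon> (a1 \<otimes> b1) (a2 \<otimes> b2)) ij \<beta> =
      iD d \<eta> (\<mu> a1 a2 \<otimes> (b1 \<diamondop> b2)) ij \<beta> + \<epsilon> * iD d \<eta> (\<mu> a2 a1 \<otimes> (b2 \<diamondop> b1)) ij \<beta>" for ij \<beta>
    unfolding iop_pt[OF mu a(1) cc(1) a(2) cc(2)] psi_def iD_add
    by (simp add: iD_def lift2_scl fun_scl_apply)
  then have "pr2 (iD d \<eta> (iop \<mu> \<epsilon> (a1 \<otimes> b1) (a2 \<otimes> b2))) \<gamma> c c' =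
      pr2 (iD d \<eta> (\<mu> a1 a2 \<otimes> (b1 \<diamondop> b2))) \<gamma> c c' + \<epsilon> * pr2 (iD d \<eta> (\<mu> a2 a1 \<otimes> (b2 \<diamondop> b1))) \<gamma> c c'"
    unfolding pr2_hom[OF iD_mem[OF d m] g c(1) kl(1) c(2) kl(2)] pr2_hom[OF iD_mem[OF d p1] g c(1) kl(1) c(2) kl(2)]
      pr2_hom[OF iD_mem[OF d p2] g c(1) kl(1) c(2) kl(2)] by simp
  then show ?thesis
    unfolding pr2_iD[OF d mc(1,3) g c] pr2_iD[OF d mc(2,4) g c] ww by (simp add: algebra_simps)
qed

end

end

section \<open>The axioms of the pre-Poisson bialgebra, evaluated at forms\<close>

locale induced_bialgebra = induced_algebra B H dia om m A ast circ + pre_Poisson_bialgebra A ast circ vth th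
  for B :: "('k::field, 'b::ab_group_add) vspace"
    and H :: "int \<Rightarrow> 'b set"
    and dia :: "'b \<Rightarrow> 'b \<Rightarrow> 'b" (infixl "\<diamondop>" 70)
    and om :: "'b \<Rightarrow> 'b \<Rightarrow> 'k" ("\<omega>")
    and m :: int
    and A :: "('k, 'a::ab_group_add) vspace"
    and ast :: "'a \<Rightarrow> 'a \<Rightarrow> 'a" (infixl "\<^bold>*" 70)
    and circ :: "'a \<Rightarrow> 'a \<Rightarrow> 'a" (infixl "\<^bold>\<circ>" 70)
    and vth :: "'a \<Rightarrow> ('k, 'a, 'a) tens2" ("\<vartheta>")
    and th :: "'a \<Rightarrow> ('k, 'a, 'a) tens2" ("\<theta>")
begin

abbreviation "\<Delta> \<equiv> iD \<vartheta> 1"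
abbreviation "\<delta> \<equiv> iD \<theta> (- 1)"

lemmas vth_mem = linear_on_mem[OF vth_linear]
lemmas th_mem = linear_on_mem[OF th_linear]

lemma bil_vth_left: "trilinear_form_on A \<tau> \<Longrightarrow> bilinear_on A A scalars (\<lambda>u w. \<vartheta> u (\<lambda>x y. \<tau> x y w))"
  by (rule bilinear_formI[OF tens_param[OF vth_mem vsA vsA trilinear_bilinear(1) trilinear_formD(3)] lin_eval[OF vth_linear]])

lemma bil_th_left: "trilinear_form_on A \<tau> \<Longrightarrow> bilinear_on A A scalars (\<lambda>u w. \<theta> u (\<lambda>x y. \<tau> x y w))"
  by (rule bilinear_formI[OF tens_param[OF th_mem vsA vsA trilinear_bilinear(1) trilinear_formD(3)] lin_eval[OF th_linear]])

context
  fixes a and \<tau> :: "'a \<Rightarrow> 'a \<Rightarrow> 'a \<Rightarrow> 'k"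
  assumes a: "a \<in> car A" and t: "trilinear_form_on A \<tau>"
begin

lemmas p3 = pure3_apply[OF t] pure3_apply[OF trilinear_permute(2)[OF t]]

lemma co_zinbiel_eval:
  "\<vartheta> a (\<lambda>u w. \<vartheta> w (\<lambda>x y. \<tau> u x y)) = \<vartheta> a (\<lambda>u w. \<vartheta> u (\<lambda>x y. \<tau> x y w)) + \<vartheta> a (\<lambda>u w. \<vartheta> u (\<lambda>x y. \<tau> y x w))"
  using fun_cong[OF co_zinbiel[OF a], of \<tau>]
  by (simp add: comul_left_def comul_right_def flip12_def lift2_def lift3_def p3)

lemma co_pre_Lie_eval:
  "\<theta> a (\<lambda>u w. \<theta> w (\<lambda>x y. \<tau> u x y)) - \<theta> a (\<lambda>u w. \<theta> w (\<lambda>x y. \<tau> x u y))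
    = \<theta> a (\<lambda>u w. \<theta> u (\<lambda>x y. \<tau> x y w)) - \<theta> a (\<lambda>u w. \<theta> u (\<lambda>x y. \<tau> y x w))"
  using fun_cong[OF co_pre_Lie[OF a], of \<tau>]
  by (simp add: comul_left_def comul_right_def flip12_def lift2_def lift3_def p3)

text \<open>The flip stands below the outer coproduct and can be evaluated only where
  \<open>w\<close> lies in the carrier, hence the detour through \<open>tens_cong\<close>.\<close>

lemma co_compat1_eval:
  "\<vartheta> a (\<lambda>u w. \<theta> u (\<lambda>x y. \<tau> x y w)) - \<vartheta> a (\<lambda>u w. \<theta> u (\<lambda>x y. \<tau> y x w))
    = \<theta> a (\<lambda>u w. \<vartheta> w (\<lambda>x y. \<tau> u x y)) - \<vartheta> a (\<lambda>u w. \<theta> w (\<lambda>x y. \<tau> x u y))"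
proof -
  note b = bil_th_left[OF t] bil_th_left[OF trilinear_permute(2)[OF t]]
  have "\<vartheta> a (\<lambda>u w. \<theta> u (\<lambda>x y. \<tau> x y w) - flip A (\<theta> u) (\<lambda>x y. \<tau> x y w))
      = \<vartheta> a (\<lambda>u w. \<theta> u (\<lambda>x y. \<tau> x y w) - \<theta> u (\<lambda>x y. \<tau> y x w))"
    by (rule tens_cong[OF vth_mem[OF a] vsA bilin_cong[OF bilin_intros(3)[OF b] vsA vsA] bilin_intros(3)[OF b]])
      (simp_all add: flipA_apply[OF trilinear_bilinear(1)[OF t]])
  then show ?thesis
    unfolding tens_diff[OF vth_mem[OF a] vsA b]
    using fun_cong[OF co_compat1[OF a], of \<tau>]
    by (simp add: comul_left_def comul_right_def flip12_def lift2_def lift3_def p3)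
qed

lemma co_compat2_eval:
  "\<theta> a (\<lambda>u w. \<vartheta> u (\<lambda>x y. \<tau> x y w)) + \<theta> a (\<lambda>u w. \<vartheta> u (\<lambda>x y. \<tau> y x w))
    = \<vartheta> a (\<lambda>u w. \<theta> w (\<lambda>x y. \<tau> u x y)) + \<vartheta> a (\<lambda>u w. \<theta> w (\<lambda>x y. \<tau> x u y))"
proof -
  note b = bil_vth_left[OF t] bil_vth_left[OF trilinear_permute(2)[OF t]]
  have "\<theta> a (\<lambda>u w. \<vartheta> u (\<lambda>x y. \<tau> x y w) + flip A (\<vartheta> u) (\<lambda>x y. \<tau> x y w))
      = \<theta> a (\<lambda>u w. \<vartheta> u (\<lambda>x y. \<tau> x y w) + \<vartheta> u (\<lambda>x y. \<tau> y x w))"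
    by (rule tens_cong[OF th_mem[OF a] vsA bilin_cong[OF bilin_intros(2)[OF b] vsA vsA] bilin_intros(2)[OF b]])
      (simp_all add: flipA_apply[OF trilinear_bilinear(1)[OF t]])
  then show ?thesis
    unfolding tens_add[OF th_mem[OF a] vsA b]
    using fun_cong[OF co_compat2[OF a], of \<tau>]
    by (simp add: comul_left_def comul_right_def flip12_def lift2_def lift3_def p3)
qed

end

context
  fixes a1 a2 and \<gamma> :: "'a \<Rightarrow> 'a \<Rightarrow> 'k"
  assumes a: "a1 \<in> car A" "a2 \<in> car A" and g: "bilinear_on A A scalars \<gamma>"
begin

lemmas mlin = bilinear_onD1[OF ast_bilinear a(1)] bilinear_onD1[OF ast_bilinear a(2)]
  bilinear_onD2[OF ast_bilinear a(1)] bilinear_onD2[OF ast_bilinear a(2)]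
  bilinear_onD1[OF circ_bilinear a(1)] bilinear_onD1[OF circ_bilinear a(2)]
  bilinear_onD2[OF circ_bilinear a(1)] bilinear_onD2[OF circ_bilinear a(2)]

lemmas op_eval = tmap_apply[OF g] tmap_apply[OF bilin_swap[OF g]] flipA_apply[OF g]
  bilin_comp[OF g linear_on_ident mlin(1), THEN flipA_apply] bilin_comp[OF g linear_on_ident mlin(2), THEN flipA_apply]
  bilin_comp[OF g linear_on_ident mlin(3), THEN flipA_apply] bilin_comp[OF g linear_on_ident mlin(4), THEN flipA_apply]
  bilin_comp[OF g linear_on_ident mlin(5), THEN flipA_apply] bilin_comp[OF g linear_on_ident mlin(6), THEN flipA_apply]
  bilin_comp[OF g linear_on_ident mlin(7), THEN flipA_apply] bilin_comp[OF g linear_on_ident mlin(8), THEN flipA_apply]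
  bilin_comp[OF g mlin(1) linear_on_ident, THEN flipA_apply] bilin_comp[OF g mlin(2) linear_on_ident, THEN flipA_apply]
  bilin_comp[OF g mlin(3) linear_on_ident, THEN flipA_apply] bilin_comp[OF g mlin(4) linear_on_ident, THEN flipA_apply]
  bilin_comp[OF g mlin(5) linear_on_ident, THEN flipA_apply] bilin_comp[OF g mlin(6) linear_on_ident, THEN flipA_apply]
  bilin_comp[OF g mlin(7) linear_on_ident, THEN flipA_apply] bilin_comp[OF g mlin(8) linear_on_ident, THEN flipA_apply]

lemmas sums = tens_add_right[OF vth_mem[OF a(1)] g] tens_add_right[OF vth_mem[OF a(2)] g]
  tens_add_right[OF th_mem[OF a(1)] g] tens_add_right[OF th_mem[OF a(2)] g]

lemmas mc = ast_car[OF a] ast_car[OF a(2,1)] circ_car[OF a] circ_car[OF a(2,1)]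

lemma bialg1_eval:
  "\<vartheta> (a1 \<^bold>* a2) \<gamma> + \<vartheta> (a1 \<^bold>* a2) (\<lambda>x y. \<gamma> y x) = \<vartheta> a1 (\<lambda>x y. \<gamma> x (y \<^bold>* a2)) + \<vartheta> a2 (\<lambda>x y. \<gamma> (a1 \<^bold>* x) y)
    + \<vartheta> a2 (\<lambda>x y. \<gamma> (a1 \<^bold>* y) x)"
  using fun_cong[OF bialg1[OF a], of \<gamma>] by (simp add: op_eval)

lemma bialg2_eval:
  "\<vartheta> (a1 \<^bold>* a2) \<gamma> + \<vartheta> (a2 \<^bold>* a1) \<gamma> = \<vartheta> a2 (\<lambda>x y. \<gamma> (a1 \<^bold>* x) y)
    + (\<vartheta> a1 (\<lambda>x y. \<gamma> x (a2 \<^bold>* y)) + \<vartheta> a1 (\<lambda>x y. \<gamma> x (y \<^bold>* a2)))"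
  using fun_cong[OF bialg2[OF a], of \<gamma>]
  by (simp add: op_eval sums mlin linear_on_add[OF vth_linear mc(1,2)])

lemma bialg3_eval:
  "\<theta> (a1 \<^bold>\<circ> a2) \<gamma> - \<theta> (a1 \<^bold>\<circ> a2) (\<lambda>x y. \<gamma> y x) = \<theta> a2 (\<lambda>x y. \<gamma> (a1 \<^bold>\<circ> x) y) - \<theta> a2 (\<lambda>x y. \<gamma> (a1 \<^bold>\<circ> y) x)
    + (\<theta> a2 (\<lambda>x y. \<gamma> x (a1 \<^bold>\<circ> y)) - \<theta> a2 (\<lambda>x y. \<gamma> y (a1 \<^bold>\<circ> x)))
    + \<theta> a1 (\<lambda>x y. \<gamma> x (y \<^bold>\<circ> a2)) - \<theta> a1 (\<lambda>x y. \<gamma> (y \<^bold>\<circ> a2) x)"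
  using fun_cong[OF bialg3[OF a], of \<gamma>] by (simp add: op_eval)

lemma bialg4_eval:
  "\<theta> (a1 \<^bold>\<circ> a2) \<gamma> - \<theta> (a2 \<^bold>\<circ> a1) \<gamma> = (\<theta> a1 (\<lambda>x y. \<gamma> x (y \<^bold>\<circ> a2)) - \<theta> a1 (\<lambda>x y. \<gamma> x (a2 \<^bold>\<circ> y)))
    + (\<theta> a2 (\<lambda>x y. \<gamma> x (a1 \<^bold>\<circ> y)) - \<theta> a2 (\<lambda>x y. \<gamma> x (y \<^bold>\<circ> a1)))
    + \<theta> a2 (\<lambda>x y. \<gamma> (a1 \<^bold>\<circ> x) y) - \<theta> a1 (\<lambda>x y. \<gamma> (a2 \<^bold>\<circ> x) y)"
  using fun_cong[OF bialg4[OF a], of \<gamma>]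
  by (simp add: op_eval sums mlin linear_on_diff[OF th_linear vsA mc(3,4)])

lemma bialg5_eval:
  "\<theta> (a1 \<^bold>* a2) \<gamma> + \<theta> (a2 \<^bold>* a1) \<gamma> = (\<theta> a1 (\<lambda>x y. \<gamma> x (a2 \<^bold>* y)) + \<theta> a1 (\<lambda>x y. \<gamma> x (y \<^bold>* a2)))
    + (\<theta> a2 (\<lambda>x y. \<gamma> x (a1 \<^bold>* y)) + \<theta> a2 (\<lambda>x y. \<gamma> x (y \<^bold>* a1)))
    - \<vartheta> a2 (\<lambda>x y. \<gamma> (a1 \<^bold>\<circ> x) y) - \<vartheta> a1 (\<lambda>x y. \<gamma> (a2 \<^bold>\<circ> x) y)"
  using fun_cong[OF bialg5[OF a], of \<gamma>]
  by (simp add: op_eval sums mlin linear_on_add[OF th_linear mc(1,2)])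

lemma bialg6_eval:
  "\<vartheta> (a1 \<^bold>\<circ> a2) \<gamma> - \<vartheta> (a2 \<^bold>\<circ> a1) \<gamma> = \<theta> a1 (\<lambda>x y. \<gamma> (a2 \<^bold>* x) y)
    - (\<theta> a1 (\<lambda>x y. \<gamma> x (a2 \<^bold>* y)) + \<theta> a1 (\<lambda>x y. \<gamma> x (y \<^bold>* a2)))
    + \<vartheta> a2 (\<lambda>x y. \<gamma> (a1 \<^bold>\<circ> x) y) + (\<vartheta> a2 (\<lambda>x y. \<gamma> x (a1 \<^bold>\<circ> y)) - \<vartheta> a2 (\<lambda>x y. \<gamma> x (y \<^bold>\<circ> a1)))"
  using fun_cong[OF bialg6[OF a], of \<gamma>]
  by (simp add: op_eval sums mlin linear_on_diff[OF vth_linear vsA mc(3,4)])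

lemma bialg7_eval:
  "\<vartheta> (a1 \<^bold>\<circ> a2) \<gamma> + \<vartheta> (a1 \<^bold>\<circ> a2) (\<lambda>x y. \<gamma> y x) = - \<theta> a1 (\<lambda>x y. \<gamma> x (y \<^bold>* a2)) - \<theta> a1 (\<lambda>x y. \<gamma> (y \<^bold>* a2) x)
    + (\<vartheta> a2 (\<lambda>x y. \<gamma> (a1 \<^bold>\<circ> x) y) + \<vartheta> a2 (\<lambda>x y. \<gamma> (a1 \<^bold>\<circ> y) x))
    + (\<vartheta> a2 (\<lambda>x y. \<gamma> x (a1 \<^bold>\<circ> y)) + \<vartheta> a2 (\<lambda>x y. \<gamma> y (a1 \<^bold>\<circ> x)))"
  using fun_cong[OF bialg7[OF a], of \<gamma>] by (simp add: op_eval)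

lemma bialg8_eval:
  "\<theta> (a1 \<^bold>* a2) \<gamma> - \<theta> (a1 \<^bold>* a2) (\<lambda>x y. \<gamma> y x) = \<theta> a1 (\<lambda>x y. \<gamma> x (y \<^bold>* a2))
    + (\<theta> a2 (\<lambda>x y. \<gamma> x (a1 \<^bold>* y)) - \<theta> a2 (\<lambda>x y. \<gamma> y (a1 \<^bold>* x)))
    + \<vartheta> a1 (\<lambda>x y. \<gamma> (y \<^bold>\<circ> a2) x)
    - (\<vartheta> a2 (\<lambda>x y. \<gamma> (a1 \<^bold>\<circ> x) y) + \<vartheta> a2 (\<lambda>x y. \<gamma> (a1 \<^bold>\<circ> y) x))"
  using fun_cong[OF bialg8[OF a], of \<gamma>] by (simp add: op_eval)

end

lemmas coproduct_mem = iD_mem[OF vth_linear] iD_mem[OF th_linear]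
lemmas left_mem = ccomul_left_mem[OF hcomul_iD[OF vth_linear]] ccomul_left_mem[OF hcomul_iD[OF th_linear]]
lemmas right_mem = ccomul_right_mem[OF hcomul_iD[OF vth_linear]] ccomul_right_mem[OF hcomul_iD[OF th_linear]]
lemmas left_iD = pr3_left_iD[OF vth_linear vth_linear] pr3_left_iD[OF vth_linear th_linear]
  pr3_left_iD[OF th_linear vth_linear] pr3_left_iD[OF th_linear th_linear]
lemmas right_iD = pr3_right_iD[OF vth_linear vth_linear] pr3_right_iD[OF vth_linear th_linear]
  pr3_right_iD[OF th_linear vth_linear] pr3_right_iD[OF th_linear th_linear]
lemmas ccadd = ccomul_add[OF vth_linear] ccomul_add[OF th_linear]

section \<open>The coalgebra axioms\<close>

text \<open>The co-Zinbiel identity rewrites a second coproduct on the right factor as a sum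
  symmetric in the first two places. After this expansion the coefficients of the three words agree
  on both sides.\<close>

lemma coassoc_pure:
  assumes ab: "a \<in> car A" "b \<in> H i"
  shows "ccomul_left P G \<Delta> (\<Delta> (a \<otimes> b)) = ccomul_right P G \<Delta> (\<Delta> (a \<otimes> b))"
proof -
  note p = ptH_car[OF ab] and bc = H_car[OF ab(2)]
  show ?thesis
  proof (rule sep3[OF left_mem(1)[OF coproduct_mem(1)[OF p]] right_mem(1)[OF coproduct_mem(1)[OF p]]])
    fix \<gamma> k1 k2 k3 c1 c2 c3
    assume g: "trilinear_form_on A \<gamma>" and c: "c1 \<in> H k1" "c2 \<in> H k2" "c3 \<in> H k3"
    note z = co_zinbiel_eval[OF ab(1)]
    note tp = trilinear_permute[OF g]
    show "pr3 (ccomul_left P G \<Delta> (\<Delta> (a \<otimes> b))) \<gamma> c1 c2 c3 = pr3 (ccomul_right P G \<Delta> (\<Delta> (a \<otimes> b))) \<gamma> c1 c2 c3"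
      unfolding left_iD(1)[OF ab(1) bc g c] right_iD(1)[OF ab(1) bc g c]
        z[OF g] z[OF tp(1)] z[OF tp(3)] z[OF tp(5)] z[OF tp(4)] z[OF tp(2)]
      by (simp add: algebra_simps)
  qed
qed

lemma co_Jacobi_pure:
  assumes ab: "a \<in> car A" "b \<in> H i"
  shows "ccomul_right P G \<delta> (\<delta> (a \<otimes> b)) - cflip12 P (ccomul_right P G \<delta> (\<delta> (a \<otimes> b)))
    = ccomul_left P G \<delta> (\<delta> (a \<otimes> b))"
proof -
  note p = ptH_car[OF ab] and bc = H_car[OF ab(2)]
  note r = right_mem(2)[OF coproduct_mem(2)[OF p]]
  show ?thesis
  proof (rule sep3[OF car3_closed(2)[OF r cflip12_mem[OF r]] left_mem(2)[OF coproduct_mem(2)[OF p]]])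
    fix \<gamma> k1 k2 k3 c1 c2 c3
    assume g: "trilinear_form_on A \<gamma>" and c: "c1 \<in> H k1" "c2 \<in> H k2" "c3 \<in> H k3"
    note z = co_pre_Lie_eval[OF ab(1)]
    note tp = trilinear_permute[OF g]
    \<comment> \<open>The flip exchanges \<open>c1\<close> and \<open>c2\<close>, which does not
      change the last letter \<open>c3\<close>; so no new word arises.\<close>
    have w: "c2 \<diamondop> (c1 \<diamondop> c3) = c1 \<diamondop> (c2 \<diamondop> c3)"
      using perm_left_commute c[THEN H_car] by blast
    show "pr3 (ccomul_right P G \<delta> (\<delta> (a \<otimes> b)) - cflip12 P (ccomul_right P G \<delta> (\<delta> (a \<otimes> b)))) \<gamma> c1 c2 c3
      = pr3 (ccomul_left P G \<delta> (\<delta> (a \<otimes> b))) \<gamma> c1 c2 c3"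
      unfolding pr3_add(2)[OF r cflip12_mem[OF r] g c] pr3_cflip12[OF r g c]
        left_iD(4)[OF ab(1) bc g c] right_iD(4)[OF ab(1) bc g c] right_iD(4)[OF ab(1) bc tp(2) c(2,1,3)] w
      using z[OF g] z[OF tp(4)] z[OF tp(5)] z[OF tp(1)] z[OF tp(2)] z[OF tp(3)]
      by algebra
  qed
qed

text \<open>The words ending in \<open>c3\<close> and \<open>c2\<close> give the first compatibility
  condition of the coalgebra, the word ending in \<open>c1\<close> the second.\<close>

lemma co_Leibniz_pure:
  assumes ab: "a \<in> car A" "b \<in> H i"
  shows "ccomul_right P G \<Delta> (\<delta> (a \<otimes> b))
    = ccomul_left P G \<delta> (\<Delta> (a \<otimes> b)) + cflip12 P (ccomul_right P G \<delta> (\<Delta> (a \<otimes> b)))"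
proof -
  note p = ptH_car[OF ab] and bc = H_car[OF ab(2)]
  note r = right_mem(2)[OF coproduct_mem(1)[OF p]] and l = left_mem(2)[OF coproduct_mem(1)[OF p]]
  show ?thesis
  proof (rule sep3[OF right_mem(1)[OF coproduct_mem(2)[OF p]] car3_closed(1)[OF l cflip12_mem[OF r]]])
    fix \<gamma> k1 k2 k3 c1 c2 c3
    assume g: "trilinear_form_on A \<gamma>" and c: "c1 \<in> H k1" "c2 \<in> H k2" "c3 \<in> H k3"
    note z = co_compat1_eval[OF ab(1)] and z' = co_compat2_eval[OF ab(1)]
    note tp = trilinear_permute[OF g]
    have w: "c2 \<diamondop> (c1 \<diamondop> c3) = c1 \<diamondop> (c2 \<diamondop> c3)"
      using perm_left_commute c[THEN H_car] by blast
    show "pr3 (ccomul_right P G \<Delta> (\<delta> (a \<otimes> b))) \<gamma> c1 c2 c3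
      = pr3 (ccomul_left P G \<delta> (\<Delta> (a \<otimes> b)) + cflip12 P (ccomul_right P G \<delta> (\<Delta> (a \<otimes> b)))) \<gamma> c1 c2 c3"
      unfolding pr3_add(1)[OF l cflip12_mem[OF r] g c] pr3_cflip12[OF r g c]
        left_iD(3)[OF ab(1) bc g c] right_iD(2)[OF ab(1) bc g c] right_iD(3)[OF ab(1) bc tp(2) c(2,1,3)] w
      using z[OF g] z[OF tp(1)] z'[OF tp(3)] z'[OF tp(4)]
      by algebra
  qed
qed

lemma coassoc: "p \<in> car P \<Longrightarrow> ccomul_left P G \<Delta> (\<Delta> p) = ccomul_right P G \<Delta> (\<Delta> p)"
  by (rule P_additive_eqI[where F = "\<lambda>p. ccomul_left P G \<Delta> (\<Delta> p)" and F' = "\<lambda>p. ccomul_right P G \<Delta> (\<Delta> p)"])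
    (simp_all only: iD_add ccadd coproduct_mem coassoc_pure)

lemma coJacobi:
  "p \<in> car P \<Longrightarrow> ccomul_right P G \<delta> (\<delta> p) - cflip12 P (ccomul_right P G \<delta> (\<delta> p)) = ccomul_left P G \<delta> (\<delta> p)"
  by (rule P_additive_eqI[where F = "\<lambda>p. ccomul_right P G \<delta> (\<delta> p) - cflip12 P (ccomul_right P G \<delta> (\<delta> p))"
      and F' = "\<lambda>p. ccomul_left P G \<delta> (\<delta> p)"])
    (simp_all only: iD_add ccadd coproduct_mem co_Jacobi_pure cflip12_add add_diff_add)

lemma coLeibniz:
  "p \<in> car P \<Longrightarrow> ccomul_right P G \<Delta> (\<delta> p) = ccomul_left P G \<delta> (\<Delta> p) + cflip12 P (ccomul_right P G \<delta> (\<Delta> p))"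
  by (rule P_additive_eqI[where F = "\<lambda>p. ccomul_right P G \<Delta> (\<delta> p)"
      and F' = "\<lambda>p. ccomul_left P G \<delta> (\<Delta> p) + cflip12 P (ccomul_right P G \<delta> (\<Delta> p))"])
    (simp_all only: iD_add ccadd coproduct_mem co_Leibniz_pure cflip12_add ac_simps)

lemma Delta_flip: "p \<in> car P \<Longrightarrow> cflip P (\<Delta> p) = \<Delta> p"
proof (rule P_additive_eqI[where F = "\<lambda>p. cflip P (\<Delta> p)" and F' = \<Delta>])
  fix a b i assume ab: "a \<in> car A" "b \<in> H i"
  note t = coproduct_mem(1)[OF ptH_car[OF ab]]
  show "cflip P (\<Delta> (a \<otimes> b)) = \<Delta> (a \<otimes> b)"
    by (rule sep2[OF cflip_mem[OF t] t])
      (simp add: pr2_cflip[OF t] pr2_iD[OF vth_linear ab(1) H_car[OF ab(2)]] bilin_swap)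
qed (simp_all only: iD_add cflip_add)

lemma uminus_ctensor: "t \<in> car (ctensor P G) \<Longrightarrow> - t \<in> car (ctensor P G)"
  by (simp add: car2_iff subtensor_closed)

lemma plus_ctensor: "s \<in> car (ctensor P G) \<Longrightarrow> t \<in> car (ctensor P G) \<Longrightarrow> s + t \<in> car (ctensor P G)"
  and minus_ctensor: "s \<in> car (ctensor P G) \<Longrightarrow> t \<in> car (ctensor P G) \<Longrightarrow> s - t \<in> car (ctensor P G)"
  by (simp_all add: car2_iff subtensor_closed)

lemma delta_flip: "p \<in> car P \<Longrightarrow> cflip P (\<delta> p) = - \<delta> p"
proof (rule P_additive_eqI[where F = "\<lambda>p. cflip P (\<delta> p)" and F' = "\<lambda>p. - \<delta> p"])
  fix a b i assume ab: "a \<in> car A" "b \<in> H i"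
  note t = coproduct_mem(2)[OF ptH_car[OF ab]]
  show "cflip P (\<delta> (a \<otimes> b)) = - \<delta> (a \<otimes> b)"
    by (rule sep2[OF cflip_mem[OF t] uminus_ctensor[OF t]])
      (simp add: pr2_cflip[OF t] pr2_add(3)[OF t t] pr2_iD[OF th_linear ab(1) H_car[OF ab(2)]] bilin_swap)
qed (simp_all only: iD_add cflip_add minus_add_distrib)

section \<open>The compatibility axioms\<close>

lemma ctmap_iop_additive:
  assumes mu: "bilinear_on A A A \<mu>" and p: "p \<in> car P" and q: "q \<in> car P" and t: "t \<in> car (ctensor P G)"
  shows "ctmap P G (iop \<mu> \<epsilon> (p + q)) id t = ctmap P G (iop \<mu> \<epsilon> p) id t + ctmap P G (iop \<mu> \<epsilon> q) id t"
    and "ctmap P G id (iop \<mu> \<epsilon> (p + q)) t = ctmap P G id (iop \<mu> \<epsilon> p) t + ctmap P G id (iop \<mu> \<epsilon> q) t"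
  unfolding iop_add[OF mu]
  by (rule ctmap_add_op[OF t locfin_iop[OF mu p] locfin_iop[OF mu q] locfin_id])+

lemma ctmap_iop_add:
  assumes mu: "bilinear_on A A A \<mu>" and p: "p \<in> car P" and s: "s \<in> car (ctensor P G)" and t: "t \<in> car (ctensor P G)"
  shows "ctmap P G (iop \<mu> \<epsilon> p) id (s + t) = ctmap P G (iop \<mu> \<epsilon> p) id s + ctmap P G (iop \<mu> \<epsilon> p) id t"
    and "ctmap P G id (iop \<mu> \<epsilon> p) (s + t) = ctmap P G id (iop \<mu> \<epsilon> p) s + ctmap P G id (iop \<mu> \<epsilon> p) t"
  by (rule ctmap_add[OF s t locfin_iop[OF mu p] locfin_id], rule ctmap_add[OF s t locfin_id locfin_iop[OF mu p]])

lemmas ct_add = ctmap_iop_additive[OF ast_bilinear] ctmap_iop_additive[OF circ_bilinear]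
  ctmap_iop_add[OF ast_bilinear] ctmap_iop_add[OF circ_bilinear]

lemmas ct_mem = ctmap_mem[OF _ locfin_iop[OF ast_bilinear] locfin_id] ctmap_mem[OF _ locfin_id locfin_iop[OF ast_bilinear]]
  ctmap_mem[OF _ locfin_iop[OF circ_bilinear] locfin_id] ctmap_mem[OF _ locfin_id locfin_iop[OF circ_bilinear]]

lemma biadditive_eqI:
  fixes F F' :: "('k, 'a, 'b) tens2 \<Rightarrow> ('k, 'a, 'b) tens2 \<Rightarrow> 'x::ab_group_add"
  assumes p: "p \<in> car P" and q: "q \<in> car P"
    and 1: "\<And>s x q. s \<in> car P \<Longrightarrow> x \<in> car P \<Longrightarrow> q \<in> car P \<Longrightarrow> F (s + x) q = F s q + F x q"
      "\<And>s x q. s \<in> car P \<Longrightarrow> x \<in> car P \<Longrightarrow> q \<in> car P \<Longrightarrow> F q (s + x) = F q s + F q x"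
    and 2: "\<And>s x q. s \<in> car P \<Longrightarrow> x \<in> car P \<Longrightarrow> q \<in> car P \<Longrightarrow> F' (s + x) q = F' s q + F' x q"
      "\<And>s x q. s \<in> car P \<Longrightarrow> x \<in> car P \<Longrightarrow> q \<in> car P \<Longrightarrow> F' q (s + x) = F' q s + F' q x"
    and 3: "\<And>a b i a' b' j. a \<in> car A \<Longrightarrow> b \<in> H i \<Longrightarrow> a' \<in> car A \<Longrightarrow> b' \<in> H j \<Longrightarrow>
      F (a \<otimes> b) (a' \<otimes> b') = F' (a \<otimes> b) (a' \<otimes> b')"
  shows "F p q = F' p q"
proof (rule P_additive_eqI[where F = "\<lambda>p. F p q" and F' = "\<lambda>p. F' p q", OF p])
  fix a b i assume ab: "a \<in> car A" "b \<in> H i"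
  show "F (a \<otimes> b) q = F' (a \<otimes> b) q"
  proof (rule P_additive_eqI[where F = "F (a \<otimes> b)" and F' = "F' (a \<otimes> b)", OF q])
    fix a' b' j assume "a' \<in> car A" "b' \<in> H j"
    then show "F (a \<otimes> b) (a' \<otimes> b') = F' (a \<otimes> b) (a' \<otimes> b')" by (rule 3[OF ab])
  qed (simp_all only: 1 2 ptH_car[OF ab])
qed (simp_all only: 1 2 q)

context
  fixes a1 a2 b1 b2 e1 e2
  assumes a: "a1 \<in> car A" "a2 \<in> car A" and b: "b1 \<in> H e1" "b2 \<in> H e2"
begin

lemmas pq = ptH_car[OF a(1) b(1)] ptH_car[OF a(2) b(2)]

text \<open>The coefficient of \<open>b2 \<diamondop> (c \<diamondop> c')\<close> is
  \<open>bialg2\<close> for the exchanged pair \<open>a2\<close>, \<open>a1\<close>, that of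
  \<open>b2 \<diamondop> (c' \<diamondop> c)\<close> is \<open>bialg2\<close> at the swapped form,
  and that of \<open>c \<diamondop> (c' \<diamondop> b2)\<close> is \<open>bialg1\<close>.\<close>

lemma Delta_mul_pure:
  "\<Delta> (mul (a1 \<otimes> b1) (a2 \<otimes> b2))
    = ctmap P G (mul (a2 \<otimes> b2)) id (\<Delta> (a1 \<otimes> b1)) + ctmap P G id (mul (a1 \<otimes> b1)) (\<Delta> (a2 \<otimes> b2))"
proof -
  note x = ct_mem(1)[OF coproduct_mem(1)[OF pq(1)] pq(2), of 1 1] and y = ct_mem(2)[OF coproduct_mem(1)[OF pq(2)] pq(1), of 1 1]
  show ?thesis
  proof (rule sep2[OF coproduct_mem(1)[OF mul_car[OF pq]] plus_ctensor[OF x y]])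
    fix \<gamma> k l c c' assume g: "bilinear_on A A scalars \<gamma>" and c: "c \<in> H k" "c' \<in> H l"
    note gs = bilin_swap[OF g]
    show "pr2 (\<Delta> (mul (a1 \<otimes> b1) (a2 \<otimes> b2))) \<gamma> c c' = pr2 (ctmap P G (mul (a2 \<otimes> b2)) id (\<Delta> (a1 \<otimes> b1))
        + ctmap P G id (mul (a1 \<otimes> b1)) (\<Delta> (a2 \<otimes> b2))) \<gamma> c c'"
      unfolding pr2_add(1)[OF x y g c] pr2_iD_iop[OF ast_bilinear vth_linear a b g c]
        pr2_left_iD[OF ast_bilinear vth_linear a b g c]
        pr2_right_iD[OF ast_bilinear vth_linear a(2,1) b(2,1) g c]
        words[OF b c]
      \<comment> \<open>The goal is linear in the three words; \<open>algebra\<close> combines the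
        axioms with the words as coefficients.\<close>
      using bialg2_eval[OF a(2,1) g] bialg2_eval[OF a gs] bialg1_eval[OF a gs]
      by algebra
  qed
qed

text \<open>\<open>bialg4\<close>, at the form and at the swapped form, settles the two words that
  begin with \<open>b2\<close>, and \<open>bialg3\<close> the word that ends with it.\<close>

lemma delta_brk_pure:
  "\<delta> (brk (a1 \<otimes> b1) (a2 \<otimes> b2))
    = (ctmap P G (brk (a1 \<otimes> b1)) id (\<delta> (a2 \<otimes> b2)) + ctmap P G id (brk (a1 \<otimes> b1)) (\<delta> (a2 \<otimes> b2)))
      - (ctmap P G (brk (a2 \<otimes> b2)) id (\<delta> (a1 \<otimes> b1)) + ctmap P G id (brk (a2 \<otimes> b2)) (\<delta> (a1 \<otimes> b1)))"
proof -
  note x = ct_mem(3)[OF coproduct_mem(2)[OF pq(2)] pq(1), of "- 1" "- 1"] and y = ct_mem(4)[OF coproduct_mem(2)[OF pq(2)] pq(1), of "- 1" "- 1"]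
  note x' = ct_mem(3)[OF coproduct_mem(2)[OF pq(1)] pq(2), of "- 1" "- 1"] and y' = ct_mem(4)[OF coproduct_mem(2)[OF pq(1)] pq(2), of "- 1" "- 1"]
  note xy = plus_ctensor[OF x y] and xy' = plus_ctensor[OF x' y']
  show ?thesis
  proof (rule sep2[OF coproduct_mem(2)[OF brk_car[OF pq]] minus_ctensor[OF xy xy']])
    fix \<gamma> k l c c' assume g: "bilinear_on A A scalars \<gamma>" and c: "c \<in> H k" "c' \<in> H l"
    note gs = bilin_swap[OF g]
    show "pr2 (\<delta> (brk (a1 \<otimes> b1) (a2 \<otimes> b2))) \<gamma> c c' =
      pr2 ((ctmap P G (brk (a1 \<otimes> b1)) id (\<delta> (a2 \<otimes> b2)) + ctmap P G id (brk (a1 \<otimes> b1)) (\<delta> (a2 \<otimes> b2)))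
      - (ctmap P G (brk (a2 \<otimes> b2)) id (\<delta> (a1 \<otimes> b1)) + ctmap P G id (brk (a2 \<otimes> b2)) (\<delta> (a1 \<otimes> b1)))) \<gamma> c c'"
      unfolding pr2_add(2)[OF xy xy' g c] pr2_add(1)[OF x y g c] pr2_add(1)[OF x' y' g c]
        pr2_iD_iop[OF circ_bilinear th_linear a b g c]
        pr2_left_iD[OF circ_bilinear th_linear a b g c] pr2_left_iD[OF circ_bilinear th_linear a(2,1) b(2,1) g c]
        pr2_right_iD[OF circ_bilinear th_linear a b g c] pr2_right_iD[OF circ_bilinear th_linear a(2,1) b(2,1) g c]
        words[OF b c]
      using bialg4_eval[OF a g] bialg4_eval[OF a gs] bialg3_eval[OF a g]
      by algebra
  qed
qed

text \<open>\<open>bialg6\<close>, at the form and at the swapped form, settles the two words that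
  begin with \<open>b2\<close>, and \<open>bialg7\<close> the word that ends with it.\<close>

lemma Delta_brk_pure:
  "\<Delta> (brk (a1 \<otimes> b1) (a2 \<otimes> b2))
    = (ctmap P G (brk (a1 \<otimes> b1)) id (\<Delta> (a2 \<otimes> b2)) + ctmap P G id (brk (a1 \<otimes> b1)) (\<Delta> (a2 \<otimes> b2)))
      + (ctmap P G (mul (a2 \<otimes> b2)) id (\<delta> (a1 \<otimes> b1)) - ctmap P G id (mul (a2 \<otimes> b2)) (\<delta> (a1 \<otimes> b1)))"
proof -
  note x = ct_mem(3)[OF coproduct_mem(1)[OF pq(2)] pq(1), of "- 1" 1] and y = ct_mem(4)[OF coproduct_mem(1)[OF pq(2)] pq(1), of "- 1" 1]
  note x' = ct_mem(1)[OF coproduct_mem(2)[OF pq(1)] pq(2), of 1 "- 1"] and y' = ct_mem(2)[OF coproduct_mem(2)[OF pq(1)] pq(2), of 1 "- 1"]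
  note xy = plus_ctensor[OF x y] and xy' = minus_ctensor[OF x' y']
  show ?thesis
  proof (rule sep2[OF coproduct_mem(1)[OF brk_car[OF pq]] plus_ctensor[OF xy xy']])
    fix \<gamma> k l c c' assume g: "bilinear_on A A scalars \<gamma>" and c: "c \<in> H k" "c' \<in> H l"
    note gs = bilin_swap[OF g]
    show "pr2 (\<Delta> (brk (a1 \<otimes> b1) (a2 \<otimes> b2))) \<gamma> c c' =
      pr2 ((ctmap P G (brk (a1 \<otimes> b1)) id (\<Delta> (a2 \<otimes> b2)) + ctmap P G id (brk (a1 \<otimes> b1)) (\<Delta> (a2 \<otimes> b2)))
      + (ctmap P G (mul (a2 \<otimes> b2)) id (\<delta> (a1 \<otimes> b1)) - ctmap P G id (mul (a2 \<otimes> b2)) (\<delta> (a1 \<otimes> b1)))) \<gamma> c c'"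
      unfolding pr2_add(1)[OF xy xy' g c] pr2_add(1)[OF x y g c] pr2_add(2)[OF x' y' g c]
        pr2_iD_iop[OF circ_bilinear vth_linear a b g c]
        pr2_left_iD[OF ast_bilinear th_linear a b g c] pr2_left_iD[OF circ_bilinear vth_linear a(2,1) b(2,1) g c]
        pr2_right_iD[OF ast_bilinear th_linear a b g c] pr2_right_iD[OF circ_bilinear vth_linear a(2,1) b(2,1) g c]
        words[OF b c]
      using bialg6_eval[OF a g] bialg6_eval[OF a gs] bialg7_eval[OF a g]
      by algebra
  qed
qed

text \<open>\<open>bialg5\<close> at the swapped form is the coefficient of
  \<open>b2 \<diamondop> (c' \<diamondop> c)\<close>, and \<open>bialg8\<close> that of
  \<open>c \<diamondop> (c' \<diamondop> b2)\<close>. The coefficient of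
  \<open>b2 \<diamondop> (c \<diamondop> c')\<close> is not an axiom by itself but a combination of
  \<open>bialg5\<close> and of \<open>bialg8\<close> for both orders of \<open>a1\<close> and
  \<open>a2\<close>.\<close>

lemma delta_mul_pure:
  "\<delta> (mul (a1 \<otimes> b1) (a2 \<otimes> b2))
    = ctmap P G (mul (a1 \<otimes> b1)) id (\<delta> (a2 \<otimes> b2)) + ctmap P G (mul (a2 \<otimes> b2)) id (\<delta> (a1 \<otimes> b1))
      + ctmap P G id (brk (a1 \<otimes> b1)) (\<Delta> (a2 \<otimes> b2)) + ctmap P G id (brk (a2 \<otimes> b2)) (\<Delta> (a1 \<otimes> b1))"
proof -
  note x = ct_mem(1)[OF coproduct_mem(2)[OF pq(2)] pq(1), of 1 "- 1"] and y = ct_mem(1)[OF coproduct_mem(2)[OF pq(1)] pq(2), of 1 "- 1"]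
  note x' = ct_mem(4)[OF coproduct_mem(1)[OF pq(2)] pq(1), of "- 1" 1] and y' = ct_mem(4)[OF coproduct_mem(1)[OF pq(1)] pq(2), of "- 1" 1]
  note s1 = plus_ctensor[OF x y] note s2 = plus_ctensor[OF s1 x']
  show ?thesis
  proof (rule sep2[OF coproduct_mem(2)[OF mul_car[OF pq]] plus_ctensor[OF s2 y']])
    fix \<gamma> k l c c' assume g: "bilinear_on A A scalars \<gamma>" and c: "c \<in> H k" "c' \<in> H l"
    note gs = bilin_swap[OF g]
    show "pr2 (\<delta> (mul (a1 \<otimes> b1) (a2 \<otimes> b2))) \<gamma> c c' =
      pr2 (ctmap P G (mul (a1 \<otimes> b1)) id (\<delta> (a2 \<otimes> b2)) + ctmap P G (mul (a2 \<otimes> b2)) id (\<delta> (a1 \<otimes> b1))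
      + ctmap P G id (brk (a1 \<otimes> b1)) (\<Delta> (a2 \<otimes> b2)) + ctmap P G id (brk (a2 \<otimes> b2)) (\<Delta> (a1 \<otimes> b1))) \<gamma> c c'"
      unfolding pr2_add(1)[OF s2 y' g c] pr2_add(1)[OF s1 x' g c] pr2_add(1)[OF x y g c]
        pr2_iD_iop[OF ast_bilinear th_linear a b g c]
        pr2_left_iD[OF ast_bilinear th_linear a b g c] pr2_left_iD[OF ast_bilinear th_linear a(2,1) b(2,1) g c]
        pr2_right_iD[OF circ_bilinear vth_linear a b g c] pr2_right_iD[OF circ_bilinear vth_linear a(2,1) b(2,1) g c]
        words[OF b c]
      using bialg5_eval[OF a gs] bialg8_eval[OF a gs] bialg8_eval[OF a(2,1) gs]
      by algebra
  qed
qed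

end

lemmas mul_add = linear_on_add[OF mul_lin2] linear_on_add[OF mul_lin1]
lemmas brk_add = linear_on_add[OF brk_lin2] linear_on_add[OF brk_lin1]

lemma Delta_mul:
  "p \<in> car P \<Longrightarrow> q \<in> car P \<Longrightarrow> \<Delta> (mul p q) = ctmap P G (mul q) id (\<Delta> p) + ctmap P G id (mul p) (\<Delta> q)"
  by (rule biadditive_eqI[where F = "\<lambda>p q. \<Delta> (mul p q)" and F' = "\<lambda>p q. ctmap P G (mul q) id (\<Delta> p) + ctmap P G id (mul p) (\<Delta> q)"])
    (simp_all only: mul_add iD_add ct_add coproduct_mem Delta_mul_pure ac_simps)

lemma delta_brk:
  "p \<in> car P \<Longrightarrow> q \<in> car P \<Longrightarrow> \<delta> (brk p q) =
    (ctmap P G (brk p) id (\<delta> q) + ctmap P G id (brk p) (\<delta> q)) - (ctmap P G (brk q) id (\<delta> p) + ctmap P G id (brk q) (\<delta> p))"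
  by (rule biadditive_eqI[where F = "\<lambda>p q. \<delta> (brk p q)" and
      F' = "\<lambda>p q. (ctmap P G (brk p) id (\<delta> q) + ctmap P G id (brk p) (\<delta> q)) - (ctmap P G (brk q) id (\<delta> p) + ctmap P G id (brk q) (\<delta> p))"])
    (simp_all only: brk_add iD_add ct_add coproduct_mem delta_brk_pure add_diff_add ac_simps)

lemma Delta_brk:
  "p \<in> car P \<Longrightarrow> q \<in> car P \<Longrightarrow> \<Delta> (brk p q) =
    (ctmap P G (brk p) id (\<Delta> q) + ctmap P G id (brk p) (\<Delta> q)) + (ctmap P G (mul q) id (\<delta> p) - ctmap P G id (mul q) (\<delta> p))"
  by (rule biadditive_eqI[where F = "\<lambda>p q. \<Delta> (brk p q)" and
      F' = "\<lambda>p q. (ctmap P G (brk p) id (\<Delta> q) + ctmap P G id (brk p) (\<Delta> q)) + (ctmap P G (mul q) id (\<delta> p) - ctmap P G id (mul q) (\<delta> p))"])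
    (simp_all only: brk_add iD_add ct_add coproduct_mem Delta_brk_pure add_diff_add ac_simps)

lemma delta_mul:
  "p \<in> car P \<Longrightarrow> q \<in> car P \<Longrightarrow> \<delta> (mul p q) =
    ctmap P G (mul p) id (\<delta> q) + ctmap P G (mul q) id (\<delta> p) + ctmap P G id (brk p) (\<Delta> q) + ctmap P G id (brk q) (\<Delta> p)"
  by (rule biadditive_eqI[where F = "\<lambda>p q. \<delta> (mul p q)" and
      F' = "\<lambda>p q. ctmap P G (mul p) id (\<delta> q) + ctmap P G (mul q) id (\<delta> p) + ctmap P G id (brk p) (\<Delta> q) + ctmap P G id (brk q) (\<Delta> p)"])
    (simp_all only: mul_add iD_add ct_add coproduct_mem delta_mul_pure ac_simps)

lemma completed_Poisson: "completed_Poisson_bialgebra P G mul brk \<Delta> \<delta>"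
proof -
  interpret graded_Poisson_algebra P G mul brk by (rule graded_Poisson)
  show ?thesis
  proof
    show "linear_on P (ctensor P G) \<Delta>" "linear_on P (ctensor P G) \<delta>"
      by (rule iD_linear[OF vth_linear], rule iD_linear[OF th_linear])
    show "comul_summable P G \<Delta> (\<Delta> p) \<and> comul_summable P G \<Delta> (\<delta> p) \<and>
        comul_summable P G \<delta> (\<Delta> p) \<and> comul_summable P G \<delta> (\<delta> p)" if "p \<in> car P" for p
      by (intro conjI summable_D hcomul_iD vth_linear th_linear coproduct_mem that)
  qed (rule Delta_flip coassoc delta_flip coJacobi coLeibniz Delta_mul delta_brk Delta_brk delta_mul; assumption)+
qed

end

context induced_setting
begin

section \<open>Quadrilinear forms\<close>

text \<open>Linearity in each of four arguments, phrased through the first and the last pair because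
  each pair is contracted with one copy of a tensor.\<close>

definition Q4 :: "('k, 'v::ab_group_add) vspace \<Rightarrow> ('v \<Rightarrow> 'v \<Rightarrow> 'v \<Rightarrow> 'v \<Rightarrow> 'k) \<Rightarrow> bool" where
  "Q4 V F \<longleftrightarrow> (\<forall>u\<in>car V. \<forall>v\<in>car V. bilinear_on V V scalars (F u v)) \<and>
     (\<forall>u\<in>car V. \<forall>v\<in>car V. bilinear_on V V scalars (\<lambda>x y. F x y u v))"

lemma Q4I:
  assumes "\<And>u v. u \<in> car V \<Longrightarrow> v \<in> car V \<Longrightarrow> bilinear_on V V scalars (F u v)"
    and "\<And>u v. u \<in> car V \<Longrightarrow> v \<in> car V \<Longrightarrow> bilinear_on V V scalars (\<lambda>x y. F x y u v)"
  shows "Q4 V F"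
  using assms by (simp add: Q4_def)

lemma Q4D:
  assumes "Q4 V F"
  shows "u \<in> car V \<Longrightarrow> v \<in> car V \<Longrightarrow> bilinear_on V V scalars (F u v)"
    and "u \<in> car V \<Longrightarrow> v \<in> car V \<Longrightarrow> bilinear_on V V scalars (\<lambda>x y. F x y u v)"
  using assms by (simp_all add: Q4_def)

lemma Q4_swap:
  assumes "Q4 V F"
  shows "Q4 V (\<lambda>a a' x x'. F x x' a a')" "Q4 V (\<lambda>a a' x x'. F a' a x x')" "Q4 V (\<lambda>a a' x x'. F a a' x' x)"
  using assms by (auto simp: Q4_def intro: bilin_swap)

lemma Q4_inner:
  assumes "Q4 V F" "t \<in> car (tensor V V)" "is_vspace V"
  shows "bilinear_on V V scalars (\<lambda>u v. t (F u v))"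
  by (rule tens_bilin[OF assms(2,3,3,3) Q4D(1)[OF assms(1)] Q4D(2)[OF assms(1)]])

context
  fixes r :: "('k, 'a, 'a) tens2"
  assumes r: "r \<in> car (tensor A A)" and rs: "flip A r = r"
begin

abbreviation "RR F \<equiv> r (\<lambda>a a'. r (\<lambda>x x'. F a a' x x'))"

lemma r_sym: "bilinear_on A A scalars \<gamma> \<Longrightarrow> r (\<lambda>x y. \<gamma> y x) = r \<gamma>"
  using flipA_apply[of \<gamma> r] rs by simp

lemma RR_sym1: "Q4 A F \<Longrightarrow> RR (\<lambda>a a' x x'. F a' a x x') = RR F"
  by (rule r_sym[OF Q4_inner[OF _ r vsA]])

lemma RR_sym2:
  assumes F: "Q4 A F"
  shows "RR (\<lambda>a a' x x'. F a a' x' x) = RR F"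
  by (rule tens_cong[OF r vsA Q4_inner[OF Q4_swap(3)[OF F] r vsA] Q4_inner[OF F r vsA] r_sym[OF Q4D(1)[OF F]]])

lemma RR_swap: "Q4 A F \<Longrightarrow> RR (\<lambda>a a' x x'. F x x' a a') = RR F"
  by (rule tens_swap[OF r r vsA vsA vsA vsA Q4D(1)[OF Q4_swap(1)] Q4D(2)[OF Q4_swap(1)]])

lemma RR_lin:
  assumes F: "Q4 A F" and G: "Q4 A G1" "Q4 A G2"
    and eq: "\<And>a a' x x'. a \<in> car A \<Longrightarrow> a' \<in> car A \<Longrightarrow> x \<in> car A \<Longrightarrow> x' \<in> car A \<Longrightarrow>
      F a a' x x' = k1 * G1 a a' x x' + k2 * G2 a a' x x'"
  shows "RR F = k1 * RR G1 + k2 * RR G2"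
proof -
  note b = Q4D(1)[OF G(1)] Q4D(1)[OF G(2)]
  note i = Q4_inner[OF G(1) r vsA] Q4_inner[OF G(2) r vsA]
  have "RR F = r (\<lambda>a a'. k1 * r (G1 a a') + k2 * r (G2 a a'))"
  proof (rule tens_cong[OF r vsA Q4_inner[OF F r vsA] bilin_intros(2)[OF bilin_intros(5)[OF i(1)] bilin_intros(5)[OF i(2)]]])
    fix a a' assume a: "a \<in> car A" "a' \<in> car A"
    note b' = bilin_intros(5)[OF b(1)[OF a], of k1] bilin_intros(5)[OF b(2)[OF a], of k2]
    have "r (F a a') = r (\<lambda>x x'. k1 * G1 a a' x x' + k2 * G2 a a' x x')"
      by (rule tens_cong[OF r vsA Q4D(1)[OF F a] bilin_intros(2)[OF b'] eq[OF a]])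
    then show "r (F a a') = k1 * r (G1 a a') + k2 * r (G2 a a')"
      unfolding tens_add[OF r vsA b'] tens_cmult[OF r vsA b(1)[OF a]] tens_cmult[OF r vsA b(2)[OF a]] .
  qed
  then show ?thesis
    unfolding tens_add[OF r vsA bilin_intros(5)[OF i(1)] bilin_intros(5)[OF i(2)]] tens_cmult[OF r vsA i(1)]
      tens_cmult[OF r vsA i(2)] .
qed

text \<open>The canonical element of \<open>B \<hat>\<otimes> B\<close> defined by \<open>\<omega>\<close>, with the sign for which \<open>r \<bullet> kap\<close> induces
  \<open>\<Delta>\<close> and \<open>\<delta>\<close>.\<close>

definition kap :: "('k, 'b) ctens2" where
  "kap = (\<lambda>(i, j). if i + j = - m then - (\<Sum>e\<in>Eb i. pure2 B B e (fb i e)) else 0)"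

lemma kap_mem: "kap (i, j) \<in> subtensor B B (H i) (H j)"
proof (cases "i + j = - m")
  case True
  then have j: "j = - m - i" by simp
  show ?thesis
    unfolding kap_def prod.case j
    using subtensor_closed(4)[OF subtensor_closed(6)[of "Eb i"], OF pure2_mem[OF Eb_H fb_H]] by simp
next
  case False
  then show ?thesis unfolding kap_def prod.case using subtensor_closed(1) by metis
qed

lemma kap_apply:
  "bilinear_on B B scalars \<beta> \<Longrightarrow> kap (i, - m - i) \<beta> = - (\<Sum>e\<in>Eb i. \<beta> e (fb i e))"
  by (simp add: kap_def fun_sum_apply pure2_apply)

text \<open>On the antidiagonal, expansion of \<open>c\<close> in the dual vectors returns \<omega>
  with the sign built into \<open>kap\<close>; off the antidiagonal both sides are 0.\<close>

lemma kap_eval: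
  assumes c: "c \<in> H (- m - i)" "c' \<in> H (- m - j)"
  shows "kap (i, j) (\<lambda>x x'. \<omega> x c * \<omega> x' c') = - \<omega> c c'"
proof (cases "i + j = - m")
  case True
  then have j: "j = - m - i" by simp
  show ?thesis
    unfolding j kap_apply[OF omega2_bil[OF c[THEN H_car]]]
      fb_expand_form[OF om_lin1[OF H_car[OF c(2)]] c(1)] ..
next
  case False
  then have "\<omega> c c' = 0" using om_deg[OF _ c] by simp
  with False show ?thesis by (simp add: kap_def)
qed

section \<open>The skew-symmetric element of the completed square\<close>

definition R :: "('k, ('k, 'a, 'b) tens2) ctens2" where
  "R = bullet A B r kap"

lemma R_mem: "R \<in> car (ctensor P G)"
  unfolding R_def car2_iff using bullet_mem[where T = kap, OF r kap_mem] by blast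

lemma R_deg: "i + j \<noteq> - m \<Longrightarrow> R (i, j) = 0"
  using tens_zero[OF r vsA] by (simp add: R_def fun_eq_iff bullet_apply kap_def)

lemma pr2_R:
  assumes g: "bilinear_on A A scalars \<gamma>" and c: "c \<in> H k" "c' \<in> H l"
  shows "pr2 R \<gamma> c c' = - (r \<gamma> * \<omega> c c')"
proof -
  have kl: "k = - m - (- m - k)" "l = - m - (- m - l)" by simp_all
  show ?thesis
    unfolding R_def pr2_bullet[OF r kap_mem g c(1) kl(1) c(2) kl(2)]
    using kap_eval[of c "- m - k" c' "- m - l"] c by simp
qed

text \<open>Symmetry of \<open>r\<close> and antisymmetry of \<omega> combine to one sign.\<close>

lemma R_skew: "cflip P R = - R"
proof (rule sep2[OF cflip_mem[OF R_mem]])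
  show "- R \<in> car (ctensor P G)" using R_mem by (simp add: car2_iff subtensor_closed)
  fix \<gamma> k l c c' assume g: "bilinear_on A A scalars \<gamma>" and c: "c \<in> H k" "c' \<in> H l"
  show "pr2 (cflip P R) \<gamma> c c' = pr2 (- R) \<gamma> c c'"
    unfolding pr2_cflip[OF R_mem g c] pr2_add(3)[OF R_mem R_mem g c] pr2_R[OF g c] pr2_R[OF bilin_swap[OF g] c(2,1)]
      r_sym[OF g] using om_antisym[OF c[THEN H_car]] by simp
qed

lemma R_apply:
  assumes \<beta>: "bilinear_on P P scalars \<beta>"
  shows "R (i, - m - i) \<beta> = - (\<Sum>e\<in>Eb i. r (\<lambda>a a'. \<beta> (a \<otimes> e) (a' \<otimes> fb i e)))"
proof -
  have b: "bilinear_on A A scalars (\<lambda>a a'. \<beta> (a \<otimes> e) (a' \<otimes> fb i e))" if "e \<in> Eb i" for e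
    by (rule bilin_comp[OF \<beta> pt_lin1[OF Eb_car[OF that]] pt_lin1[OF fb_car[OF that]]])
  have "R (i, - m - i) \<beta> = r (\<lambda>a a'. - (\<Sum>e\<in>Eb i. \<beta> (a \<otimes> e) (a' \<otimes> fb i e)))"
    unfolding R_def bullet_apply
  proof (rule tens_cong[OF r vsA bullet_inner[OF subtensor_car[OF H_sub H_sub kap_mem]] bilin_intros(4)[OF bilin_sum[OF b]]])
    fix a a' assume a: "a \<in> car A" "a' \<in> car A"
    show "kap (i, - m - i) (\<lambda>b' b''. pure2 P P (a \<otimes> b') (a' \<otimes> b'') \<beta>) = - (\<Sum>e\<in>Eb i. \<beta> (a \<otimes> e) (a' \<otimes> fb i e))"
      using kap_apply[OF bilin_comp[OF pure2_eval pt_lin2[OF a(1)] pt_lin2[OF a(2)]], of i \<beta>] by (simp add: pure2_apply[OF \<beta>])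
  qed
  also have "\<dots> = - r (\<lambda>a a'. \<Sum>e\<in>Eb i. \<beta> (a \<otimes> e) (a' \<otimes> fb i e))"
    by (rule tens_minus[OF r vsA bilin_sum[OF b]])
  also have "r (\<lambda>a a'. \<Sum>e\<in>Eb i. \<beta> (a \<otimes> e) (a' \<otimes> fb i e)) = (\<Sum>e\<in>Eb i. r (\<lambda>a a'. \<beta> (a \<otimes> e) (a' \<otimes> fb i e)))"
    by (rule tens_sum[OF r vsA b])
  finally show ?thesis .
qed

lemma Q4_pt:
  assumes F: "Q4 P F" and b: "b1 \<in> car B" "b2 \<in> car B" "b3 \<in> car B" "b4 \<in> car B"
  shows "Q4 A (\<lambda>a a' x x'. F (a \<otimes> b1) (a' \<otimes> b2) (x \<otimes> b3) (x' \<otimes> b4))"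
  by (rule Q4I[OF bilin_comp[OF Q4D(1)[OF F pt_car[OF _ b(1)] pt_car[OF _ b(2)]] pt_lin1[OF b(3)] pt_lin1[OF b(4)]]
    bilin_comp[OF Q4D(2)[OF F pt_car[OF _ b(3)] pt_car[OF _ b(4)]] pt_lin1[OF b(1)] pt_lin1[OF b(2)]]])

text \<open>The signs of the two copies of \<open>kap\<close> cancel.\<close>

lemma R_R_apply:
  assumes F: "Q4 P F"
  shows "R (i, - m - i) (\<lambda>u v. R (j, - m - j) (F u v)) =
    (\<Sum>e\<in>Eb i. \<Sum>e'\<in>Eb j. RR (\<lambda>a a' x x'. F (a \<otimes> e) (a' \<otimes> fb i e) (x \<otimes> e') (x' \<otimes> fb j e')))"
proof -
  note Rc = blk_car[OF car2D[OF R_mem]]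
  have "r (\<lambda>a a'. R (j, - m - j) (F (a \<otimes> e) (a' \<otimes> fb i e))) =
      - (\<Sum>e'\<in>Eb j. RR (\<lambda>a a' x x'. F (a \<otimes> e) (a' \<otimes> fb i e) (x \<otimes> e') (x' \<otimes> fb j e')))"
    if e: "e \<in> Eb i" for e
  proof -
    note ec = Eb_car[OF e] fb_car[OF e]
    have q: "bilinear_on A A scalars (\<lambda>a a'. r (\<lambda>x x'. F (a \<otimes> e) (a' \<otimes> fb i e) (x \<otimes> e') (x' \<otimes> fb j e')))"
      if "e' \<in> Eb j" for e'
      by (rule Q4_inner[OF Q4_pt[OF F ec Eb_car[OF that] fb_car[OF that]] r vsA])
    have "r (\<lambda>a a'. R (j, - m - j) (F (a \<otimes> e) (a' \<otimes> fb i e))) =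
      r (\<lambda>a a'. - (\<Sum>e'\<in>Eb j. r (\<lambda>x x'. F (a \<otimes> e) (a' \<otimes> fb i e) (x \<otimes> e') (x' \<otimes> fb j e'))))"
      by (rule tens_cong[OF r vsA bilin_comp[OF Q4_inner[OF F Rc vsP] pt_lin1[OF ec(1)] pt_lin1[OF ec(2)]]
        bilin_intros(4)[OF bilin_sum[OF q]] R_apply[OF Q4D(1)[OF F pt_car[OF _ ec(1)] pt_car[OF _ ec(2)]]]])
    also have "\<dots> = - r (\<lambda>a a'. \<Sum>e'\<in>Eb j. r (\<lambda>x x'. F (a \<otimes> e) (a' \<otimes> fb i e) (x \<otimes> e') (x' \<otimes> fb j e')))"
      by (rule tens_minus[OF r vsA bilin_sum[OF q]])
    also have "r (\<lambda>a a'. \<Sum>e'\<in>Eb j. r (\<lambda>x x'. F (a \<otimes> e) (a' \<otimes> fb i e) (x \<otimes> e') (x' \<otimes> fb j e'))) =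
        (\<Sum>e'\<in>Eb j. RR (\<lambda>a a' x x'. F (a \<otimes> e) (a' \<otimes> fb i e) (x \<otimes> e') (x' \<otimes> fb j e')))"
      by (rule tens_sum[OF r vsA q])
    finally show ?thesis .
  qed
  then show ?thesis
    unfolding R_apply[OF Q4_inner[OF F Rc vsP]] by (simp add: sum_negf)
qed

lemma R_R_zero:
  assumes F: "Q4 P F" and z: "\<And>u v u' v'. u \<in> G i \<Longrightarrow> v \<in> G j \<Longrightarrow> u' \<in> G i' \<Longrightarrow> v' \<in> G j' \<Longrightarrow> F u v u' v' = 0"
  shows "R (i, j) (\<lambda>u v. R (i', j') (F u v)) = 0"
proof -
  note Rb = car2D[OF R_mem] and Rc = blk_car[OF car2D[OF R_mem]]
  have "R (i, j) (\<lambda>u v. R (i', j') (F u v)) = R (i, j) (\<lambda>_ _. 0)"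
  proof (rule subtensor_cong[OF Rb G_sub G_sub G_scl Q4_inner[OF F Rc vsP] bilin_intros(1)])
    fix u v assume uv: "u \<in> G i" "v \<in> G j"
    have "R (i', j') (F u v) = R (i', j') (\<lambda>_ _. 0)"
      by (rule subtensor_cong[OF Rb G_sub G_sub G_scl Q4D(1)[OF F G_car[OF uv(1)] G_car[OF uv(2)]] bilin_intros(1) z[OF uv]])
    then show "R (i', j') (F u v) = 0" using tens_zero[OF Rc vsP] by simp
  qed
  then show ?thesis using tens_zero[OF Rc vsP] by simp
qed

text \<open>\<open>R\<close> is supported on the antidiagonal \<open>i + j = - m\<close>. Hence
  fixing the degree of one leg in each copy of \<open>R\<close> fixes both blocks, and the sum over
  pairs of blocks reduces to the term \<open>pq\<close>.\<close>

lemma quad_block: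
  assumes Q: "\<And>\<tau>. Q4 P (\<lambda>u v u' v'. \<phi> u v u' v' n \<tau>)"
    and z: "\<And>i j i' j' u v u' v' \<tau>. \<lbrakk>i + j = - m; i' + j' = - m; ((i, j), (i', j')) \<noteq> pq;
      u \<in> G i; v \<in> G j; u' \<in> G i'; v' \<in> G j'\<rbrakk> \<Longrightarrow> \<phi> u v u' v' n \<tau> = 0"
  shows "finite {x. cterm' \<phi> R n x \<noteq> 0}" and "clift' \<phi> R n = cterm' \<phi> R n pq"
proof -
  have 0: "cterm' \<phi> R n x = 0" if "x \<noteq> pq" for x
  proof -
    obtain i j i' j' where x: "x = ((i, j), (i', j'))" by (metis surj_pair)
    show ?thesis
    proof (cases "i + j = - m \<and> i' + j' = - m")
      case True
      then show ?thesis
        using R_R_zero[OF Q z[of i j i' j']] that unfolding x by (simp add: cterm'_def lift2_def fun_eq_iff)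
    next
      case False
      then have "R (i, j) = 0 \<or> R (i', j') = 0" using R_deg by blast
      then show ?thesis
        unfolding x cterm'_def using tens_zero[OF blk_car[OF car2D[OF R_mem]] vsP]
        by (auto simp: lift2_def fun_eq_iff)
    qed
  qed
  then have "{x. cterm' \<phi> R n x \<noteq> 0} \<subseteq> {pq}" by blast
  then show "finite {x. cterm' \<phi> R n x \<noteq> 0}" using finite_subset by blast
  show "clift' \<phi> R n = cterm' \<phi> R n pq"
    unfolding clift'_def by (rule Sum_any_single[OF 0])
qed

lemma cterm'_mem:
  assumes Q: "\<And>\<tau>. Q4 P (\<lambda>u v u' v'. \<phi> u v u' v' n \<tau>)"
    and S: "0 \<in> S" "\<And>x y. x \<in> S \<Longrightarrow> y \<in> S \<Longrightarrow> x + y \<in> S"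
    and mem: "\<And>u v u' v'. u \<in> car P \<Longrightarrow> v \<in> car P \<Longrightarrow> u' \<in> car P \<Longrightarrow> v' \<in> car P \<Longrightarrow> \<phi> u v u' v' n \<in> S"
  shows "cterm' \<phi> R n pq \<in> S"
proof -
  obtain i j i' j' where x: "pq = ((i, j), (i', j'))" by (metis surj_pair)
  note Rb = car2D[OF R_mem] and Rc = blk_car[OF car2D[OF R_mem]]
  show ?thesis
    unfolding x cterm'_def prod.case
  proof (rule lift2_mem[OF Rb G_sub G_sub G_scl _ S])
    show "bilinear_on P P scalars (\<lambda>u v. lift2 (\<lambda>u' v'. \<phi> u v u' v' n) (R (i', j')) \<beta>)" for \<beta>
      unfolding lift2_def by (rule Q4_inner[OF Q Rc vsP])
    fix u v assume uv: "u \<in> G i" "v \<in> G j"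
    show "lift2 (\<lambda>u' v'. \<phi> u v u' v' n) (R (i', j')) \<in> S"
      by (rule lift2_mem[OF Rb G_sub G_sub G_scl Q4D(1)[OF Q G_car[OF uv(1)] G_car[OF uv(2)]] S])
        (assumption | rule mem G_car uv)+
  qed
qed

end

text \<open>A form that sees degree \<open>i\<close> only does not notice the projection to degree
  \<open>i\<close>. Through \<open>tst3_component\<close> this removes the projection around a
  product inside a test form.\<close>

lemma form_component:
  assumes f: "linear_on P scalars f" and z: "\<And>j u. j \<noteq> i \<Longrightarrow> u \<in> G j \<Longrightarrow> f u = 0" and p: "p \<in> car P"
  shows "f (component G i p) = f p"
proof -
  let ?I = "insert i {k. component G k p \<noteq> 0}"
  note cc = component_car[OF gradedP p]
  have fin: "finite ?I" using component_finite[OF gradedP p] by simp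
  have "f p = f (\<Sum>k\<in>?I. component G k p)"
    by (rule arg_cong[OF component_sum[OF gradedP p fin]]) blast
  also have "\<dots> = (\<Sum>k\<in>?I. f (component G k p))"
    by (rule linear_on_sum[OF f vsP cc])
  also have "\<dots> = (\<Sum>k\<in>?I. if k = i then f (component G i p) else 0)"
    using z[OF _ component_mem[OF gradedP p]] by (intro sum.cong) auto
  also have "\<dots> = f (component G i p)" using fin by (simp add: sum.delta)
  finally show ?thesis by simp
qed

text \<open>The four ways in which a product of one leg from each copy enters the Yang-Baxter
  terms.\<close>

lemma Q4_shapes:
  assumes T: "trilinear_form_on V T" and f: "bilinear_on V V V f"
  shows "Q4 V (\<lambda>u v u' v'. T (f u u') v v')" "Q4 V (\<lambda>u v u' v'. T u u' (f v v'))"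
    "Q4 V (\<lambda>u v u' v'. T u' (f u v') v)" "Q4 V (\<lambda>u v u' v'. T u (f v u') v')"
proof -
  note t = trilinear_bilinear[OF T] and f1 = bilinear_onD1[OF f] and f2 = bilinear_onD2[OF f]
  note id = linear_on_ident
  show "Q4 V (\<lambda>u v u' v'. T (f u u') v v')"
    by (rule Q4I[OF bilin_comp[OF t(2) f1 id] bilin_comp[OF t(1) f2 id]])
  show "Q4 V (\<lambda>u v u' v'. T u u' (f v v'))"
    by (rule Q4I[OF bilin_comp[OF t(3) id f1] bilin_comp[OF t(2) id f2]])
  show "Q4 V (\<lambda>u v u' v'. T u' (f u v') v)"
    by (rule Q4I[OF bilin_comp[OF t(1) id f1] bilin_comp[OF t(3) f2 id]])
  show "Q4 V (\<lambda>u v u' v'. T u (f v u') v')"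
    by (rule Q4I[OF bilin_comp[OF t(3) f1 id] bilin_comp[OF t(1) id f2]])
qed

lemma cpure3_tri: "trilinear_form_on P (\<lambda>x y z. cpure3 P G x y z n \<tau>)"
proof -
  obtain i j k where n: "n = (i, j, k)" by (metis surj_pair)
  note t = trilinear_formD[OF pure3_tri] and cl = componentP_lin
  note c = linear_on_mem[OF cl]
  show ?thesis
    unfolding n cpure3_def prod.case
    by (rule trilinear_formI[OF linear_on_comp[OF t(1)[OF c c] cl] linear_on_comp[OF t(2)[OF c c] cl]
      linear_on_comp[OF t(3)[OF c c] cl]])
qed

lemma cpure3_zero:
  assumes "x \<in> car P" "y \<in> car P"
  shows "u \<in> G l \<Longrightarrow> l \<noteq> i \<Longrightarrow> cpure3 P G u x y (i, j, k) \<tau> = 0"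
    and "u \<in> G l \<Longrightarrow> l \<noteq> j \<Longrightarrow> cpure3 P G x u y (i, j, k) \<tau> = 0"
    and "u \<in> G l \<Longrightarrow> l \<noteq> k \<Longrightarrow> cpure3 P G x y u (i, j, k) \<tau> = 0"
proof -
  note t = trilinear_formD[OF pure3_tri] and c = linear_on_mem[OF componentP_lin]
  note z = linear_on_0[OF t(1)[OF c[OF assms(1)] c[OF assms(2)]] vsP]
    linear_on_0[OF t(2)[OF c[OF assms(1)] c[OF assms(2)]] vsP]
    linear_on_0[OF t(3)[OF c[OF assms(1)] c[OF assms(2)]] vsP]
  show "u \<in> G l \<Longrightarrow> l \<noteq> i \<Longrightarrow> cpure3 P G u x y (i, j, k) \<tau> = 0"
    "u \<in> G l \<Longrightarrow> l \<noteq> j \<Longrightarrow> cpure3 P G x u y (i, j, k) \<tau> = 0"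
    "u \<in> G l \<Longrightarrow> l \<noteq> k \<Longrightarrow> cpure3 P G x y u (i, j, k) \<tau> = 0"
    using z by (simp_all add: cpure3_def componentP_hom)
qed

lemma cpure3_mem: "x \<in> car P \<Longrightarrow> y \<in> car P \<Longrightarrow> z \<in> car P \<Longrightarrow> cpure3 P G x y z (i, j, k) \<in> blk3 i j k"
  unfolding cpure3_def prod.case by (intro pure3_mem component_mem[OF gradedP])

text \<open>Two dual-basis expansions with signs \<open>s\<close> and \<open>s'\<close>, stated
  abstractly so that all four combinations of \<open>expand_E\<close> and \<open>expand_F\<close>
  are instances.\<close>

lemma double_expand:
  assumes I: "\<And>g. linear_on B scalars g \<Longrightarrow> (\<Sum>e\<in>I. g (p e) * \<alpha> e) = s * g c"
    and I': "\<And>g. linear_on B scalars g \<Longrightarrow> (\<Sum>e\<in>I'. g (p' e) * \<alpha>' e) = s' * g c'"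
    and p: "\<And>e. e \<in> I \<Longrightarrow> p e \<in> car B" and c': "c' \<in> car B" and g: "bilinear_on B B scalars g"
  shows "(\<Sum>e\<in>I. \<Sum>e'\<in>I'. g (p e) (p' e') * (\<alpha> e * \<alpha>' e')) = s * s' * g c c'"
proof -
  have "(\<Sum>e\<in>I. \<Sum>e'\<in>I'. g (p e) (p' e') * (\<alpha> e * \<alpha>' e')) = (\<Sum>e\<in>I. (\<Sum>e'\<in>I'. g (p e) (p' e') * \<alpha>' e') * \<alpha> e)"
    by (simp add: sum_distrib_left sum_distrib_right mult_ac)
  also have "\<dots> = (\<Sum>e\<in>I. (s' * g (p e) c') * \<alpha> e)"
    by (rule sum.cong[OF refl]) (simp add: I'[OF bilinear_onD1[OF g p]])
  also have "\<dots> = s' * (\<Sum>e\<in>I. g (p e) c' * \<alpha> e)" by (simp add: sum_distrib_left mult_ac)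
  finally show ?thesis by (simp add: I[OF bilinear_onD2[OF g c']])
qed

text \<open>The sign arises because the dual vector stands in the first argument of \<omega>; in
  \<open>expand_F\<close> the basis vector stands there.\<close>

lemma expand_E:
  assumes "c \<in> H i" "linear_on B scalars g"
  shows "(\<Sum>e\<in>Eb i. g e * \<omega> (fb i e) c) = - 1 * g c"
proof -
  have "(\<Sum>e\<in>Eb i. g e * \<omega> (fb i e) c) = (\<Sum>e\<in>Eb i. - (\<omega> c (fb i e) * g e))"
    using om_antisym[OF fb_car H_car[OF assms(1)]] by (intro sum.cong refl) (simp add: mult.commute)
  then show ?thesis using Eb_expand_form[OF assms(2,1)] by (simp add: sum_negf)
qed

lemma expand_F:
  assumes "c \<in> H (- m - i)" "linear_on B scalars g"
  shows "(\<Sum>e\<in>Eb i. g (fb i e) * \<omega> e c) = 1 * g c"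
  using fb_expand_form[OF assms(2,1)] by (simp add: mult.commute)

lemma tst3_component:
  assumes g: "trilinear_form_on A \<gamma>" and c: "c1 \<in> H k1" "c2 \<in> H k2" "c3 \<in> H k3"
    and ab: "a' \<in> car A" "b' \<in> car B" "a'' \<in> car A" "b'' \<in> car B" and p: "p \<in> car P"
  shows "tst3 \<gamma> c1 c2 c3 (component G (- m - k1) p) (a' \<otimes> b') (a'' \<otimes> b'') = tst3 \<gamma> c1 c2 c3 p (a' \<otimes> b') (a'' \<otimes> b'')"
    and "tst3 \<gamma> c1 c2 c3 (a' \<otimes> b') (component G (- m - k2) p) (a'' \<otimes> b'') = tst3 \<gamma> c1 c2 c3 (a' \<otimes> b') p (a'' \<otimes> b'')"
    and "tst3 \<gamma> c1 c2 c3 (a' \<otimes> b') (a'' \<otimes> b'') (component G (- m - k3) p) = tst3 \<gamma> c1 c2 c3 (a' \<otimes> b') (a'' \<otimes> b'') p"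
proof -
  note cc = c[THEN H_car] and x = pt_car[OF ab(1,2)] and y = pt_car[OF ab(3,4)]
  note t = trilinear_formD[OF tst3_tri[OF g cc]]
  have z: "\<omega> b c = 0" if "b \<in> H j" "c \<in> H k" "j \<noteq> - m - k" for b c j k
    using om_deg[OF _ that(1,2)] that(3) by auto
  show "tst3 \<gamma> c1 c2 c3 (component G (- m - k1) p) (a' \<otimes> b') (a'' \<otimes> b'') = tst3 \<gamma> c1 c2 c3 p (a' \<otimes> b') (a'' \<otimes> b'')"
  proof (rule form_component[OF t(1)[OF x y] _ p])
    fix j u assume j: "j \<noteq> - m - k1" and u: "u \<in> G j"
    show "tst3 \<gamma> c1 c2 c3 u (a' \<otimes> b') (a'' \<otimes> b'') = 0"
      by (rule G_form_eq[OF u t(1)[OF x y] lin_intros(1)])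
        (simp add: tst3_pt[OF g cc _ H_car ab] z[OF _ c(1) j])
  qed
  show "tst3 \<gamma> c1 c2 c3 (a' \<otimes> b') (component G (- m - k2) p) (a'' \<otimes> b'') = tst3 \<gamma> c1 c2 c3 (a' \<otimes> b') p (a'' \<otimes> b'')"
  proof (rule form_component[OF t(2)[OF x y] _ p])
    fix j u assume j: "j \<noteq> - m - k2" and u: "u \<in> G j"
    show "tst3 \<gamma> c1 c2 c3 (a' \<otimes> b') u (a'' \<otimes> b'') = 0"
      by (rule G_form_eq[OF u t(2)[OF x y] lin_intros(1)])
        (simp add: tst3_pt[OF g cc ab(1,2) _ H_car ab(3,4)] z[OF _ c(2) j])
  qed
  show "tst3 \<gamma> c1 c2 c3 (a' \<otimes> b') (a'' \<otimes> b'') (component G (- m - k3) p) = tst3 \<gamma> c1 c2 c3 (a' \<otimes> b') (a'' \<otimes> b'') p"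
  proof (rule form_component[OF t(3)[OF x y] _ p])
    fix j u assume j: "j \<noteq> - m - k3" and u: "u \<in> G j"
    show "tst3 \<gamma> c1 c2 c3 (a' \<otimes> b') (a'' \<otimes> b'') u = 0"
      by (rule G_form_eq[OF u t(3)[OF x y] lin_intros(1)])
        (simp add: tst3_pt[OF g cc ab _ H_car] z[OF _ c(3) j])
  qed
qed

context
  fixes r :: "('k, 'a, 'a) tens2" and \<mu> :: "'a \<Rightarrow> 'a \<Rightarrow> 'a" and \<epsilon> :: 'k
  assumes r: "r \<in> car (tensor A A)" and rs: "flip A r = r" and mu: "bilinear_on A A A \<mu>"
begin

definition K :: "('a \<Rightarrow> 'a \<Rightarrow> 'a \<Rightarrow> 'k) \<Rightarrow> 'k" where
  "K \<gamma> = r (\<lambda>a a'. r (\<lambda>x x'. \<gamma> (\<mu> a x) a' x'))"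

text \<open>\<open>K \<gamma>\<close> is the value of \<open>r\<^sub>1\<^sub>2 \<star> r\<^sub>1\<^sub>3\<close> at \<open>\<gamma>\<close>.  As \<open>r\<close> is symmetric, its two factors may be flipped in either
  copy and the two copies exchanged, so every product of two copies of \<open>r\<close> is a value of \<open>K\<close>.\<close>

lemma K_variants:
  assumes g: "trilinear_form_on A \<gamma>"
  shows "r (\<lambda>a a'. r (\<lambda>x x'. \<gamma> (\<mu> a' x) a x')) = K \<gamma>"
    and "r (\<lambda>a a'. r (\<lambda>x x'. \<gamma> (\<mu> a x') a' x)) = K \<gamma>"
    and "r (\<lambda>a a'. r (\<lambda>x x'. \<gamma> (\<mu> a' x') a x)) = K \<gamma>"
    and "r (\<lambda>a a'. r (\<lambda>x x'. \<gamma> (\<mu> x a) x' a')) = K \<gamma>"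
    and "r (\<lambda>a a'. r (\<lambda>x x'. \<gamma> (\<mu> x' a) x a')) = K \<gamma>"
    and "r (\<lambda>a a'. r (\<lambda>x x'. \<gamma> (\<mu> x a') x' a)) = K \<gamma>"
    and "r (\<lambda>a a'. r (\<lambda>x x'. \<gamma> (\<mu> x' a') x a)) = K \<gamma>"
proof -
  note q = Q4_shapes(1)[OF g mu]
  note q1 = Q4_swap(2)[OF q] and q2 = Q4_swap(3)[OF q]
  note q3 = Q4_swap(3)[OF q1]
  show 1: "r (\<lambda>a a'. r (\<lambda>x x'. \<gamma> (\<mu> a' x) a x')) = K \<gamma>"
    unfolding K_def by (rule RR_sym1[OF r rs q])
  show 2: "r (\<lambda>a a'. r (\<lambda>x x'. \<gamma> (\<mu> a x') a' x)) = K \<gamma>"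
    unfolding K_def by (rule RR_sym2[OF r rs q])
  show 3: "r (\<lambda>a a'. r (\<lambda>x x'. \<gamma> (\<mu> a' x') a x)) = K \<gamma>"
    unfolding 1[symmetric] by (rule RR_sym2[OF r rs q1])
  show "r (\<lambda>a a'. r (\<lambda>x x'. \<gamma> (\<mu> x a) x' a')) = K \<gamma>"
    unfolding K_def by (rule RR_swap[OF r rs q])
  show "r (\<lambda>a a'. r (\<lambda>x x'. \<gamma> (\<mu> x' a) x a')) = K \<gamma>"
    unfolding 1[symmetric] by (rule RR_swap[OF r rs q1])
  show "r (\<lambda>a a'. r (\<lambda>x x'. \<gamma> (\<mu> x a') x' a)) = K \<gamma>"
    unfolding 2[symmetric] by (rule RR_swap[OF r rs q2])
  show "r (\<lambda>a a'. r (\<lambda>x x'. \<gamma> (\<mu> x' a') x a)) = K \<gamma>"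
    unfolding 3[symmetric] by (rule RR_swap[OF r rs q3])
qed

abbreviation "op \<equiv> iop \<mu> \<epsilon>"
abbreviation "Rh \<equiv> R r"

text \<open>The summands of the two Yang-Baxter equations: \<phi>1, \<phi>2 and \<phi>3 for the
  product, \<phi>1, \<phi>2 and \<phi>4 for the bracket.\<close>

abbreviation "\<phi>1 \<equiv> \<lambda>xa ya xb yb. cpure3 P G (op xa xb) ya yb"
abbreviation "\<phi>2 \<equiv> \<lambda>xa ya xb yb. cpure3 P G xa xb (op ya yb)"
abbreviation "\<phi>3 \<equiv> \<lambda>xa ya xb yb. cpure3 P G xb (op xa yb) ya"
abbreviation "\<phi>4 \<equiv> \<lambda>xa ya xb yb. cpure3 P G xa (op ya xb) yb"

lemmas op_bil = iop_bil[OF mu, of \<epsilon>]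
lemmas op_car = iop_car[OF mu, of _ _ \<epsilon>]
lemmas phi_Q4 = Q4_shapes[OF cpure3_tri op_bil]

lemma phi_zero:
  "\<lbrakk>u \<in> G p; v \<in> G q; u' \<in> G p'; v' \<in> G q'; q \<noteq> j \<or> q' \<noteq> k\<rbrakk> \<Longrightarrow> \<phi>1 u v u' v' (i, j, k) \<tau> = 0"
  "\<lbrakk>u \<in> G p; v \<in> G q; u' \<in> G p'; v' \<in> G q'; p \<noteq> i \<or> p' \<noteq> j\<rbrakk> \<Longrightarrow> \<phi>2 u v u' v' (i, j, k) \<tau> = 0"
  "\<lbrakk>u \<in> G p; v \<in> G q; u' \<in> G p'; v' \<in> G q'; p' \<noteq> i \<or> q \<noteq> k\<rbrakk> \<Longrightarrow> \<phi>3 u v u' v' (i, j, k) \<tau> = 0"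
  "\<lbrakk>u \<in> G p; v \<in> G q; u' \<in> G p'; v' \<in> G q'; p \<noteq> i \<or> q' \<noteq> k\<rbrakk> \<Longrightarrow> \<phi>4 u v u' v' (i, j, k) \<tau> = 0"
  by (elim disjE; rule cpure3_zero[OF G_car G_car] cpure3_zero[OF op_car[OF G_car G_car] G_car]
      cpure3_zero[OF G_car op_car[OF G_car G_car]]; assumption)+

text \<open>In each term two legs, one from each copy of \<open>R\<close>, survive as factors of the
  result, and their degrees determine the blocks. The unsimplified \<open>- m - (- m - j)\<close>
  keeps the shape \<open>(i, - m - i)\<close> expected by \<open>R_R_apply\<close>.\<close>

lemma phi_block:
  "finite {x. cterm' \<phi>1 Rh (i, j, k) x \<noteq> 0}"
  "clift' \<phi>1 Rh (i, j, k) = cterm' \<phi>1 Rh (i, j, k) ((- m - j, - m - (- m - j)), (- m - k, - m - (- m - k)))"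
  "finite {x. cterm' \<phi>2 Rh (i, j, k) x \<noteq> 0}"
  "clift' \<phi>2 Rh (i, j, k) = cterm' \<phi>2 Rh (i, j, k) ((i, - m - i), (j, - m - j))"
  "finite {x. cterm' \<phi>3 Rh (i, j, k) x \<noteq> 0}"
  "clift' \<phi>3 Rh (i, j, k) = cterm' \<phi>3 Rh (i, j, k) ((- m - k, - m - (- m - k)), (i, - m - i))"
  "finite {x. cterm' \<phi>4 Rh (i, j, k) x \<noteq> 0}"
  "clift' \<phi>4 Rh (i, j, k) = cterm' \<phi>4 Rh (i, j, k) ((i, - m - i), (- m - k, - m - (- m - k)))"
proof -
  have z1: "\<phi>1 u v u' v' (i, j, k) \<tau> = 0" if "p + q = - m" "p' + q' = - m"
    "((p, q), (p', q')) \<noteq> ((- m - j, - m - (- m - j)), (- m - k, - m - (- m - k)))"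
    "u \<in> G p" "v \<in> G q" "u' \<in> G p'" "v' \<in> G q'" for p q p' q' u v u' v' \<tau>
    by (rule phi_zero(1)[OF that(4-7)]) (use that(1-3) in auto)
  have z2: "\<phi>2 u v u' v' (i, j, k) \<tau> = 0" if "p + q = - m" "p' + q' = - m"
    "((p, q), (p', q')) \<noteq> ((i, - m - i), (j, - m - j))"
    "u \<in> G p" "v \<in> G q" "u' \<in> G p'" "v' \<in> G q'" for p q p' q' u v u' v' \<tau>
    by (rule phi_zero(2)[OF that(4-7)]) (use that(1-3) in auto)
  have z3: "\<phi>3 u v u' v' (i, j, k) \<tau> = 0" if "p + q = - m" "p' + q' = - m"
    "((p, q), (p', q')) \<noteq> ((- m - k, - m - (- m - k)), (i, - m - i))"
    "u \<in> G p" "v \<in> G q" "u' \<in> G p'" "v' \<in> G q'" for p q p' q' u v u' v' \<tau>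
    by (rule phi_zero(3)[OF that(4-7)]) (use that(1-3) in auto)
  have z4: "\<phi>4 u v u' v' (i, j, k) \<tau> = 0" if "p + q = - m" "p' + q' = - m"
    "((p, q), (p', q')) \<noteq> ((i, - m - i), (- m - k, - m - (- m - k)))"
    "u \<in> G p" "v \<in> G q" "u' \<in> G p'" "v' \<in> G q'" for p q p' q' u v u' v' \<tau>
    by (rule phi_zero(4)[OF that(4-7)]) (use that(1-3) in auto)
  show "finite {x. cterm' \<phi>1 Rh (i, j, k) x \<noteq> 0}"
    "clift' \<phi>1 Rh (i, j, k) = cterm' \<phi>1 Rh (i, j, k) ((- m - j, - m - (- m - j)), (- m - k, - m - (- m - k)))"
    "finite {x. cterm' \<phi>2 Rh (i, j, k) x \<noteq> 0}"
    "clift' \<phi>2 Rh (i, j, k) = cterm' \<phi>2 Rh (i, j, k) ((i, - m - i), (j, - m - j))"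
    "finite {x. cterm' \<phi>3 Rh (i, j, k) x \<noteq> 0}"
    "clift' \<phi>3 Rh (i, j, k) = cterm' \<phi>3 Rh (i, j, k) ((- m - k, - m - (- m - k)), (i, - m - i))"
    "finite {x. cterm' \<phi>4 Rh (i, j, k) x \<noteq> 0}"
    "clift' \<phi>4 Rh (i, j, k) = cterm' \<phi>4 Rh (i, j, k) ((i, - m - i), (- m - k, - m - (- m - k)))"
    by (rule
      quad_block[where \<phi> = \<phi>1 and n = "(i, j, k)" and pq = "((- m - j, - m - (- m - j)), (- m - k, - m - (- m - k)))", OF r rs phi_Q4(1) z1]
      quad_block[where \<phi> = \<phi>2 and n = "(i, j, k)" and pq = "((i, - m - i), (j, - m - j))", OF r rs phi_Q4(2) z2]
      quad_block[where \<phi> = \<phi>3 and n = "(i, j, k)" and pq = "((- m - k, - m - (- m - k)), (i, - m - i))", OF r rs phi_Q4(3) z3]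
      quad_block[where \<phi> = \<phi>4 and n = "(i, j, k)" and pq = "((i, - m - i), (- m - k, - m - (- m - k)))", OF r rs phi_Q4(4) z4]; assumption)+
qed

lemma phi_summable: "csummable' \<phi>1 Rh" "csummable' \<phi>2 Rh" "csummable' \<phi>3 Rh" "csummable' \<phi>4 Rh"
  unfolding csummable'_def split_paired_All using phi_block(1,3,5,7) by blast+

lemma phi_mem: "clift' \<phi>1 Rh \<in> car3" "clift' \<phi>2 Rh \<in> car3" "clift' \<phi>3 Rh \<in> car3" "clift' \<phi>4 Rh \<in> car3"
  unfolding car3_def mem_Collect_eq phi_block
  by (intro allI cterm'_mem[where \<phi> = \<phi>1, OF r rs phi_Q4(1)] cterm'_mem[where \<phi> = \<phi>2, OF r rs phi_Q4(2)]
    cterm'_mem[where \<phi> = \<phi>3, OF r rs phi_Q4(3)] cterm'_mem[where \<phi> = \<phi>4, OF r rs phi_Q4(4)]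
    subtensor3_closed cpure3_mem op_car; assumption)+

end

section \<open>The terms of the Yang-Baxter equation\<close>

lemma om_dia_bil:
  assumes "c \<in> car B"
  shows "bilinear_on B B scalars (\<lambda>x y. \<omega> (x \<diamondop> y) c)" "bilinear_on B B scalars (\<lambda>x y. \<omega> (y \<diamondop> x) c)"
  by (rule bilinear_formI[OF linear_on_comp[OF om_lin1[OF assms] dia_lin2] linear_on_comp[OF om_lin1[OF assms] dia_lin1]],
    assumption+) (rule bilinear_formI[OF linear_on_comp[OF om_lin1[OF assms] dia_lin1] linear_on_comp[OF om_lin1[OF assms] dia_lin2]],
    assumption+)

text \<open>Every expansion of type \<open>expand_E\<close> contributes a factor \<open>- 1\<close>,
  so the sign is negative exactly in the two mixed cases.\<close>

lemma expand_pairs: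
  assumes g: "bilinear_on B B scalars g"
  shows "\<lbrakk>c \<in> H i; c' \<in> H j\<rbrakk> \<Longrightarrow> (\<Sum>e\<in>Eb i. \<Sum>e'\<in>Eb j. g e e' * (\<omega> (fb i e) c * \<omega> (fb j e') c')) = g c c'"
    and "\<lbrakk>c \<in> H (- m - i); c' \<in> H (- m - j)\<rbrakk> \<Longrightarrow>
      (\<Sum>e\<in>Eb i. \<Sum>e'\<in>Eb j. g (fb i e) (fb j e') * (\<omega> e c * \<omega> e' c')) = g c c'"
    and "\<lbrakk>c \<in> H i; c' \<in> H (- m - j)\<rbrakk> \<Longrightarrow>
      (\<Sum>e\<in>Eb i. \<Sum>e'\<in>Eb j. g e (fb j e') * (\<omega> (fb i e) c * \<omega> e' c')) = - g c c'"
    and "\<lbrakk>c \<in> H (- m - i); c' \<in> H j\<rbrakk> \<Longrightarrow>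
      (\<Sum>e\<in>Eb i. \<Sum>e'\<in>Eb j. g (fb i e) e' * (\<omega> e c * \<omega> (fb j e') c')) = - g c c'"
  using double_expand[where p = "\<lambda>e. e" and p' = "\<lambda>e. e" and \<alpha> = "\<lambda>e. \<omega> (fb i e) c" and \<alpha>' = "\<lambda>e. \<omega> (fb j e) c'",
      OF expand_E[of c i] expand_E[of c' j] Eb_car H_car g]
    double_expand[where p = "fb i" and p' = "fb j" and \<alpha> = "\<lambda>e. \<omega> e c" and \<alpha>' = "\<lambda>e. \<omega> e c'",
      OF expand_F[of c i] expand_F[of c' j] fb_car H_car g]
    double_expand[where p = "\<lambda>e. e" and p' = "fb j" and \<alpha> = "\<lambda>e. \<omega> (fb i e) c" and \<alpha>' = "\<lambda>e. \<omega> e c'",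
      OF expand_E[of c i] expand_F[of c' j] Eb_car H_car g]
    double_expand[where p = "fb i" and p' = "\<lambda>e. e" and \<alpha> = "\<lambda>e. \<omega> e c" and \<alpha>' = "\<lambda>e. \<omega> (fb j e) c'",
      OF expand_F[of c i] expand_E[of c' j] fb_car H_car g]
  by simp_all

text \<open>\<open>\<omega> (x \<diamondop> y) z\<close> is antisymmetric in \<open>y\<close> and
  \<open>z\<close>, and invariance gives one more relation; the six arrangements of three letters
  are thus expressed by two of them.\<close>

lemma triple_words:
  assumes "c1 \<in> car B" "c2 \<in> car B" "c3 \<in> car B"
  shows "\<omega> (c2 \<diamondop> c3) c1 = - \<omega> (c2 \<diamondop> c1) c3" "\<omega> (c3 \<diamondop> c2) c1 = - \<omega> (c3 \<diamondop> c1) c2"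
    "\<omega> (c1 \<diamondop> c2) c3 = \<omega> (c2 \<diamondop> c1) c3 - \<omega> (c3 \<diamondop> c1) c2"
    "\<omega> (c1 \<diamondop> c3) c2 = - \<omega> (c2 \<diamondop> c1) c3 + \<omega> (c3 \<diamondop> c1) c2"
proof -
  have s: "\<omega> (x \<diamondop> y) z = - \<omega> (x \<diamondop> z) y" if "x \<in> car B" "y \<in> car B" "z \<in> car B" for x y z
    using om_left[OF that] om_antisym[of y "x \<diamondop> z"] that by (simp add: dia_car)
  show 1: "\<omega> (c2 \<diamondop> c3) c1 = - \<omega> (c2 \<diamondop> c1) c3" "\<omega> (c3 \<diamondop> c2) c1 = - \<omega> (c3 \<diamondop> c1) c2"
    by (rule s; fact)+
  have "\<omega> c1 (c2 \<diamondop> c3) = - \<omega> (c2 \<diamondop> c3) c1" "\<omega> c1 (c3 \<diamondop> c2) = - \<omega> (c3 \<diamondop> c2) c1"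
    by (rule om_antisym; simp add: dia_car assms)+
  with om_right[OF assms] 1 show 2: "\<omega> (c1 \<diamondop> c2) c3 = \<omega> (c2 \<diamondop> c1) c3 - \<omega> (c3 \<diamondop> c1) c2" by simp
  show "\<omega> (c1 \<diamondop> c3) c2 = - \<omega> (c2 \<diamondop> c1) c3 + \<omega> (c3 \<diamondop> c1) c2"
    using s[OF assms(1,3,2)] 2 by simp
qed

context
  fixes r :: "('k, 'a, 'a) tens2" and \<mu> :: "'a \<Rightarrow> 'a \<Rightarrow> 'a" and \<epsilon> :: 'k
  assumes r: "r \<in> car (tensor A A)" and rs: "flip A r = r" and mu: "bilinear_on A A A \<mu>"
begin

lemma form_iop:
  assumes f: "linear_on P scalars f" and ab: "a \<in> car A" "b \<in> car B" "a' \<in> car A" "b' \<in> car B"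
  shows "f (iop \<mu> \<epsilon> (a \<otimes> b) (a' \<otimes> b')) = f (\<mu> a a' \<otimes> (b \<diamondop> b')) + \<epsilon> * f (\<mu> a' a \<otimes> (b' \<diamondop> b))"
proof -
  note c = pt_car[OF mu_car[OF mu ab(1,3)] dia_car[OF ab(2,4)]] pt_car[OF mu_car[OF mu ab(3,1)] dia_car[OF ab(4,2)]]
  show ?thesis
    unfolding iop_pt[OF mu ab] psi_def
      linear_form_add[OF f c(1) is_vspaceD(3)[OF vsP c(2), unfolded scl_tensor]]
      linear_form_scl[OF f c(2), unfolded scl_tensor] ..
qed

text \<open>Separates the coefficients from \<open>B\<close>, which are summed over the dual bases,
  from the two values on \<open>A\<close>, which do not depend on basis vectors.\<close>

lemma sum_K:
  assumes "\<And>e e'. e \<in> I \<Longrightarrow> e' \<in> J \<Longrightarrow> F e e' = X e e' * K1 + \<epsilon> * X' e e' * K2"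
    and "(\<Sum>e\<in>I. \<Sum>e'\<in>J. X e e') = w" "(\<Sum>e\<in>I. \<Sum>e'\<in>J. X' e e') = w'"
  shows "(\<Sum>e\<in>I. \<Sum>e'\<in>J. F e e') = w * K1 + \<epsilon> * (w' * K2)"
proof -
  have "(\<Sum>e\<in>I. \<Sum>e'\<in>J. F e e') = (\<Sum>e\<in>I. \<Sum>e'\<in>J. X e e' * K1 + \<epsilon> * (X' e e' * K2))"
    using assms(1) by (simp add: mult.assoc)
  then show ?thesis
    by (simp add: sum.distrib sum_distrib_left sum_distrib_right flip: assms(2,3))
qed

context
  fixes \<gamma> :: "'a \<Rightarrow> 'a \<Rightarrow> 'a \<Rightarrow> 'k" and c1 c2 c3 :: 'b and k1 k2 k3 :: int
  assumes g: "trilinear_form_on A \<gamma>" and c: "c1 \<in> H k1" "c2 \<in> H k2" "c3 \<in> H k3"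
begin

lemma c_car: "c1 \<in> car B" "c2 \<in> car B" "c3 \<in> car B"
  using c H_car by blast+

lemma c_deg: "k1 = - m - (- m - k1)" "k2 = - m - (- m - k2)" "k3 = - m - (- m - k3)"
  by simp_all

lemma c_neg: "c1 \<in> H (- m - (- m - k1))" "c2 \<in> H (- m - (- m - k2))" "c3 \<in> H (- m - (- m - k3))"
  using c by simp_all

lemmas t3D = trilinear_formD[OF tst3_tri[OF g c_car]]
lemmas t3pt = tst3_pt[OF g c_car]
lemmas t3comp = tst3_component[OF g c]
lemmas pr3h = pr3_hom[OF _ g c(1) c_deg(1) c(2) c_deg(2) c(3) c_deg(3)]

text \<open>The legs \<open>ya\<close> and \<open>yb\<close> meet \<open>c2\<close> and
  \<open>c3\<close>, and the two dual-basis sums replace the factors of the product by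
  \<open>c2\<close> and \<open>c3\<close>. The two orders in \<open>iop\<close> give the two values
  of \<open>K\<close>, the second with the last two arguments of \<gamma> exchanged.\<close>

lemma pr3_phi1:
  "pr3 (clift' (\<phi>1 \<mu> \<epsilon>) (R r)) \<gamma> c1 c2 c3 = \<omega> (c2 \<diamondop> c3) c1 * K r \<mu> \<gamma> + \<epsilon> * (\<omega> (c3 \<diamondop> c2) c1 * K r \<mu> (\<lambda>u v w. \<gamma> u w v))"
proof -
  let ?n = "(- m - k1, - m - k2, - m - k3)" and ?\<tau> = "tst3 \<gamma> c1 c2 c3"
  note Q = phi_Q4(1)[OF r rs mu, of \<epsilon>]
  have "pr3 (clift' (\<phi>1 \<mu> \<epsilon>) (R r)) \<gamma> c1 c2 c3 = clift' (\<phi>1 \<mu> \<epsilon>) (R r) ?n ?\<tau>"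
    by (rule pr3h[OF phi_mem(1)[OF r rs mu]])
  \<comment> \<open>Leg \<open>ya\<close> pairs with \<open>c2\<close> and so has degree
    \<open>- m - k2\<close>, which puts \<open>xa\<close> into degree \<open>k2\<close>; likewise
    for the second copy with \<open>c3\<close>.\<close>
  also have "\<dots> = R r (k2, - m - k2) (\<lambda>u v. R r (k3, - m - k3) (\<lambda>u' v'. \<phi>1 \<mu> \<epsilon> u v u' v' ?n ?\<tau>))"
    unfolding phi_block(2)[OF r rs mu] by (simp add: cterm'_def lift2_def)
  also have "\<dots> = (\<Sum>e\<in>Eb k2. \<Sum>e'\<in>Eb k3. r (\<lambda>a a'. r (\<lambda>x x'.
      \<phi>1 \<mu> \<epsilon> (a \<otimes> e) (a' \<otimes> fb k2 e) (x \<otimes> e') (x' \<otimes> fb k3 e') ?n ?\<tau>)))"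
    by (rule R_R_apply[OF r rs Q])
  also have "\<dots> = \<omega> (c2 \<diamondop> c3) c1 * K r \<mu> \<gamma> + \<epsilon> * (\<omega> (c3 \<diamondop> c2) c1 * K r \<mu> (\<lambda>u v w. \<gamma> u w v))"
  proof (rule sum_K)
    fix e e' assume e: "e \<in> Eb k2" "e' \<in> Eb k3"
    note ec = Eb_car[OF e(1)] fb_car[OF e(1)] Eb_car[OF e(2)] fb_car[OF e(2)]
    note eH = Eb_H[OF e(1)] fb_H[OF e(1)] Eb_H[OF e(2)] fb_H[OF e(2)]
    have "r (\<lambda>a a'. r (\<lambda>x x'. \<phi>1 \<mu> \<epsilon> (a \<otimes> e) (a' \<otimes> fb k2 e) (x \<otimes> e') (x' \<otimes> fb k3 e') ?n ?\<tau>)) =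
      (\<omega> (e \<diamondop> e') c1 * (\<omega> (fb k2 e) c2 * \<omega> (fb k3 e') c3)) * r (\<lambda>a a'. r (\<lambda>x x'. \<gamma> (\<mu> a x) a' x')) + (\<epsilon> * (\<omega> (e' \<diamondop> e) c1 * (\<omega> (fb k2 e) c2 * \<omega> (fb k3 e') c3))) * r (\<lambda>a a'. r (\<lambda>x x'. \<gamma> (\<mu> x a) a' x'))"
    proof (rule RR_lin[OF r rs Q4_pt[OF r rs Q ec] Q4_shapes(1)[OF g mu] Q4_swap(1)[OF Q4_shapes(1)[OF trilinear_permute(1)[OF g] mu]]])
      fix a a' x x' assume pc: "a \<in> car A" "a' \<in> car A" "x \<in> car A" "x' \<in> car A"
      note oc = op_car[OF r rs mu pt_car[OF pc(1) ec(1)] pt_car[OF pc(3) ec(3)], of \<epsilon>]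
      have "\<phi>1 \<mu> \<epsilon> (a \<otimes> e) (a' \<otimes> fb k2 e) (x \<otimes> e') (x' \<otimes> fb k3 e') ?n ?\<tau> = tst3 \<gamma> c1 c2 c3 (iop \<mu> \<epsilon> (a \<otimes> e) (x \<otimes> e')) (a' \<otimes> fb k2 e) (x' \<otimes> fb k3 e')"
        using t3comp(1)[OF pc(2) ec(2) pc(4) ec(4) oc] eH pc
        by (simp add: cpure3_def pure3_apply[OF tst3_tri[OF g c_car]] componentP_hom[OF pt_G])
      then show "\<phi>1 \<mu> \<epsilon> (a \<otimes> e) (a' \<otimes> fb k2 e) (x \<otimes> e') (x' \<otimes> fb k3 e') ?n ?\<tau> =
        (\<omega> (e \<diamondop> e') c1 * (\<omega> (fb k2 e) c2 * \<omega> (fb k3 e') c3)) * \<gamma> (\<mu> a x) a' x' + (\<epsilon> * (\<omega> (e' \<diamondop> e) c1 * (\<omega> (fb k2 e) c2 * \<omega> (fb k3 e') c3))) * \<gamma> (\<mu> x a) a' x'"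
        unfolding form_iop[OF t3D(1)[OF pt_car[OF pc(2) ec(2)] pt_car[OF pc(4) ec(4)]] pc(1) ec(1) pc(3) ec(3)]
        by (simp add: t3pt pc ec mu_car[OF mu] dia_car algebra_simps)
    qed
    also have "r (\<lambda>a a'. r (\<lambda>x x'. \<gamma> (\<mu> a x) a' x')) = K r \<mu> \<gamma>"
      unfolding K_def[OF r rs mu] ..
    also have "r (\<lambda>a a'. r (\<lambda>x x'. \<gamma> (\<mu> x a) a' x')) = K r \<mu> (\<lambda>u v w. \<gamma> u w v)"
      by (rule K_variants(4)[OF r rs mu trilinear_permute(1)[OF g]])
    finally show "r (\<lambda>a a'. r (\<lambda>x x'. \<phi>1 \<mu> \<epsilon> (a \<otimes> e) (a' \<otimes> fb k2 e) (x \<otimes> e') (x' \<otimes> fb k3 e') ?n ?\<tau>)) =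
      (\<omega> (e \<diamondop> e') c1 * (\<omega> (fb k2 e) c2 * \<omega> (fb k3 e') c3)) * K r \<mu> \<gamma> + \<epsilon> * (\<omega> (e' \<diamondop> e) c1 * (\<omega> (fb k2 e) c2 * \<omega> (fb k3 e') c3)) * K r \<mu> (\<lambda>u v w. \<gamma> u w v)" .
  next
    show "(\<Sum>e\<in>Eb k2. \<Sum>e'\<in>Eb k3. \<omega> (e \<diamondop> e') c1 * (\<omega> (fb k2 e) c2 * \<omega> (fb k3 e') c3)) = \<omega> (c2 \<diamondop> c3) c1"
      by (rule expand_pairs(1)[OF om_dia_bil(1)[OF c_car(1)] c(2) c(3)])
    show "(\<Sum>e\<in>Eb k2. \<Sum>e'\<in>Eb k3. \<omega> (e' \<diamondop> e) c1 * (\<omega> (fb k2 e) c2 * \<omega> (fb k3 e') c3)) = \<omega> (c3 \<diamondop> c2) c1"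
      by (rule expand_pairs(1)[OF om_dia_bil(2)[OF c_car(1)] c(2) c(3)])
  qed
  finally show ?thesis .
qed

text \<open>Here \<open>xa\<close> and \<open>xb\<close> meet \<open>c1\<close> and
  \<open>c2\<close>, so dual vectors are multiplied; both expansions are of type
  \<open>expand_F\<close> and no sign appears.\<close>

lemma pr3_phi2:
  "pr3 (clift' (\<phi>2 \<mu> \<epsilon>) (R r)) \<gamma> c1 c2 c3 = \<omega> (c1 \<diamondop> c2) c3 * K r \<mu> (\<lambda>u v w. \<gamma> v w u) + \<epsilon> * (\<omega> (c2 \<diamondop> c1) c3 * K r \<mu> (\<lambda>u v w. \<gamma> w v u))"
proof -
  let ?n = "(- m - k1, - m - k2, - m - k3)" and ?\<tau> = "tst3 \<gamma> c1 c2 c3"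
  note Q = phi_Q4(2)[OF r rs mu, of \<epsilon>]
  have "pr3 (clift' (\<phi>2 \<mu> \<epsilon>) (R r)) \<gamma> c1 c2 c3 = clift' (\<phi>2 \<mu> \<epsilon>) (R r) ?n ?\<tau>"
    by (rule pr3h[OF phi_mem(2)[OF r rs mu]])
  also have "\<dots> = R r ((- m - k1), - m - (- m - k1)) (\<lambda>u v. R r ((- m - k2), - m - (- m - k2)) (\<lambda>u' v'. \<phi>2 \<mu> \<epsilon> u v u' v' ?n ?\<tau>))"
    unfolding phi_block(4)[OF r rs mu] by (simp add: cterm'_def lift2_def)
  also have "\<dots> = (\<Sum>e\<in>Eb (- m - k1). \<Sum>e'\<in>Eb (- m - k2). r (\<lambda>a a'. r (\<lambda>x x'.
      \<phi>2 \<mu> \<epsilon> (a \<otimes> e) (a' \<otimes> fb (- m - k1) e) (x \<otimes> e') (x' \<otimes> fb (- m - k2) e') ?n ?\<tau>)))"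
    by (rule R_R_apply[OF r rs Q])
  also have "\<dots> = \<omega> (c1 \<diamondop> c2) c3 * K r \<mu> (\<lambda>u v w. \<gamma> v w u) + \<epsilon> * (\<omega> (c2 \<diamondop> c1) c3 * K r \<mu> (\<lambda>u v w. \<gamma> w v u))"
  proof (rule sum_K)
    fix e e' assume e: "e \<in> Eb (- m - k1)" "e' \<in> Eb (- m - k2)"
    note ec = Eb_car[OF e(1)] fb_car[OF e(1)] Eb_car[OF e(2)] fb_car[OF e(2)]
    note eH = Eb_H[OF e(1)] fb_H[OF e(1)] Eb_H[OF e(2)] fb_H[OF e(2)]
    have "r (\<lambda>a a'. r (\<lambda>x x'. \<phi>2 \<mu> \<epsilon> (a \<otimes> e) (a' \<otimes> fb (- m - k1) e) (x \<otimes> e') (x' \<otimes> fb (- m - k2) e') ?n ?\<tau>)) =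
      (\<omega> (fb (- m - k1) e \<diamondop> fb (- m - k2) e') c3 * (\<omega> e c1 * \<omega> e' c2)) * r (\<lambda>a a'. r (\<lambda>x x'. \<gamma> a x (\<mu> a' x'))) + (\<epsilon> * (\<omega> (fb (- m - k2) e' \<diamondop> fb (- m - k1) e) c3 * (\<omega> e c1 * \<omega> e' c2))) * r (\<lambda>a a'. r (\<lambda>x x'. \<gamma> a x (\<mu> x' a')))"
    proof (rule RR_lin[OF r rs Q4_pt[OF r rs Q ec] Q4_shapes(2)[OF g mu] Q4_swap(1)[OF Q4_shapes(2)[OF trilinear_permute(2)[OF g] mu]]])
      fix a a' x x' assume pc: "a \<in> car A" "a' \<in> car A" "x \<in> car A" "x' \<in> car A"
      note oc = op_car[OF r rs mu pt_car[OF pc(2) ec(2)] pt_car[OF pc(4) ec(4)], of \<epsilon>]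
      have "\<phi>2 \<mu> \<epsilon> (a \<otimes> e) (a' \<otimes> fb (- m - k1) e) (x \<otimes> e') (x' \<otimes> fb (- m - k2) e') ?n ?\<tau> = tst3 \<gamma> c1 c2 c3 (a \<otimes> e) (x \<otimes> e') (iop \<mu> \<epsilon> (a' \<otimes> fb (- m - k1) e) (x' \<otimes> fb (- m - k2) e'))"
        using t3comp(3)[OF pc(1) ec(1) pc(3) ec(3) oc] eH pc
        by (simp add: cpure3_def pure3_apply[OF tst3_tri[OF g c_car]] componentP_hom[OF pt_G])
      then show "\<phi>2 \<mu> \<epsilon> (a \<otimes> e) (a' \<otimes> fb (- m - k1) e) (x \<otimes> e') (x' \<otimes> fb (- m - k2) e') ?n ?\<tau> =
        (\<omega> (fb (- m - k1) e \<diamondop> fb (- m - k2) e') c3 * (\<omega> e c1 * \<omega> e' c2)) * \<gamma> a x (\<mu> a' x') + (\<epsilon> * (\<omega> (fb (- m - k2) e' \<diamondop> fb (- m - k1) e) c3 * (\<omega> e c1 * \<omega> e' c2))) * \<gamma> a x (\<mu> x' a')"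
        unfolding form_iop[OF t3D(3)[OF pt_car[OF pc(1) ec(1)] pt_car[OF pc(3) ec(3)]] pc(2) ec(2) pc(4) ec(4)]
        by (simp add: t3pt pc ec mu_car[OF mu] dia_car algebra_simps)
    qed
    also have "r (\<lambda>a a'. r (\<lambda>x x'. \<gamma> a x (\<mu> a' x'))) = K r \<mu> (\<lambda>u v w. \<gamma> v w u)"
      by (rule K_variants(3)[OF r rs mu trilinear_permute(3)[OF g]])
    also have "r (\<lambda>a a'. r (\<lambda>x x'. \<gamma> a x (\<mu> x' a'))) = K r \<mu> (\<lambda>u v w. \<gamma> w v u)"
      by (rule K_variants(7)[OF r rs mu trilinear_permute(5)[OF g]])
    finally show "r (\<lambda>a a'. r (\<lambda>x x'. \<phi>2 \<mu> \<epsilon> (a \<otimes> e) (a' \<otimes> fb (- m - k1) e) (x \<otimes> e') (x' \<otimes> fb (- m - k2) e') ?n ?\<tau>)) =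
      (\<omega> (fb (- m - k1) e \<diamondop> fb (- m - k2) e') c3 * (\<omega> e c1 * \<omega> e' c2)) * K r \<mu> (\<lambda>u v w. \<gamma> v w u) + \<epsilon> * (\<omega> (fb (- m - k2) e' \<diamondop> fb (- m - k1) e) c3 * (\<omega> e c1 * \<omega> e' c2)) * K r \<mu> (\<lambda>u v w. \<gamma> w v u)" .
  next
    show "(\<Sum>e\<in>Eb (- m - k1). \<Sum>e'\<in>Eb (- m - k2). \<omega> (fb (- m - k1) e \<diamondop> fb (- m - k2) e') c3 * (\<omega> e c1 * \<omega> e' c2)) = \<omega> (c1 \<diamondop> c2) c3"
      by (rule expand_pairs(2)[OF om_dia_bil(1)[OF c_car(3)] c_neg(1) c_neg(2)])
    show "(\<Sum>e\<in>Eb (- m - k1). \<Sum>e'\<in>Eb (- m - k2). \<omega> (fb (- m - k2) e' \<diamondop> fb (- m - k1) e) c3 * (\<omega> e c1 * \<omega> e' c2)) = \<omega> (c2 \<diamondop> c1) c3"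
      by (rule expand_pairs(2)[OF om_dia_bil(2)[OF c_car(3)] c_neg(1) c_neg(2)])
  qed
  finally show ?thesis .
qed

text \<open>The surviving legs are a first one, which meets \<open>c1\<close>, and a second one,
  which meets \<open>c3\<close>. So one expansion of each type occurs, which is the source of the
  minus signs.\<close>

lemma pr3_phi3:
  "pr3 (clift' (\<phi>3 \<mu> \<epsilon>) (R r)) \<gamma> c1 c2 c3 = - \<omega> (c3 \<diamondop> c1) c2 * K r \<mu> (\<lambda>u v w. \<gamma> w u v) + \<epsilon> * (- \<omega> (c1 \<diamondop> c3) c2 * K r \<mu> (\<lambda>u v w. \<gamma> v u w))"
proof -
  let ?n = "(- m - k1, - m - k2, - m - k3)" and ?\<tau> = "tst3 \<gamma> c1 c2 c3"
  note Q = phi_Q4(3)[OF r rs mu, of \<epsilon>]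
  have "pr3 (clift' (\<phi>3 \<mu> \<epsilon>) (R r)) \<gamma> c1 c2 c3 = clift' (\<phi>3 \<mu> \<epsilon>) (R r) ?n ?\<tau>"
    by (rule pr3h[OF phi_mem(3)[OF r rs mu]])
  also have "\<dots> = R r (k3, - m - k3) (\<lambda>u v. R r ((- m - k1), - m - (- m - k1)) (\<lambda>u' v'. \<phi>3 \<mu> \<epsilon> u v u' v' ?n ?\<tau>))"
    unfolding phi_block(6)[OF r rs mu] by (simp add: cterm'_def lift2_def)
  also have "\<dots> = (\<Sum>e\<in>Eb k3. \<Sum>e'\<in>Eb (- m - k1). r (\<lambda>a a'. r (\<lambda>x x'.
      \<phi>3 \<mu> \<epsilon> (a \<otimes> e) (a' \<otimes> fb k3 e) (x \<otimes> e') (x' \<otimes> fb (- m - k1) e') ?n ?\<tau>)))"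
    by (rule R_R_apply[OF r rs Q])
  also have "\<dots> = - \<omega> (c3 \<diamondop> c1) c2 * K r \<mu> (\<lambda>u v w. \<gamma> w u v) + \<epsilon> * (- \<omega> (c1 \<diamondop> c3) c2 * K r \<mu> (\<lambda>u v w. \<gamma> v u w))"
  proof (rule sum_K)
    fix e e' assume e: "e \<in> Eb k3" "e' \<in> Eb (- m - k1)"
    note ec = Eb_car[OF e(1)] fb_car[OF e(1)] Eb_car[OF e(2)] fb_car[OF e(2)]
    note eH = Eb_H[OF e(1)] fb_H[OF e(1)] Eb_H[OF e(2)] fb_H[OF e(2)]
    have "r (\<lambda>a a'. r (\<lambda>x x'. \<phi>3 \<mu> \<epsilon> (a \<otimes> e) (a' \<otimes> fb k3 e) (x \<otimes> e') (x' \<otimes> fb (- m - k1) e') ?n ?\<tau>)) =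
      (\<omega> (e \<diamondop> fb (- m - k1) e') c2 * (\<omega> (fb k3 e) c3 * \<omega> e' c1)) * r (\<lambda>a a'. r (\<lambda>x x'. \<gamma> x (\<mu> a x') a')) + (\<epsilon> * (\<omega> (fb (- m - k1) e' \<diamondop> e) c2 * (\<omega> (fb k3 e) c3 * \<omega> e' c1))) * r (\<lambda>a a'. r (\<lambda>x x'. \<gamma> x (\<mu> x' a) a'))"
    proof (rule RR_lin[OF r rs Q4_pt[OF r rs Q ec] Q4_shapes(3)[OF g mu] Q4_swap(1)[OF Q4_shapes(4)[OF g mu]]])
      fix a a' x x' assume pc: "a \<in> car A" "a' \<in> car A" "x \<in> car A" "x' \<in> car A"
      note oc = op_car[OF r rs mu pt_car[OF pc(1) ec(1)] pt_car[OF pc(4) ec(4)], of \<epsilon>]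
      have "\<phi>3 \<mu> \<epsilon> (a \<otimes> e) (a' \<otimes> fb k3 e) (x \<otimes> e') (x' \<otimes> fb (- m - k1) e') ?n ?\<tau> = tst3 \<gamma> c1 c2 c3 (x \<otimes> e') (iop \<mu> \<epsilon> (a \<otimes> e) (x' \<otimes> fb (- m - k1) e')) (a' \<otimes> fb k3 e)"
        using t3comp(2)[OF pc(3) ec(3) pc(2) ec(2) oc] eH pc
        by (simp add: cpure3_def pure3_apply[OF tst3_tri[OF g c_car]] componentP_hom[OF pt_G])
      then show "\<phi>3 \<mu> \<epsilon> (a \<otimes> e) (a' \<otimes> fb k3 e) (x \<otimes> e') (x' \<otimes> fb (- m - k1) e') ?n ?\<tau> =
        (\<omega> (e \<diamondop> fb (- m - k1) e') c2 * (\<omega> (fb k3 e) c3 * \<omega> e' c1)) * \<gamma> x (\<mu> a x') a' + (\<epsilon> * (\<omega> (fb (- m - k1) e' \<diamondop> e) c2 * (\<omega> (fb k3 e) c3 * \<omega> e' c1))) * \<gamma> x (\<mu> x' a) a'"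
        unfolding form_iop[OF t3D(2)[OF pt_car[OF pc(3) ec(3)] pt_car[OF pc(2) ec(2)]] pc(1) ec(1) pc(4) ec(4)]
        by (simp add: t3pt pc ec mu_car[OF mu] dia_car algebra_simps)
    qed
    also have "r (\<lambda>a a'. r (\<lambda>x x'. \<gamma> x (\<mu> a x') a')) = K r \<mu> (\<lambda>u v w. \<gamma> w u v)"
      by (rule K_variants(2)[OF r rs mu trilinear_permute(4)[OF g]])
    also have "r (\<lambda>a a'. r (\<lambda>x x'. \<gamma> x (\<mu> x' a) a')) = K r \<mu> (\<lambda>u v w. \<gamma> v u w)"
      by (rule K_variants(5)[OF r rs mu trilinear_permute(2)[OF g]])
    finally show "r (\<lambda>a a'. r (\<lambda>x x'. \<phi>3 \<mu> \<epsilon> (a \<otimes> e) (a' \<otimes> fb k3 e) (x \<otimes> e') (x' \<otimes> fb (- m - k1) e') ?n ?\<tau>)) =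
      (\<omega> (e \<diamondop> fb (- m - k1) e') c2 * (\<omega> (fb k3 e) c3 * \<omega> e' c1)) * K r \<mu> (\<lambda>u v w. \<gamma> w u v) + \<epsilon> * (\<omega> (fb (- m - k1) e' \<diamondop> e) c2 * (\<omega> (fb k3 e) c3 * \<omega> e' c1)) * K r \<mu> (\<lambda>u v w. \<gamma> v u w)" .
  next
    show "(\<Sum>e\<in>Eb k3. \<Sum>e'\<in>Eb (- m - k1). \<omega> (e \<diamondop> fb (- m - k1) e') c2 * (\<omega> (fb k3 e) c3 * \<omega> e' c1)) = - \<omega> (c3 \<diamondop> c1) c2"
      by (rule expand_pairs(3)[OF om_dia_bil(1)[OF c_car(2)] c(3) c_neg(1)])
    show "(\<Sum>e\<in>Eb k3. \<Sum>e'\<in>Eb (- m - k1). \<omega> (fb (- m - k1) e' \<diamondop> e) c2 * (\<omega> (fb k3 e) c3 * \<omega> e' c1)) = - \<omega> (c1 \<diamondop> c3) c2"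
      by (rule expand_pairs(3)[OF om_dia_bil(2)[OF c_car(2)] c(3) c_neg(1)])
  qed
  finally show ?thesis .
qed

text \<open>By symmetry of \<open>r\<close> this is the product of \<open>pr3_phi3\<close> taken in
  the opposite order: the summand with \<epsilon> and the one without exchange their places.\<close>

lemma pr3_phi4:
  "pr3 (clift' (\<phi>4 \<mu> \<epsilon>) (R r)) \<gamma> c1 c2 c3 = - \<omega> (c1 \<diamondop> c3) c2 * K r \<mu> (\<lambda>u v w. \<gamma> v u w) + \<epsilon> * (- \<omega> (c3 \<diamondop> c1) c2 * K r \<mu> (\<lambda>u v w. \<gamma> w u v))"
proof -
  let ?n = "(- m - k1, - m - k2, - m - k3)" and ?\<tau> = "tst3 \<gamma> c1 c2 c3"
  note Q = phi_Q4(4)[OF r rs mu, of \<epsilon>]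
  have "pr3 (clift' (\<phi>4 \<mu> \<epsilon>) (R r)) \<gamma> c1 c2 c3 = clift' (\<phi>4 \<mu> \<epsilon>) (R r) ?n ?\<tau>"
    by (rule pr3h[OF phi_mem(4)[OF r rs mu]])
  also have "\<dots> = R r ((- m - k1), - m - (- m - k1)) (\<lambda>u v. R r (k3, - m - k3) (\<lambda>u' v'. \<phi>4 \<mu> \<epsilon> u v u' v' ?n ?\<tau>))"
    unfolding phi_block(8)[OF r rs mu] by (simp add: cterm'_def lift2_def)
  also have "\<dots> = (\<Sum>e\<in>Eb (- m - k1). \<Sum>e'\<in>Eb k3. r (\<lambda>a a'. r (\<lambda>x x'.
      \<phi>4 \<mu> \<epsilon> (a \<otimes> e) (a' \<otimes> fb (- m - k1) e) (x \<otimes> e') (x' \<otimes> fb k3 e') ?n ?\<tau>)))"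
    by (rule R_R_apply[OF r rs Q])
  also have "\<dots> = - \<omega> (c1 \<diamondop> c3) c2 * K r \<mu> (\<lambda>u v w. \<gamma> v u w) + \<epsilon> * (- \<omega> (c3 \<diamondop> c1) c2 * K r \<mu> (\<lambda>u v w. \<gamma> w u v))"
  proof (rule sum_K)
    fix e e' assume e: "e \<in> Eb (- m - k1)" "e' \<in> Eb k3"
    note ec = Eb_car[OF e(1)] fb_car[OF e(1)] Eb_car[OF e(2)] fb_car[OF e(2)]
    note eH = Eb_H[OF e(1)] fb_H[OF e(1)] Eb_H[OF e(2)] fb_H[OF e(2)]
    have "r (\<lambda>a a'. r (\<lambda>x x'. \<phi>4 \<mu> \<epsilon> (a \<otimes> e) (a' \<otimes> fb (- m - k1) e) (x \<otimes> e') (x' \<otimes> fb k3 e') ?n ?\<tau>)) =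
      (\<omega> (fb (- m - k1) e \<diamondop> e') c2 * (\<omega> e c1 * \<omega> (fb k3 e') c3)) * r (\<lambda>a a'. r (\<lambda>x x'. \<gamma> a (\<mu> a' x) x')) + (\<epsilon> * (\<omega> (e' \<diamondop> fb (- m - k1) e) c2 * (\<omega> e c1 * \<omega> (fb k3 e') c3))) * r (\<lambda>a a'. r (\<lambda>x x'. \<gamma> a (\<mu> x a') x'))"
    proof (rule RR_lin[OF r rs Q4_pt[OF r rs Q ec] Q4_shapes(4)[OF g mu] Q4_swap(1)[OF Q4_shapes(3)[OF g mu]]])
      fix a a' x x' assume pc: "a \<in> car A" "a' \<in> car A" "x \<in> car A" "x' \<in> car A"
      note oc = op_car[OF r rs mu pt_car[OF pc(2) ec(2)] pt_car[OF pc(3) ec(3)], of \<epsilon>]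
      have "\<phi>4 \<mu> \<epsilon> (a \<otimes> e) (a' \<otimes> fb (- m - k1) e) (x \<otimes> e') (x' \<otimes> fb k3 e') ?n ?\<tau> = tst3 \<gamma> c1 c2 c3 (a \<otimes> e) (iop \<mu> \<epsilon> (a' \<otimes> fb (- m - k1) e) (x \<otimes> e')) (x' \<otimes> fb k3 e')"
        using t3comp(2)[OF pc(1) ec(1) pc(4) ec(4) oc] eH pc
        by (simp add: cpure3_def pure3_apply[OF tst3_tri[OF g c_car]] componentP_hom[OF pt_G])
      then show "\<phi>4 \<mu> \<epsilon> (a \<otimes> e) (a' \<otimes> fb (- m - k1) e) (x \<otimes> e') (x' \<otimes> fb k3 e') ?n ?\<tau> =
        (\<omega> (fb (- m - k1) e \<diamondop> e') c2 * (\<omega> e c1 * \<omega> (fb k3 e') c3)) * \<gamma> a (\<mu> a' x) x' + (\<epsilon> * (\<omega> (e' \<diamondop> fb (- m - k1) e) c2 * (\<omega> e c1 * \<omega> (fb k3 e') c3))) * \<gamma> a (\<mu> x a') x'"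
        unfolding form_iop[OF t3D(2)[OF pt_car[OF pc(1) ec(1)] pt_car[OF pc(4) ec(4)]] pc(2) ec(2) pc(3) ec(3)]
        by (simp add: t3pt pc ec mu_car[OF mu] dia_car algebra_simps)
    qed
    also have "r (\<lambda>a a'. r (\<lambda>x x'. \<gamma> a (\<mu> a' x) x')) = K r \<mu> (\<lambda>u v w. \<gamma> v u w)"
      by (rule K_variants(1)[OF r rs mu trilinear_permute(2)[OF g]])
    also have "r (\<lambda>a a'. r (\<lambda>x x'. \<gamma> a (\<mu> x a') x')) = K r \<mu> (\<lambda>u v w. \<gamma> w u v)"
      by (rule K_variants(6)[OF r rs mu trilinear_permute(4)[OF g]])
    finally show "r (\<lambda>a a'. r (\<lambda>x x'. \<phi>4 \<mu> \<epsilon> (a \<otimes> e) (a' \<otimes> fb (- m - k1) e) (x \<otimes> e') (x' \<otimes> fb k3 e') ?n ?\<tau>)) =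
      (\<omega> (fb (- m - k1) e \<diamondop> e') c2 * (\<omega> e c1 * \<omega> (fb k3 e') c3)) * K r \<mu> (\<lambda>u v w. \<gamma> v u w) + \<epsilon> * (\<omega> (e' \<diamondop> fb (- m - k1) e) c2 * (\<omega> e c1 * \<omega> (fb k3 e') c3)) * K r \<mu> (\<lambda>u v w. \<gamma> w u v)" .
  next
    show "(\<Sum>e\<in>Eb (- m - k1). \<Sum>e'\<in>Eb k3. \<omega> (fb (- m - k1) e \<diamondop> e') c2 * (\<omega> e c1 * \<omega> (fb k3 e') c3)) = - \<omega> (c1 \<diamondop> c3) c2"
      by (rule expand_pairs(4)[OF om_dia_bil(1)[OF c_car(2)] c_neg(1) c(3)])
    show "(\<Sum>e\<in>Eb (- m - k1). \<Sum>e'\<in>Eb k3. \<omega> (e' \<diamondop> fb (- m - k1) e) c2 * (\<omega> e c1 * \<omega> (fb k3 e') c3)) = - \<omega> (c3 \<diamondop> c1) c2"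
      by (rule expand_pairs(4)[OF om_dia_bil(2)[OF c_car(2)] c_neg(1) c(3)])
  qed
  finally show ?thesis .
qed

end

end

context
  fixes r :: "('k, 'a, 'a) tens2" and \<mu> :: "'a \<Rightarrow> 'a \<Rightarrow> 'a"
  assumes r: "r \<in> car (tensor A A)" and rs: "flip A r = r" and mu: "bilinear_on A A A \<mu>"
begin

lemma PYBE_terms:
  assumes g: "trilinear_form_on A \<gamma>"
  shows "r13_r23 A \<mu> r \<gamma> = K r \<mu> (\<lambda>u v w. \<gamma> v w u)" "r23_r13 A \<mu> r \<gamma> = K r \<mu> (\<lambda>u v w. \<gamma> w v u)"
    "r12_r13 A \<mu> r \<gamma> = K r \<mu> \<gamma>" "r12_r23 A \<mu> r \<gamma> = K r \<mu> (\<lambda>u v w. \<gamma> v u w)"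
  using K_variants(3)[OF r rs mu trilinear_permute(3)[OF g]] K_variants(3)[OF r rs mu trilinear_permute(5)[OF g]]
    K_variants(1)[OF r rs mu trilinear_permute(2)[OF g]]
  by (simp_all add: r13_r23_def r23_r13_def r12_r13_def r12_r23_def lift2_def pure3_apply[OF g] K_def[OF r rs mu])

end

end

context induced_bialgebra
begin

section \<open>Triangularity\<close>

context
  fixes r :: "('k, 'a, 'a) tens2"
  assumes sol: "symmetric_pPYBE_solution A ast circ r"
    and vth_r: "\<And>a. a \<in> car A \<Longrightarrow> vth a = vth_of A ast r a"
    and th_r: "\<And>a. a \<in> car A \<Longrightarrow> th a = th_of A circ r a"
begin

lemma r: "r \<in> car (tensor A A)" and rs: "flip A r = r"
  using sol by (simp_all add: symmetric_pPYBE_solution_def)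

lemma PYBE_ast:
  assumes g: "trilinear_form_on A \<gamma>"
  shows "K r ast (\<lambda>u v w. \<gamma> v w u) + K r ast (\<lambda>u v w. \<gamma> w v u) = K r ast \<gamma> + K r ast (\<lambda>u v w. \<gamma> v u w)"
proof -
  have "(r13_r23 A ast r + r23_r13 A ast r - r12_r13 A ast r - r12_r23 A ast r) \<gamma> = 0"
    using sol by (simp add: symmetric_pPYBE_solution_def)
  then show ?thesis
    by (simp add: PYBE_terms[OF r rs ast_bilinear g] algebra_simps)
qed

lemma PYBE_circ:
  assumes g: "trilinear_form_on A \<gamma>"
  shows "K r circ \<gamma> + K r circ (\<lambda>u v w. \<gamma> w v u) = K r circ (\<lambda>u v w. \<gamma> v w u) + K r circ (\<lambda>u v w. \<gamma> v u w)"
proof -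
  have "(r12_r13 A circ r - r12_r23 A circ r - r13_r23 A circ r + r23_r13 A circ r) \<gamma> = 0"
    using sol by (simp add: symmetric_pPYBE_solution_def)
  then show ?thesis
    by (simp add: PYBE_terms[OF r rs circ_bilinear g] algebra_simps)
qed

lemmas clift_ast_mem = phi_mem[OF r rs ast_bilinear, of 1] and clift_circ_mem = phi_mem[OF r rs circ_bilinear, of "- 1"]
lemmas pr3_ast = pr3_phi1[OF r rs ast_bilinear] pr3_phi2[OF r rs ast_bilinear] pr3_phi3[OF r rs ast_bilinear]
lemmas pr3_circ = pr3_phi1[OF r rs circ_bilinear] pr3_phi2[OF r rs circ_bilinear] pr3_phi4[OF r rs circ_bilinear]

text \<open>The first word, \<open>\<omega> (c2 \<diamondop> c1) c3\<close>, needs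
  \<open>PYBE_ast\<close> at \<gamma> itself; the second,
  \<open>\<omega> (c3 \<diamondop> c1) c2\<close>, needs it at \<gamma> with its last two arguments
  exchanged.\<close>

lemma cPYBE_mul: "clift' (\<phi>1 ast 1) (R r) + clift' (\<phi>2 ast 1) (R r) - clift' (\<phi>3 ast 1) (R r) = 0"
proof (rule sep3[OF car3_closed(2)[OF car3_closed(1)[OF clift_ast_mem(1,2)] clift_ast_mem(3)] car3_closed(3)])
  fix \<gamma> k1 k2 k3 c1 c2 c3
  assume g: "trilinear_form_on A \<gamma>" and c: "c1 \<in> H k1" "c2 \<in> H k2" "c3 \<in> H k3"
  have 0: "pr3 0 \<gamma> c1 c2 c3 = 0" by (simp add: pr3_def)
  show "pr3 (clift' (\<phi>1 ast 1) (R r) + clift' (\<phi>2 ast 1) (R r) - clift' (\<phi>3 ast 1) (R r)) \<gamma> c1 c2 c3 = pr3 0 \<gamma> c1 c2 c3"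
    unfolding pr3_add(2)[OF car3_closed(1)[OF clift_ast_mem(1,2)] clift_ast_mem(3) g c] pr3_add(1)[OF clift_ast_mem(1,2) g c] pr3_ast[OF g c]
      triple_words[OF c[THEN H_car]] 0
    using PYBE_ast[OF g] PYBE_ast[OF trilinear_permute(1)[OF g]]
    by algebra
qed

lemma cPYBE_brk: "clift' (\<phi>1 circ (- 1)) (R r) + clift' (\<phi>2 circ (- 1)) (R r) + clift' (\<phi>4 circ (- 1)) (R r) = 0"
proof (rule sep3[OF car3_closed(1)[OF car3_closed(1)[OF clift_circ_mem(1,2)] clift_circ_mem(4)] car3_closed(3)])
  fix \<gamma> k1 k2 k3 c1 c2 c3
  assume g: "trilinear_form_on A \<gamma>" and c: "c1 \<in> H k1" "c2 \<in> H k2" "c3 \<in> H k3"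
  have 0: "pr3 0 \<gamma> c1 c2 c3 = 0" by (simp add: pr3_def)
  show "pr3 (clift' (\<phi>1 circ (- 1)) (R r) + clift' (\<phi>2 circ (- 1)) (R r) + clift' (\<phi>4 circ (- 1)) (R r)) \<gamma> c1 c2 c3
      = pr3 0 \<gamma> c1 c2 c3"
    unfolding pr3_add(1)[OF car3_closed(1)[OF clift_circ_mem(1,2)] clift_circ_mem(4) g c] pr3_add(1)[OF clift_circ_mem(1,2) g c] pr3_circ[OF g c]
      triple_words[OF c[THEN H_car]] 0
    using PYBE_circ[OF g] PYBE_circ[OF trilinear_permute(1)[OF g]]
    by algebra
qed

lemma completed_PYBE: "completed_PYBE_solution P G mul brk (R r)"
  unfolding completed_PYBE_solution_def
  using R_mem[OF r rs] phi_summable[OF r rs ast_bilinear, of 1] phi_summable[OF r rs circ_bilinear, of "- 1"]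
    cPYBE_mul cPYBE_brk by simp

text \<open>One letter \<open>b\<close> and two test letters leave only
  \<open>\<omega> b (c \<diamondop> c')\<close> and \<open>\<omega> b (c' \<diamondop> c)\<close>,
  the two words in which the coproduct of a pure tensor is expressed.\<close>

lemma pair_words:
  assumes "b \<in> car B" "c \<in> car B" "c' \<in> car B"
  shows "\<omega> c (b \<diamondop> c') = \<omega> b (c \<diamondop> c') - \<omega> b (c' \<diamondop> c)" "\<omega> c (b \<diamondop> c' - c' \<diamondop> b) = \<omega> b (c \<diamondop> c')"
    "\<omega> (b \<diamondop> c) c' = \<omega> b (c \<diamondop> c') - \<omega> b (c' \<diamondop> c)" "\<omega> (b \<diamondop> c - c \<diamondop> b) c' = - \<omega> b (c' \<diamondop> c)"
proof -
  have 1: "\<omega> c (b \<diamondop> c') = \<omega> (b \<diamondop> c) c'" using om_left[OF assms] by simp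
  have 2: "\<omega> (c \<diamondop> b) c' = \<omega> b (c \<diamondop> c')" using om_left[of c b c'] assms by simp
  show 3: "\<omega> (b \<diamondop> c) c' = \<omega> b (c \<diamondop> c') - \<omega> b (c' \<diamondop> c)" by (rule om_right[OF assms])
  then show "\<omega> c (b \<diamondop> c') = \<omega> b (c \<diamondop> c') - \<omega> b (c' \<diamondop> c)" using 1 by simp
  show "\<omega> c (b \<diamondop> c' - c' \<diamondop> b) = \<omega> b (c \<diamondop> c')"
    using om_invariant[of c b c'] 2 assms by simp
  have "\<omega> (b \<diamondop> c - c \<diamondop> b) c' = \<omega> (b \<diamondop> c) c' - \<omega> (c \<diamondop> b) c'"
    by (rule om_diff1[OF dia_car[OF assms(1,2)] dia_car[OF assms(2,1)] assms(3)])
  then show "\<omega> (b \<diamondop> c - c \<diamondop> b) c' = - \<omega> b (c' \<diamondop> c)" using 2 3 by simp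
qed

lemma vth_eval:
  assumes a: "a \<in> car A" and g: "bilinear_on A A scalars \<gamma>"
  shows "vth a \<gamma> = r (\<lambda>x y. \<gamma> x (ast a y)) + r (\<lambda>x y. \<gamma> x (ast y a)) - r (\<lambda>x y. \<gamma> (ast a x) y)"
  using tens_add_right(1)[OF r g bilinear_onD1[OF ast_bilinear a] bilinear_onD2[OF ast_bilinear a]]
  by (simp add: vth_r[OF a] vth_of_def tmap_apply[OF g])

lemma th_eval:
  assumes a: "a \<in> car A" and g: "bilinear_on A A scalars \<gamma>"
  shows "th a \<gamma> = r (\<lambda>x y. \<gamma> (circ a x) y) + r (\<lambda>x y. \<gamma> x (circ a y)) - r (\<lambda>x y. \<gamma> x (circ y a))"
  using tens_add_right(3)[OF r g bilinear_onD1[OF circ_bilinear a] bilinear_onD2[OF circ_bilinear a]]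
  by (simp add: th_r[OF a] th_of_def tmap_apply[OF g])

lemma comm_H: "b \<in> H i \<Longrightarrow> c \<in> H j \<Longrightarrow> b \<diamondop> c - c \<diamondop> b \<in> H (i + j)"
  using dia_degree[of b i c j] dia_degree[of c j b i] by (simp add: H_closed add.commute)

context
  fixes a b e \<gamma> c c' k l
  assumes a: "a \<in> car A" and b: "b \<in> H e" and g: "bilinear_on A A scalars \<gamma>" and c: "c \<in> H k" "c' \<in> H l"
begin

lemma pr2_ctmap_R:
  assumes mu: "bilinear_on A A A \<mu>"
  shows "pr2 (ctmap P G id (iop \<mu> \<epsilon> (a \<otimes> b)) (R r)) \<gamma> c c' =
      - (r (\<lambda>x y. \<gamma> x (\<mu> a y)) * (\<omega> b (c \<diamondop> c') - \<omega> b (c' \<diamondop> c))) - \<epsilon> * (r (\<lambda>x y. \<gamma> x (\<mu> y a)) * \<omega> b (c \<diamondop> c'))"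
    and "pr2 (ctmap P G (iop \<mu> \<epsilon> (a \<otimes> b)) id (R r)) \<gamma> c c' =
      - (r (\<lambda>x y. \<gamma> (\<mu> a x) y) * (\<omega> b (c \<diamondop> c') - \<omega> b (c' \<diamondop> c))) + \<epsilon> * (r (\<lambda>x y. \<gamma> (\<mu> x a) y) * \<omega> b (c' \<diamondop> c))"
proof -
  note cc = H_car[OF b] c[THEN H_car]
  note l1 = bilin_comp[OF g bilinear_onD1[OF mu a] linear_on_ident] bilin_comp[OF g bilinear_onD2[OF mu a] linear_on_ident]
  note l2 = bilin_comp[OF g linear_on_ident bilinear_onD1[OF mu a]] bilin_comp[OF g linear_on_ident bilinear_onD2[OF mu a]]
  show "pr2 (ctmap P G id (iop \<mu> \<epsilon> (a \<otimes> b)) (R r)) \<gamma> c c' =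
      - (r (\<lambda>x y. \<gamma> x (\<mu> a y)) * (\<omega> b (c \<diamondop> c') - \<omega> b (c' \<diamondop> c))) - \<epsilon> * (r (\<lambda>x y. \<gamma> x (\<mu> y a)) * \<omega> b (c \<diamondop> c'))"
    unfolding pr2_ctmap_right[OF mu R_mem[OF r rs] a b g c] pr2_R[OF r rs l2(1) c(1) dia_degree[OF b c(2)]]
      pr2_R[OF r rs l2(2) c(1) comm_H[OF b c(2)]] pair_words[OF cc]
    by simp
  show "pr2 (ctmap P G (iop \<mu> \<epsilon> (a \<otimes> b)) id (R r)) \<gamma> c c' =
      - (r (\<lambda>x y. \<gamma> (\<mu> a x) y) * (\<omega> b (c \<diamondop> c') - \<omega> b (c' \<diamondop> c))) + \<epsilon> * (r (\<lambda>x y. \<gamma> (\<mu> x a) y) * \<omega> b (c' \<diamondop> c))"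
    unfolding pr2_ctmap_left[OF mu R_mem[OF r rs] a b g c] pr2_R[OF r rs l1(1) dia_degree[OF b c(1)] c(2)]
      pr2_R[OF r rs l1(2) comm_H[OF b c(1)] c(2)] pair_words[OF cc]
    by simp
qed

end

text \<open>Up to a common sign, the coefficient of \<open>\<omega> b (c \<diamondop> c')\<close> is
  \<open>vth_of\<close> as it stands, and that of \<open>\<omega> b (c' \<diamondop> c)\<close> is
  its flip, by symmetry of \<open>r\<close>. The sign chosen in \<open>kap\<close> matches the one
  in \<open>nu\<close>.\<close>

lemma Delta_R: "p \<in> car P \<Longrightarrow> \<Delta> p = ctmap P G id (mul p) (R r) - ctmap P G (mul p) id (R r)"
proof (rule P_additive_eqI[where F = \<Delta> and F' = "\<lambda>p. ctmap P G id (mul p) (R r) - ctmap P G (mul p) id (R r)"])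
  fix a b i assume ab: "a \<in> car A" "b \<in> H i"
  note p = ptH_car[OF ab] and Rm = R_mem[OF r rs]
  note x = ct_mem(2)[OF Rm p, of 1] and y = ct_mem(1)[OF Rm p, of 1]
  show "\<Delta> (a \<otimes> b) = ctmap P G id (mul (a \<otimes> b)) (R r) - ctmap P G (mul (a \<otimes> b)) id (R r)"
  proof (rule sep2[OF coproduct_mem(1)[OF p] minus_ctensor[OF x y]])
    fix \<gamma> k l c c' assume g: "bilinear_on A A scalars \<gamma>" and c: "c \<in> H k" "c' \<in> H l"
    note rr = r_sym[OF r rs bilin_comp[OF g linear_on_ident bilinear_onD1[OF ast_bilinear ab(1)]]]
      r_sym[OF r rs bilin_comp[OF g linear_on_ident bilinear_onD2[OF ast_bilinear ab(1)]]]
      r_sym[OF r rs bilin_comp[OF g bilinear_onD1[OF ast_bilinear ab(1)] linear_on_ident]]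
      r_sym[OF r rs bilin_comp[OF g bilinear_onD2[OF ast_bilinear ab(1)] linear_on_ident]]
    show "pr2 (\<Delta> (a \<otimes> b)) \<gamma> c c' = pr2 (ctmap P G id (mul (a \<otimes> b)) (R r) - ctmap P G (mul (a \<otimes> b)) id (R r)) \<gamma> c c'"
      unfolding pr2_add(2)[OF x y g c] pr2_ctmap_R[OF ab g c ast_bilinear] pr2_iD[OF vth_linear ab(1) H_car[OF ab(2)] g c]
        vth_eval[OF ab(1) g] vth_eval[OF ab(1) bilin_swap[OF g]]
      by (simp add: rr algebra_simps)
  qed
qed (simp_all only: iD_add ct_add coproduct_mem add_diff_add R_mem[OF r rs])

text \<open>The same two coefficients, now with \<open>th_of\<close> and, by \<epsilon> = -1, with
  the negative of its flip.\<close>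

lemma delta_R: "p \<in> car P \<Longrightarrow> \<delta> p = ctmap P G id (brk p) (R r) + ctmap P G (brk p) id (R r)"
proof (rule P_additive_eqI[where F = \<delta> and F' = "\<lambda>p. ctmap P G id (brk p) (R r) + ctmap P G (brk p) id (R r)"])
  fix a b i assume ab: "a \<in> car A" "b \<in> H i"
  note p = ptH_car[OF ab] and Rm = R_mem[OF r rs]
  note x = ct_mem(4)[OF Rm p, of "- 1"] and y = ct_mem(3)[OF Rm p, of "- 1"]
  show "\<delta> (a \<otimes> b) = ctmap P G id (brk (a \<otimes> b)) (R r) + ctmap P G (brk (a \<otimes> b)) id (R r)"
  proof (rule sep2[OF coproduct_mem(2)[OF p] plus_ctensor[OF x y]])
    fix \<gamma> k l c c' assume g: "bilinear_on A A scalars \<gamma>" and c: "c \<in> H k" "c' \<in> H l"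
    note rr = r_sym[OF r rs bilin_comp[OF g linear_on_ident bilinear_onD1[OF circ_bilinear ab(1)]]]
      r_sym[OF r rs bilin_comp[OF g linear_on_ident bilinear_onD2[OF circ_bilinear ab(1)]]]
      r_sym[OF r rs bilin_comp[OF g bilinear_onD1[OF circ_bilinear ab(1)] linear_on_ident]]
      r_sym[OF r rs bilin_comp[OF g bilinear_onD2[OF circ_bilinear ab(1)] linear_on_ident]]
    show "pr2 (\<delta> (a \<otimes> b)) \<gamma> c c' = pr2 (ctmap P G id (brk (a \<otimes> b)) (R r) + ctmap P G (brk (a \<otimes> b)) id (R r)) \<gamma> c c'"
      unfolding pr2_add(1)[OF x y g c] pr2_ctmap_R[OF ab g c circ_bilinear] pr2_iD[OF th_linear ab(1) H_car[OF ab(2)] g c]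
        th_eval[OF ab(1) g] th_eval[OF ab(1) bilin_swap[OF g]]
      by (simp add: rr algebra_simps)
  qed
qed (simp_all only: iD_add ct_add coproduct_mem add_diff_add R_mem[OF r rs] ac_simps)

lemma triangular: "triangular_completed_Poisson_bialgebra P G mul brk \<Delta> \<delta>"
  unfolding triangular_completed_Poisson_bialgebra_def
  using completed_Poisson completed_PYBE R_skew[OF r rs] Delta_R delta_R by blast

end

end

theorem proposition4p17:
  fixes A :: "('k::field_char_0, 'a::ab_group_add) vspace"
    and ast circ :: "'a \<Rightarrow> 'a \<Rightarrow> 'a"
    and vth th :: "'a \<Rightarrow> ('k, 'a, 'a) tens2"
    and B :: "('k, 'b::ab_group_add) vspace"
    and H :: "int \<Rightarrow> 'b set"
    and dia :: "'b \<Rightarrow> 'b \<Rightarrow> 'b"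
    and om :: "'b \<Rightarrow> 'b \<Rightarrow> 'k"
  assumes "finite_dim A (car A)"
    and "pre_Poisson_bialgebra A ast circ vth th"
    and "quadratic_graded_perm_algebra B H dia om"
    and "triangular_pre_Poisson_bialgebra A ast circ vth th"
  shows "triangular_completed_Poisson_bialgebra
           (tensor A B) (ind_grading A B H)
           (ind_mul A B ast dia) (ind_brk A B circ dia)
           (ind_Delta A B vth (nu B H dia om)) (ind_delta A B th (nu B H dia om))"
proof -
  interpret Q: quadratic_graded_perm_algebra B H dia om by fact
  interpret bialg: pre_Poisson_bialgebra A ast circ vth th by fact
  \<comment> \<open>The degree of \<open>om\<close> is fixed here, as the locales carry it as a
    parameter.\<close>
  obtain m where m: "\<And>i j b c. i + j + m \<noteq> 0 \<Longrightarrow> b \<in> H i \<Longrightarrow> c \<in> H j \<Longrightarrow> om b c = 0"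
    using Q.om_degree by blast
  interpret induced_bialgebra B H dia om m A ast circ vth th
    by unfold_locales (use m assms(1) bialg.vspace in auto)
  obtain r where "symmetric_pPYBE_solution A ast circ r"
    and "\<And>a. a \<in> car A \<Longrightarrow> vth a = vth_of A ast r a" "\<And>a. a \<in> car A \<Longrightarrow> th a = th_of A circ r a"
    using assms(4) unfolding triangular_pre_Poisson_bialgebra_def by blast
  then show ?thesis
    \<comment> \<open>The operations of the statement are the cases \<epsilon> = 1 and \<epsilon> =
      -1 of \<open>iop\<close> and \<open>iD\<close>.\<close>
    unfolding ind_mul_iop ind_brk_iop ind_Delta_iD ind_delta_iD by (rule triangular)
qed

end
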